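(* Let $(M,\omega)$ be a connected symplectic manifold (either open or closed) and let $N:=M\times T^*S^1$ with symplectic form $\Omega:=\omega+dr\wedge ds$. Let $X,Y\subset M$ be compact subsets such that: (Q1) $\mathrm{stab}(Y)$ cannot be displaced from $\mathrm{stab}(X)$ by any Hamiltonian diffeomorphism of $(N,\Omega)$, i.e. $\theta(\mathrm{stab}(Y))\cap\mathrm{stab}(X)\ne\emptyset$ for every Hamiltonian diffeomorphism $\theta$ of $N$; (Q2) there exists a closed 1-form $\alpha$ on $M$ whose locally Hamiltonian flow $\{\psi_t\}$ is defined for all $t\in\mathbb{R}$ and satisfies $\psi_1(Y)\cap X=\emptyset$. Put $X':=\psi_1(Y)$ and let $a\in H^1(M,\mathbb{R})$ be the cohomology class of $\alpha$. Then for every compactly supported $F\in C^\infty(M\times S^1)$ with $$F_t|_X\le 0,\qquad F_t|_{X'}\ge 1\qquad\text{for all } t\in\mathbb{R},$$ where $F_t(x):=F(x,t)$, the time-one map $\phi$ of the Hamiltonian flow $\{\phi_t\}$ generated by $F$ possesses an invariant compactly supported Borel probability measure $\mu$ with $$|\langle a,\rho(\mu,\phi)\rangle|\ge 1 .$$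
   Context: $S^1=\mathbb{R}/\mathbb{Z}$; a function on $M\times S^1$ is regarded as a time-dependent function on $M$, 1-periodic in time. $(r,s \bmod 1)$ are the canonical coordinates on $T^*S^1$. For $Z\subset M$, its stabilization is $\mathrm{stab}(Z):=Z\times\{r=0\}\subset N$. For a closed 1-form $\alpha$ on a symplectic manifold $(M,\omega)$, its locally Hamiltonian vector field $\mathrm{sgrad}\,\alpha$ is defined by $i_{\mathrm{sgrad}\,\alpha}\omega=\alpha$, and its locally Hamiltonian flow is the flow of $\mathrm{sgrad}\,\alpha$. For a function $F$, $\mathrm{sgrad}\,F:=\mathrm{sgrad}(-dF)$. The Hamiltonian flow $\{\phi_t\}$ generated by $F\in C^\infty(M\times S^1)$ is the solution of $\frac{d}{dt}\phi_t=\mathrm{sgrad}\,F_t\circ\phi_t$, $\phi_0=\mathrm{id}$; its time-one map is $\phi=\phi_1$. A Hamiltonian diffeomorphism of $N$ is the time-one map of the flow generated by a (time-dependent) Hamiltonian function on $N$ for which this flow is defined on the time interval $[0,1]$. Rotation vector: for a compactly supported Borel probability measure $\mu$ on $M$ invariant under $\phi$, $\rho(\mu,\phi)$ is the compactly supported first homology class (with real coefficients) of $M$ defined by $$\langle a,\rho(\mu,\phi)\rangle:=\int_0^1\int_M\langle\alpha,\mathrm{sgrad}\,F_t\rangle(\phi_t x)\,d\mu(x)\,dt=\int_M\Big(\int_{\gamma_x}\alpha\Big)d\mu(x)\qquad\text{for all } a\in H^1(M,\mathbb{R}),$$ where $\alpha$ is any closed 1-form representing $a$ and $\gamma_x$ is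 the trajectory $\{\phi_t x\}_{t\in[0,1]}$. *)

theory Defs
  imports "HOL-Analysis.Analysis" "HOL-Probability.Probability"
begin

section \<open>Smooth functions between Euclidean spaces\<close>

text \<open>On an open subset of a finite-dimensional space this is the class \<open>C\<^sup>k\<close>:
  \<open>f\<close> is differentiable and all its directional derivatives are of class \<open>C\<^sup>k\<^sup>-\<^sup>1\<close>.\<close>

primrec Ck_on :: "nat \<Rightarrow> ('a::euclidean_space \<Rightarrow> 'b::real_normed_vector) \<Rightarrow> 'a set \<Rightarrow> bool" where
  "Ck_on 0 f S \<longleftrightarrow> continuous_on S f"
| "Ck_on (Suc k) f S \<longleftrightarrow>
     (\<forall>x\<in>S. f differentiable (at x)) \<and> (\<forall>v. Ck_on k (\<lambda>x. frechet_derivative f (at x) v) S)"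

definition smooth_on :: "('a::euclidean_space \<Rightarrow> 'b::real_normed_vector) \<Rightarrow> 'a set \<Rightarrow> bool" where
  "smooth_on f S \<longleftrightarrow> (\<forall>k. Ck_on k f S)"


section \<open>Smooth manifolds\<close>

text \<open>A manifold is a whole type with a second countable Hausdorff topology, equipped with an
  atlas, i.e. a family of charts \<open>A i\<close> indexed by a type \<open>'i\<close>. The coordinate map of a chart is
  meaningful on the domain of the chart only. The dimension is that of the model space \<open>'e\<close>.
  There is no boundary.\<close>

datatype ('a, 'e) chart = Chart (cdom: "'a set") (cmap: "'a \<Rightarrow> 'e")

type_synonym ('i, 'a, 'e) atlas = "'i \<Rightarrow> ('a, 'e) chart"

definition cinv :: "('a, 'e) chart \<Rightarrow> 'e \<Rightarrow> 'a" where
  "cinv c = inv_into (cdom c) (cmap c)"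

abbreviation crange :: "('a, 'e) chart \<Rightarrow> 'e set" where
  "crange c \<equiv> cmap c ` cdom c"

definition smooth_atlas ::
  "('i, 'a::{second_countable_topology,t2_space}, 'e::euclidean_space) atlas \<Rightarrow> bool" where
  "smooth_atlas A \<longleftrightarrow>
     (\<Union>i. cdom (A i)) = UNIV \<and>
     (\<forall>i. open (cdom (A i)) \<and> open (crange (A i)) \<and>
          homeomorphism (cdom (A i)) (crange (A i)) (cmap (A i)) (cinv (A i))) \<and>
     (\<forall>i j. smooth_on (cmap (A j) \<circ> cinv (A i)) (cmap (A i) ` (cdom (A i) \<inter> cdom (A j))))"

definition smooth_fun :: "('i, 'a, 'e::euclidean_space) atlas \<Rightarrow> ('a \<Rightarrow> real) \<Rightarrow> bool" where
  "smooth_fun A f \<longleftrightarrow> (\<forall>i. smooth_on (f \<circ> cinv (A i)) (crange (A i)))"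

definition compactly_supported :: "('a::topological_space \<Rightarrow> real) \<Rightarrow> bool" where
  "compactly_supported f \<longleftrightarrow> compact (closure {x. f x \<noteq> 0})"

definition prod_atlas ::
  "('i, 'a, 'e) atlas \<Rightarrow> ('j, 'b, 'f) atlas \<Rightarrow> ('i \<times> 'j, 'a \<times> 'b, 'e \<times> 'f) atlas" where
  "prod_atlas A B = (\<lambda>(i, j). Chart (cdom (A i) \<times> cdom (B j)) (map_prod (cmap (A i)) (cmap (B j))))"

definition real_atlas :: "(unit, real, real) atlas" where
  "real_atlas = (\<lambda>_. Chart UNIV id)"


section \<open>Vector fields and differential forms\<close>

text \<open>Vector fields and forms are families of local representatives: \<open>X i p\<close> is the coordinate
  vector of \<open>X\<close> at \<open>p\<close> in the chart \<open>A i\<close>, and \<open>\<alpha> i p v\<close> is the value of \<open>\<alpha>\<close> at \<open>p\<close> on the tangent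
  vector with coordinates \<open>v\<close> in the chart \<open>A i\<close>. These are meaningful for \<open>p \<in> cdom (A i)\<close> only.\<close>

type_synonym ('i, 'a, 'e) vfield = "'i \<Rightarrow> 'a \<Rightarrow> 'e"
type_synonym ('i, 'a, 'e) form1 = "'i \<Rightarrow> 'a \<Rightarrow> 'e \<Rightarrow> real"
type_synonym ('i, 'a, 'e) form2 = "'i \<Rightarrow> 'a \<Rightarrow> 'e \<Rightarrow> 'e \<Rightarrow> real"

definition tchange ::
  "('i, 'a, 'e::euclidean_space) atlas \<Rightarrow> 'i \<Rightarrow> 'i \<Rightarrow> 'a \<Rightarrow> 'e \<Rightarrow> 'e" where
  "tchange A i j p = frechet_derivative (cmap (A j) \<circ> cinv (A i)) (at (cmap (A i) p))"

definition one_form :: "('i, 'a, 'e::euclidean_space) atlas \<Rightarrow> ('i, 'a, 'e) form1 \<Rightarrow> bool" where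
  "one_form A \<alpha> \<longleftrightarrow>
     (\<forall>i. \<forall>p\<in>cdom (A i). linear (\<alpha> i p)) \<and>
     (\<forall>i j. \<forall>p\<in>cdom (A i) \<inter> cdom (A j). \<forall>v. \<alpha> j p (tchange A i j p v) = \<alpha> i p v) \<and>
     (\<forall>i v. smooth_on (\<lambda>x. \<alpha> i (cinv (A i) x) v) (crange (A i)))"

definition two_form :: "('i, 'a, 'e::euclidean_space) atlas \<Rightarrow> ('i, 'a, 'e) form2 \<Rightarrow> bool" where
  "two_form A \<omega> \<longleftrightarrow>
     (\<forall>i. \<forall>p\<in>cdom (A i). bilinear (\<omega> i p) \<and> (\<forall>v. \<omega> i p v v = 0)) \<and>
     (\<forall>i j. \<forall>p\<in>cdom (A i) \<inter> cdom (A j). \<forall>v w.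
        \<omega> j p (tchange A i j p v) (tchange A i j p w) = \<omega> i p v w) \<and>
     (\<forall>i v w. smooth_on (\<lambda>x. \<omega> i (cinv (A i) x) v w) (crange (A i)))"

text \<open>\<open>d\<alpha> = 0\<close> and \<open>d\<omega> = 0\<close>, evaluated on coordinate vector fields with constant coefficients.\<close>

definition closed_one_form :: "('i, 'a, 'e::euclidean_space) atlas \<Rightarrow> ('i, 'a, 'e) form1 \<Rightarrow> bool" where
  "closed_one_form A \<alpha> \<longleftrightarrow> one_form A \<alpha> \<and>
     (\<forall>i. \<forall>x\<in>crange (A i). \<forall>u v.
        frechet_derivative (\<lambda>y. \<alpha> i (cinv (A i) y) v) (at x) u
      - frechet_derivative (\<lambda>y. \<alpha> i (cinv (A i) y) u) (at x) v = 0)"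

definition closed_two_form :: "('i, 'a, 'e::euclidean_space) atlas \<Rightarrow> ('i, 'a, 'e) form2 \<Rightarrow> bool" where
  "closed_two_form A \<omega> \<longleftrightarrow> two_form A \<omega> \<and>
     (\<forall>i. \<forall>x\<in>crange (A i). \<forall>u v w.
        frechet_derivative (\<lambda>y. \<omega> i (cinv (A i) y) v w) (at x) u
      + frechet_derivative (\<lambda>y. \<omega> i (cinv (A i) y) w u) (at x) v
      + frechet_derivative (\<lambda>y. \<omega> i (cinv (A i) y) u v) (at x) w = 0)"

definition differential :: "('i, 'a, 'e::euclidean_space) atlas \<Rightarrow> ('a \<Rightarrow> real) \<Rightarrow> ('i, 'a, 'e) form1" where
  "differential A f = (\<lambda>i p. frechet_derivative (f \<circ> cinv (A i)) (at (cmap (A i) p)))"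

text \<open>\<open>\<langle>\<alpha>, X\<rangle>(p)\<close>; for an honest form and vector field it does not depend on the chart.\<close>

definition contract :: "('i, 'a, 'e) atlas \<Rightarrow> ('i, 'a, 'e) form1 \<Rightarrow> ('i, 'a, 'e) vfield \<Rightarrow> 'a \<Rightarrow> real" where
  "contract A \<alpha> X p = (let i = (SOME i. p \<in> cdom (A i)) in \<alpha> i p (X i p))"

text \<open>The de Rham class of a closed 1-form, as the set of all closed 1-forms cohomologous to it.\<close>

definition deRham_class ::
  "('i, 'a, 'e::euclidean_space) atlas \<Rightarrow> ('i, 'a, 'e) form1 \<Rightarrow> ('i, 'a, 'e) form1 set" where
  "deRham_class A \<alpha> = {\<beta>. closed_one_form A \<beta> \<and>
     (\<exists>g. smooth_fun A g \<and>
       (\<forall>i. \<forall>p\<in>cdom (A i). \<forall>v. \<beta> i p v = \<alpha> i p v + differential A g i p v))}"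


section \<open>Symplectic manifolds and Hamiltonian dynamics\<close>

definition symplectic_manifold ::
  "('i, 'a::{second_countable_topology,t2_space}, 'e::euclidean_space) atlas
     \<Rightarrow> ('i, 'a, 'e) form2 \<Rightarrow> bool" where
  "symplectic_manifold A \<omega> \<longleftrightarrow> smooth_atlas A \<and> closed_two_form A \<omega> \<and>
     (\<forall>i. \<forall>p\<in>cdom (A i). \<forall>u. (\<forall>v. \<omega> i p u v = 0) \<longrightarrow> u = 0)"

definition sgrad :: "('i, 'a, 'e) form2 \<Rightarrow> ('i, 'a, 'e) form1 \<Rightarrow> ('i, 'a, 'e) vfield" where
  "sgrad \<omega> \<alpha> = (\<lambda>i p. THE u. \<forall>v. \<omega> i p u v = \<alpha> i p v)"

definition sgrad_fun ::
  "('i, 'a, 'e::euclidean_space) atlas \<Rightarrow> ('i, 'a, 'e) form2 \<Rightarrow> ('a \<Rightarrow> real) \<Rightarrow> ('i, 'a, 'e) vfield" where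
  "sgrad_fun A \<omega> f = sgrad \<omega> (\<lambda>i p v. - differential A f i p v)"

text \<open>Continuity has to be required separately, because coordinate maps are arbitrary outside the
  domains of the charts.\<close>

definition integral_curve ::
  "('i, 'a::topological_space, 'e::euclidean_space) atlas \<Rightarrow> (real \<Rightarrow> ('i, 'a, 'e) vfield)
     \<Rightarrow> real set \<Rightarrow> (real \<Rightarrow> 'a) \<Rightarrow> bool" where
  "integral_curve A X T \<gamma> \<longleftrightarrow> continuous_on T \<gamma> \<and>
     (\<forall>t\<in>T. \<forall>i. \<gamma> t \<in> cdom (A i) \<longrightarrow>
        ((cmap (A i) \<circ> \<gamma>) has_vector_derivative X t i (\<gamma> t)) (at t within T))"

text \<open>\<open>\<phi>\<close> is the flow of the time-dependent vector field \<open>X\<close>, starting at time \<open>0\<close> and defined on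
  the time interval \<open>T\<close>. Bijectivity is automatic for a time-independent field and \<open>T = UNIV\<close>, and
  for a compactly supported field. In general it is what makes the maps \<open>\<phi> t\<close> diffeomorphisms
  (smoothness of \<open>\<phi> t\<close> and of its inverse follows from smooth dependence on initial
  conditions).\<close>

definition is_flow ::
  "('i, 'a::topological_space, 'e::euclidean_space) atlas \<Rightarrow> (real \<Rightarrow> ('i, 'a, 'e) vfield)
     \<Rightarrow> real set \<Rightarrow> (real \<Rightarrow> 'a \<Rightarrow> 'a) \<Rightarrow> bool" where
  "is_flow A X T \<phi> \<longleftrightarrow> \<phi> 0 = id \<and> (\<forall>x. integral_curve A X T (\<lambda>t. \<phi> t x)) \<and> (\<forall>t\<in>T. bij (\<phi> t))"

definition hamiltonian_diffeo ::
  "('i, 'a::topological_space, 'e::euclidean_space) atlas \<Rightarrow> ('i, 'a, 'e) form2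
     \<Rightarrow> ('a \<Rightarrow> 'a) \<Rightarrow> bool" where
  "hamiltonian_diffeo A \<omega> \<theta> \<longleftrightarrow>
     (\<exists>H :: 'a \<times> real \<Rightarrow> real. \<exists>\<phi>.
        smooth_fun (prod_atlas A real_atlas) H \<and>
        is_flow A (\<lambda>t. sgrad_fun A \<omega> (\<lambda>x. H (x, t))) {0..1} \<phi> \<and> \<theta> = \<phi> 1)"

definition invariant_measure :: "('a::topological_space \<Rightarrow> 'a) \<Rightarrow> 'a measure \<Rightarrow> bool" where
  "invariant_measure \<phi> \<mu> \<longleftrightarrow> \<phi> \<in> measurable \<mu> \<mu> \<and> distr \<mu> \<mu> \<phi> = \<mu>"

definition compactly_supported_borel_prob :: "'a::topological_space measure \<Rightarrow> bool" where
  "compactly_supported_borel_prob \<mu> \<longleftrightarrow>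
     prob_space \<mu> \<and> sets \<mu> = sets borel \<and> (\<exists>K. compact K \<and> (AE x in \<mu>. x \<in> K))"


section \<open>The circle \<open>\<real>/\<int>\<close> and its cotangent bundle\<close>

definition int_cong :: "real \<Rightarrow> real \<Rightarrow> bool" where
  "int_cong x y \<longleftrightarrow> x - y \<in> \<int>"

quotient_type circle = real / int_cong
  morphisms rep_circle circle_of
proof (rule equivpI)
  show "reflp int_cong" by (auto simp: reflp_def int_cong_def)
  show "symp int_cong"
  proof (rule sympI)
    fix x y assume "int_cong x y"
    then have "- (x - y) \<in> \<int>" unfolding int_cong_def by (rule Ints_minus)
    then show "int_cong y x" by (simp add: int_cong_def)
  qed
  show "transp int_cong"
  proof (rule transpI)
    fix x y z assume "int_cong x y" "int_cong y z"
    then have "(x - y) + (y - z) \<in> \<int>" unfolding int_cong_def by (rule Ints_add)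
    then show "int_cong x z" by (simp add: int_cong_def)
  qed
qed

instantiation circle :: topological_space
begin
definition open_circle :: "circle set \<Rightarrow> bool" where
  "open_circle U \<longleftrightarrow> open (circle_of -` U)"
instance
proof
  show "open (UNIV :: circle set)" by (simp add: open_circle_def)
  show "open (S \<inter> T)" if "open S" "open T" for S T :: "circle set"
    using that by (auto simp: open_circle_def)
  show "open (\<Union>K)" if "\<forall>S\<in>K. open S" for K :: "circle set set"
    using that by (auto simp: open_circle_def vimage_Union)
qed
end

lemma circle_of_eq_iff: "circle_of x = circle_of y \<longleftrightarrow> x - y \<in> \<int>"
  by (simp add: circle.abs_eq_iff int_cong_def)

lemma vimage_circle_of_image: "circle_of -` (circle_of ` S) = (\<Union>n::int. (+) (of_int n) ` S)"
proof (intro set_eqI iffI)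
  fix x assume "x \<in> circle_of -` (circle_of ` S)"
  then obtain y n where "y \<in> S" "x - y = of_int n"
    by (auto simp: circle_of_eq_iff elim!: Ints_cases)
  then have "x = of_int n + y" by simp
  then show "x \<in> (\<Union>n::int. (+) (of_int n) ` S)" using \<open>y \<in> S\<close> by blast
next
  fix x assume "x \<in> (\<Union>n::int. (+) (of_int n) ` S)"
  then obtain n :: int and y where "y \<in> S" "x = of_int n + y" by blast
  then have "circle_of x = circle_of y" by (simp add: circle_of_eq_iff)
  then show "x \<in> circle_of -` (circle_of ` S)" using \<open>y \<in> S\<close> by simp
qed

lemma open_circle_of_image: "open S \<Longrightarrow> open (circle_of ` S)"
  unfolding open_circle_def vimage_circle_of_image by (intro open_UN ballI open_translation) auto

lemma continuous_on_circle_of: "continuous_on S circle_of"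
  by (rule continuous_on_subset[of UNIV]) (auto simp: continuous_on_open_vimage open_circle_def)

lemma circle_of_cases: obtains t where "z = circle_of t"
  by (metis Quotient_abs_rep Quotient_circle)

instance circle :: t2_space
proof
  fix x y :: circle
  assume "x \<noteq> y"
  obtain s t where st: "x = circle_of s" "y = circle_of t"
    by (metis circle_of_cases)
  have "closed (\<int> :: real set)" by (rule closed_Ints)
  moreover have "s - t \<notin> \<int>" using \<open>x \<noteq> y\<close> st by (simp add: circle_of_eq_iff)
  ultimately obtain e where e: "e > 0" "\<And>u. dist u (s - t) < e \<Longrightarrow> u \<notin> \<int>"
    using open_dist[of "- \<int> :: real set"] by (metis ComplD ComplI open_Compl)
  define U V where "U = circle_of ` ball s (e/2)" and "V = circle_of ` ball t (e/2)"
  have "U \<inter> V = {}"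
  proof (rule ccontr)
    assume "U \<inter> V \<noteq> {}"
    then obtain a b where ab: "a \<in> ball s (e/2)" "b \<in> ball t (e/2)" "circle_of a = circle_of b"
      by (auto simp: U_def V_def)
    then have "dist (a - b) (s - t) < e"
      unfolding mem_ball dist_real_def by linarith
    with e ab show False by (auto simp: circle_of_eq_iff)
  qed
  moreover have "open U" "open V" "x \<in> U" "y \<in> V"
    using e by (auto simp: U_def V_def st open_circle_of_image)
  ultimately show "\<exists>U V. open U \<and> open V \<and> x \<in> U \<and> y \<in> V \<and> U \<inter> V = {}" by blast
qed

instance circle :: second_countable_topology
proof
  obtain B :: "real set set" where B: "countable B" "topological_basis B"
    using ex_countable_basis by blast
  have "topological_basis ((`) circle_of ` B)"
  proof (rule topological_basisI)
    show "open U" if "U \<in> (`) circle_of ` B" for U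
      using that B(2) by (auto intro: open_circle_of_image topological_basis_open)
    fix U :: "circle set" and z assume "open U" "z \<in> U"
    obtain t where t: "z = circle_of t" by (rule circle_of_cases)
    have "open (circle_of -` U)" "t \<in> circle_of -` U"
      using \<open>open U\<close> \<open>z \<in> U\<close> t by (auto simp: open_circle_def)
    then obtain W where "W \<in> B" "t \<in> W" "W \<subseteq> circle_of -` U"
      using B(2) topological_basisE by metis
    then show "\<exists>B'\<in>(`) circle_of ` B. z \<in> B' \<and> B' \<subseteq> U"
      using t by (intro bexI[of _ "circle_of ` W"]) auto
  qed
  then show "\<exists>B::circle set set. countable B \<and> open = generate_topology B"
    using B(1) by (metis countable_image topological_basis_imp_subbasis)
qed

text \<open>The chart with index \<open>a\<close> sends \<open>s mod 1\<close> to its representative in the interval \<open>(a, a + 1)\<close>.\<close>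

definition circle_atlas :: "(real, circle, real) atlas" where
  "circle_atlas = (\<lambda>a. Chart (circle_of ` {a<..<a + 1}) (inv_into {a<..<a + 1} circle_of))"

text \<open>\<open>T\<^sup>*S\<^sup>1\<close> with the canonical coordinates \<open>(r, s mod 1)\<close> and the symplectic form \<open>dr \<and> ds\<close>.\<close>

definition cot_circle_atlas :: "(unit \<times> real, real \<times> circle, real \<times> real) atlas" where
  "cot_circle_atlas = prod_atlas real_atlas circle_atlas"

definition dr_ds :: "(unit \<times> real, real \<times> circle, real \<times> real) form2" where
  "dr_ds = (\<lambda>_ _ (v\<^sub>r, v\<^sub>s) (w\<^sub>r, w\<^sub>s). v\<^sub>r * w\<^sub>s - v\<^sub>s * w\<^sub>r)"

text \<open>The stabilization \<open>N = M \<times> T\<^sup>*S\<^sup>1\<close> of \<open>(M, \<omega>)\<close>, with \<open>\<Omega> = \<omega> + dr \<and> ds\<close>.\<close>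

definition stab_atlas ::
  "('i, 'a, 'e) atlas \<Rightarrow> ('i \<times> unit \<times> real, 'a \<times> real \<times> circle, 'e \<times> real \<times> real) atlas" where
  "stab_atlas A = prod_atlas A cot_circle_atlas"

definition stab_form ::
  "('i, 'a, 'e) form2 \<Rightarrow> ('i \<times> unit \<times> real, 'a \<times> real \<times> circle, 'e \<times> real \<times> real) form2" where
  "stab_form \<omega> = (\<lambda>(i, j) (p, q) (v, v') (w, w'). \<omega> i p v w + dr_ds j q v' w')"

definition stab :: "'a set \<Rightarrow> ('a \<times> real \<times> circle) set" where
  "stab Z = Z \<times> {(r, s). r = 0}"

text \<open>A function \<open>F\<close> on \<open>M \<times> S\<^sup>1\<close> as a function on \<open>M\<close> depending on the time \<open>t\<close>.\<close>

definition at_time :: "('a \<times> circle \<Rightarrow> real) \<Rightarrow> real \<Rightarrow> 'a \<Rightarrow> real" where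
  "at_time F t x = F (x, circle_of t)"

text \<open>The rotation vector of \<open>\<mu>\<close> for the Hamiltonian flow \<open>\<phi>\<close> generated by \<open>F\<close>. A real homology
  class is given by its pairing with the elements of \<open>H\<^sup>1(M, \<real>)\<close>; when \<open>\<mu>\<close> is invariant under \<open>\<phi> 1\<close>,
  the value does not depend on the closed form \<open>\<alpha>\<close> chosen in the cohomology class \<open>a\<close>.\<close>

definition rotation_vector ::
  "('i, 'a, 'e::euclidean_space) atlas \<Rightarrow> ('i, 'a, 'e) form2 \<Rightarrow> ('a \<times> circle \<Rightarrow> real)
     \<Rightarrow> (real \<Rightarrow> 'a \<Rightarrow> 'a) \<Rightarrow> 'a measure \<Rightarrow> ('i, 'a, 'e) form1 set \<Rightarrow> real" where
  "rotation_vector A \<omega> F \<phi> \<mu> a =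
     (let \<alpha> = (SOME \<alpha>. \<alpha> \<in> a) in
        LINT t:{0..1}|lborel. LINT x|\<mu>. contract A \<alpha> (sgrad_fun A \<omega> (at_time F t)) (\<phi> t x))"

end

theory Submission
  imports Defs
begin

text \<open>On \<open>N\<close> put \<open>H = F + r\<close>; its flow \<open>\<Phi>\<close> is autonomous and projects to the flow of \<open>F\<close> on \<open>M\<close>. If for some
  \<open>n\<close> the integral of \<open>\<langle>\<alpha>, sgrad H\<rangle>\<close> over every \<open>\<Phi>\<close>-orbit of length \<open>n\<close> is less than \<open>n\<close>, then averaging along
  \<open>\<Phi>\<close> gives a function \<open>g\<close> with \<open>\<langle>\<alpha> + dg, sgrad H\<rangle> < 1\<close> everywhere. Along the flow \<open>\<psi>'\<close> of
  \<open>sgrad (\<alpha> + dg)\<close> the function \<open>H\<close> then grows at rate less than \<open>1\<close>, whereas the Hamiltonian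
  diffeomorphism \<open>\<theta> = (\<psi>'\<^sub>1)\<^sup>-\<^sup>1 \<psi>\<^sub>1\<close> of \<open>N\<close> maps a point of \<open>stab Y\<close> into \<open>stab X\<close> by (Q1), so that \<open>H\<close> grows
  from at most \<open>0\<close> on \<open>stab X\<close> to at least \<open>1\<close> on \<open>stab X'\<close>. Hence for every \<open>n\<close> there is an orbit with integral at
  least \<open>n\<close>, and a weak limit of the empirical measures on these orbits is the required invariant
  measure (Krylov--Bogoliubov).\<close>

section \<open>Calculus of smooth maps\<close>

text \<open>With \<open>V = sgrad H\<close>, antisymmetry of \<Omega> gives
  \<open>dH(sgrad \<beta>) = \<beta>(V)\<close> for each closed form \<beta>. Hence adding
  \<open>dg\<close> to \<alpha> changes the growth of \<open>H\<close> by the derivative of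
  \<open>g\<close> along \<Phi>, and a weighted average \<open>g\<close> turns the rate into its
  time average. This requires an autonomous \<open>H\<close>, which is what the term
  \<open>r\<close> provides. That \<theta> is Hamiltonian rests on \<psi> being smooth and
  preserving the symplectic form, so flows must depend smoothly on initial points. The flow \<psi>'
  has to be complete, although \<open>g\<close> has no compact support in the direction of
  \<open>r\<close>. Orbits of \<Phi> start at any phase of the circle, while empirical measures use
  the time-one map; since the integrand is bounded, the two sums differ by a constant, harmless
  after division by \<open>n\<close>. A change of the representative of the class costs a constant
  as well. The topology is second countable and Hausdorff, with no metric given, so weak limits are
  taken on the real line after coding the compact set that contains the orbits.\<close>

lemma frechet_derivative_eq: "(f has_derivative f') (at x) \<Longrightarrow> frechet_derivative f (at x) = f'"
  by (metis frechet_derivative_at)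

text \<open>Values off \<open>S\<close> enter \<open>Ck_on\<close> through the two-sided derivative
  at each point; openness of \<open>S\<close> is what keeps them out.\<close>

lemma Ck_on_cong:
  assumes "open S" "\<And>x. x \<in> S \<Longrightarrow> f x = g x" "Ck_on k f S"
  shows "Ck_on k g S"
  using assms(2,3)
proof (induction k arbitrary: f g)
  case 0
  then show ?case by (simp cong: continuous_on_cong)
next
  case (Suc k)
  have d: "(g has_derivative frechet_derivative f (at x)) (at x)" if "x \<in> S" for x
    by (rule has_derivative_transform_within_open[of f, OF _ \<open>open S\<close> that])
      (use Suc.prems that in \<open>auto simp: frechet_derivative_works[symmetric]\<close>)
  then have e: "frechet_derivative f (at x) v = frechet_derivative g (at x) v" if "x \<in> S" for x v
    using that frechet_derivative_eq by metis
  have "Ck_on k (\<lambda>x. frechet_derivative g (at x) v) S" for v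
    by (rule Suc.IH[of "\<lambda>x. frechet_derivative f (at x) v"]) (use e Suc.prems in auto)
  then show ?case
    using d by (auto simp: differentiable_def)
qed

lemma Ck_on_subset: "Ck_on k f S \<Longrightarrow> T \<subseteq> S \<Longrightarrow> Ck_on k f T"
  by (induction k arbitrary: f) (auto intro: continuous_on_subset)

lemma Ck_on_imp_continuous_on: "Ck_on k f S \<Longrightarrow> continuous_on S f"
  by (cases k) (auto intro!: continuous_at_imp_continuous_on differentiable_imp_continuous_within)

lemma Ck_on_Suc_imp: "Ck_on (Suc k) f S \<Longrightarrow> Ck_on k f S"
  by (induction k arbitrary: f)
    (auto intro!: continuous_at_imp_continuous_on differentiable_imp_continuous_within)

lemma Ck_on_has_derivative:
  "Ck_on (Suc k) f S \<Longrightarrow> x \<in> S \<Longrightarrow> (f has_derivative frechet_derivative f (at x)) (at x)"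
  by (simp add: frechet_derivative_works[symmetric])

text \<open>Introduces the class from an explicit formula for the derivative, in place of the choice
  operator behind \<open>frechet_derivative\<close>.\<close>

lemma Ck_on_SucI:
  assumes "open S" "\<And>x. x \<in> S \<Longrightarrow> (f has_derivative f' x) (at x)" "\<And>v. Ck_on k (\<lambda>x. f' x v) S"
  shows "Ck_on (Suc k) f S"
proof -
  have "frechet_derivative f (at x) = f' x" if "x \<in> S" for x
    using assms(2)[OF that] by (rule frechet_derivative_eq)
  then have "Ck_on k (\<lambda>x. frechet_derivative f (at x) v) S" for v
    by (intro Ck_on_cong[OF assms(1) _ assms(3)[of v]]) simp
  then show ?thesis using assms(2) by (auto simp: differentiable_def)
qed

lemma Ck_on_const: "open S \<Longrightarrow> Ck_on k (\<lambda>x. c) S"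
proof (induction k arbitrary: c)
  case (Suc k)
  show ?case by (rule Ck_on_SucI[OF Suc.prems]) (use Suc in \<open>auto intro!: derivative_eq_intros\<close>)
qed simp

lemma Ck_on_bounded_linear: "open S \<Longrightarrow> bounded_linear f \<Longrightarrow> Ck_on k f S"
proof (cases k)
  case (Suc j)
  assume "open S" "bounded_linear f"
  then show ?thesis unfolding Suc
    by (intro Ck_on_SucI[of S f "\<lambda>_. f"] Ck_on_const bounded_linear_imp_has_derivative)
qed (simp add: linear_continuous_on)

lemma Ck_on_compose_linear:
  assumes "bounded_linear L" "open S" "Ck_on k f S"
  shows "Ck_on k (\<lambda>x. L (f x)) S"
  using assms(3)
proof (induction k arbitrary: f)
  case 0
  then show ?case using bounded_linear.continuous_on[OF assms(1)] by simp
next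
  case (Suc k)
  show ?case
    by (rule Ck_on_SucI[OF assms(2) bounded_linear.has_derivative[OF assms(1) Ck_on_has_derivative[OF Suc.prems]]])
      (use Suc in auto)
qed

lemma Ck_on_add:
  assumes "open S" "Ck_on k f S" "Ck_on k g S"
  shows "Ck_on k (\<lambda>x. f x + g x) S"
  using assms(2,3)
proof (induction k arbitrary: f g)
  case (Suc k)
  show ?case
    by (rule Ck_on_SucI[OF assms(1) has_derivative_add[OF Ck_on_has_derivative[OF Suc.prems(1)] Ck_on_has_derivative[OF Suc.prems(2)]]])
      (use Suc in auto)
qed (auto intro: continuous_intros)

lemma Ck_on_sum:
  assumes "open S" "\<And>i. i \<in> I \<Longrightarrow> Ck_on k (f i) S"
  shows "Ck_on k (\<lambda>x. \<Sum>i\<in>I. f i x) S"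
  using assms(2) by (induction I rule: infinite_finite_induct) (auto intro: Ck_on_const Ck_on_add assms(1))

lemma Ck_on_bilinear:
  assumes B: "bounded_bilinear B" and S: "open S" and "Ck_on k f S" "Ck_on k g S"
  shows "Ck_on k (\<lambda>x. B (f x) (g x)) S"
  using assms(3,4)
proof (induction k arbitrary: f g)
  case 0
  then show ?case using bounded_bilinear.continuous_on[OF B] by simp
next
  case (Suc k)
  show ?case
    proof (rule Ck_on_SucI[OF S bounded_bilinear.FDERIV[OF B Ck_on_has_derivative[OF Suc.prems(1)] Ck_on_has_derivative[OF Suc.prems(2)]]])
    fix v
    show "Ck_on k (\<lambda>x. B (f x) (frechet_derivative g (at x) v) + B (frechet_derivative f (at x) v) (g x)) S"
      by (intro Ck_on_add S Suc.IH Ck_on_Suc_imp[OF Suc.prems(1)] Ck_on_Suc_imp[OF Suc.prems(2)])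
        (use Suc.prems in auto)
  qed
qed

lemmas Ck_on_scaleR = Ck_on_bilinear[OF bounded_bilinear_scaleR]
lemmas Ck_on_mult = Ck_on_bilinear[OF bounded_bilinear_mult]
lemmas Ck_on_inner = Ck_on_bilinear[OF bounded_bilinear_inner]

text \<open>Trades a linear map that varies with a point for finitely many functions of that point,
  its values on the basis; this matters because \<open>Ck_on\<close> only speaks of derivatives in
  fixed directions.\<close>

lemma linear_expand_basis:
  assumes "linear L"
  shows "L v = (\<Sum>b\<in>Basis. (v \<bullet> b) *\<^sub>R L b)"
proof -
  have "L v = L (\<Sum>b\<in>Basis. (v \<bullet> b) *\<^sub>R b)" by (simp only: euclidean_representation)
  also have "\<dots> = (\<Sum>b\<in>Basis. (v \<bullet> b) *\<^sub>R L b)"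
    by (simp only: linear_sum[OF assms] linear_scale[OF assms])
  finally show ?thesis .
qed

text \<open>In the chain rule the direction \<open>?f' x v\<close> moves with \<open>x\<close>,
  while the induction hypothesis covers the derivative of \<open>g\<close> in a fixed direction
  only. Expanding the direction over the basis separates the two.\<close>

lemma Ck_on_compose:
  fixes f :: "'a::euclidean_space \<Rightarrow> 'b::euclidean_space"
  assumes "open S" "open T" "\<And>x. x \<in> S \<Longrightarrow> f x \<in> T" "Ck_on k f S" "Ck_on k g T"
  shows "Ck_on k (\<lambda>x. g (f x)) S"
  using assms(4,5)
proof (induction k arbitrary: g)
  case 0
  then show ?case using continuous_on_compose2[of T g S f] assms(3) by auto
next
  case (Suc k)
  let ?f' = "\<lambda>x. frechet_derivative f (at x)" and ?g' = "\<lambda>x. frechet_derivative g (at x)"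
  have df: "(f has_derivative ?f' x) (at x)" if "x \<in> S" for x
    using Ck_on_has_derivative Suc.prems(1) that by blast
  have dg: "(g has_derivative ?g' y) (at y)" if "y \<in> T" for y
    using Ck_on_has_derivative Suc.prems(2) that by blast
  have d: "((\<lambda>x. g (f x)) has_derivative (\<lambda>v. \<Sum>b\<in>Basis. (?f' x v \<bullet> b) *\<^sub>R ?g' (f x) b)) (at x)"
    if "x \<in> S" for x
  proof -
    have "linear (?g' (f x))" using dg[OF assms(3)[OF that]] has_derivative_linear by blast
    then have "?g' (f x) \<circ> ?f' x = (\<lambda>v. \<Sum>b\<in>Basis. (?f' x v \<bullet> b) *\<^sub>R ?g' (f x) b)"
      using linear_expand_basis by (metis comp_apply)
    then show ?thesis
      using diff_chain_at[OF df[OF that] dg[OF assms(3)[OF that]]] by (simp add: o_def)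
  qed
  show ?case
  proof (rule Ck_on_SucI[OF assms(1) d])
    fix v
    have "Ck_on k (\<lambda>x. ?g' (f x) b) S" for b
      using Suc.IH[of "\<lambda>y. ?g' y b"] Suc.prems Ck_on_Suc_imp by auto
    moreover have "Ck_on k (\<lambda>x. ?f' x v \<bullet> b) S" for b
      using Suc.prems by (intro Ck_on_compose_linear[OF bounded_linear_inner_left assms(1)]) auto
    ultimately show "Ck_on k (\<lambda>x. \<Sum>b\<in>Basis. (?f' x v \<bullet> b) *\<^sub>R ?g' (f x) b) S"
      by (intro Ck_on_sum Ck_on_scaleR assms(1))
  qed
qed

lemma Ck_on_Pair:
  assumes "open S" "Ck_on k f S" "Ck_on k g S"
  shows "Ck_on k (\<lambda>x. (f x, g x)) S"
proof -
  have "Ck_on k (\<lambda>x. (f x, 0) + (0, g x)) S"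
    by (intro Ck_on_add assms Ck_on_compose_linear[where L="\<lambda>x. (x, 0)"]
        Ck_on_compose_linear[where L="\<lambda>x. (0, x)"] bounded_linear_Pair bounded_linear_ident bounded_linear_zero)
  then show ?thesis by simp
qed

lemma Ck_on_local:
  assumes "\<And>x. x \<in> S \<Longrightarrow> \<exists>T. open T \<and> x \<in> T \<and> Ck_on k f T"
  shows "Ck_on k f S"
  using assms
proof (induction k arbitrary: f)
  case 0
  then have "continuous (at x) f" if "x \<in> S" for x
    using that continuous_on_eq_continuous_at by (auto simp: continuous_on_interior)
  then show ?case by (simp add: continuous_at_imp_continuous_on)
next
  case (Suc k)
  have "f differentiable (at x)" if "x \<in> S" for x
    using Suc.prems[OF that] by auto
  moreover have "Ck_on k (\<lambda>x. frechet_derivative f (at x) v) S" for v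
  proof (rule Suc.IH)
    fix x assume "x \<in> S"
    from Suc.prems[OF this] show "\<exists>T. open T \<and> x \<in> T \<and> Ck_on k (\<lambda>x. frechet_derivative f (at x) v) T"
      by auto
  qed
  ultimately show ?case by simp
qed

lemma smooth_on_cong: "open S \<Longrightarrow> (\<And>x. x \<in> S \<Longrightarrow> f x = g x) \<Longrightarrow> smooth_on f S \<Longrightarrow> smooth_on g S"
  unfolding smooth_on_def using Ck_on_cong by blast

lemma smooth_on_subset: "smooth_on f S \<Longrightarrow> T \<subseteq> S \<Longrightarrow> smooth_on f T"
  unfolding smooth_on_def using Ck_on_subset by blast

lemma smooth_on_imp_continuous_on: "smooth_on f S \<Longrightarrow> continuous_on S f"
  unfolding smooth_on_def using Ck_on_imp_continuous_on by blast

lemma smooth_on_has_derivative: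
  "smooth_on f S \<Longrightarrow> x \<in> S \<Longrightarrow> (f has_derivative frechet_derivative f (at x)) (at x)"
  unfolding smooth_on_def using Ck_on_has_derivative by blast

lemma smooth_on_frechet_derivative: "smooth_on f S \<Longrightarrow> smooth_on (\<lambda>x. frechet_derivative f (at x) v) S"
  unfolding smooth_on_def using Ck_on.simps(2) by blast

lemma smooth_on_compose:
  fixes f :: "'a::euclidean_space \<Rightarrow> 'b::euclidean_space"
  assumes "open S" "open T" "\<And>x. x \<in> S \<Longrightarrow> f x \<in> T" "smooth_on f S" "smooth_on g T"
  shows "smooth_on (\<lambda>x. g (f x)) S"
  using assms Ck_on_compose unfolding smooth_on_def by blast

lemma smooth_on_local:
  assumes "\<And>x. x \<in> S \<Longrightarrow> \<exists>T. open T \<and> x \<in> T \<and> smooth_on f T"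
  shows "smooth_on f S"
  unfolding smooth_on_def
proof (intro allI Ck_on_local)
  fix k x assume "x \<in> S"
  from assms[OF this] show "\<exists>T. open T \<and> x \<in> T \<and> Ck_on k f T" by (auto simp: smooth_on_def)
qed

lemma smooth_on_const: "open S \<Longrightarrow> smooth_on (\<lambda>x. c) S"
  by (simp add: smooth_on_def Ck_on_const)

lemma smooth_on_bounded_linear: "open S \<Longrightarrow> bounded_linear f \<Longrightarrow> smooth_on f S"
  by (simp add: smooth_on_def Ck_on_bounded_linear)

lemma smooth_on_compose_linear:
  "bounded_linear L \<Longrightarrow> open S \<Longrightarrow> smooth_on f S \<Longrightarrow> smooth_on (\<lambda>x. L (f x)) S"
  by (simp add: smooth_on_def Ck_on_compose_linear)

lemma smooth_on_add: "open S \<Longrightarrow> smooth_on f S \<Longrightarrow> smooth_on g S \<Longrightarrow> smooth_on (\<lambda>x. f x + g x) S"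
  by (simp add: smooth_on_def Ck_on_add)

lemma smooth_on_sum: "open S \<Longrightarrow> (\<And>i. i \<in> I \<Longrightarrow> smooth_on (f i) S) \<Longrightarrow> smooth_on (\<lambda>x. \<Sum>i\<in>I. f i x) S"
  by (simp add: smooth_on_def Ck_on_sum)

lemma smooth_on_mult:
  fixes f g :: "'a::euclidean_space \<Rightarrow> real"
  shows "open S \<Longrightarrow> smooth_on f S \<Longrightarrow> smooth_on g S \<Longrightarrow> smooth_on (\<lambda>x. f x * g x) S"
  by (simp add: smooth_on_def Ck_on_bilinear[OF bounded_bilinear_mult])

lemma smooth_on_Pair: "open S \<Longrightarrow> smooth_on f S \<Longrightarrow> smooth_on g S \<Longrightarrow> smooth_on (\<lambda>x. (f x, g x)) S"
  by (simp add: smooth_on_def Ck_on_Pair)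

lemma smooth_on_minus: "open S \<Longrightarrow> smooth_on f S \<Longrightarrow> smooth_on (\<lambda>x. - f x) S"
  by (rule smooth_on_compose_linear[where L=uminus]) (auto intro: bounded_linear_minus bounded_linear_ident)

section \<open>Ordinary differential equations and smooth dependence on initial points\<close>

text \<open>The squared norm is differentiated because the norm itself is singular at zero. Then
  \<open>2 * (d s \<bullet> d' s)\<close> is at most
  \<open>2 * L * (norm (d s))\<^sup>2 + 2 * e * norm (d s)\<close>, and the square of
  \<open>norm (d s) - e\<close> absorbs the mixed term; hence the exponent
  \<open>2 * L + 1\<close>.\<close>

lemma gronwall_forward:
  fixes d :: "real \<Rightarrow> 'a::real_inner"
  assumes t: "0 \<le> t" and L: "0 \<le> L"
    and d: "\<And>s. 0 \<le> s \<Longrightarrow> s \<le> t \<Longrightarrow> (d has_vector_derivative d' s) (at s)"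
    and bound: "\<And>s. 0 \<le> s \<Longrightarrow> s \<le> t \<Longrightarrow> norm (d' s) \<le> L * norm (d s) + e"
  shows "(norm (d t))\<^sup>2 \<le> exp ((2 * L + 1) * t) * ((norm (d 0))\<^sup>2 + e\<^sup>2 * t)"
proof -
  define M where "M = 2 * L + 1"
  define \<phi> where "\<phi> s = exp (- (M * s)) * (d s \<bullet> d s) - e\<^sup>2 * s" for s
  have "\<phi> t \<le> \<phi> 0"
  proof (rule DERIV_nonpos_imp_nonincreasing[OF t])
    fix s assume s: "0 \<le> s" "s \<le> t"
    have i: "((\<lambda>s. d s \<bullet> d s) has_real_derivative 2 * (d s \<bullet> d' s)) (at s)"
      using has_derivative_inner[OF d[OF s, unfolded has_vector_derivative_def] d[OF s, unfolded has_vector_derivative_def]]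
      by (simp add: has_field_derivative_def inner_commute algebra_simps mult_2_right mult_commute_abs)
    let ?D = "exp (- (M * s)) * (2 * (d s \<bullet> d' s) - M * (d s \<bullet> d s)) - e\<^sup>2"
    have "(\<phi> has_real_derivative ?D) (at s)"
      unfolding \<phi>_def by (auto intro!: derivative_eq_intros i simp: algebra_simps)
    moreover have "?D \<le> 0"
    proof -
      have "d s \<bullet> d' s \<le> norm (d s) * (L * norm (d s) + e)"
        using bound[OF s] by (meson norm_cauchy_schwarz order_trans mult_left_mono norm_ge_zero)
      moreover have "0 \<le> (norm (d s) - e)\<^sup>2" by simp
      ultimately have "2 * (d s \<bullet> d' s) - M * (d s \<bullet> d s) \<le> e\<^sup>2"
        unfolding M_def by (simp add: dot_square_norm power2_eq_square algebra_simps)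
      then have "exp (- (M * s)) * (2 * (d s \<bullet> d' s) - M * (d s \<bullet> d s)) \<le> exp (- (M * s)) * e\<^sup>2"
        by (simp add: mult_left_mono)
      also have "\<dots> \<le> 1 * e\<^sup>2"
        by (intro mult_right_mono) (use s L in \<open>auto simp: M_def\<close>)
      finally show ?thesis by simp
    qed
    ultimately show "\<exists>y. (\<phi> has_real_derivative y) (at s) \<and> y \<le> 0" by blast
  qed
  then have "exp (- (M * t)) * (norm (d t))\<^sup>2 \<le> (norm (d 0))\<^sup>2 + e\<^sup>2 * t"
    by (simp add: \<phi>_def dot_square_norm)
  then have "exp (M * t) * (exp (- (M * t)) * (norm (d t))\<^sup>2) \<le> exp (M * t) * ((norm (d 0))\<^sup>2 + e\<^sup>2 * t)"
    by (intro mult_left_mono) auto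
  then show ?thesis by (simp add: M_def mult.assoc[symmetric] exp_add[symmetric])
qed

lemma gronwall:
  fixes d :: "real \<Rightarrow> 'a::real_inner"
  assumes L: "0 \<le> L" and t: "\<bar>t\<bar> \<le> T"
    and d: "\<And>s. \<bar>s\<bar> \<le> \<bar>t\<bar> \<Longrightarrow> (d has_vector_derivative d' s) (at s)"
    and bound: "\<And>s. \<bar>s\<bar> \<le> \<bar>t\<bar> \<Longrightarrow> norm (d' s) \<le> L * norm (d s) + e"
  shows "(norm (d t))\<^sup>2 \<le> exp ((2 * L + 1) * T) * ((norm (d 0))\<^sup>2 + e\<^sup>2 * T)"
proof -
  have "(norm (d t))\<^sup>2 \<le> exp ((2 * L + 1) * \<bar>t\<bar>) * ((norm (d 0))\<^sup>2 + e\<^sup>2 * \<bar>t\<bar>)"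
  proof (cases "0 \<le> t")
    case True
    then show ?thesis using gronwall_forward[of t L d d' e] assms by auto
  next
    case False
    have "((\<lambda>s. d (- s)) has_vector_derivative - d' (- s)) (at s)" if "0 \<le> s" "s \<le> - t" for s
    proof -
      have "((\<lambda>s::real. - s) has_vector_derivative -1) (at s)"
        by (auto intro!: derivative_eq_intros)
      then show ?thesis
        using vector_diff_chain_at[of "\<lambda>s. - s" "-1" s d "d' (- s)"] d[of "- s"] that False
        by (simp add: o_def)
    qed
    then show ?thesis
      using gronwall_forward[of "- t" L "\<lambda>s. d (- s)" "\<lambda>s. - d' (- s)" e] bound False L by auto
  qed
  also have "\<dots> \<le> exp ((2 * L + 1) * T) * ((norm (d 0))\<^sup>2 + e\<^sup>2 * T)"
    using t L by (intro mult_mono add_mono mult_left_mono) auto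
  finally show ?thesis .
qed

text \<open>Picard iteration. Curves on \<open>{-\<delta>..\<delta>}\<close> are encoded as bounded
  continuous functions on the whole line by truncating time with \<open>k\<close>, which places the
  fixed point argument in a complete space; integrating the Lipschitz bound over a time of at most
  \<delta> gives the contraction constant \<open>L * \<delta>\<close>.\<close>

lemma lipschitz_ode_exists:
  fixes f :: "real \<Rightarrow> 'a::euclidean_space \<Rightarrow> 'a"
  assumes \<delta>: "0 < \<delta>" and L: "0 \<le> L" "L * \<delta> < 1"
    and cont: "continuous_on ({-\<delta>..\<delta>} \<times> UNIV) (\<lambda>(t, x). f t x)"
    and lip: "\<And>t x y. \<bar>t\<bar> \<le> \<delta> \<Longrightarrow> norm (f t x - f t y) \<le> L * norm (x - y)"
  obtains c where "c 0 = x0" "\<And>t. \<bar>t\<bar> < \<delta> \<Longrightarrow> (c has_vector_derivative f t (c t)) (at t)"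
proof -
  define g where "g c s = f s (apply_bcontfun c s)" for c :: "real \<Rightarrow>\<^sub>C 'a" and s
  \<comment> \<open>Subtracting the integral up to \<open>0\<close> gives the primitive based at
    \<open>0\<close> for either sign of \<open>t\<close>.\<close>
  define I where "I c t = x0 + (integral {-\<delta>..t} (g c) - integral {-\<delta>..0} (g c))" for c t
  define k where "k t = max (-\<delta>) (min \<delta> t)" for t
  define P where "P c = Bcontfun (\<lambda>t. I c (k t))" for c
  have gc: "continuous_on {-\<delta>..\<delta>} (g c)" for c
    unfolding g_def
    by (rule continuous_on_compose2[OF cont, of _ "\<lambda>s. (s, apply_bcontfun c s)", simplified])
      (auto intro!: continuous_intros)
  have dI: "(I c has_vector_derivative g c t) (at t within {-\<delta>..\<delta>})" if "\<bar>t\<bar> \<le> \<delta>" for c t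
    unfolding I_def using integral_has_vector_derivative[OF gc[of c], of t] that
    by (auto intro!: derivative_eq_intros simp: abs_le_iff)
  have cI: "continuous_on {-\<delta>..\<delta>} (I c)" for c
    unfolding continuous_on_eq_continuous_within
    using has_vector_derivative_continuous[OF dI] by (auto simp: abs_le_iff)
  have k: "k t \<in> {-\<delta>..\<delta>}" for t using \<delta> by (auto simp: k_def)
  have ck: "continuous_on UNIV k" unfolding k_def by (intro continuous_intros)
  have "(\<lambda>t. I c (k t)) \<in> bcontfun" for c
  proof -
    have "continuous_on UNIV (\<lambda>t. I c (k t))"
      by (rule continuous_on_compose2[OF cI ck]) (use k in auto)
    moreover have "bounded (I c ` {-\<delta>..\<delta>})"
      by (intro compact_imp_bounded compact_continuous_image cI compact_Icc)
    then have "bounded (range (\<lambda>t. I c (k t)))"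
      by (rule bounded_subset) (use k in auto)
    ultimately show ?thesis by (simp add: bcontfun_def)
  qed
  then have P: "apply_bcontfun (P c) t = I c (k t)" for c t
    by (simp add: P_def Bcontfun_inverse)
  have "dist (P c) (P c') \<le> (L * \<delta>) * dist c c'" for c c'
  proof (rule dist_bound)
    fix t
    let ?D = "\<lambda>t. I c t - I c' t"
    have "norm (?D (k t) - ?D 0) \<le> (L * dist c c') * norm (k t - 0)"
    proof (rule differentiable_bound[of "{-\<delta>..\<delta>}" ?D "\<lambda>t s. s *\<^sub>R (g c t - g c' t)"])
      fix s assume s: "s \<in> {-\<delta>..\<delta>}"
      then show "(?D has_derivative (\<lambda>r. r *\<^sub>R (g c s - g c' s))) (at s within {-\<delta>..\<delta>})"
        using has_vector_derivative_diff[OF dI dI, of s c c'] by (auto simp: has_vector_derivative_def)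
      have "norm (g c s - g c' s) \<le> L * norm (apply_bcontfun c s - apply_bcontfun c' s)"
        unfolding g_def using s by (intro lip) auto
      also have "\<dots> \<le> L * dist c c'"
        using dist_bounded[of c s c'] L by (intro mult_left_mono) (auto simp: dist_norm)
      finally show "onorm (\<lambda>r. r *\<^sub>R (g c s - g c' s)) \<le> L * dist c c'"
        by (intro onorm_le) (simp add: mult.commute mult_left_mono)
    qed (use k \<delta> in auto)
    also have "\<dots> \<le> (L * dist c c') * \<delta>"
      using k[of t] L by (intro mult_left_mono) auto
    finally show "dist (apply_bcontfun (P c) t) (apply_bcontfun (P c') t) \<le> (L * \<delta>) * dist c c'"
      by (simp add: P dist_norm I_def algebra_simps)
  qed
  then obtain c where c: "P c = c"
    using banach_fix_type[of "L * \<delta>" P] L \<delta> by auto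
  have I: "I c t = apply_bcontfun c t" if "\<bar>t\<bar> \<le> \<delta>" for t
    using P[of c t] c that \<delta> by (simp add: k_def)
  show ?thesis
  proof (rule that[of "apply_bcontfun c"])
    show "apply_bcontfun c 0 = x0" using I[of 0] \<delta> by (simp add: I_def)
    fix t assume t: "\<bar>t\<bar> < \<delta>"
    have "(I c has_vector_derivative g c t) (at t within {-\<delta><..<\<delta>})"
      by (rule has_vector_derivative_within_subset[OF dI]) (use t in auto)
    then have "(apply_bcontfun c has_vector_derivative g c t) (at t within {-\<delta><..<\<delta>})"
      by (rule has_vector_derivative_transform[rotated 2]) (use t I in auto)
    then show "(apply_bcontfun c has_vector_derivative f t (apply_bcontfun c t)) (at t)"
      using t by (simp add: g_def at_within_open[of t "{-\<delta><..<\<delta>}"] abs_less_iff)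
  qed
qed

section \<open>Linear equations depending on a parameter\<close>

text \<open>The difference between a solution and the one at a fixed parameter \<open>z\<close>
  solves the linear equation with a forcing term that is uniformly small on compact time intervals
  once the parameter is close to \<open>z\<close>, so Gronwall's inequality applies. The parameter
  space is arbitrary because both initial points and the increment \<open>h\<close> of a difference
  quotient occur as parameters.\<close>

lemma linear_ode_continuous:
  fixes w :: "'z::t2_space \<times> real \<Rightarrow> 'c::euclidean_space"
  assumes A: "\<And>b. b \<in> Basis \<Longrightarrow> continuous_on (Z \<times> {-\<delta><..<\<delta>}) (A b)"
    and g: "continuous_on (Z \<times> {-\<delta><..<\<delta>}) g"
    and w0: "continuous_on Z (\<lambda>z. w (z, 0))"
    and w: "\<And>z t. z \<in> Z \<Longrightarrow> \<bar>t\<bar> < \<delta> \<Longrightarrow>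
      ((\<lambda>t. w (z, t)) has_vector_derivative (\<Sum>b\<in>Basis. (w (z, t) \<bullet> b) *\<^sub>R A b (z, t)) + g (z, t)) (at t)"
  shows "continuous_on (Z \<times> {-\<delta><..<\<delta>}) w"
proof -
  have unif: "\<exists>X. open X \<and> z \<in> X \<and> (\<forall>z'\<in>X \<inter> Z. \<forall>t. \<bar>t\<bar> \<le> T \<longrightarrow> norm (w (z', t) - w (z, t)) \<le> \<epsilon>)"
    if z: "z \<in> Z" and T: "0 \<le> T" "T < \<delta>" and \<epsilon>: "0 < \<epsilon>" for z T \<epsilon>
  proof -
    let ?C = "{-T..T}"
    have sub: "Z \<times> ?C \<subseteq> Z \<times> {-\<delta><..<\<delta>}" using T by auto
    have ww: "continuous_on {-\<delta><..<\<delta>} (\<lambda>t. w (z, t))"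
      by (intro continuous_at_imp_continuous_on ballI has_vector_derivative_continuous[OF w[OF z]]) auto
    have wz: "continuous_on (Z \<times> ?C) (\<lambda>p. w (z, snd p))"
      by (rule continuous_on_compose2[OF ww]) (use T in \<open>auto intro!: continuous_intros\<close>)
    define S where "S p = (\<Sum>b\<in>Basis. norm (A b p))" for p
    have S: "continuous_on (Z \<times> ?C) S" unfolding S_def
      by (intro continuous_intros continuous_on_subset[OF A sub])
    have Az: "continuous_on (Z \<times> ?C) (\<lambda>p. A b (z, snd p))" if "b \<in> Basis" for b
      by (rule continuous_on_compose2[OF A[OF that]]) (use T z in \<open>auto intro!: continuous_intros\<close>)
    have gz: "continuous_on (Z \<times> ?C) (\<lambda>p. g (z, snd p))"
      by (rule continuous_on_compose2[OF g]) (use T z in \<open>auto intro!: continuous_intros\<close>)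
    \<comment> \<open>The defect of the fixed solution \<open>w (z, t)\<close> in the equation with
      another parameter; it vanishes at the parameter \<open>z\<close> itself.\<close>
    define k where "k p = (\<Sum>b\<in>Basis. (w (z, snd p) \<bullet> b) *\<^sub>R (A b p - A b (z, snd p))) + (g p - g (z, snd p))" for p
    have k: "continuous_on (Z \<times> ?C) k" unfolding k_def
      by (intro continuous_intros continuous_on_subset[OF A sub] continuous_on_subset[OF g sub] Az gz wz)
    have "compact ((\<lambda>t. S (z, t)) ` ?C)"
      by (intro compact_continuous_image compact_Icc continuous_on_compose2[OF S])
        (use z in \<open>auto intro!: continuous_intros\<close>)
    then obtain L0 where "\<forall>x\<in>(\<lambda>t. S (z, t)) ` ?C. norm x \<le> L0"
      using compact_imp_bounded bounded_iff by metis
    then have L0: "\<And>t. \<bar>t\<bar> \<le> T \<Longrightarrow> S (z, t) \<le> L0"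
      by (auto simp: abs_le_iff)
    \<comment> \<open>\<open>L0\<close> bounds the coefficients at \<open>z\<close>; the extra
      \<open>1\<close> covers the nearby parameters in \<open>X1\<close>.\<close>
    define L where "L = L0 + 1"
    have L: "0 \<le> L" using L0[of 0] T sum_nonneg[of Basis "\<lambda>b. norm (A b (z, 0))"] by (simp add: L_def S_def)
    obtain X1 where X1: "z \<in> X1" "open X1" "\<forall>z'\<in>X1 \<inter> Z. \<forall>t\<in>?C. dist (S (z', t)) (S (z, t)) \<le> 1"
      by (rule continuous_on_prod_compactE[OF S compact_Icc z zero_less_one])
    define E where "E = exp ((2 * L + 1) * T) * (1 + T)"
    have E: "0 < E" using T by (auto simp: E_def)
    \<comment> \<open>Makes Gronwall's bound \<open>E * e\<^sup>2\<close> equal to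
      \<open>\<epsilon>\<^sup>2\<close>.\<close>
    define e where "e = \<epsilon> / sqrt E"
    have e: "0 < e" using \<epsilon> E by (simp add: e_def)
    obtain X2 where X2: "z \<in> X2" "open X2" "\<forall>z'\<in>X2 \<inter> Z. \<forall>t\<in>?C. dist (k (z', t)) (k (z, t)) \<le> e"
      by (rule continuous_on_prod_compactE[OF k compact_Icc z e])
    have "\<exists>X3. open X3 \<and> z \<in> X3 \<and> (\<forall>z'\<in>Z. z' \<in> X3 \<longrightarrow> w (z', 0) \<in> ball (w (z, 0)) e)"
      using w0[unfolded continuous_on_topological, rule_format, OF z open_ball] e by simp
    then obtain X3 where X3: "z \<in> X3" "open X3" "\<And>z'. z' \<in> X3 \<inter> Z \<Longrightarrow> dist (w (z', 0)) (w (z, 0)) < e"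
      by (metis IntD1 IntD2 dist_commute mem_ball)
    show ?thesis
    proof (intro exI[of _ "X1 \<inter> X2 \<inter> X3"] conjI ballI allI impI)
      fix z' t assume z': "z' \<in> X1 \<inter> X2 \<inter> X3 \<inter> Z" and t: "\<bar>t\<bar> \<le> T"
      let ?d = "\<lambda>t. w (z', t) - w (z, t)"
      let ?d' = "\<lambda>t. (\<Sum>b\<in>Basis. (?d t \<bullet> b) *\<^sub>R A b (z', t)) + k (z', t)"
      have "(norm (?d t))\<^sup>2 \<le> exp ((2 * L + 1) * T) * ((norm (?d 0))\<^sup>2 + e\<^sup>2 * T)"
      proof (rule gronwall[OF L t])
        fix s assume "\<bar>s\<bar> \<le> \<bar>t\<bar>"
        then have s: "\<bar>s\<bar> < \<delta>" "\<bar>s\<bar> \<le> T" using t T by auto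
        have "?d' s = (\<Sum>b\<in>Basis. (w (z', s) \<bullet> b) *\<^sub>R A b (z', s)) + g (z', s)
            - ((\<Sum>b\<in>Basis. (w (z, s) \<bullet> b) *\<^sub>R A b (z, s)) + g (z, s))"
          by (simp add: k_def algebra_simps sum_subtractf sum.distrib)
        then show "(?d has_vector_derivative ?d' s) (at s)"
          using has_vector_derivative_diff[OF w[of z' s] w[of z s]] s z z' by simp
        have "norm (\<Sum>b\<in>Basis. (?d s \<bullet> b) *\<^sub>R A b (z', s)) \<le> (\<Sum>b\<in>Basis. norm (?d s) * norm (A b (z', s)))"
          by (intro sum_norm_le) (auto intro!: mult_right_mono simp: Basis_le_norm)
        also have "\<dots> = S (z', s) * norm (?d s)" by (simp add: S_def sum_distrib_right mult.commute)
        also have "\<dots> \<le> L * norm (?d s)"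
        proof (intro mult_right_mono)
          have "dist (S (z', s)) (S (z, s)) \<le> 1" using X1(3) z' s by (auto simp: abs_le_iff)
          then show "S (z', s) \<le> L" using L0[OF s(2)] by (simp add: L_def dist_real_def)
        qed simp
        finally have "norm (\<Sum>b\<in>Basis. (?d s \<bullet> b) *\<^sub>R A b (z', s)) \<le> L * norm (?d s)" .
        moreover have "norm (k (z', s)) \<le> e"
          using X2(3)[rule_format, of z' s] z' s by (simp add: abs_le_iff k_def[of "(z, s)"])
        ultimately show "norm (?d' s) \<le> L * norm (?d s) + e" by (rule norm_triangle_mono)
      qed
      also have "\<dots> \<le> exp ((2 * L + 1) * T) * (e\<^sup>2 + e\<^sup>2 * T)"
        using X3(3)[of z'] z' by (intro mult_left_mono add_right_mono power_mono) (auto simp: dist_norm)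
      also have "\<dots> = E * e\<^sup>2" by (simp add: E_def algebra_simps)
      also have "\<dots> = \<epsilon>\<^sup>2" using E by (simp add: e_def power_divide)
      finally show "norm (?d t) \<le> \<epsilon>" using \<epsilon> by (simp add: power2_le_iff_abs_le)
    qed (use X1 X2 X3 in auto)
  qed
  show ?thesis
    unfolding continuous_on_eq_continuous_within
  proof (safe)
    fix z t assume z: "z \<in> Z" and t: "t \<in> {-\<delta><..<\<delta>}"
    define T where "T = (\<bar>t\<bar> + \<delta>) / 2"
    have T: "\<bar>t\<bar> < T" "0 \<le> T" "T < \<delta>" using t by (auto simp: T_def)
    show "continuous (at (z, t) within Z \<times> {-\<delta><..<\<delta>}) w"
      unfolding continuous_within
    proof (rule tendstoI)
      fix e :: real assume e: "0 < e"
      obtain X where X: "open X" "z \<in> X" "\<forall>z'\<in>X \<inter> Z. \<forall>t. \<bar>t\<bar> \<le> T \<longrightarrow> norm (w (z', t) - w (z, t)) \<le> e / 3"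
        using unif[OF z T(2,3), of "e / 3"] e by auto
      have "isCont (\<lambda>t. w (z, t)) t"
        by (rule has_vector_derivative_continuous[OF w[OF z]]) (use t in auto)
      then obtain d where d: "d > 0" "\<And>s. dist s t < d \<Longrightarrow> dist (w (z, s)) (w (z, t)) < e / 3"
        using e unfolding continuous_at_eps_delta by (meson divide_pos_pos zero_less_numeral)
      have "w p \<in> ball (w (z, t)) e" if "p \<in> X \<times> (ball t d \<inter> {-T<..<T})" "p \<in> Z \<times> {-\<delta><..<\<delta>}" for p
      proof -
        obtain z' s where p: "p = (z', s)" by (cases p)
        have "norm (w (z', s) - w (z, s)) \<le> e / 3" using X that p by auto
        moreover have "dist (w (z, s)) (w (z, t)) < e / 3" using d(2)[of s] that p by (auto simp: dist_commute)
        moreover have "dist (w (z, t)) (w (z', s)) \<le> dist (w (z', s)) (w (z, s)) + dist (w (z, s)) (w (z, t))"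
          by (metis dist_commute dist_triangle)
        ultimately show ?thesis using e unfolding p mem_ball dist_norm by linarith
      qed
      moreover have "open (X \<times> (ball t d \<inter> {-T<..<T}))" using X by (intro open_Times open_Int) auto
      moreover have "(z, t) \<in> X \<times> (ball t d \<inter> {-T<..<T})" using X d T by auto
      ultimately show "\<forall>\<^sub>F p in at (z, t) within Z \<times> {-\<delta><..<\<delta>}. dist (w p) (w (z, t)) < e"
        unfolding eventually_at_topological by (metis dist_commute mem_ball)
    qed
  qed
qed

text \<open>The quotient is the mean of the derivative over the segment from \<open>x\<close> to
  \<open>x + h *\<^sub>R e\<close>. As an integral over \<open>s\<close> in the unit interval this
  mean makes sense at \<open>h = 0\<close> too and depends continuously on
  \<open>(h, t)\<close>.\<close>

lemma difference_quotient_continuous: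
  fixes F :: "'a::euclidean_space \<times> real \<Rightarrow> 'c::euclidean_space"
  assumes F: "\<And>x t. x \<in> B \<Longrightarrow> t \<in> J \<Longrightarrow> (F has_derivative F' (x, t)) (at (x, t))"
    and F': "continuous_on (B \<times> J) (\<lambda>p. F' p (e, 0))"
    and x: "\<And>h. \<bar>h\<bar> < r \<Longrightarrow> x + h *\<^sub>R e \<in> B"
  shows "continuous_on ({-r<..<r} \<times> J)
    (\<lambda>(h, t). if h = 0 then F' (x, t) (e, 0) else (F (x + h *\<^sub>R e, t) - F (x, t)) /\<^sub>R h)"
proof -
  let ?Q = "\<lambda>(p, s). F' (x + (s * fst p) *\<^sub>R e, snd p) (e, 0)"
  have in': "\<bar>s * h\<bar> < r" if "\<bar>h\<bar> < r" "0 \<le> s" "s \<le> 1" for s h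
  proof -
    have "\<bar>s * h\<bar> \<le> 1 * \<bar>h\<bar>" unfolding abs_mult using that by (intro mult_right_mono) auto
    then show ?thesis using that by simp
  qed
  have "continuous_on (({-r<..<r} \<times> J) \<times> cbox 0 1) ?Q"
    unfolding split_def
    by (rule continuous_on_compose2[OF F']) (use in' x in \<open>auto intro!: continuous_intros\<close>)
  then have "continuous_on ({-r<..<r} \<times> J) (\<lambda>p. integral (cbox 0 1) (\<lambda>s. F' (x + (s * fst p) *\<^sub>R e, snd p) (e, 0)))"
    by (intro integral_continuous_on_param) (simp add: split_def)
  moreover have "integral (cbox 0 1) (\<lambda>s. F' (x + (s * fst p) *\<^sub>R e, snd p) (e, 0)) =
      (case p of (h, t) \<Rightarrow> if h = 0 then F' (x, t) (e, 0) else (F (x + h *\<^sub>R e, t) - F (x, t)) /\<^sub>R h)"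
    if "p \<in> {-r<..<r} \<times> J" for p
  proof -
    obtain h t where p1: "p = (h, t)" by (cases p)
    then have p: "p = (h, t)" "\<bar>h\<bar> < r" "t \<in> J" using that by auto
    have "((\<lambda>s. F (x + (s * h) *\<^sub>R e, t)) has_vector_derivative h *\<^sub>R F' (x + (s * h) *\<^sub>R e, t) (e, 0)) (at s within {0..1})"
      if s: "s \<in> {0..1}" for s
    proof -
      have 1: "((\<lambda>s. (x + (s * h) *\<^sub>R e, t)) has_vector_derivative h *\<^sub>R (e, 0)) (at s within {0..1})"
        by (auto intro!: derivative_eq_intros simp: has_vector_derivative_def)
      have 2: "(F has_derivative F' (x + (s * h) *\<^sub>R e, t)) (at (x + (s * h) *\<^sub>R e, t))"
        using F x in' p s by auto
      have 3: "linear (F' (x + (s * h) *\<^sub>R e, t))" using 2 has_derivative_linear by blast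
      show ?thesis
        using vector_derivative_diff_chain_within[OF 1 has_derivative_at_withinI[OF 2]]
        by (simp only: o_def linear_scale[OF 3])
    qed
    then have "((\<lambda>s. h *\<^sub>R F' (x + (s * h) *\<^sub>R e, t) (e, 0)) has_integral F (x + (1 * h) *\<^sub>R e, t) - F (x + (0 * h) *\<^sub>R e, t)) {0..1}"
      by (intro fundamental_theorem_of_calculus) auto
    then have "integral {0..1} (\<lambda>s. h *\<^sub>R F' (x + (s * h) *\<^sub>R e, t) (e, 0)) = F (x + h *\<^sub>R e, t) - F (x, t)"
      by (simp only: mult_1 mult_zero_left scaleR_zero_left add_0_right integral_unique)
    then have "F (x + h *\<^sub>R e, t) - F (x, t) = h *\<^sub>R integral {0..1} (\<lambda>s. F' (x + (s * h) *\<^sub>R e, t) (e, 0))"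
      by (simp only: integral_cmul)
    then show ?thesis by (cases "h = 0") (simp_all add: p(1))
  qed
  ultimately show ?thesis by (simp cong: continuous_on_cong)
qed

text \<open>Coordinates are changed one at a time, by induction over a set \<open>D\<close> of basis
  vectors. Dropping or shrinking coordinates of \<open>v\<close> does not increase its norm, so all
  intermediate points stay in the ball where the partial derivatives are nearly constant.\<close>

lemma has_derivative_partials:
  fixes f :: "'a::euclidean_space \<Rightarrow> 'c::real_normed_vector"
  assumes S: "open S" and x: "x \<in> S"
    and f: "\<And>b x. b \<in> Basis \<Longrightarrow> x \<in> S \<Longrightarrow> ((\<lambda>h. f (x + h *\<^sub>R b)) has_vector_derivative g b x) (at 0)"
    and g: "\<And>b. b \<in> Basis \<Longrightarrow> continuous_on S (g b)"
  shows "(f has_derivative (\<lambda>v. \<Sum>b\<in>Basis. (v \<bullet> b) *\<^sub>R g b x)) (at x)"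
  unfolding has_derivative_at_alt
proof (intro conjI allI impI)
  show "bounded_linear (\<lambda>v. \<Sum>b\<in>Basis. (v \<bullet> b) *\<^sub>R g b x)"
    by (rule bounded_linear_sum, rule bounded_linear_scaleR_const, rule bounded_linear_inner_left)
  fix e :: real assume e: "0 < e"
  \<comment> \<open>There are \<open>DIM('a)\<close> coordinate steps, each with an error of at most
    \<open>\<epsilon> * norm v\<close>.\<close>
  define \<epsilon> where "\<epsilon> = e / DIM('a)"
  have \<epsilon>: "0 < \<epsilon>" using e by (simp add: \<epsilon>_def)
  have "\<forall>\<^sub>F y in at x. \<forall>b\<in>Basis. dist (g b y) (g b x) < \<epsilon>"
    using g S x \<epsilon> by (intro eventually_ball_finite ballI tendstoD) (auto simp: continuous_on_eq_continuous_at isCont_def)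
  then obtain r1 where r1: "0 < r1" "\<And>y b. dist y x < r1 \<Longrightarrow> b \<in> Basis \<Longrightarrow> dist (g b y) (g b x) < \<epsilon>"
  proof -
    assume r: "\<And>r1. 0 < r1 \<Longrightarrow> (\<And>y b. dist y x < r1 \<Longrightarrow> b \<in> Basis \<Longrightarrow> dist (g b y) (g b x) < \<epsilon>) \<Longrightarrow> thesis"
    assume "\<forall>\<^sub>F y in at x. \<forall>b\<in>Basis. dist (g b y) (g b x) < \<epsilon>"
    then obtain d where "0 < d" "\<forall>y. y \<noteq> x \<and> dist y x < d \<longrightarrow> (\<forall>b\<in>Basis. dist (g b y) (g b x) < \<epsilon>)"
      unfolding eventually_at by auto
    then show thesis using \<epsilon> by (intro r[of d]) (auto, metis dist_self)
  qed
  obtain r2 where r2: "0 < r2" "ball x r2 \<subseteq> S" using S x open_contains_ball by blast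
  define r where "r = min r1 r2"
  have r: "0 < r" using r1 r2 by (simp add: r_def)
  show "\<exists>d>0. \<forall>y. norm (y - x) < d \<longrightarrow> norm (f y - f x - (\<Sum>b\<in>Basis. ((y - x) \<bullet> b) *\<^sub>R g b x)) \<le> e * norm (y - x)"
  proof (intro exI[of _ r] conjI allI impI r)
    fix y assume y: "norm (y - x) < r"
    define v where "v = y - x"
    have "norm (f (x + (\<Sum>b\<in>D. (v \<bullet> b) *\<^sub>R b)) - f x - (\<Sum>b\<in>D. (v \<bullet> b) *\<^sub>R g b x)) \<le> \<epsilon> * (\<Sum>b\<in>D. \<bar>v \<bullet> b\<bar>)"
      if "D \<subseteq> Basis" for D
      using finite_subset[OF that finite_Basis] that
    proof (induction D rule: finite_induct)
      case (insert b D)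
      let ?z = "x + (\<Sum>b\<in>D. (v \<bullet> b) *\<^sub>R b)"
      have b: "b \<in> Basis" using insert by auto
      have z: "dist (?z + s *\<^sub>R b) x < r" if "\<bar>s\<bar> \<le> \<bar>v \<bullet> b\<bar>" for s
      proof -
        have "\<bar>((\<Sum>b\<in>D. (v \<bullet> b) *\<^sub>R b) + s *\<^sub>R b) \<bullet> i\<bar> \<le> \<bar>v \<bullet> i\<bar>" if "i \<in> Basis" for i
        proof -
          have "(\<Sum>b\<in>D. (v \<bullet> b) *\<^sub>R b) \<bullet> i = (\<Sum>b\<in>D. if b = i then v \<bullet> b else 0)"
            unfolding inner_sum_left by (intro sum.cong refl) (use insert.prems that in \<open>auto simp: inner_Basis\<close>)
          then have "(\<Sum>b\<in>D. (v \<bullet> b) *\<^sub>R b) \<bullet> i = (if i \<in> D then v \<bullet> i else 0)"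
            using insert.hyps by simp
          then show ?thesis
            using that insert.hyps b \<open>\<bar>s\<bar> \<le> \<bar>v \<bullet> b\<bar>\<close> by (auto simp: inner_left_distrib inner_Basis)
        qed
        then have "norm ((\<Sum>b\<in>D. (v \<bullet> b) *\<^sub>R b) + s *\<^sub>R b) \<le> norm v"
          by (rule norm_le_componentwise)
        then show ?thesis using y by (simp add: dist_norm v_def add.assoc)
      qed
      let ?k = "\<lambda>s. f (?z + s *\<^sub>R b) - s *\<^sub>R g b x"
      have "norm (?k (v \<bullet> b) - ?k 0) \<le> \<epsilon> * norm ((v \<bullet> b) - 0)"
      proof (rule differentiable_bound[of "cball 0 \<bar>v \<bullet> b\<bar>" ?k "\<lambda>s h. h *\<^sub>R (g b (?z + s *\<^sub>R b) - g b x)"])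
        fix s :: real assume "s \<in> cball 0 \<bar>v \<bullet> b\<bar>"
        then have s: "dist (?z + s *\<^sub>R b) x < r" using z by simp
        then have "?z + s *\<^sub>R b \<in> S" using r2 by (auto simp: r_def dist_commute)
        from f[OF b this]
        have "((\<lambda>h. f (?z + (s + h) *\<^sub>R b)) has_vector_derivative g b (?z + s *\<^sub>R b)) (at 0)"
          by (simp add: algebra_simps)
        moreover have "((\<lambda>h. h - s) has_vector_derivative 1) (at s)"
          by (auto intro!: derivative_eq_intros)
        ultimately have "((\<lambda>h. f (?z + h *\<^sub>R b)) has_vector_derivative g b (?z + s *\<^sub>R b)) (at s)"
          using vector_diff_chain_at[of "\<lambda>h. h - s" 1 s "\<lambda>h. f (?z + (s + h) *\<^sub>R b)" "g b (?z + s *\<^sub>R b)"]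
          by (simp add: o_def)
        then have "(?k has_vector_derivative g b (?z + s *\<^sub>R b) - g b x) (at s)"
          by (auto intro!: derivative_eq_intros)
        then show "(?k has_derivative (\<lambda>h. h *\<^sub>R (g b (?z + s *\<^sub>R b) - g b x))) (at s within cball 0 \<bar>v \<bullet> b\<bar>)"
          by (auto simp: has_vector_derivative_def intro: has_derivative_at_withinI)
        show "onorm (\<lambda>h. h *\<^sub>R (g b (?z + s *\<^sub>R b) - g b x)) \<le> \<epsilon>"
          using r1(2)[of "?z + s *\<^sub>R b" b] s b
          by (intro onorm_le) (auto simp: r_def dist_norm mult.commute[of \<epsilon>] intro!: mult_left_mono)
      qed auto
      then have "norm (f (?z + (v \<bullet> b) *\<^sub>R b) - (v \<bullet> b) *\<^sub>R g b x - f ?z) \<le> \<epsilon> * \<bar>v \<bullet> b\<bar>" by simp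
      moreover have "norm (f ?z - f x - (\<Sum>b\<in>D. (v \<bullet> b) *\<^sub>R g b x)) \<le> \<epsilon> * (\<Sum>b\<in>D. \<bar>v \<bullet> b\<bar>)"
        using insert by auto
      ultimately have "norm ((f (?z + (v \<bullet> b) *\<^sub>R b) - (v \<bullet> b) *\<^sub>R g b x - f ?z) + (f ?z - f x - (\<Sum>b\<in>D. (v \<bullet> b) *\<^sub>R g b x)))
          \<le> \<epsilon> * \<bar>v \<bullet> b\<bar> + \<epsilon> * (\<Sum>b\<in>D. \<bar>v \<bullet> b\<bar>)"
        by (rule norm_triangle_mono)
      then show ?case using insert by (simp add: algebra_simps)
    qed simp
    from this[of Basis] have "norm (f y - f x - (\<Sum>b\<in>Basis. (v \<bullet> b) *\<^sub>R g b x)) \<le> \<epsilon> * (\<Sum>b\<in>Basis. \<bar>v \<bullet> b\<bar>)"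
      by (simp add: euclidean_representation v_def)
    also have "\<dots> \<le> \<epsilon> * (\<Sum>b\<in>(Basis::'a set). norm v)"
      using \<epsilon> by (intro mult_left_mono sum_mono) (auto simp: Basis_le_norm)
    also have "\<dots> = e * norm v" by (simp add: \<epsilon>_def)
    finally show "norm (f y - f x - (\<Sum>b\<in>Basis. ((y - x) \<bullet> b) *\<^sub>R g b x)) \<le> e * norm (y - x)"
      by (simp add: v_def)
  qed
qed

lemma Ck_on_Suc_partials:
  fixes f :: "'a::euclidean_space \<Rightarrow> 'c::real_normed_vector"
  assumes "open S"
    and "\<And>b x. b \<in> Basis \<Longrightarrow> x \<in> S \<Longrightarrow> ((\<lambda>h. f (x + h *\<^sub>R b)) has_vector_derivative g b x) (at 0)"
    and g: "\<And>b. b \<in> Basis \<Longrightarrow> Ck_on k (g b) S"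
  shows "Ck_on (Suc k) f S"
proof (rule Ck_on_SucI[OF assms(1)])
  show "(f has_derivative (\<lambda>v. \<Sum>b\<in>Basis. (v \<bullet> b) *\<^sub>R g b x)) (at x)" if "x \<in> S" for x
    using assms Ck_on_imp_continuous_on that by (intro has_derivative_partials) blast+
  show "Ck_on k (\<lambda>x. \<Sum>b\<in>Basis. (v \<bullet> b) *\<^sub>R g b x) S" for v
    by (intro Ck_on_sum Ck_on_scaleR Ck_on_const assms)
qed

lemma has_vector_derivative_quotientI:
  fixes f :: "real \<Rightarrow> 'a::real_normed_vector"
  assumes "((\<lambda>h. (f h - f 0) /\<^sub>R h) \<longlongrightarrow> d) (at 0)"
  shows "(f has_vector_derivative d) (at 0)"
  unfolding has_vector_derivative_def has_derivative_at
proof (intro conjI)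
  have "((\<lambda>h. norm ((f h - f 0) /\<^sub>R h - d)) \<longlongrightarrow> 0) (at 0)"
    using assms by (simp add: LIM_zero tendsto_norm_zero)
  moreover have "\<forall>\<^sub>F h in at 0. norm ((f h - f 0) /\<^sub>R h - d) = norm (f (0 + h) - f 0 - h *\<^sub>R d) / norm h"
    unfolding eventually_at_topological
  proof (intro exI[of _ UNIV] conjI ballI impI)
    fix h :: real assume "h \<noteq> 0"
    then have "(f h - f 0) /\<^sub>R h - d = (f (0 + h) - f 0 - h *\<^sub>R d) /\<^sub>R h"
      by (simp add: scaleR_diff_right)
    then show "norm ((f h - f 0) /\<^sub>R h - d) = norm (f (0 + h) - f 0 - h *\<^sub>R d) / norm h"
      by (simp add: divide_inverse_commute)
  qed auto
  ultimately show "((\<lambda>h. norm (f (0 + h) - f 0 - h *\<^sub>R d) / norm h) \<longlongrightarrow> 0) (at 0)"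
    by (rule Lim_transform_eventually)
qed (rule bounded_linear_scaleR_left)

lemma has_vector_derivative_shift:
  fixes f :: "real \<Rightarrow> 'a::real_normed_vector"
  shows "((\<lambda>h. f (t + h)) has_vector_derivative d) (at s) \<longleftrightarrow> (f has_vector_derivative d) (at (t + s))"
proof
  assume "(f has_vector_derivative d) (at (t + s))"
  moreover have "((\<lambda>h. t + h) has_vector_derivative 1) (at s)" by (auto intro!: derivative_eq_intros)
  ultimately show "((\<lambda>h. f (t + h)) has_vector_derivative d) (at s)"
    using vector_diff_chain_at[of "\<lambda>h. t + h" 1 s f d] by (simp add: o_def)
next
  assume "((\<lambda>h. f (t + h)) has_vector_derivative d) (at s)"
  moreover have "((\<lambda>h. h - t) has_vector_derivative 1) (at (t + s))" by (auto intro!: derivative_eq_intros)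
  ultimately show "(f has_vector_derivative d) (at (t + s))"
    using vector_diff_chain_at[of "\<lambda>h. h - t" 1 "t + s" "\<lambda>h. f (t + h)" d] by (simp add: o_def)
qed

text \<open>The basis of the product splits into space directions \<open>(e, 0)\<close> and the time
  direction \<open>(0, 1)\<close>; for solutions of an equation the latter derivative is known from
  the right-hand side.\<close>

lemma Ck_on_time_partials:
  fixes w :: "'a::euclidean_space \<times> real \<Rightarrow> 'c::real_normed_vector"
  assumes B: "open B" and J: "open J"
    and u: "\<And>e. e \<in> Basis \<Longrightarrow> Ck_on k (u e) (B \<times> J)"
    and r: "Ck_on k r (B \<times> J)"
    and wx: "\<And>e x t. e \<in> Basis \<Longrightarrow> x \<in> B \<Longrightarrow> t \<in> J \<Longrightarrow> ((\<lambda>h. w (x + h *\<^sub>R e, t)) has_vector_derivative u e (x, t)) (at 0)"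
    and wt: "\<And>x t. x \<in> B \<Longrightarrow> t \<in> J \<Longrightarrow> ((\<lambda>t. w (x, t)) has_vector_derivative r (x, t)) (at t)"
  shows "Ck_on (Suc k) w (B \<times> J)"
proof (rule Ck_on_Suc_partials[where g="\<lambda>b. if snd b = 0 then u (fst b) else r"])
  fix b :: "'a \<times> real" and p assume b: "b \<in> Basis" and p: "p \<in> B \<times> J"
  obtain x t where [simp]: "p = (x, t)" by (cases p)
  consider e where "b = (e, 0)" "e \<in> Basis" | "b = (0, 1)" using b by (auto simp: Basis_prod_def)
  then show "((\<lambda>h. w (p + h *\<^sub>R b)) has_vector_derivative (if snd b = 0 then u (fst b) else r) p) (at 0)"
  proof cases
    case 2
    have "((\<lambda>h. w (x, t + h)) has_vector_derivative r (x, t)) (at 0)"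
      using wt[of x t] p has_vector_derivative_shift[of "\<lambda>t. w (x, t)" t] by simp
    then show ?thesis by (simp add: 2)
  qed (use wx p in auto)
qed (use u r B J in \<open>auto simp: Basis_prod_def intro!: open_Times\<close>)

lemma norm_linear_combination_le:
  fixes y :: "'c::euclidean_space" and A :: "'c \<Rightarrow> 'd::real_normed_vector"
  shows "norm (\<Sum>b\<in>Basis. (y \<bullet> b) *\<^sub>R A b) \<le> (\<Sum>b\<in>Basis. norm (A b)) * norm y"
proof -
  have "norm (\<Sum>b\<in>Basis. (y \<bullet> b) *\<^sub>R A b) \<le> (\<Sum>b\<in>Basis. norm y * norm (A b))"
    by (intro sum_norm_le) (auto intro!: mult_right_mono simp: Basis_le_norm)
  then show ?thesis by (simp add: sum_distrib_left mult.commute)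
qed

lemma linear_ode_exists:
  fixes A :: "'c::euclidean_space \<Rightarrow> real \<Rightarrow> 'c"
  assumes d: "0 < d" and L: "0 \<le> L" "L * d < 1"
    and A: "\<And>b. b \<in> Basis \<Longrightarrow> continuous_on {-d..d} (A b)"
    and bound: "\<And>t. \<bar>t\<bar> \<le> d \<Longrightarrow> (\<Sum>b\<in>Basis. norm (A b t)) \<le> L"
    and g: "continuous_on {-d..d} g"
  shows "\<exists>c. c 0 = c0 \<and> (\<forall>t. \<bar>t\<bar> < d \<longrightarrow> (c has_vector_derivative (\<Sum>b\<in>Basis. (c t \<bullet> b) *\<^sub>R A b t) + g t) (at t))"
proof -
  have "continuous_on ({-d..d} \<times> UNIV) (\<lambda>(t, y::'c). (\<Sum>b\<in>Basis. (y \<bullet> b) *\<^sub>R A b t) + g t)"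
  proof -
    have "continuous_on ({-d..d} \<times> (UNIV::'c set)) (\<lambda>p. A b (fst p))" if "b \<in> Basis" for b
      by (rule continuous_on_compose2[OF A[OF that]]) (auto intro!: continuous_intros)
    moreover have "continuous_on ({-d..d} \<times> (UNIV::'c set)) (\<lambda>p. g (fst p))"
      by (rule continuous_on_compose2[OF g]) (auto intro!: continuous_intros)
    ultimately show ?thesis unfolding split_def by (intro continuous_intros) auto
  qed
  then show ?thesis
  proof (rule lipschitz_ode_exists[OF d L, where ?x0.0=c0])
    fix t and y z :: 'c assume t: "\<bar>t\<bar> \<le> d"
    have "norm (\<Sum>b\<in>Basis. ((y - z) \<bullet> b) *\<^sub>R A b t) \<le> (\<Sum>b\<in>Basis. norm (A b t)) * norm (y - z)"
      by (rule norm_linear_combination_le)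
    also have "\<dots> \<le> L * norm (y - z)" using bound[OF t] by (intro mult_right_mono) auto
    finally show "norm ((\<Sum>b\<in>Basis. (y \<bullet> b) *\<^sub>R A b t) + g t - ((\<Sum>b\<in>Basis. (z \<bullet> b) *\<^sub>R A b t) + g t)) \<le> L * norm (y - z)"
      by (simp add: inner_diff_left scaleR_diff_left sum_subtractf)
  qed blast
qed

text \<open>Induction on \<open>k\<close>. A derivative of \<open>w\<close> in a space direction has
  to solve the equation obtained by differentiating the right-hand side. That equation is solved
  first, by some \<open>u\<close>; then \<open>u\<close> is recognized as the derivative, since the
  difference quotients of \<open>w\<close>, completed by \<open>u\<close> at \<open>h = 0\<close>,
  solve a linear equation whose coefficients are continuous in \<open>h\<close>. The forcing term
  for \<open>u\<close> contains \<open>w\<close>, whose regularity is known on a shorter time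
  interval only; hence \<open>\<delta>' < \<delta>\<close>.\<close>

lemma linear_ode_Ck:
  fixes w :: "'a::euclidean_space \<times> real \<Rightarrow> 'c::euclidean_space"
  assumes B: "open B" and L: "0 \<le> L" "L * \<delta> < 1"
    and A: "\<And>b. b \<in> Basis \<Longrightarrow> Ck_on k (A b) (B \<times> {-\<delta><..<\<delta>})"
    and bound: "\<And>x t. x \<in> B \<Longrightarrow> \<bar>t\<bar> < \<delta> \<Longrightarrow> (\<Sum>b\<in>Basis. norm (A b (x, t))) \<le> L"
    and g: "Ck_on k g (B \<times> {-\<delta><..<\<delta>})"
    and w0: "Ck_on k (\<lambda>x. w (x, 0)) B"
    and w: "\<And>x t. x \<in> B \<Longrightarrow> \<bar>t\<bar> < \<delta> \<Longrightarrow>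
      ((\<lambda>t. w (x, t)) has_vector_derivative (\<Sum>b\<in>Basis. (w (x, t) \<bullet> b) *\<^sub>R A b (x, t)) + g (x, t)) (at t)"
    and \<delta>': "0 < \<delta>'" "\<delta>' < \<delta>"
  shows "Ck_on k w (B \<times> {-\<delta>'<..<\<delta>'})"
  using L A bound g w0 w \<delta>'
proof (induction k arbitrary: w g \<delta> \<delta>')
  case 0
  have "continuous_on (B \<times> {-\<delta><..<\<delta>}) w"
    by (rule linear_ode_continuous[OF _ _ _ 0(7)]) (use 0(3,5,6) in \<open>simp_all only: Ck_on.simps\<close>)
  then have "continuous_on (B \<times> {-\<delta>'<..<\<delta>'}) w"
    by (rule continuous_on_subset) (use 0(9) in auto)
  then show ?case by simp
next
  case (Suc k)
  note A = Suc.prems(3) and bound = Suc.prems(4) and g = Suc.prems(5) and w0 = Suc.prems(6)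
    and w = Suc.prems(7) and \<delta>' = Suc.prems(8,9)
  \<comment> \<open>On \<delta>1 the induction hypothesis gives class \<open>k\<close> for
    \<open>w\<close>; on \<delta>2 the function \<open>u\<close> is constructed, with coefficients
    continuous up to the endpoints; the regularity of \<open>u\<close> costs a further shrinking to
    \<delta>'.\<close>
  define \<delta>1 where "\<delta>1 = (\<delta>' + \<delta>) / 2"
  define \<delta>2 where "\<delta>2 = (\<delta>' + \<delta>1) / 2"
  have \<delta>s: "0 < \<delta>'" "\<delta>' < \<delta>2" "\<delta>2 < \<delta>1" "\<delta>1 < \<delta>" using \<delta>' by (auto simp: \<delta>1_def \<delta>2_def)
  let ?J = "\<lambda>d::real. {-d<..<d}"
  have L2: "L * \<delta>2 < 1"
  proof -
    have "L * \<delta>2 \<le> L * \<delta>" using \<delta>s Suc.prems(1) by (intro mult_left_mono) auto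
    then show ?thesis using Suc.prems(2) by simp
  qed
  have op: "open (B \<times> ?J d)" for d using B by (auto intro: open_Times)
  have mem: "(x, t) \<in> B \<times> ?J d" if "x \<in> B" "\<bar>t\<bar> < d" for x t d using that by auto
  have sub: "B \<times> ?J d \<subseteq> B \<times> ?J d'" if "d \<le> d'" for d d' using that by auto
  note S = Ck_on_Suc_imp
  let ?w0' = "\<lambda>x. frechet_derivative (\<lambda>x. w (x, 0)) (at x)"
  let ?A' = "\<lambda>b p. frechet_derivative (A b) (at p)"
  let ?g' = "\<lambda>p. frechet_derivative g (at p)"
  have A': "(A b has_derivative ?A' b (x, t)) (at (x, t))" if "b \<in> Basis" "x \<in> B" "\<bar>t\<bar> < \<delta>" for b x t
    using Ck_on_has_derivative[OF A mem] that by auto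
  have g': "(g has_derivative ?g' (x, t)) (at (x, t))" if "x \<in> B" "\<bar>t\<bar> < \<delta>" for x t
    using Ck_on_has_derivative[OF g mem] that by auto
  have A'k: "Ck_on k (\<lambda>p. ?A' b p v) (B \<times> ?J \<delta>)" if "b \<in> Basis" for b v using A[OF that] by (simp only: Ck_on.simps)
  have g'k: "Ck_on k (\<lambda>p. ?g' p v) (B \<times> ?J \<delta>)" for v using g by (simp only: Ck_on.simps)
  have wk: "Ck_on k w (B \<times> ?J \<delta>1)"
    by (rule Suc.IH[OF Suc.prems(1,2) S[OF A] bound S[OF g] S[OF w0] w]) (use \<delta>s in auto)
  let ?rhs = "\<lambda>p. (\<Sum>b\<in>Basis. (w p \<bullet> b) *\<^sub>R A b p) + g p"
  have rhs: "Ck_on k ?rhs (B \<times> ?J \<delta>1)"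
    using \<delta>s by (intro Ck_on_add Ck_on_sum Ck_on_scaleR op Ck_on_compose_linear[OF bounded_linear_inner_left] wk
        Ck_on_subset[OF S[OF A] sub] Ck_on_subset[OF S[OF g] sub]) auto
  have "\<exists>u. Ck_on k u (B \<times> ?J \<delta>') \<and> (\<forall>x\<in>B. \<forall>t\<in>?J \<delta>'. ((\<lambda>h. w (x + h *\<^sub>R e, t)) has_vector_derivative u (x, t)) (at 0))"
    if e: "e \<in> Basis" for e
  proof -
    \<comment> \<open>The terms of the differentiated right-hand side in which the derivative does
      not fall on \<open>w\<close>.\<close>
    define g1 where "g1 p = (\<Sum>b\<in>Basis. (w p \<bullet> b) *\<^sub>R ?A' b p (e, 0)) + ?g' p (e, 0)" for p
    have g1: "Ck_on k g1 (B \<times> ?J \<delta>1)"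
      unfolding g1_def using \<delta>s
      by (intro Ck_on_add Ck_on_sum Ck_on_scaleR op Ck_on_compose_linear[OF bounded_linear_inner_left] wk
          Ck_on_subset[OF A'k sub] Ck_on_subset[OF g'k sub]) auto
    have "\<forall>x\<in>B. \<exists>c. c 0 = ?w0' x e \<and>
        (\<forall>t. \<bar>t\<bar> < \<delta>2 \<longrightarrow> (c has_vector_derivative (\<Sum>b\<in>Basis. (c t \<bullet> b) *\<^sub>R A b (x, t)) + g1 (x, t)) (at t))"
    proof
      fix x assume x: "x \<in> B"
      show "\<exists>c. c 0 = ?w0' x e \<and>
          (\<forall>t. \<bar>t\<bar> < \<delta>2 \<longrightarrow> (c has_vector_derivative (\<Sum>b\<in>Basis. (c t \<bullet> b) *\<^sub>R A b (x, t)) + g1 (x, t)) (at t))"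
      proof (rule linear_ode_exists[OF _ Suc.prems(1) L2])
        show "continuous_on {-\<delta>2..\<delta>2} (\<lambda>t. A b (x, t))" if "b \<in> Basis" for b
          by (rule continuous_on_compose2[OF Ck_on_imp_continuous_on[OF A[OF that]]])
            (use x \<delta>s in \<open>auto intro!: continuous_intros\<close>)
        show "continuous_on {-\<delta>2..\<delta>2} (\<lambda>t. g1 (x, t))"
          by (rule continuous_on_compose2[OF Ck_on_imp_continuous_on[OF g1]])
            (use x \<delta>s in \<open>auto intro!: continuous_intros\<close>)
        show "(\<Sum>b\<in>Basis. norm (A b (x, t))) \<le> L" if "\<bar>t\<bar> \<le> \<delta>2" for t
          using bound[OF x, of t] that \<delta>s by simp
      qed (use \<delta>s in auto)
    qed
    from bchoice[OF this] obtain u where u0: "\<And>x. x \<in> B \<Longrightarrow> u x 0 = ?w0' x e"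
      and u: "\<And>x t. x \<in> B \<Longrightarrow> \<bar>t\<bar> < \<delta>2 \<Longrightarrow>
        (u x has_vector_derivative (\<Sum>b\<in>Basis. (u x t \<bullet> b) *\<^sub>R A b (x, t)) + g1 (x, t)) (at t)"
      by blast
    have uk: "Ck_on k (\<lambda>(x, t). u x t) (B \<times> ?J \<delta>')"
    proof (rule Suc.IH[of \<delta>2 g1])
      show "Ck_on k (A b) (B \<times> ?J \<delta>2)" if "b \<in> Basis" for b
        using Ck_on_subset[OF S[OF A[OF that]] sub] \<delta>s by simp
      show "Ck_on k g1 (B \<times> ?J \<delta>2)" using Ck_on_subset[OF g1 sub] \<delta>s by simp
      have "Ck_on k (\<lambda>x. ?w0' x e) B" using w0 by simp
      then show "Ck_on k (\<lambda>x. case (x, 0) of (x, t) \<Rightarrow> u x t) B"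
        by (rule Ck_on_cong[OF B, rotated]) (simp add: u0)
    qed (use Suc.prems(1) L2 bound u \<delta>s in auto)
    have "((\<lambda>h. w (x + h *\<^sub>R e, t)) has_vector_derivative u x t) (at 0)" if x: "x \<in> B" and t: "t \<in> ?J \<delta>'" for x t
    proof -
      obtain r where r: "0 < r" "ball x r \<subseteq> B" using B x open_contains_ball by blast
      have xB: "x + h *\<^sub>R e \<in> B" if "\<bar>h\<bar> < r" for h
        using r e that by (auto simp: dist_norm intro!: subsetD[OF r(2)])
      define DA where "DA b = (\<lambda>(h, t). if h = 0 then ?A' b (x, t) (e, 0) else (A b (x + h *\<^sub>R e, t) - A b (x, t)) /\<^sub>R h)" for b
      define Dg where "Dg = (\<lambda>(h, t). if h = 0 then ?g' (x, t) (e, 0) else (g (x + h *\<^sub>R e, t) - g (x, t)) /\<^sub>R h)"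
      define Q where "Q = (\<lambda>(h, t). if h = 0 then u x t else (w (x + h *\<^sub>R e, t) - w (x, t)) /\<^sub>R h)"
      let ?Z = "{-r<..<r} \<times> ?J \<delta>2"
      have DA: "continuous_on ?Z (DA b)" if "b \<in> Basis" for b
        unfolding DA_def
        by (rule difference_quotient_continuous[where B=B])
          (use A' A'k[OF that] that xB \<delta>s in \<open>auto intro: continuous_on_subset[OF Ck_on_imp_continuous_on[OF A'k[OF that]]]\<close>)
      have Dg: "continuous_on ?Z Dg"
        unfolding Dg_def
        by (rule difference_quotient_continuous[where B=B])
          (use g' xB \<delta>s in \<open>auto intro: continuous_on_subset[OF Ck_on_imp_continuous_on[OF g'k]]\<close>)
      have "continuous_on ?Z Q"
      proof (rule linear_ode_continuous[where A="\<lambda>b p. A b (x + fst p *\<^sub>R e, snd p)"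
            and g="\<lambda>p. (\<Sum>b\<in>Basis. (w (x, snd p) \<bullet> b) *\<^sub>R DA b p) + Dg p"])
        show "continuous_on ?Z (\<lambda>p. A b (x + fst p *\<^sub>R e, snd p))" if "b \<in> Basis" for b
          by (rule continuous_on_compose2[OF Ck_on_imp_continuous_on[OF A[OF that]]])
            (use xB \<delta>s in \<open>auto intro!: continuous_intros\<close>)
        have "continuous_on ?Z (\<lambda>p. w (x, snd p))"
          by (rule continuous_on_compose2[OF Ck_on_imp_continuous_on[OF wk]])
            (use x \<delta>s in \<open>auto intro!: continuous_intros\<close>)
        then show "continuous_on ?Z (\<lambda>p. (\<Sum>b\<in>Basis. (w (x, snd p) \<bullet> b) *\<^sub>R DA b p) + Dg p)"
          by (intro continuous_intros DA Dg)
        have "continuous_on ({-r<..<r} \<times> {0}) (\<lambda>(h, t). if h = 0 then ?w0' (fst (x, t::real)) (fst (e, 0::real))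
            else (w (fst (x + h *\<^sub>R e, t), 0) - w (fst (x, t), 0)) /\<^sub>R h)"
        proof (rule difference_quotient_continuous[where B=B and F="\<lambda>p. w (fst p, 0)" and F'="\<lambda>p v. ?w0' (fst p) (fst v)"])
          show "((\<lambda>p. w (fst p, 0)) has_derivative (\<lambda>v. ?w0' (fst (x, t)) (fst v))) (at (x, t))"
            if "x \<in> B" for x and t :: real
          proof -
            have "((\<lambda>x. w (x, 0)) has_derivative ?w0' x) (at (fst (x, t)))"
              using Ck_on_has_derivative[OF w0 that] by simp
            from has_derivative_compose[OF has_derivative_fst[OF has_derivative_ident] this]
            show ?thesis by simp
          qed
          have "Ck_on k (\<lambda>x. ?w0' x e) B" using w0 by simp
          from Ck_on_imp_continuous_on[OF this]
          show "continuous_on (B \<times> {0}) (\<lambda>p::'a \<times> real. ?w0' (fst p) (fst (e, 0::real)))"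
            unfolding fst_conv by (rule continuous_on_compose2) (auto intro!: continuous_intros)
        qed (use xB in auto)
        then have "continuous_on {-r<..<r} (\<lambda>h. case (h, 0::real) of (h, t) \<Rightarrow> if h = 0 then ?w0' (fst (x, t::real)) (fst (e, 0::real))
            else (w (fst (x + h *\<^sub>R e, t), 0) - w (fst (x, t), 0)) /\<^sub>R h)"
          by (rule continuous_on_compose2) (auto intro!: continuous_intros)
        then show "continuous_on {-r<..<r} (\<lambda>h. Q (h, 0))"
          by (simp only: Q_def u0[OF x] split_conv fst_conv)
        fix h s assume h: "h \<in> {-r<..<r}" and s: "\<bar>s\<bar> < \<delta>2"
        show "((\<lambda>t. Q (h, t)) has_vector_derivative (\<Sum>b\<in>Basis. (Q (h, s) \<bullet> b) *\<^sub>R A b (x + fst (h, s) *\<^sub>R e, snd (h, s))) +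
            ((\<Sum>b\<in>Basis. (w (x, snd (h, s)) \<bullet> b) *\<^sub>R DA b (h, s)) + Dg (h, s))) (at s)"
        proof (cases "h = 0")
          case True
          then show ?thesis
            using u[OF x s] by (simp only: Q_def DA_def Dg_def g1_def split_conv if_True fst_conv snd_conv
                scaleR_zero_left add_0_right refl)
        next
          case False
          have xh: "x + h *\<^sub>R e \<in> B" using xB h by auto
          have s': "\<bar>s\<bar> < \<delta>" using s \<delta>s by simp
          have "((\<lambda>t. (w (x + h *\<^sub>R e, t) - w (x, t)) /\<^sub>R h) has_vector_derivative
              (?rhs (x + h *\<^sub>R e, s) - ?rhs (x, s)) /\<^sub>R h) (at s)"
            by (rule bounded_linear.has_vector_derivative[OF bounded_linear_scaleR_right
                has_vector_derivative_diff[OF w[OF xh s'] w[OF x s']]])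
          moreover have "(?rhs (x + h *\<^sub>R e, s) - ?rhs (x, s)) /\<^sub>R h =
             (\<Sum>b\<in>Basis. (Q (h, s) \<bullet> b) *\<^sub>R A b (x + h *\<^sub>R e, s)) + ((\<Sum>b\<in>Basis. (w (x, s) \<bullet> b) *\<^sub>R DA b (h, s)) + Dg (h, s))"
          proof -
            \<comment> \<open>Discrete product rule with \<open>A\<close> at the shifted point and
              \<open>w\<close> at the base point; this dictates the coefficients chosen above in the
              equation for \<open>Q\<close>.\<close>
            have b: "((w (x + h *\<^sub>R e, s) \<bullet> b) *\<^sub>R A b (x + h *\<^sub>R e, s) - (w (x, s) \<bullet> b) *\<^sub>R A b (x, s)) /\<^sub>R h
                = (Q (h, s) \<bullet> b) *\<^sub>R A b (x + h *\<^sub>R e, s) + (w (x, s) \<bullet> b) *\<^sub>R DA b (h, s)" for b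
              using False by (simp add: Q_def DA_def inner_diff_left scaleR_diff_left scaleR_diff_right algebra_simps)
            have "(?rhs (x + h *\<^sub>R e, s) - ?rhs (x, s)) /\<^sub>R h =
               (\<Sum>b\<in>Basis. ((w (x + h *\<^sub>R e, s) \<bullet> b) *\<^sub>R A b (x + h *\<^sub>R e, s) - (w (x, s) \<bullet> b) *\<^sub>R A b (x, s)) /\<^sub>R h)
                + (g (x + h *\<^sub>R e, s) - g (x, s)) /\<^sub>R h"
              by (simp only: scaleR_sum_right[symmetric] sum_subtractf scaleR_add_right[symmetric] add_diff_add)
            then show ?thesis
              using False by (simp only: b sum.distrib add.assoc Dg_def split_conv if_False)
          qed
          ultimately show ?thesis using False by (simp add: Q_def)
        qed
      qed
      then have "continuous_on {-r<..<r} (\<lambda>h. Q (h, t))"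
        by (rule continuous_on_compose2) (use t \<delta>s in \<open>auto intro!: continuous_intros\<close>)
      then have "((\<lambda>h. Q (h, t)) \<longlongrightarrow> Q (0, t)) (at 0)"
        using r by (simp add: continuous_on_eq_continuous_at isCont_def)
      moreover have "Q (0, t) = u x t" by (simp add: Q_def)
      ultimately have "((\<lambda>h. Q (h, t)) \<longlongrightarrow> u x t) (at 0)" by simp
      then have "((\<lambda>h. (w (x + h *\<^sub>R e, t) - w (x + 0 *\<^sub>R e, t)) /\<^sub>R h) \<longlongrightarrow> u x t) (at 0)"
        by (rule Lim_transform_within[OF _ zero_less_one]) (auto simp: Q_def)
      then show ?thesis by (rule has_vector_derivative_quotientI)
    qed
    then show ?thesis using uk by (intro exI[of _ "\<lambda>(x, t). u x t"]) auto
  qed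
  then obtain U where U: "\<And>e. e \<in> Basis \<Longrightarrow> Ck_on k (U e) (B \<times> ?J \<delta>')"
    "\<And>e x t. e \<in> Basis \<Longrightarrow> x \<in> B \<Longrightarrow> t \<in> ?J \<delta>' \<Longrightarrow> ((\<lambda>h. w (x + h *\<^sub>R e, t)) has_vector_derivative U e (x, t)) (at 0)"
    by metis
  show ?case
  proof (rule Ck_on_time_partials[OF B open_greaterThanLessThan U(1) _ U(2)])
    show "Ck_on k ?rhs (B \<times> ?J \<delta>')" using Ck_on_subset[OF rhs sub] \<delta>s by simp
    show "((\<lambda>t. w (x, t)) has_vector_derivative ?rhs (x, t)) (at t)" if "x \<in> B" "t \<in> ?J \<delta>'" for x t
      by (rule w[OF that(1)]) (use that(2) \<delta>s in auto)
  qed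
qed

section \<open>Local flows of smooth vector fields in Euclidean space\<close>

lemma C1_bounds_cball:
  fixes f :: "'a::euclidean_space \<Rightarrow> 'c::real_normed_vector"
  assumes "smooth_on f U" "cball p r \<subseteq> U"
  obtains L where "0 \<le> L"
    "\<And>x. x \<in> cball p r \<Longrightarrow> (\<Sum>b\<in>Basis. norm (frechet_derivative f (at x) b)) \<le> L"
    "\<And>x y. x \<in> cball p r \<Longrightarrow> y \<in> cball p r \<Longrightarrow> norm (f x - f y) \<le> L * norm (x - y)"
proof -
  let ?f' = "\<lambda>x. frechet_derivative f (at x)"
  have "continuous_on (cball p r) (\<lambda>x. ?f' x b)" for b
    using smooth_on_imp_continuous_on[OF smooth_on_frechet_derivative[OF assms(1)]] assms(2)
    by (rule continuous_on_subset)
  then have "compact ((\<lambda>x. \<Sum>b\<in>Basis. norm (?f' x b)) ` cball p r)"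
    by (intro compact_continuous_image compact_cball continuous_intros)
  then obtain L where L: "\<forall>y\<in>(\<lambda>x. \<Sum>b\<in>Basis. norm (?f' x b)) ` cball p r. norm y \<le> L"
    using compact_imp_bounded bounded_iff by metis
  have 2: "(\<Sum>b\<in>Basis. norm (?f' x b)) \<le> \<bar>L\<bar>" if "x \<in> cball p r" for x
  proof -
    have "norm (\<Sum>b\<in>Basis. norm (?f' x b)) \<le> L" by (rule bspec[OF L imageI[OF that]])
    then show ?thesis by simp
  qed
  show ?thesis
  proof (rule that[OF abs_ge_zero[of L] 2])
    show "norm (f x - f y) \<le> \<bar>L\<bar> * norm (x - y)" if "x \<in> cball p r" "y \<in> cball p r" for x y
    proof (rule differentiable_bound[OF convex_cball _ _ that])
      fix x assume x: "x \<in> cball p r"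
      show f': "(f has_derivative ?f' x) (at x within cball p r)"
        using smooth_on_has_derivative[OF assms(1) subsetD[OF assms(2) x]] by (rule has_derivative_at_withinI)
      have "norm (?f' x v) \<le> \<bar>L\<bar> * norm v" for v
      proof -
        have "norm (?f' x v) = norm (\<Sum>b\<in>Basis. (v \<bullet> b) *\<^sub>R ?f' x b)"
          using linear_expand_basis[OF has_derivative_linear[OF f']] by metis
        also have "\<dots> \<le> (\<Sum>b\<in>Basis. norm (?f' x b)) * norm v"
          by (rule norm_linear_combination_le)
        also have "\<dots> \<le> \<bar>L\<bar> * norm v" using 2[OF x] by (intro mult_right_mono) auto
        finally show ?thesis .
      qed
      then show "onorm (?f' x) \<le> \<bar>L\<bar>" by (rule onorm_le)
    qed
  qed
qed

lemma hadamard: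
  fixes f :: "'a::euclidean_space \<Rightarrow> 'c::euclidean_space"
  assumes f: "smooth_on f U" and K: "convex K" "K \<subseteq> U" "x \<in> K" "y \<in> K"
  shows "f y - f x = (\<Sum>b\<in>Basis. ((y - x) \<bullet> b) *\<^sub>R
    integral (cbox 0 1) (\<lambda>s. frechet_derivative f (at (x + s *\<^sub>R (y - x))) b))"
proof -
  let ?f' = "\<lambda>x. frechet_derivative f (at x)" and ?c = "\<lambda>s. x + s *\<^sub>R (y - x)"
  have c: "?c s \<in> U" if "s \<in> {0..1}" for s
  proof -
    have "(1 - s) *\<^sub>R x + s *\<^sub>R y \<in> K" using K that by (simp add: convex_alt)
    then show ?thesis using K(2) by (auto simp: algebra_simps)
  qed
  have cont: "continuous_on {0..1} (\<lambda>s. ?f' (?c s) b)" for b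
    by (rule continuous_on_compose2[OF smooth_on_imp_continuous_on[OF smooth_on_frechet_derivative[OF f]]])
      (use c in \<open>auto intro!: continuous_intros\<close>)
  have "((\<lambda>s. \<Sum>b\<in>Basis. ((y - x) \<bullet> b) *\<^sub>R ?f' (?c s) b) has_integral f (?c 1) - f (?c 0)) {0..1}"
  proof (rule fundamental_theorem_of_calculus)
    fix s :: real assume s: "s \<in> {0..1}"
    have 1: "(?c has_vector_derivative (y - x)) (at s within {0..1})"
      by (auto intro!: derivative_eq_intros)
    have 2: "(f has_derivative ?f' (?c s)) (at (?c s))"
      using smooth_on_has_derivative[OF f c[OF s]] .
    have "((f \<circ> ?c) has_vector_derivative ?f' (?c s) (y - x)) (at s within {0..1})"
      by (rule vector_derivative_diff_chain_within[OF 1 has_derivative_at_withinI[OF 2]])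
    moreover have "?f' (?c s) (y - x) = (\<Sum>b\<in>Basis. ((y - x) \<bullet> b) *\<^sub>R ?f' (?c s) b)"
      by (rule linear_expand_basis[OF has_derivative_linear[OF 2]])
    ultimately show "((\<lambda>s. f (?c s)) has_vector_derivative (\<Sum>b\<in>Basis. ((y - x) \<bullet> b) *\<^sub>R ?f' (?c s) b)) (at s within {0..1})"
      by (simp only: o_def)
  qed simp
  then have "f (?c 1) - f (?c 0) = integral {0..1} (\<lambda>s. \<Sum>b\<in>Basis. ((y - x) \<bullet> b) *\<^sub>R ?f' (?c s) b)"
    by (rule integral_unique[symmetric])
  also have "\<dots> = (\<Sum>b\<in>Basis. integral {0..1} (\<lambda>s. ((y - x) \<bullet> b) *\<^sub>R ?f' (?c s) b))"
    by (intro integral_sum finite_Basis integrable_continuous_real continuous_intros cont)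
  finally show ?thesis by (simp only: integral_cmul cbox_interval) simp
qed

text \<open>Composing \<open>f\<close> with the nearest point projection onto the ball makes it
  Lipschitz on the whole space, so \<open>lipschitz_ode_exists\<close> applies. By
  \<open>C * d \<le> r\<close> the solution never leaves the ball of radius \<open>2 * r\<close>,
  where the projection is the identity.\<close>

lemma local_solution_exists:
  fixes f :: "'a::euclidean_space \<Rightarrow> 'a"
  assumes r: "0 < r" and d: "0 < d" and L: "0 \<le> L" "L * d < 1" and C: "C * d \<le> r"
    and lip: "\<And>x y. x \<in> cball p (2 * r) \<Longrightarrow> y \<in> cball p (2 * r) \<Longrightarrow> norm (f x - f y) \<le> L * norm (x - y)"
    and bd: "\<And>x. x \<in> cball p (2 * r) \<Longrightarrow> norm (f x) \<le> C"
    and x: "x \<in> ball p r"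
  shows "\<exists>c. c 0 = x \<and> (\<forall>t. \<bar>t\<bar> < d \<longrightarrow> (c has_vector_derivative f (c t)) (at t) \<and> c t \<in> cball p (2 * r))"
proof -
  let ?K = "cball p (2 * r)"
  let ?P = "closest_point ?K"
  have K: "convex ?K" "closed ?K" "?K \<noteq> {}" using r by auto
  have P: "?P y \<in> ?K" for y using closest_point_in_set[OF K(2,3)] .
  have lipP: "norm (f (?P y) - f (?P z)) \<le> L * norm (y - z)" for y z
  proof -
    have "norm (f (?P y) - f (?P z)) \<le> L * norm (?P y - ?P z)" by (intro lip P)
    also have "\<dots> \<le> L * norm (y - z)"
      using closest_point_lipschitz[OF K, of y z] L by (intro mult_left_mono) (auto simp: dist_norm)
    finally show ?thesis .
  qed
  have "L-lipschitz_on UNIV (\<lambda>y. f (?P y))"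
    using lipP L by (auto simp: lipschitz_on_def dist_norm)
  then have "continuous_on UNIV (\<lambda>y. f (?P y))" by (rule lipschitz_on_continuous_on)
  then have "continuous_on ({-d..d} \<times> UNIV) (\<lambda>p. f (?P (snd p)))"
    by (rule continuous_on_compose2) (auto intro!: continuous_intros)
  then have "continuous_on ({-d..d} \<times> UNIV) (\<lambda>(t, y). f (?P y))" by (simp only: split_def)
  then show ?thesis
  proof (rule lipschitz_ode_exists[OF d L, where ?x0.0=x])
    fix c assume c0: "c 0 = x" and c: "\<And>t. \<bar>t\<bar> < d \<Longrightarrow> (c has_vector_derivative f (?P (c t))) (at t)"
    have cK: "c t \<in> ?K" if t: "\<bar>t\<bar> < d" for t
    proof -
      have "norm (c t - c 0) \<le> C * norm (t - 0)"
      proof (rule differentiable_bound[of "cball 0 \<bar>t\<bar>" c "\<lambda>s h. h *\<^sub>R f (?P (c s))"])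
        fix s :: real assume "s \<in> cball 0 \<bar>t\<bar>"
        then have "\<bar>s\<bar> < d" using t by simp
        from c[OF this] show "(c has_derivative (\<lambda>h. h *\<^sub>R f (?P (c s)))) (at s within cball 0 \<bar>t\<bar>)"
          by (simp add: has_vector_derivative_def has_derivative_at_withinI)
        show "onorm (\<lambda>h. h *\<^sub>R f (?P (c s))) \<le> C"
          by (intro onorm_le) (use mult_right_mono[OF bd[OF P[of "c s"]] abs_ge_zero] in \<open>simp add: mult.commute\<close>)
      qed auto
      also have "\<dots> \<le> C * d"
        using t order_trans[OF norm_ge_zero bd[OF P]] by (intro mult_left_mono) auto
      also have "\<dots> \<le> r" by (rule C)
      finally have "dist x (c t) \<le> r" by (simp add: c0 dist_norm norm_minus_commute)
      then show ?thesis using x dist_triangle[of p "c t" x] by simp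
    qed
    show ?thesis
      using c0 c cK closest_point_self[OF cK] by (intro exI[of _ c]) simp
  qed (use lipP in auto)
qed

lemma local_uniqueness:
  fixes f :: "'a::euclidean_space \<Rightarrow> 'a"
  assumes U: "open U" "smooth_on f U" and d: "0 < d" and p: "c1 t0 = c2 t0" "c1 t0 \<in> U"
    and c1: "\<And>t. \<bar>t - t0\<bar> < d \<Longrightarrow> (c1 has_vector_derivative f (c1 t)) (at t)"
    and c2: "\<And>t. \<bar>t - t0\<bar> < d \<Longrightarrow> (c2 has_vector_derivative f (c2 t)) (at t)"
  shows "\<exists>e>0. \<forall>t. \<bar>t - t0\<bar> < e \<longrightarrow> c1 t = c2 t"
proof -
  obtain r where r: "0 < r" "cball (c1 t0) r \<subseteq> U" using U p open_contains_cball by blast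
  obtain L where L: "0 \<le> L" "\<And>x y. x \<in> cball (c1 t0) r \<Longrightarrow> y \<in> cball (c1 t0) r \<Longrightarrow> norm (f x - f y) \<le> L * norm (x - y)"
    using C1_bounds_cball[OF U(2) r(2)] by metis
  have "isCont c1 t0" "isCont c2 t0"
    using c1[of t0] c2[of t0] d by (auto intro!: has_vector_derivative_continuous)
  then obtain e1 e2 where e: "0 < e1" "\<And>t. dist t t0 < e1 \<Longrightarrow> dist (c1 t) (c1 t0) < r"
     "0 < e2" "\<And>t. dist t t0 < e2 \<Longrightarrow> dist (c2 t) (c2 t0) < r"
    using r(1) unfolding continuous_at_eps_delta by metis
  define e where "e = min d (min e1 e2)"
  have "c1 t = c2 t" if t: "\<bar>t - t0\<bar> < e" for t
  proof -
    let ?d = "\<lambda>s. c1 (t0 + s) - c2 (t0 + s)"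
    have "(norm (?d (t - t0)))\<^sup>2 \<le> exp ((2 * L + 1) * e) * ((norm (?d 0))\<^sup>2 + 0\<^sup>2 * e)"
    proof (rule gronwall[OF L(1), where d'="\<lambda>s. f (c1 (t0 + s)) - f (c2 (t0 + s))"])
      fix s assume "\<bar>s\<bar> \<le> \<bar>t - t0\<bar>"
      then have s: "\<bar>t0 + s - t0\<bar> < d" "dist (t0 + s) t0 < e1" "dist (t0 + s) t0 < e2"
        using t by (auto simp: e_def dist_real_def)
      show "(?d has_vector_derivative f (c1 (t0 + s)) - f (c2 (t0 + s))) (at s)"
        by (intro has_vector_derivative_diff) (use c1[OF s(1)] c2[OF s(1)] in \<open>simp_all add: has_vector_derivative_shift\<close>)
      show "norm (f (c1 (t0 + s)) - f (c2 (t0 + s))) \<le> L * norm (?d s) + 0"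
        using L(2)[of "c1 (t0 + s)" "c2 (t0 + s)"] e(2)[OF s(2)] e(4)[OF s(3)] p(1)
        by (simp add: dist_commute less_imp_le)
    qed (use t in simp)
    then show ?thesis using p by simp
  qed
  then show ?thesis using d e by (intro exI[of _ e]) (auto simp: e_def)
qed

text \<open>By Hadamard's lemma the difference of two solutions solves a linear equation with continuous
  coefficients. Letting the two initial points come together gives the variational equation for the
  derivative, and its regularity in turn is bootstrapped through \<open>linear_ode_Ck\<close>.\<close>

lemma local_flow:
  fixes f :: "'a::euclidean_space \<Rightarrow> 'a"
  assumes U: "open U" "smooth_on f U" "p \<in> U"
  shows "\<exists>\<delta> \<rho> y. 0 < \<delta> \<and> 0 < \<rho> \<and> ball p \<rho> \<subseteq> U \<and>
    (\<forall>x\<in>ball p \<rho>. y (x, 0) = x) \<and>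
    (\<forall>x\<in>ball p \<rho>. \<forall>t. \<bar>t\<bar> < \<delta> \<longrightarrow> y (x, t) \<in> U \<and>
      ((\<lambda>t. y (x, t)) has_vector_derivative f (y (x, t))) (at t)) \<and>
    smooth_on y (ball p \<rho> \<times> {-\<delta><..<\<delta>}) \<and>
    (\<forall>x\<in>ball p \<rho>. \<forall>v.
      ((\<lambda>t. frechet_derivative y (at (x, t)) (v, 0)) has_vector_derivative frechet_derivative f (at x) v) (at 0))"
proof -
  obtain r0 where r0: "0 < r0" "cball p r0 \<subseteq> U" using U open_contains_cball by blast
  \<comment> \<open>Initial points are taken within \<open>r\<close> of \<open>p\<close>; solutions
    may travel another \<open>r\<close>.\<close>
  define r where "r = r0 / 2"
  let ?K = "cball p (2 * r)" and ?B = "ball p r" and ?J = "\<lambda>d::real. {-d<..<d}"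
  have r: "0 < r" "?K \<subseteq> U" using r0 by (auto simp: r_def)
  let ?f' = "\<lambda>x. frechet_derivative f (at x)"
  obtain L where L: "0 \<le> L"
    and f'L: "\<And>x. x \<in> ?K \<Longrightarrow> (\<Sum>b\<in>Basis. norm (?f' x b)) \<le> L"
    and lip: "\<And>x y. x \<in> ?K \<Longrightarrow> y \<in> ?K \<Longrightarrow> norm (f x - f y) \<le> L * norm (x - y)"
    using C1_bounds_cball[OF U(2) r(2)] by metis
  have "compact (f ` ?K)"
    by (intro compact_continuous_image compact_cball continuous_on_subset[OF smooth_on_imp_continuous_on[OF U(2)] r(2)])
  then obtain C0 where C0: "\<forall>y\<in>f ` ?K. norm y \<le> C0"
    using compact_imp_bounded bounded_iff by metis
  define C where "C = \<bar>C0\<bar> + 1"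
  have C: "norm (f x) \<le> C" if "x \<in> ?K" for x
    using bspec[OF C0 imageI[OF that]] by (simp add: C_def)
  have C1: "1 \<le> C" by (simp add: C_def)
  \<comment> \<open>\<open>r / C\<close> limits the distance travelled to \<open>r\<close>;
    \<open>1 / (L + 1)\<close> makes the Picard iteration contract.\<close>
  define d where "d = min (r / C) (1 / (L + 1)) / 2"
  have m: "0 < min (r / C) (1 / (L + 1))" using r C1 L by simp
  then have d: "0 < d" by (simp add: d_def)
  have "z / 2 \<le> z" if "0 < z" for z :: real using that by simp
  from this[OF m] have "d \<le> min (r / C) (1 / (L + 1))" unfolding d_def .
  then have d1: "d \<le> r / C" "d \<le> 1 / (L + 1)" by simp_all
  have dC: "C * d \<le> r"
  proof -
    have "C * d \<le> C * (r / C)" using C1 d1 by (intro mult_left_mono) auto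
    then show ?thesis using C1 by simp
  qed
  have dL: "L * d < 1"
  proof -
    have "L * d \<le> L * (1 / (L + 1))" using L d1 by (intro mult_left_mono) auto
    also have "\<dots> < 1" using L by (simp add: field_simps)
    finally show ?thesis .
  qed
  have "\<forall>x\<in>?B. \<exists>c. c 0 = x \<and> (\<forall>t. \<bar>t\<bar> < d \<longrightarrow> (c has_vector_derivative f (c t)) (at t) \<and> c t \<in> ?K)"
  proof
    fix x assume x: "x \<in> ?B"
    show "\<exists>c. c 0 = x \<and> (\<forall>t. \<bar>t\<bar> < d \<longrightarrow> (c has_vector_derivative f (c t)) (at t) \<and> c t \<in> ?K)"
      by (rule local_solution_exists[OF r(1) d L dL dC lip C x])
  qed
  from bchoice[OF this] obtain Y where Y: "\<forall>x\<in>?B. Y x 0 = x \<and>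
      (\<forall>t. \<bar>t\<bar> < d \<longrightarrow> (Y x has_vector_derivative f (Y x t)) (at t) \<and> Y x t \<in> ?K)" by blast
  define y where "y = (\<lambda>(x, t). Y x t)"
  have y0: "y (x, 0) = x" if "x \<in> ?B" for x using Y that by (simp add: y_def)
  have y': "((\<lambda>t. y (x, t)) has_vector_derivative f (y (x, t))) (at t)" if "x \<in> ?B" "\<bar>t\<bar> < d" for x t
    using Y that by (simp add: y_def)
  have yK: "y (x, t) \<in> ?K" if "x \<in> ?B" "\<bar>t\<bar> < d" for x t
    using Y that by (simp add: y_def)
  have yU: "y (x, t) \<in> U" if "x \<in> ?B" "\<bar>t\<bar> < d" for x t
    using yK[OF that] r(2) by blast
  have op: "open (?B \<times> ?J e)" for e by (intro open_Times) auto
  define E where "E = exp ((2 * L + 1) * d)"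
  have ylip1: "norm (y (x, t) - y (x', t)) \<le> sqrt E * norm (x - x')" if x: "x \<in> ?B" "x' \<in> ?B" and t: "\<bar>t\<bar> < d" for x x' t
  proof -
    have "(norm (y (x, t) - y (x', t)))\<^sup>2 \<le> exp ((2 * L + 1) * d) * ((norm (y (x, 0) - y (x', 0)))\<^sup>2 + 0\<^sup>2 * d)"
    proof (rule gronwall[OF L, where d'="\<lambda>s. f (y (x, s)) - f (y (x', s))"])
      fix s assume "\<bar>s\<bar> \<le> \<bar>t\<bar>"
      then have s: "\<bar>s\<bar> < d" using t by simp
      show "((\<lambda>s. y (x, s) - y (x', s)) has_vector_derivative f (y (x, s)) - f (y (x', s))) (at s)"
        by (rule has_vector_derivative_diff[OF y'[OF x(1) s] y'[OF x(2) s]])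
      show "norm (f (y (x, s)) - f (y (x', s))) \<le> L * norm (y (x, s) - y (x', s)) + 0"
        using lip[OF yK[OF x(1) s] yK[OF x(2) s]] by simp
    qed (use t in simp)
    then have "(norm (y (x, t) - y (x', t)))\<^sup>2 \<le> (sqrt E * norm (x - x'))\<^sup>2"
      using x by (simp add: y0 E_def power_mult_distrib)
    then show ?thesis by (rule power2_le_imp_le) (simp add: E_def)
  qed
  have ylip2: "norm (y (x, t) - y (x, t')) \<le> C * norm (t - t')" if x: "x \<in> ?B" and t: "\<bar>t\<bar> < d" "\<bar>t'\<bar> < d" for x t t'
  proof (rule differentiable_bound[of "?J d" "\<lambda>t. y (x, t)" "\<lambda>t h. h *\<^sub>R f (y (x, t))"])
    fix s assume "s \<in> ?J d"
    then have s: "\<bar>s\<bar> < d" by auto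
    show "((\<lambda>t. y (x, t)) has_derivative (\<lambda>h. h *\<^sub>R f (y (x, s)))) (at s within ?J d)"
      using y'[OF x s] by (simp add: has_vector_derivative_def has_derivative_at_withinI)
    show "onorm (\<lambda>h. h *\<^sub>R f (y (x, s))) \<le> C"
      by (intro onorm_le) (use mult_right_mono[OF C[OF yK[OF x s]] abs_ge_zero] in \<open>simp add: mult.commute\<close>)
  qed (use t in auto)
  have ycont: "continuous_on (?B \<times> ?J d) y"
  proof (rule lipschitz_on_continuous_on)
    show "(sqrt E + C)-lipschitz_on (?B \<times> ?J d) y"
      unfolding lipschitz_on_def
    proof (intro conjI ballI)
      show "0 \<le> sqrt E + C" using C1 by (simp add: E_def)
      fix p q assume pq: "p \<in> ?B \<times> ?J d" "q \<in> ?B \<times> ?J d"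
      obtain x t x' t' where [simp]: "p = (x, t)" "q = (x', t')" by (cases p, cases q)
      have "dist (y p) (y q) \<le> dist (y (x, t)) (y (x', t)) + dist (y (x', t)) (y (x', t'))"
        by (simp add: dist_triangle)
      also have "\<dots> \<le> sqrt E * dist x x' + C * dist t t'"
        using ylip1[of x x' t] ylip2[of x' t t'] pq by (intro add_mono) (auto simp: dist_norm abs_less_iff)
      also have "\<dots> \<le> sqrt E * dist p q + C * dist p q"
        using dist_fst_le[of p q] dist_snd_le[of p q] C1 by (intro add_mono mult_left_mono) (auto simp: E_def)
      finally show "dist (y p) (y q) \<le> (sqrt E + C) * dist p q" by (simp add: algebra_simps)
    qed
  qed
  have f'cont: "continuous_on U (\<lambda>x. ?f' x b)" for b
    by (rule smooth_on_imp_continuous_on[OF smooth_on_frechet_derivative[OF U(2)]])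
  \<comment> \<open>The derivative in direction \<open>e\<close> is the solution of the variational
    equation along the orbit with initial value \<open>e\<close>. It is constructed on shorter
    intervals, up to whose endpoints the coefficients are continuous.\<close>
  have var: "\<exists>u. (\<forall>x\<in>?B. u (x, 0) = e \<and> (\<forall>t. \<bar>t\<bar> < d' \<longrightarrow>
        ((\<lambda>t. u (x, t)) has_vector_derivative (\<Sum>b\<in>Basis. (u (x, t) \<bullet> b) *\<^sub>R ?f' (y (x, t)) b)) (at t) \<and>
        ((\<lambda>h. y (x + h *\<^sub>R e, t)) has_vector_derivative u (x, t)) (at 0)))"
    if e: "e \<in> Basis" and d': "0 < d'" "d' < d" for e d'
  proof -
    have L2: "L * d' < 1"
      using dL mult_left_mono[of d' d L] L d' by simp
    have "\<forall>x\<in>?B. \<exists>c. c 0 = e \<and> (\<forall>t. \<bar>t\<bar> < d' \<longrightarrow> (c has_vector_derivative (\<Sum>b\<in>Basis. (c t \<bullet> b) *\<^sub>R ?f' (y (x, t)) b) + 0) (at t))"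
    proof
      fix x assume x: "x \<in> ?B"
      show "\<exists>c. c 0 = e \<and> (\<forall>t. \<bar>t\<bar> < d' \<longrightarrow> (c has_vector_derivative (\<Sum>b\<in>Basis. (c t \<bullet> b) *\<^sub>R ?f' (y (x, t)) b) + 0) (at t))"
      proof (rule linear_ode_exists[OF d'(1) L L2])
        have "continuous_on {-d'..d'} (\<lambda>t. y (x, t))"
          by (rule continuous_on_compose2[OF ycont]) (use x d' in \<open>auto intro!: continuous_intros\<close>)
        then show "continuous_on {-d'..d'} (\<lambda>t. ?f' (y (x, t)) b)" for b
          by (rule continuous_on_compose2[OF f'cont]) (use yU[OF x] d' in auto)
        show "(\<Sum>b\<in>Basis. norm (?f' (y (x, t)) b)) \<le> L" if "\<bar>t\<bar> \<le> d'" for t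
          by (rule f'L[OF yK[OF x]]) (use that d' in simp)
      qed simp
    qed
    from bchoice[OF this] obtain u where u: "\<forall>x\<in>?B. u x 0 = e \<and> (\<forall>t. \<bar>t\<bar> < d' \<longrightarrow>
        (u x has_vector_derivative (\<Sum>b\<in>Basis. (u x t \<bullet> b) *\<^sub>R ?f' (y (x, t)) b) + 0) (at t))" by blast
    have "((\<lambda>h. y (x + h *\<^sub>R e, t)) has_vector_derivative u x t) (at 0)" if x: "x \<in> ?B" and t: "\<bar>t\<bar> < d'" for x t
    proof -
      obtain \<eta> where \<eta>: "0 < \<eta>" "ball x \<eta> \<subseteq> ?B" using x open_contains_ball[of ?B] by blast
      have xB: "x + h *\<^sub>R e \<in> ?B" if "\<bar>h\<bar> < \<eta>" for h
        by (rule subsetD[OF \<eta>(2)]) (use e that in \<open>simp add: dist_norm\<close>)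
      \<comment> \<open>\<open>m q s\<close> runs through the segment between two solutions, and
        \<open>M b q\<close> is Hadamard's mean derivative over it. At \<open>h = 0\<close> the
        segment is a point and \<open>M\<close> becomes the derivative along the orbit, so one
        linear equation governs \<open>Q\<close> for all \<open>h\<close>.\<close>
      define m where "m q s = y (x, snd q) + s *\<^sub>R (y (x + fst q *\<^sub>R e, snd q) - y (x, snd q))" for q :: "real \<times> real" and s :: real
      define M where "M b q = integral (cbox 0 1) (\<lambda>s. ?f' (m q s) b)" for b q
      define Q where "Q = (\<lambda>(h, t). if h = 0 then u x t else (y (x + h *\<^sub>R e, t) - y (x, t)) /\<^sub>R h)"
      let ?Z = "?J \<eta> \<times> ?J d'"
      have y1: "continuous_on ?Z (\<lambda>q. y (x, snd q))"
        by (rule continuous_on_compose2[OF ycont]) (use x d' in \<open>auto intro!: continuous_intros\<close>)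
      have y2: "continuous_on ?Z (\<lambda>q. y (x + fst q *\<^sub>R e, snd q))"
        by (rule continuous_on_compose2[OF ycont]) (use xB d' in \<open>auto intro!: continuous_intros\<close>)
      have mU: "m q s \<in> U" if "q \<in> ?Z" "s \<in> cbox 0 1" for q s
      proof -
        have "y (x, snd q) \<in> ?K" "y (x + fst q *\<^sub>R e, snd q) \<in> ?K"
          using that d' x xB by (auto intro!: yK simp del: mem_cball mem_ball)
        then have "(1 - s) *\<^sub>R y (x, snd q) + s *\<^sub>R y (x + fst q *\<^sub>R e, snd q) \<in> ?K"
          using that(2) convex_cball[of p "2 * r"] unfolding convex_alt by auto
        then show ?thesis using r(2) by (auto simp: m_def algebra_simps)
      qed
      have "continuous_on ?Z Q"
      proof (rule linear_ode_continuous[where A=M and g="\<lambda>q. 0"])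
        show "continuous_on ?Z (M b)" for b
          unfolding M_def
        proof (rule integral_continuous_on_param)
          have "continuous_on (?Z \<times> cbox 0 1) (\<lambda>q. m (fst q) (snd q))"
            unfolding m_def
            by (intro continuous_intros continuous_on_compose2[OF y1 continuous_on_fst] continuous_on_compose2[OF y2 continuous_on_fst]) auto
          then have "continuous_on (?Z \<times> cbox 0 1) (\<lambda>q. ?f' (m (fst q) (snd q)) b)"
            by (rule continuous_on_compose2[OF f'cont]) (use mU in auto)
          then show "continuous_on (?Z \<times> cbox 0 1) (\<lambda>(q, s). ?f' (m q s) b)" by (simp only: split_def)
        qed
        have "Q (h, 0) = e" if "h \<in> ?J \<eta>" for h
          using that xB[of h] u x y0 by (auto simp: Q_def abs_less_iff simp del: mem_ball)
        then show "continuous_on (?J \<eta>) (\<lambda>h. Q (h, 0))"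
          by (intro continuous_on_eq[OF continuous_on_const]) simp
        fix h s assume h: "h \<in> ?J \<eta>" and s: "\<bar>s\<bar> < d'"
        show "((\<lambda>t. Q (h, t)) has_vector_derivative (\<Sum>b\<in>Basis. (Q (h, s) \<bullet> b) *\<^sub>R M b (h, s)) + 0) (at s)"
        proof (cases "h = 0")
          case True
          have "(u x has_vector_derivative (\<Sum>b\<in>Basis. (u x s \<bullet> b) *\<^sub>R ?f' (y (x, s)) b) + 0) (at s)"
            using u x s by blast
          moreover have "M b (0, s) = ?f' (y (x, s)) b" for b by (simp add: M_def m_def)
          ultimately show ?thesis by (simp only: Q_def True split_conv if_True refl)
        next
          case False
          have xh: "x + h *\<^sub>R e \<in> ?B" using xB h by auto
          have s': "\<bar>s\<bar> < d" using s d' by simp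
          have "((\<lambda>t. (y (x + h *\<^sub>R e, t) - y (x, t)) /\<^sub>R h) has_vector_derivative
              (f (y (x + h *\<^sub>R e, s)) - f (y (x, s))) /\<^sub>R h) (at s)"
            by (rule bounded_linear.has_vector_derivative[OF bounded_linear_scaleR_right
                has_vector_derivative_diff[OF y'[OF xh s'] y'[OF x s']]])
          moreover have "(f (y (x + h *\<^sub>R e, s)) - f (y (x, s))) /\<^sub>R h = (\<Sum>b\<in>Basis. (Q (h, s) \<bullet> b) *\<^sub>R M b (h, s))"
            using False hadamard[OF U(2) convex_cball r(2) yK[OF x s'] yK[OF xh s']]
            by (simp add: Q_def M_def m_def scaleR_sum_right)
          ultimately show ?thesis using False by (simp add: Q_def)
        qed
      qed simp
      then have "continuous_on (?J \<eta>) (\<lambda>h. Q (h, t))"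
        by (rule continuous_on_compose2) (use t in \<open>auto intro!: continuous_intros\<close>)
      then have "((\<lambda>h. Q (h, t)) \<longlongrightarrow> Q (0, t)) (at 0)"
        using \<eta> by (simp add: continuous_on_eq_continuous_at isCont_def)
      moreover have "Q (0, t) = u x t" by (simp add: Q_def)
      ultimately have "((\<lambda>h. Q (h, t)) \<longlongrightarrow> u x t) (at 0)" by simp
      then have "((\<lambda>h. (y (x + h *\<^sub>R e, t) - y (x + 0 *\<^sub>R e, t)) /\<^sub>R h) \<longlongrightarrow> u x t) (at 0)"
        by (rule Lim_transform_within[OF _ zero_less_one]) (auto simp: Q_def)
      then show ?thesis by (rule has_vector_derivative_quotientI)
    qed
    then show ?thesis using u by (intro exI[of _ "\<lambda>(x, t). u x t"]) simp
  qed
  \<comment> \<open>Bootstrap: if \<open>y\<close> is of class \<open>k\<close>, so are the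
    coefficients of the variational equation, hence by \<open>linear_ode_Ck\<close> the space
    derivatives of \<open>y\<close>; the time derivative is \<open>f (y q)\<close>. Thus
    \<open>y\<close> is of class \<open>Suc k\<close>.\<close>
  have yk: "Ck_on k y (?B \<times> ?J d')" if "0 < d'" "d' < d" for k d'
    using that
  proof (induction k arbitrary: d')
    case 0
    have "continuous_on (?B \<times> ?J d') y" by (rule continuous_on_subset[OF ycont]) (use 0 in auto)
    then show ?case by simp
  next
    case (Suc k)
    define d2 where "d2 = (d' + d) / 2"
    have d2: "0 < d2" "d' < d2" "d2 < d" using Suc.prems by (auto simp: d2_def)
    have L2: "L * d2 < 1" using dL mult_left_mono[of d2 d L] L d2 by simp
    have yk: "Ck_on k y (?B \<times> ?J d2)" by (rule Suc.IH[OF d2(1,3)])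
    have cf: "Ck_on k (\<lambda>q. g (y q)) (?B \<times> ?J d2)" if "smooth_on g U" for g :: "'a \<Rightarrow> 'a"
      by (rule Ck_on_compose[OF op U(1) _ yk]) (use yU d2 that in \<open>auto simp: smooth_on_def\<close>)
    have "\<forall>e\<in>Basis. \<exists>u. Ck_on k u (?B \<times> ?J d') \<and>
        (\<forall>x\<in>?B. \<forall>t\<in>?J d'. ((\<lambda>h. y (x + h *\<^sub>R e, t)) has_vector_derivative u (x, t)) (at 0))"
    proof
      fix e :: 'a assume e: "e \<in> Basis"
      from var[OF this d2(1,3)] obtain u where u: "\<forall>x\<in>?B. u (x, 0) = e \<and> (\<forall>t. \<bar>t\<bar> < d2 \<longrightarrow>
        ((\<lambda>t. u (x, t)) has_vector_derivative (\<Sum>b\<in>Basis. (u (x, t) \<bullet> b) *\<^sub>R ?f' (y (x, t)) b)) (at t) \<and>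
        ((\<lambda>h. y (x + h *\<^sub>R e, t)) has_vector_derivative u (x, t)) (at 0))" by blast
      have "Ck_on k u (?B \<times> ?J d')"
      proof (rule linear_ode_Ck[OF open_ball L L2 _ _ _ _ _ Suc.prems(1) d2(2), where g="\<lambda>q. 0"])
        show "Ck_on k (\<lambda>q. ?f' (y q) b) (?B \<times> ?J d2)" for b
          by (rule cf[OF smooth_on_frechet_derivative[OF U(2)]])
        show "(\<Sum>b\<in>Basis. norm (?f' (y (x, t)) b)) \<le> L" if "x \<in> ?B" "\<bar>t\<bar> < d2" for x t
          by (rule f'L[OF yK[OF that(1)]]) (use that d2 in simp)
        show "Ck_on k (\<lambda>q. 0) (?B \<times> ?J d2)" by (rule Ck_on_const[OF op])
        show "Ck_on k (\<lambda>x. u (x, 0)) ?B"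
          by (rule Ck_on_cong[OF open_ball _ Ck_on_const[OF open_ball, where c=e]]) (use u in simp)
        show "((\<lambda>t. u (x, t)) has_vector_derivative (\<Sum>b\<in>Basis. (u (x, t) \<bullet> b) *\<^sub>R ?f' (y (x, t)) b) + 0) (at t)"
          if "x \<in> ?B" "\<bar>t\<bar> < d2" for x t
          using u that by (simp only: add_0_right)
      qed
      moreover have "((\<lambda>h. y (x + h *\<^sub>R e, t)) has_vector_derivative u (x, t)) (at 0)" if "x \<in> ?B" "t \<in> ?J d'" for x t
      proof -
        have "\<bar>t\<bar> < d2" using that d2 by auto
        then show ?thesis using u that(1) by blast
      qed
      ultimately show "\<exists>u. Ck_on k u (?B \<times> ?J d') \<and>
        (\<forall>x\<in>?B. \<forall>t\<in>?J d'. ((\<lambda>h. y (x + h *\<^sub>R e, t)) has_vector_derivative u (x, t)) (at 0))" by blast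
    qed
    from bchoice[OF this] obtain V where V: "\<forall>e\<in>Basis. Ck_on k (V e) (?B \<times> ?J d') \<and>
        (\<forall>x\<in>?B. \<forall>t\<in>?J d'. ((\<lambda>h. y (x + h *\<^sub>R e, t)) has_vector_derivative V e (x, t)) (at 0))" by blast
    show ?case
    proof (rule Ck_on_time_partials[OF open_ball open_greaterThanLessThan, where u=V and r="\<lambda>q. f (y q)"])
      show "Ck_on k (V e) (?B \<times> ?J d')" if "e \<in> Basis" for e using V that by blast
      show "((\<lambda>h. y (x + h *\<^sub>R e, t)) has_vector_derivative V e (x, t)) (at 0)"
        if "e \<in> Basis" "x \<in> ?B" "t \<in> ?J d'" for e x t using V that by blast
      show "Ck_on k (\<lambda>q. f (y q)) (?B \<times> ?J d')"
        by (rule Ck_on_subset[OF cf[OF U(2)]]) (use d2 in auto)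
      show "((\<lambda>t. y (x, t)) has_vector_derivative f (y (x, t))) (at t)" if "x \<in> ?B" "t \<in> ?J d'" for x t
        by (rule y'[OF that(1)]) (use that(2) d2 in auto)
    qed
  qed
  have ysm: "smooth_on y (?B \<times> ?J d)"
  proof (rule smooth_on_local)
    fix q assume q: "q \<in> ?B \<times> ?J d"
    define d' where "d' = (\<bar>snd q\<bar> + d) / 2"
    have d': "0 < d'" "d' < d" "\<bar>snd q\<bar> < d'" using q by (auto simp: d'_def)
    have "smooth_on y (?B \<times> ?J d')" using yk[OF d'(1,2)] by (simp add: smooth_on_def)
    moreover have "q \<in> ?B \<times> ?J d'" using q d'(3) by (cases q) (auto simp: abs_less_iff)
    ultimately show "\<exists>T. open T \<and> q \<in> T \<and> smooth_on y T" using op by blast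
  qed
  \<comment> \<open>The variational equation at time \<open>0\<close>, where its solution is the
    direction itself; from it the Lie derivative of the symplectic form is later read off in
    coordinates.\<close>
  have "((\<lambda>t. frechet_derivative y (at (x, t)) (v, 0)) has_vector_derivative ?f' x v) (at 0)" if x: "x \<in> ?B" for x v
  proof -
    define d' where "d' = d / 2"
    have d': "0 < d'" "d' < d" using d by (auto simp: d'_def)
    have "\<forall>e\<in>Basis. \<exists>u. (\<forall>x\<in>?B. u (x, 0) = e \<and> (\<forall>t. \<bar>t\<bar> < d' \<longrightarrow>
        ((\<lambda>t. u (x, t)) has_vector_derivative (\<Sum>b\<in>Basis. (u (x, t) \<bullet> b) *\<^sub>R ?f' (y (x, t)) b)) (at t) \<and>
        ((\<lambda>h. y (x + h *\<^sub>R e, t)) has_vector_derivative u (x, t)) (at 0)))"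
      using var[OF _ d'] by blast
    from bchoice[OF this] obtain V where V: "\<forall>e\<in>Basis. \<forall>x\<in>?B. V e (x, 0) = e \<and> (\<forall>t. \<bar>t\<bar> < d' \<longrightarrow>
        ((\<lambda>t. V e (x, t)) has_vector_derivative (\<Sum>b\<in>Basis. (V e (x, t) \<bullet> b) *\<^sub>R ?f' (y (x, t)) b)) (at t) \<and>
        ((\<lambda>h. y (x + h *\<^sub>R e, t)) has_vector_derivative V e (x, t)) (at 0))" ..
    note Ve = bspec[OF bspec[OF V] x]
    have V0: "V e (x, 0) = e" if "e \<in> Basis" for e using Ve[OF that] by simp
    have V1: "((\<lambda>t. V e (x, t)) has_vector_derivative (\<Sum>b\<in>Basis. (V e (x, t) \<bullet> b) *\<^sub>R ?f' (y (x, t)) b)) (at t)"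
      if "e \<in> Basis" "\<bar>t\<bar> < d'" for e t using Ve[OF that(1)] that(2) by (simp only:)
    have V2: "((\<lambda>h. y (x + h *\<^sub>R e, t)) has_vector_derivative V e (x, t)) (at 0)"
      if "e \<in> Basis" "\<bar>t\<bar> < d'" for e t using Ve[OF that(1)] that(2) by (simp only:)
    have f': "linear (?f' x)"
      using smooth_on_has_derivative[OF U(2), of x] yU[OF x, of 0] y0[OF x] d has_derivative_linear by auto
    have V1': "((\<lambda>t. V e (x, t)) has_vector_derivative ?f' x e) (at 0)" if "e \<in> Basis" for e
      using V1[OF that, of 0] d' y0[OF x] V0[OF that] linear_expand_basis[OF f', of e] by simp
    have D: "frechet_derivative y (at (x, t)) (v, 0) = (\<Sum>e\<in>Basis. (v \<bullet> e) *\<^sub>R V e (x, t))" if t: "\<bar>t\<bar> < d'" for t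
    proof -
      have y': "(y has_derivative frechet_derivative y (at (x, t))) (at (x, t))"
        by (rule smooth_on_has_derivative[OF ysm]) (use x t d' in auto)
      let ?D = "\<lambda>v. frechet_derivative y (at (x, t)) (v, 0)"
      have "linear (\<lambda>v::'a. (v, 0::real))" by (auto intro!: linearI)
      from linear_compose[OF this has_derivative_linear[OF y']] have lin: "linear ?D" by (simp only: o_def)
      have "?D e = V e (x, t)" if e: "e \<in> Basis" for e
      proof -
        have "((\<lambda>h. (x + h *\<^sub>R e, t)) has_vector_derivative (e, 0)) (at 0)"
          by (auto intro!: derivative_eq_intros simp: has_vector_derivative_def)
        moreover have "(y has_derivative frechet_derivative y (at (x, t))) (at (x + 0 *\<^sub>R e, t))"
          using y' by simp
        ultimately have "((y \<circ> (\<lambda>h. (x + h *\<^sub>R e, t))) has_vector_derivative ?D e) (at 0)"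
          by (intro vector_derivative_diff_chain_within[of _ _ 0 UNIV]) (auto intro: has_derivative_at_withinI)
        then show ?thesis using V2[OF e t] by (simp add: o_def vector_derivative_unique_at)
      qed
      then show ?thesis using linear_expand_basis[OF lin, of v] by simp
    qed
    have "((\<lambda>t. \<Sum>e\<in>Basis. (v \<bullet> e) *\<^sub>R V e (x, t)) has_vector_derivative (\<Sum>e\<in>Basis. (v \<bullet> e) *\<^sub>R ?f' x e)) (at 0)"
      by (intro has_vector_derivative_sum bounded_linear.has_vector_derivative[OF bounded_linear_scaleR_right] V1')
    then have "((\<lambda>t. \<Sum>e\<in>Basis. (v \<bullet> e) *\<^sub>R V e (x, t)) has_vector_derivative ?f' x v) (at 0)"
      by (simp only: linear_expand_basis[OF f', of v, symmetric])
    then show ?thesis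
    proof (rule has_vector_derivative_transform_within_open[OF _ open_greaterThanLessThan])
      show "0 \<in> ?J d'" using d' by simp
      show "(\<Sum>e\<in>Basis. (v \<bullet> e) *\<^sub>R V e (x, t)) = frechet_derivative y (at (x, t)) (v, 0)" if "t \<in> ?J d'" for t
        by (rule D[symmetric]) (use that in auto)
    qed
  qed
  note D = this
  have "?B \<subseteq> ?K" using r(1) by auto
  then have "?B \<subseteq> U" using r(2) by (rule order_trans)
  then show ?thesis
    using d r(1) ysm y0 yU y' D by (intro exI[of _ d] exI[of _ r] exI[of _ y] conjI ballI allI impI)
qed

section \<open>Vector fields and flows on manifolds\<close>

text \<open>By \<open>step\<close> both \<open>{t. P t}\<close> and its complement are open, and the
  line is connected. In this form a local property is continued along a whole orbit.\<close>

lemma connected_UNIV_real_induct: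
  fixes P :: "real \<Rightarrow> bool"
  assumes "P t0" and step: "\<And>t. \<exists>e>0. \<forall>s s'. \<bar>s - t\<bar> < e \<longrightarrow> \<bar>s' - t\<bar> < e \<longrightarrow> P s \<longrightarrow> P s'"
  shows "P t"
proof -
  have o: "open {t. Q (P t)}" if "Q = id \<or> Q = Not" for Q
    unfolding open_dist
  proof (intro ballI)
    fix t assume t: "t \<in> {t. Q (P t)}"
    obtain e where e: "e > 0" "\<forall>s s'. \<bar>s - t\<bar> < e \<longrightarrow> \<bar>s' - t\<bar> < e \<longrightarrow> P s \<longrightarrow> P s'"
      using step by blast
    have "Q (P s)" if "\<bar>s - t\<bar> < e" for s
    proof -
      have "P s = P t" using e(1) e(2)[rule_format, of s t] e(2)[rule_format, of t s] that by auto
      then show ?thesis using t by simp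
    qed
    then show "\<exists>e>0. \<forall>y. dist y t < e \<longrightarrow> y \<in> {t. Q (P t)}"
      using e(1) by (auto simp: dist_real_def)
  qed
  have "open {t. P t}" "closed {t. P t}"
    using o[of id] o[of Not] by (simp_all add: closed_def Collect_neg_eq)
  from conjI[OF this(2,1)] have "{t. P t} = {} \<or> {t. P t} = UNIV" by (simp only: clopen)
  then show ?thesis
  proof
    assume "{t. P t} = {}"
    then show ?thesis using assms(1) by simp
  next
    assume "{t. P t} = UNIV"
    then show ?thesis by blast
  qed
qed

section \<open>Charts, integral curves and their uniqueness\<close>

locale smooth_manifold =
  fixes A :: "('i, 'a::{second_countable_topology,t2_space}, 'e::euclidean_space) atlas"
  assumes atlas: "smooth_atlas A"
begin

abbreviation "Cd i \<equiv> cdom (A i)"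
abbreviation "cm i \<equiv> cmap (A i)"
abbreviation "ci i \<equiv> cinv (A i)"
abbreviation "Cr i \<equiv> crange (A i)"

lemma open_Cd: "open (Cd i)" and open_Cr: "open (Cr i)"
  and chart_homeomorphism: "homeomorphism (Cd i) (Cr i) (cm i) (ci i)"
  and ex_chart: "\<exists>i. p \<in> Cd i"
  and transition_smooth: "smooth_on (cm j \<circ> ci i) (cm i ` (Cd i \<inter> Cd j))"
  using atlas unfolding smooth_atlas_def by auto

lemma ci_cm [simp]: "p \<in> Cd i \<Longrightarrow> ci i (cm i p) = p"
  and cm_ci [simp]: "x \<in> Cr i \<Longrightarrow> cm i (ci i x) = x"
  and ci_in [simp]: "x \<in> Cr i \<Longrightarrow> ci i x \<in> Cd i"
  and cm_in [simp]: "p \<in> Cd i \<Longrightarrow> cm i p \<in> Cr i"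
  and continuous_on_cm: "continuous_on (Cd i) (cm i)"
  and continuous_on_ci: "continuous_on (Cr i) (ci i)"
  using chart_homeomorphism[of i] unfolding homeomorphism_def by auto

lemma open_ci_vimage: "open W \<Longrightarrow> open {x \<in> Cr i. ci i x \<in> W}"
  using continuous_open_preimage[OF continuous_on_ci open_Cr] by (simp add: Int_def vimage_def)

lemma open_cm_vimage: "open W \<Longrightarrow> open {p \<in> Cd i. cm i p \<in> W}"
  using continuous_open_preimage[OF continuous_on_cm open_Cd] by (simp add: Int_def vimage_def)

lemma overlap_image: "cm i ` (Cd i \<inter> W) = {x \<in> Cr i. ci i x \<in> W}"
proof (intro set_eqI iffI)
  fix x assume "x \<in> {x \<in> Cr i. ci i x \<in> W}"
  then have "x = cm i (ci i x)" "ci i x \<in> Cd i \<inter> W" by auto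
  then show "x \<in> cm i ` (Cd i \<inter> W)" by blast
qed auto

lemma open_overlap: "open (cm i ` (Cd i \<inter> Cd j))"
  unfolding overlap_image by (rule open_ci_vimage[OF open_Cd])

lemma tchange_has_derivative:
  "p \<in> Cd i \<Longrightarrow> p \<in> Cd j \<Longrightarrow> ((cm j \<circ> ci i) has_derivative tchange A i j p) (at (cm i p))"
  unfolding tchange_def by (rule smooth_on_has_derivative[OF transition_smooth]) auto

lemma tchange_self: "p \<in> Cd i \<Longrightarrow> tchange A i i p = id"
proof -
  assume p: "p \<in> Cd i"
  have "(id has_derivative tchange A i i p) (at (cm i p))"
    by (rule has_derivative_transform_within_open[OF tchange_has_derivative[OF p p] open_Cr]) (use p in auto)
  then show ?thesis using has_derivative_id has_derivative_unique by blast
qed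

lemma tchange_compose:
  assumes p: "p \<in> Cd i" "p \<in> Cd j" "p \<in> Cd k"
  shows "tchange A j k p (tchange A i j p v) = tchange A i k p v"
proof -
  have "((cm k \<circ> ci j) has_derivative tchange A j k p) (at ((cm j \<circ> ci i) (cm i p)))"
    using tchange_has_derivative[OF p(2,3)] p by simp
  from diff_chain_at[OF tchange_has_derivative[OF p(1,2)] this]
  have "((cm k \<circ> ci i) has_derivative tchange A j k p \<circ> tchange A i j p) (at (cm i p))"
    by (rule has_derivative_transform_within_open[OF _ open_overlap[of i j]]) (use p in auto)
  from has_derivative_unique[OF this tchange_has_derivative[OF p(1,3)]]
  show ?thesis by (metis comp_apply)
qed

lemma chart_change_has_vector_derivative:
  assumes c: "continuous_on T \<gamma>" and t: "t \<in> T" and i: "\<gamma> t \<in> Cd i" and j: "\<gamma> t \<in> Cd j"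
    and d: "((cm i \<circ> \<gamma>) has_vector_derivative v) (at t within T)"
  shows "((cm j \<circ> \<gamma>) has_vector_derivative tchange A i j (\<gamma> t) v) (at t within T)"
proof -
  have "((cm j \<circ> ci i) has_derivative tchange A i j (\<gamma> t)) (at ((cm i \<circ> \<gamma>) t) within (cm i \<circ> \<gamma>) ` T)"
    using tchange_has_derivative[OF i j] by (simp add: has_derivative_at_withinI)
  from vector_derivative_diff_chain_within[OF d this]
  have d': "((cm j \<circ> ci i \<circ> (cm i \<circ> \<gamma>)) has_vector_derivative tchange A i j (\<gamma> t) v) (at t within T)" .
  obtain B where B: "open B" "t \<in> B" "\<forall>s\<in>T. s \<in> B \<longrightarrow> \<gamma> s \<in> Cd i"
    using c[unfolded continuous_on_topological, rule_format, OF t open_Cd i] by blast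
  then obtain e where e: "0 < e" "ball t e \<subseteq> B" using open_contains_ball by blast
  show ?thesis
  proof (rule has_vector_derivative_transform_within[OF d' e(1) t])
    fix s assume s: "s \<in> T" "dist s t < e"
    then have "s \<in> B" using e(2) by (auto simp: dist_commute)
    then show "(cm j \<circ> ci i \<circ> (cm i \<circ> \<gamma>)) s = (cm j \<circ> \<gamma>) s" using B(3) s(1) by simp
  qed
qed

definition vector_field :: "('i, 'a, 'e) vfield \<Rightarrow> bool" where
  "vector_field X \<longleftrightarrow> (\<forall>i. smooth_on (\<lambda>x. X i (ci i x)) (Cr i)) \<and>
     (\<forall>i j. \<forall>p\<in>Cd i \<inter> Cd j. tchange A i j p (X i p) = X j p)"

abbreviation "curve X \<equiv> integral_curve A (\<lambda>_. X)"

text \<open>An integral curve needs the right derivative in every chart around each of its points;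
  compatibility of the field under changes of charts reduces this to a single chart.\<close>

lemma integral_curveI:
  assumes X: "\<And>t i j p. t \<in> T \<Longrightarrow> p \<in> Cd i \<Longrightarrow> p \<in> Cd j \<Longrightarrow> tchange A i j p (X t i p) = X t j p"
    and c: "continuous_on T \<gamma>"
    and d: "\<And>t. t \<in> T \<Longrightarrow> \<exists>i. \<gamma> t \<in> Cd i \<and> ((cm i \<circ> \<gamma>) has_vector_derivative X t i (\<gamma> t)) (at t within T)"
  shows "integral_curve A X T \<gamma>"
  unfolding integral_curve_def
proof (intro conjI c ballI allI impI)
  fix t j assume t: "t \<in> T" and j: "\<gamma> t \<in> Cd j"
  obtain i where i: "\<gamma> t \<in> Cd i" "((cm i \<circ> \<gamma>) has_vector_derivative X t i (\<gamma> t)) (at t within T)"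
    using d[OF t] by blast
  from chart_change_has_vector_derivative[OF c t i(1) j i(2)]
  show "((cm j \<circ> \<gamma>) has_vector_derivative X t j (\<gamma> t)) (at t within T)"
    using X[OF t i(1) j] by simp
qed

lemma integral_curve_chart:
  assumes \<gamma>: "integral_curve A X T \<gamma>" and T: "open T" and t: "t \<in> T" and i: "\<gamma> t \<in> Cd i"
  obtains e where "0 < e" "\<And>s. \<bar>s - t\<bar> < e \<Longrightarrow> s \<in> T \<and> \<gamma> s \<in> Cd i \<and>
    ((\<lambda>s. cm i (\<gamma> s)) has_vector_derivative X s i (\<gamma> s)) (at s)"
proof -
  have c: "continuous_on T \<gamma>" using \<gamma> by (simp add: integral_curve_def)
  have "open (T \<inter> \<gamma> -` Cd i)" by (rule continuous_open_preimage[OF c T open_Cd])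
  then obtain e where e: "0 < e" "ball t e \<subseteq> T \<inter> \<gamma> -` Cd i"
    using t i open_contains_ball by (metis IntI vimageI2)
  show ?thesis
  proof (rule that[OF e(1)])
    fix s assume "\<bar>s - t\<bar> < e"
    then have "s \<in> ball t e" by (simp add: dist_real_def abs_minus_commute)
    then have s: "s \<in> T" "\<gamma> s \<in> Cd i" using e(2) by auto
    then have "((cm i \<circ> \<gamma>) has_vector_derivative X s i (\<gamma> s)) (at s within T)"
      using \<gamma> by (simp add: integral_curve_def)
    then show "s \<in> T \<and> \<gamma> s \<in> Cd i \<and> ((\<lambda>s. cm i (\<gamma> s)) has_vector_derivative X s i (\<gamma> s)) (at s)"
      using s by (simp only: at_within_open[OF s(1) T] o_def)
  qed
qed

text \<open>The times of agreement form an open set by local uniqueness in a chart, the times of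
  disagreement by the Hausdorff property; since \<open>T\<close> is connected, one of the two is
  empty.\<close>

lemma integral_curve_unique:
  assumes X: "vector_field X" and T: "open T" "connected T"
    and \<gamma>: "curve X T \<gamma>1" "curve X T \<gamma>2" and t0: "t0 \<in> T" "\<gamma>1 t0 = \<gamma>2 t0" and t: "t \<in> T"
  shows "\<gamma>1 t = \<gamma>2 t"
proof -
  let ?E = "{t \<in> T. \<gamma>1 t = \<gamma>2 t}" and ?N = "{t \<in> T. \<gamma>1 t \<noteq> \<gamma>2 t}"
  have c: "continuous_on T \<gamma>1" "continuous_on T \<gamma>2" using \<gamma> by (auto simp: integral_curve_def)
  have "open ?E"
    unfolding open_dist
  proof
    fix s assume s: "s \<in> ?E"
    obtain i where i: "\<gamma>1 s \<in> Cd i" using ex_chart by blast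
    obtain e1 where e1: "0 < e1" "\<And>u. \<bar>u - s\<bar> < e1 \<Longrightarrow> u \<in> T \<and> \<gamma>1 u \<in> Cd i \<and>
        ((\<lambda>s. cm i (\<gamma>1 s)) has_vector_derivative X i (\<gamma>1 u)) (at u)"
      by (rule integral_curve_chart[OF \<gamma>(1) T(1), of s i]) (use s i in auto)
    obtain e2 where e2: "0 < e2" "\<And>u. \<bar>u - s\<bar> < e2 \<Longrightarrow> u \<in> T \<and> \<gamma>2 u \<in> Cd i \<and>
        ((\<lambda>s. cm i (\<gamma>2 s)) has_vector_derivative X i (\<gamma>2 u)) (at u)"
      by (rule integral_curve_chart[OF \<gamma>(2) T(1), of s i]) (use s i in auto)
    have "\<exists>e>0. \<forall>u. \<bar>u - s\<bar> < e \<longrightarrow> cm i (\<gamma>1 u) = cm i (\<gamma>2 u)"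
    proof (rule local_uniqueness[OF open_Cr, where f="\<lambda>x. X i (ci i x)" and d="min e1 e2"])
      show "smooth_on (\<lambda>x. X i (ci i x)) (Cr i)" using X by (simp add: vector_field_def)
      show "((\<lambda>s. cm i (\<gamma>1 s)) has_vector_derivative X i (ci i (cm i (\<gamma>1 u)))) (at u)" if "\<bar>u - s\<bar> < min e1 e2" for u
        using e1(2)[of u] that by simp
      show "((\<lambda>s. cm i (\<gamma>2 s)) has_vector_derivative X i (ci i (cm i (\<gamma>2 u)))) (at u)" if "\<bar>u - s\<bar> < min e1 e2" for u
        using e2(2)[of u] that by simp
    qed (use e1(1) e2(1) s i in auto)
    then obtain e where e: "0 < e" "\<And>u. \<bar>u - s\<bar> < e \<Longrightarrow> cm i (\<gamma>1 u) = cm i (\<gamma>2 u)" by blast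
    have "u \<in> ?E" if "dist u s < min e (min e1 e2)" for u
    proof -
      have "\<bar>u - s\<bar> < e" "\<bar>u - s\<bar> < e1" "\<bar>u - s\<bar> < e2" using that by (auto simp: dist_real_def)
      then have "ci i (cm i (\<gamma>1 u)) = ci i (cm i (\<gamma>2 u))" "u \<in> T" "\<gamma>1 u \<in> Cd i" "\<gamma>2 u \<in> Cd i"
        using e(2) e1(2) e2(2) by auto
      then show ?thesis by simp
    qed
    then show "\<exists>e>0. \<forall>u. dist u s < e \<longrightarrow> u \<in> ?E"
      using e(1) e1(1) e2(1) by (intro exI[of _ "min e (min e1 e2)"]) auto
  qed
  moreover have "open ?N"
  proof (subst open_subopen, intro ballI)
    fix s assume s: "s \<in> ?N"
    then obtain U V where UV: "open U" "open V" "\<gamma>1 s \<in> U" "\<gamma>2 s \<in> V" "U \<inter> V = {}"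
      using hausdorff[of "\<gamma>1 s" "\<gamma>2 s"] by auto
    have "open (T \<inter> \<gamma>1 -` U)" "open (T \<inter> \<gamma>2 -` V)"
      using c T UV by (auto intro: continuous_open_preimage)
    then show "\<exists>B. open B \<and> s \<in> B \<and> B \<subseteq> ?N"
      using s UV by (intro exI[of _ "(T \<inter> \<gamma>1 -` U) \<inter> (T \<inter> \<gamma>2 -` V)"]) auto
  qed
  ultimately have "?E \<inter> T = {} \<or> ?N \<inter> T = {}"
    using connectedD[OF T(2), of ?E ?N] by auto
  then show ?thesis using t0 t by auto
qed

lemma integral_curve_shift:
  assumes "integral_curve A X T \<gamma>"
  shows "integral_curve A (\<lambda>t. X (t + s)) ((\<lambda>t. t - s) ` T) (\<lambda>t. \<gamma> (t + s))"
  unfolding integral_curve_def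
proof (intro conjI ballI allI impI)
  show "continuous_on ((\<lambda>t. t - s) ` T) (\<lambda>t. \<gamma> (t + s))"
    using assms unfolding integral_curve_def
    by (intro continuous_on_compose2[of T \<gamma> _ "\<lambda>t. t + s"] continuous_intros) auto
  fix t i assume t: "t \<in> (\<lambda>t. t - s) ` T" and i: "\<gamma> (t + s) \<in> Cd i"
  have im: "(\<lambda>t. t + s) ` (\<lambda>t. t - s) ` T = T" by (simp add: image_image)
  have "t + s \<in> T" using t by auto
  then have d: "((cm i \<circ> \<gamma>) has_vector_derivative X (t + s) i (\<gamma> (t + s))) (at (t + s) within (\<lambda>t. t + s) ` (\<lambda>t. t - s) ` T)"
    unfolding im using assms i unfolding integral_curve_def by blast
  have "((\<lambda>t. t + s) has_vector_derivative 1) (at t within (\<lambda>t. t - s) ` T)"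
    by (auto intro!: derivative_eq_intros)
  from vector_diff_chain_within[OF this d]
  show "((cm i \<circ> (\<lambda>t. \<gamma> (t + s))) has_vector_derivative X (t + s) i (\<gamma> (t + s))) (at t within (\<lambda>t. t - s) ` T)"
    by (simp add: o_def)
qed

lemma curve_shift_UNIV:
  assumes "curve X UNIV \<gamma>"
  shows "curve X UNIV (\<lambda>t. \<gamma> (t + s))"
  using integral_curve_shift[OF assms, of s] by (simp only: surj_diff_right)

lemma local_flow_manifold:
  assumes X: "vector_field X" and p: "p \<in> Cd i"
  shows "\<exists>\<delta> W y. 0 < \<delta> \<and> open W \<and> p \<in> W \<and> W \<subseteq> Cd i \<and> open (cm i ` W) \<and>
    smooth_on y (cm i ` W \<times> {-\<delta><..<\<delta>}) \<and>
    (\<forall>q\<in>W. y (cm i q, 0) = cm i q \<and> (\<forall>t. \<bar>t\<bar> < \<delta> \<longrightarrow> y (cm i q, t) \<in> Cr i) \<and>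
      curve X {-\<delta><..<\<delta>} (\<lambda>t. ci i (y (cm i q, t))) \<and>
      (\<forall>v. ((\<lambda>t. frechet_derivative y (at (cm i q, t)) (v, 0)) has_vector_derivative
        frechet_derivative (\<lambda>x. X i (ci i x)) (at (cm i q)) v) (at 0)))"
proof -
  let ?f = "\<lambda>x. X i (ci i x)"
  have f: "smooth_on ?f (Cr i)" using X by (simp add: vector_field_def)
  obtain \<delta> \<rho> y where \<delta>: "0 < \<delta>" "0 < \<rho>" "ball (cm i p) \<rho> \<subseteq> Cr i"
    and y0: "\<forall>x\<in>ball (cm i p) \<rho>. y (x, 0) = x"
    and y1: "\<forall>x\<in>ball (cm i p) \<rho>. \<forall>t. \<bar>t\<bar> < \<delta> \<longrightarrow> y (x, t) \<in> Cr i \<and>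
      ((\<lambda>t. y (x, t)) has_vector_derivative ?f (y (x, t))) (at t)"
    and ys: "smooth_on y (ball (cm i p) \<rho> \<times> {-\<delta><..<\<delta>})"
    and yv: "\<forall>x\<in>ball (cm i p) \<rho>. \<forall>v.
      ((\<lambda>t. frechet_derivative y (at (x, t)) (v, 0)) has_vector_derivative frechet_derivative ?f (at x) v) (at 0)"
    using local_flow[OF open_Cr f cm_in[OF p]] by (elim exE conjE) (rule that)
  have yU: "y (x, t) \<in> Cr i" if "x \<in> ball (cm i p) \<rho>" "\<bar>t\<bar> < \<delta>" for x t
    using y1[rule_format, OF that] ..
  have y': "((\<lambda>t. y (x, t)) has_vector_derivative ?f (y (x, t))) (at t)" if "x \<in> ball (cm i p) \<rho>" "\<bar>t\<bar> < \<delta>" for x t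
    using y1[rule_format, OF that] ..
  define W where "W = {q \<in> Cd i. cm i q \<in> ball (cm i p) \<rho>}"
  have "open W" unfolding W_def by (rule open_cm_vimage[OF open_ball])
  moreover have "p \<in> W" using \<delta>(2) p by (simp add: W_def)
  moreover have "W \<subseteq> Cd i" by (auto simp: W_def)
  ultimately have W: "open W" "p \<in> W" "W \<subseteq> Cd i" by this+
  have cW: "cm i ` W = ball (cm i p) \<rho>"
  proof (intro set_eqI iffI)
    fix x assume x: "x \<in> ball (cm i p) \<rho>"
    then have "x \<in> Cr i" using \<delta>(3) by blast
    then have "cm i (ci i x) = x" "ci i x \<in> W" using x by (simp_all add: W_def del: mem_ball)
    then show "x \<in> cm i ` W" by (metis imageI)
  qed (auto simp: W_def)
  have in_ball: "cm i q \<in> ball (cm i p) \<rho>" if "q \<in> W" for q using that by (simp add: W_def)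
  have curve: "curve X {-\<delta><..<\<delta>} (\<lambda>t. ci i (y (cm i q, t)))" if q: "q \<in> W" for q
  proof (rule integral_curveI)
    show "tchange A j k p (X j p) = X k p" if "p \<in> Cd j" "p \<in> Cd k" for j k p
      using X that by (simp add: vector_field_def)
    have "continuous_on {-\<delta><..<\<delta>} (\<lambda>t. y (cm i q, t))"
      by (intro continuous_at_imp_continuous_on ballI has_vector_derivative_continuous[OF y'[OF in_ball[OF q]]]) auto
    then show "continuous_on {-\<delta><..<\<delta>} (\<lambda>t. ci i (y (cm i q, t)))"
      by (rule continuous_on_compose2[OF continuous_on_ci]) (use yU[OF in_ball[OF q]] in auto)
    fix t assume t: "t \<in> {-\<delta><..<\<delta>}"
    then have t': "\<bar>t\<bar> < \<delta>" by auto
    have "((cm i \<circ> (\<lambda>t. ci i (y (cm i q, t)))) has_vector_derivative ?f (y (cm i q, t))) (at t)"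
      by (rule has_vector_derivative_transform_within_open[OF y'[OF in_ball[OF q] t'] open_greaterThanLessThan t])
        (use yU[OF in_ball[OF q]] in auto)
    from conjI[OF ci_in[OF yU[OF in_ball[OF q] t']] has_vector_derivative_at_within[OF this]]
    show "\<exists>j. ci i (y (cm i q, t)) \<in> Cd j \<and> ((cm j \<circ> (\<lambda>t. ci i (y (cm i q, t)))) has_vector_derivative X j (ci i (y (cm i q, t)))) (at t within {-\<delta><..<\<delta>})"
      by (rule exI)
  qed
  show ?thesis
    using \<delta>(1) W ys cW y0 yU yv curve in_ball
    by (intro exI[of _ \<delta>] exI[of _ W] exI[of _ y] conjI ballI allI impI) (simp_all del: mem_ball)
qed

end

lemma smooth_on_fst_compose:
  "open V \<Longrightarrow> open J \<Longrightarrow> smooth_on g V \<Longrightarrow> smooth_on (\<lambda>q. g (fst q)) (V \<times> J)"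
  by (rule smooth_on_compose[of "V \<times> J" V]) (auto intro: open_Times smooth_on_bounded_linear bounded_linear_fst)

section \<open>Global flows and their differentials\<close>

context smooth_manifold
begin

abbreviation "flow X \<equiv> is_flow A (\<lambda>_. X) UNIV"

lemma flow_curve: "flow X \<psi> \<Longrightarrow> curve X UNIV (\<lambda>t. \<psi> t x)"
  and flow_0: "flow X \<psi> \<Longrightarrow> \<psi> 0 x = x"
  unfolding is_flow_def by auto

lemma curve_flow_add:
  assumes X: "vector_field X" and \<psi>: "\<And>x. curve X UNIV (\<lambda>t. \<psi> t x)" "\<And>x. \<psi> 0 x = x"
  shows "\<psi> (s + t) x = \<psi> s (\<psi> t x)"
  by (rule integral_curve_unique[OF X open_UNIV connected_UNIV curve_shift_UNIV[OF \<psi>(1)] \<psi>(1), of 0])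
    (simp_all add: \<psi>(2))

lemma flow_add: "vector_field X \<Longrightarrow> flow X \<psi> \<Longrightarrow> \<psi> (s + t) x = \<psi> s (\<psi> t x)"
  by (rule curve_flow_add) (auto simp: flow_curve flow_0)

text \<open>Uniqueness gives the group law, which makes \<open>\<psi> (- t)\<close> the inverse of
  \<open>\<psi> t\<close>.\<close>

lemma flowI:
  assumes X: "vector_field X" and \<psi>: "\<And>x. curve X UNIV (\<lambda>t. \<psi> t x)" "\<And>x. \<psi> 0 x = x"
  shows "flow X \<psi>"
  unfolding is_flow_def
proof (intro conjI allI ballI)
  show "\<psi> 0 = id" using \<psi>(2) by auto
  show "curve X UNIV (\<lambda>t. \<psi> t x)" for x by (rule \<psi>(1))
  show "bij (\<psi> t)" for t
  proof (rule o_bij)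
    show "\<psi> (- t) \<circ> \<psi> t = id" using curve_flow_add[OF X \<psi>, of "- t" t] \<psi>(2) by auto
    show "\<psi> t \<circ> \<psi> (- t) = id" using curve_flow_add[OF X \<psi>, of t "- t"] \<psi>(2) by auto
  qed
qed

lemma integral_curve_subset:
  assumes "integral_curve A X T \<gamma>" "S \<subseteq> T"
  shows "integral_curve A X S \<gamma>"
  unfolding integral_curve_def
proof (intro conjI ballI allI impI)
  show "continuous_on S \<gamma>" using assms continuous_on_subset unfolding integral_curve_def by blast
  fix t i assume "t \<in> S" "\<gamma> t \<in> Cd i"
  then have "((cm i \<circ> \<gamma>) has_vector_derivative X t i (\<gamma> t)) (at t within T)"
    using assms unfolding integral_curve_def by blast
  then show "((cm i \<circ> \<gamma>) has_vector_derivative X t i (\<gamma> t)) (at t within S)"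
    by (rule has_vector_derivative_within_subset[OF _ assms(2)])
qed

context
  fixes X \<psi>
  assumes X: "vector_field X" and \<psi>: "flow X \<psi>"
begin

text \<open>Uniqueness identifies the given flow, near \<open>p\<close> and for short times, with
  the smooth local flow in a chart.\<close>

lemma flow_local:
  assumes p: "p \<in> Cd j"
  shows "\<exists>\<delta> W y. 0 < \<delta> \<and> open W \<and> p \<in> W \<and> W \<subseteq> Cd j \<and> open (cm j ` W) \<and>
    smooth_on y (cm j ` W \<times> {-\<delta><..<\<delta>}) \<and>
    (\<forall>q\<in>W. \<forall>t. \<bar>t\<bar> < \<delta> \<longrightarrow> y (cm j q, t) \<in> Cr j \<and> \<psi> t q = ci j (y (cm j q, t))) \<and>
    (\<forall>v. ((\<lambda>t. frechet_derivative y (at (cm j p, t)) (v, 0)) has_vector_derivative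
        frechet_derivative (\<lambda>x. X j (ci j x)) (at (cm j p)) v) (at 0))"
proof -
  obtain \<delta> W y where \<delta>: "0 < \<delta>" and W: "open W" "p \<in> W" "W \<subseteq> Cd j" "open (cm j ` W)"
    and ys: "smooth_on y (cm j ` W \<times> {-\<delta><..<\<delta>})"
    and y: "\<forall>q\<in>W. y (cm j q, 0) = cm j q \<and> (\<forall>t. \<bar>t\<bar> < \<delta> \<longrightarrow> y (cm j q, t) \<in> Cr j) \<and>
      curve X {-\<delta><..<\<delta>} (\<lambda>t. ci j (y (cm j q, t))) \<and>
      (\<forall>v. ((\<lambda>t. frechet_derivative y (at (cm j q, t)) (v, 0)) has_vector_derivative
        frechet_derivative (\<lambda>x. X j (ci j x)) (at (cm j q)) v) (at 0))"
    using local_flow_manifold[OF X p] by (elim exE conjE) (rule that)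
  have "\<psi> t q = ci j (y (cm j q, t))" if q: "q \<in> W" and t: "\<bar>t\<bar> < \<delta>" for q t
  proof (rule integral_curve_unique[OF X open_greaterThanLessThan connected_Ioo])
    show "curve X {-\<delta><..<\<delta>} (\<lambda>t. \<psi> t q)"
      by (rule integral_curve_subset[OF flow_curve[OF \<psi>] subset_UNIV])
    show "curve X {-\<delta><..<\<delta>} (\<lambda>t. ci j (y (cm j q, t)))" using y q by blast
    have "q \<in> Cd j" using q W by blast
    then show "\<psi> 0 q = ci j (y (cm j q, 0))" using y q flow_0[OF \<psi>] by simp
  qed (use \<delta> t in auto)
  then show ?thesis
    using \<delta> W ys y by (intro exI[of _ \<delta>] exI[of _ W] exI[of _ y] conjI ballI allI impI) simp_all
qed

text \<open>The local flow is smooth for short times only. Smoothness is carried along the orbit: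
  for \<open>s\<close> close to \<open>t\<close>, the flow at nearby times is the local flow around
  \<open>\<psi> t (ci i x)\<close> after the map \<open>\<psi> s\<close>, so \<open>good\<close> is
  locally constant in time. The target chart obtained in this way need not be \<open>j\<close>, and
  a transition map corrects it at the end.\<close>

lemma flow_chart_smooth:
  assumes x: "x \<in> Cr i" and j: "\<psi> t (ci i x) \<in> Cd j"
  shows "\<exists>W. open W \<and> (x, t) \<in> W \<and> (\<forall>q\<in>W. fst q \<in> Cr i \<and> \<psi> (snd q) (ci i (fst q)) \<in> Cd j) \<and>
    smooth_on (\<lambda>q. cm j (\<psi> (snd q) (ci i (fst q)))) W"
proof -
  let ?R = "\<lambda>k q. cm k (\<psi> (snd q) (ci i (fst q)))"
  define good where "good t \<longleftrightarrow> (\<exists>k W. open W \<and> (x, t) \<in> W \<and>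
    (\<forall>q\<in>W. fst q \<in> Cr i \<and> \<psi> (snd q) (ci i (fst q)) \<in> Cd k) \<and> smooth_on (?R k) W)" for t
  have good0: "good 0"
  proof -
    obtain \<delta> W y where \<delta>: "0 < \<delta>" and W: "open W" "ci i x \<in> W" "W \<subseteq> Cd i" "open (cm i ` W)"
      and ys: "smooth_on y (cm i ` W \<times> {-\<delta><..<\<delta>})"
      and y: "\<forall>q\<in>W. \<forall>t. \<bar>t\<bar> < \<delta> \<longrightarrow> y (cm i q, t) \<in> Cr i \<and> \<psi> t q = ci i (y (cm i q, t))"
      using flow_local[OF ci_in[OF x]] by (elim exE conjE) (rule that)
    let ?V = "cm i ` W \<times> {-\<delta><..<\<delta>}"
    have V: "fst q \<in> Cr i \<and> y q \<in> Cr i \<and> \<psi> (snd q) (ci i (fst q)) = ci i (y q)" if q: "q \<in> ?V" for q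
    proof -
      obtain z t where zt: "z \<in> W" "\<bar>t\<bar> < \<delta>" "q = (cm i z, t)" using q by auto
      then have "z \<in> Cd i" using W by blast
      then show ?thesis using zt(3) y[rule_format, OF zt(1,2)] by simp
    qed
    have "(x, 0) \<in> ?V" using W(2) \<delta> x by (auto intro!: image_eqI[of _ _ "ci i x"])
    moreover have "open ?V" using W(4) by (intro open_Times) auto
    moreover have "smooth_on (?R i) ?V"
      by (rule smooth_on_cong[OF \<open>open ?V\<close> _ ys]) (simp add: V)
    ultimately show ?thesis unfolding good_def
      using V by (intro exI[of _ i] exI[of _ ?V]) simp
  qed
  have step: "\<exists>e>0. \<forall>s s'. \<bar>s - t\<bar> < e \<longrightarrow> \<bar>s' - t\<bar> < e \<longrightarrow> good s \<longrightarrow> good s'" for t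
  proof -
    obtain j where j: "\<psi> t (ci i x) \<in> Cd j" using ex_chart by blast
    obtain \<delta> W y where \<delta>: "0 < \<delta>" and W: "open W" "\<psi> t (ci i x) \<in> W" "W \<subseteq> Cd j" "open (cm j ` W)"
      and ys: "smooth_on y (cm j ` W \<times> {-\<delta><..<\<delta>})"
      and y: "\<forall>q\<in>W. \<forall>t. \<bar>t\<bar> < \<delta> \<longrightarrow> y (cm j q, t) \<in> Cr j \<and> \<psi> t q = ci j (y (cm j q, t))"
      using flow_local[OF j] by (elim exE conjE) (rule that)
    have "continuous_on UNIV (\<lambda>t. \<psi> t (ci i x))"
      using flow_curve[OF \<psi>] unfolding integral_curve_def by blast
    then have "open ((\<lambda>t. \<psi> t (ci i x)) -` W)" using W(1) by (rule open_vimage[rotated])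
    then obtain e where e: "0 < e" "ball t e \<subseteq> (\<lambda>t. \<psi> t (ci i x)) -` W"
      using W(2) open_contains_ball by (metis vimageI2)
    \<comment> \<open>\<open>e\<close> keeps the orbit inside \<open>W\<close>, and
      \<open>\<delta> / 2\<close> puts any two admissible times within \<delta> of each
      other.\<close>
    define \<eta> where "\<eta> = min e (\<delta> / 2)"
    have "good s'" if s: "\<bar>s - t\<bar> < \<eta>" "\<bar>s' - t\<bar> < \<eta>" "good s" for s s'
    proof -
      obtain k V where V: "open V" "(x, s) \<in> V" "\<forall>q\<in>V. fst q \<in> Cr i \<and> \<psi> (snd q) (ci i (fst q)) \<in> Cd k"
        "smooth_on (?R k) V" using s(3) unfolding good_def by blast
      define Vs where "Vs = (\<lambda>z. (z, s)) -` V"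
      have Vs: "open Vs" unfolding Vs_def by (rule open_vimage[OF V(1)]) (intro continuous_intros)
      define G where "G z = cm k (\<psi> s (ci i z))" for z
      have "smooth_on (\<lambda>z. (z, s)) Vs"
        by (rule smooth_on_Pair[OF Vs smooth_on_bounded_linear[OF Vs bounded_linear_ident] smooth_on_const[OF Vs]])
      from smooth_on_compose[OF Vs V(1) _ this V(4)]
      have "smooth_on (\<lambda>z. ?R k (z, s)) Vs" by (simp add: Vs_def)
      then have G: "smooth_on G Vs" by (simp only: G_def[abs_def] fst_conv snd_conv)
      have Gk: "z \<in> Cr i" "\<psi> s (ci i z) \<in> Cd k" "ci k (G z) = \<psi> s (ci i z)" if "z \<in> Vs" for z
        using V(3) that by (auto simp: Vs_def G_def)
      define V1 where "V1 = {z \<in> Vs. \<psi> s (ci i z) \<in> W}"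
      have "open (Vs \<inter> G -` {x \<in> Cr k. ci k x \<in> W})"
        by (rule continuous_open_preimage[OF smooth_on_imp_continuous_on[OF G] Vs open_ci_vimage[OF W(1)]])
      moreover have "G z \<in> {x \<in> Cr k. ci k x \<in> W} \<longleftrightarrow> \<psi> s (ci i z) \<in> W" if "z \<in> Vs" for z
        using Gk[OF that] by (simp add: G_def)
      then have "Vs \<inter> G -` {x \<in> Cr k. ci k x \<in> W} = V1" unfolding V1_def by blast
      ultimately have V1: "open V1" by simp
      have subV1: "V1 \<subseteq> Vs" by (auto simp: V1_def)
      have "(cm j \<circ> ci k) (G z) = cm j (\<psi> s (ci i z))" if "z \<in> V1" for z
        using Gk subV1 that by auto
      have \<tau>: "smooth_on (\<lambda>z. cm j (\<psi> s (ci i z))) V1"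
      proof -
        have "smooth_on (\<lambda>z. (cm j \<circ> ci k) (G z)) V1"
        proof (rule smooth_on_compose[OF V1 open_overlap _ smooth_on_subset[OF G subV1] transition_smooth])
          show "G z \<in> cm k ` (Cd k \<inter> Cd j)" if "z \<in> V1" for z
            using Gk(2)[of z] that W(3) by (auto simp: V1_def G_def)
        qed
        then show ?thesis
          by (rule smooth_on_cong[OF V1, rotated]) (use Gk(3) subV1 in auto)
      qed
      let ?W = "V1 \<times> {s - \<delta><..<s + \<delta>}"
      have oW: "open ?W" using V1 by (intro open_Times) auto
      have eq: "\<psi> (snd q) (ci i (fst q)) = ci j (y (cm j (\<psi> s (ci i (fst q))), snd q - s)) \<and>
          y (cm j (\<psi> s (ci i (fst q))), snd q - s) \<in> Cr j" if q: "q \<in> ?W" for q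
      proof -
        have 1: "\<psi> s (ci i (fst q)) \<in> W" using q by (auto simp: V1_def)
        have 2: "\<bar>snd q - s\<bar> < \<delta>" using q by auto
        have "\<psi> (snd q) (ci i (fst q)) = \<psi> (snd q - s) (\<psi> s (ci i (fst q)))"
          using flow_add[OF X \<psi>, of "snd q - s" s "ci i (fst q)"] by simp
        then show ?thesis using y[rule_format, OF 1 2] by simp
      qed
      have "smooth_on (\<lambda>q. y (cm j (\<psi> s (ci i (fst q))), snd q - s)) ?W"
      proof (rule smooth_on_compose[OF oW _ _ _ ys])
        show "open (cm j ` W \<times> {- \<delta><..<\<delta>})" using W(4) by (intro open_Times) auto
        show "(cm j (\<psi> s (ci i (fst q))), snd q - s) \<in> cm j ` W \<times> {- \<delta><..<\<delta>}" if "q \<in> ?W" for q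
          using that by (auto simp: V1_def)
        have "smooth_on (\<lambda>q::'e \<times> real. snd q + (- s)) ?W"
          by (rule smooth_on_add[OF oW smooth_on_bounded_linear[OF oW bounded_linear_snd] smooth_on_const[OF oW]])
        then have "smooth_on (\<lambda>q::'e \<times> real. snd q - s) ?W" by simp
        then show "smooth_on (\<lambda>q. (cm j (\<psi> s (ci i (fst q))), snd q - s)) ?W"
          by (rule smooth_on_Pair[OF oW smooth_on_fst_compose[OF V1 open_greaterThanLessThan \<tau>]])
      qed
      then have "smooth_on (?R j) ?W"
        by (rule smooth_on_cong[OF oW, rotated]) (simp add: eq del: mem_Sigma_iff)
      moreover have "(x, s') \<in> ?W"
      proof -
        have "t \<in> ball t e" "s \<in> ball t e" using s e(1) by (auto simp: \<eta>_def dist_real_def)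
        then have "\<psi> s (ci i x) \<in> W" using e(2) by auto
        moreover have "\<bar>s - t\<bar> < \<delta> / 2" "\<bar>s' - t\<bar> < \<delta> / 2" using s by (simp_all add: \<eta>_def)
        then have "s' \<in> {s - \<delta><..<s + \<delta>}" unfolding greaterThanLessThan_iff by linarith
        ultimately show ?thesis using V(2) by (simp add: V1_def Vs_def)
      qed
      moreover have "fst q \<in> Cr i \<and> \<psi> (snd q) (ci i (fst q)) \<in> Cd j" if q: "q \<in> ?W" for q
      proof -
        have "fst q \<in> Vs" using q subV1 by auto
        then show ?thesis using eq[OF q] Gk(1) by simp
      qed
      ultimately show ?thesis unfolding good_def using oW by blast
    qed
    moreover have "0 < \<eta>" using e \<delta> by (simp add: \<eta>_def)
    ultimately show ?thesis by blast
  qed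
  have "good t" by (rule connected_UNIV_real_induct[of good, OF good0 step])
  then obtain k W where W: "open W" "(x, t) \<in> W" "\<forall>q\<in>W. fst q \<in> Cr i \<and> \<psi> (snd q) (ci i (fst q)) \<in> Cd k"
    and s: "smooth_on (?R k) W" unfolding good_def by blast
  let ?O = "cm k ` (Cd k \<inter> Cd j)"
  let ?W = "W \<inter> ?R k -` ?O"
  have oW: "open ?W"
    by (rule continuous_open_preimage[OF smooth_on_imp_continuous_on[OF s] W(1) open_overlap])
  have in_W: "fst q \<in> Cr i \<and> \<psi> (snd q) (ci i (fst q)) \<in> Cd k \<and> \<psi> (snd q) (ci i (fst q)) \<in> Cd j" if "q \<in> ?W" for q
  proof -
    have q: "fst q \<in> Cr i" "\<psi> (snd q) (ci i (fst q)) \<in> Cd k" using W(3) that by auto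
    have "?R k q \<in> ?O" using that by simp
    then obtain p where p: "?R k q = cm k p" "p \<in> Cd k \<inter> Cd j" by (rule imageE)
    then have "p = \<psi> (snd q) (ci i (fst q))" using q(2) ci_cm[of p k] ci_cm[OF q(2)] by simp
    then show ?thesis using q p(2) by simp
  qed
  have "smooth_on (\<lambda>q. (cm j \<circ> ci k) (?R k q)) ?W"
    by (rule smooth_on_compose[OF oW open_overlap _ smooth_on_subset[OF s Int_lower1] transition_smooth]) simp
  then have "smooth_on (?R j) ?W"
  proof (rule smooth_on_cong[OF oW, rotated])
    fix q assume "q \<in> ?W"
    from in_W[OF this] show "(cm j \<circ> ci k) (?R k q) = ?R j q" by simp
  qed
  moreover have "(x, t) \<in> ?W" using W(2) bspec[OF W(3,2)] j by simp
  moreover have "\<forall>q\<in>?W. fst q \<in> Cr i \<and> \<psi> (snd q) (ci i (fst q)) \<in> Cd j" using in_W by blast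
  ultimately show ?thesis using oW by (intro exI[of _ ?W] conjI)
qed

lemma flow_continuous: "continuous_on UNIV (\<lambda>q. \<psi> (snd q) (fst q))"
proof -
  have "isCont (\<lambda>q. \<psi> (snd q) (fst q)) q0" for q0
  proof -
    obtain p t where q0: "q0 = (p, t)" by (cases q0)
    obtain i where i: "p \<in> Cd i" using ex_chart by blast
    obtain j where j: "\<psi> t p \<in> Cd j" using ex_chart by blast
    have "\<psi> t (ci i (cm i p)) \<in> Cd j" using i j by simp
    from flow_chart_smooth[OF cm_in[OF i] this] obtain W where W: "open W" "(cm i p, t) \<in> W"
      "\<forall>q\<in>W. fst q \<in> Cr i \<and> \<psi> (snd q) (ci i (fst q)) \<in> Cd j"
      and s: "smooth_on (\<lambda>q. cm j (\<psi> (snd q) (ci i (fst q)))) W" by blast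
    let ?m = "\<lambda>q. (cm i (fst q), snd q)"
    have cm': "continuous_on (Cd i \<times> UNIV) ?m"
      by (intro continuous_intros continuous_on_compose2[OF continuous_on_cm]) auto
    define N where "N = (Cd i \<times> UNIV) \<inter> ?m -` W"
    have NW: "ci i (fst (?m q)) = fst q \<and> \<psi> (snd (?m q)) (fst q) \<in> Cd j" if "q \<in> N" for q
    proof -
      have "?m q \<in> W" "fst q \<in> Cd i" using that by (auto simp: N_def)
      from bspec[OF W(3) this(1)] this(2) show ?thesis by simp
    qed
    have N: "open N" unfolding N_def
      by (rule continuous_open_preimage[OF cm' _ W(1)]) (intro open_Times open_Cd open_UNIV)
    have c1: "continuous_on N (\<lambda>q. cm j (\<psi> (snd (?m q)) (ci i (fst (?m q)))))"
      by (rule continuous_on_compose2[OF smooth_on_imp_continuous_on[OF s] continuous_on_subset[OF cm']]) (auto simp: N_def)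
    have "continuous_on N (\<lambda>q. ci j (cm j (\<psi> (snd (?m q)) (ci i (fst (?m q))))))"
      by (rule continuous_on_compose2[OF continuous_on_ci c1]) (rule image_subsetI, use NW in simp)
    then have "continuous_on N (\<lambda>q. \<psi> (snd q) (fst q))"
    proof (rule continuous_on_eq)
      fix q assume "q \<in> N"
      from NW[OF this] show "ci j (cm j (\<psi> (snd (?m q)) (ci i (fst (?m q))))) = \<psi> (snd q) (fst q)" by simp
    qed
    moreover have "q0 \<in> N" using W(2) i by (simp add: N_def q0)
    ultimately show ?thesis using N by (simp add: continuous_on_eq_continuous_at)
  qed
  then show ?thesis by (simp add: continuous_at_imp_continuous_on)
qed

lemma flow_continuous_on: "continuous_on S (\<psi> t)"
proof -
  have "continuous_on UNIV (\<lambda>p. \<psi> (snd (p, t)) (fst (p, t)))"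
    by (rule continuous_on_compose2[OF flow_continuous]) (auto intro!: continuous_intros)
  then have "continuous_on UNIV (\<psi> t)" by simp
  then show ?thesis by (rule continuous_on_subset) simp
qed

text \<open>The differential of the diffeomorphism \<open>\<psi> t\<close> at \<open>p\<close>, read
  in chart \<open>i\<close> at \<open>p\<close> and chart \<open>j\<close> at the image.\<close>

definition dflow :: "'i \<Rightarrow> 'i \<Rightarrow> real \<Rightarrow> 'a \<Rightarrow> 'e \<Rightarrow> 'e" where
  "dflow i j t p = frechet_derivative (\<lambda>z. cm j (\<psi> t (ci i z))) (at (cm i p))"

lemma dflow_has_derivative:
  assumes i: "p \<in> Cd i" and j: "\<psi> t p \<in> Cd j"
  shows "((\<lambda>z. cm j (\<psi> t (ci i z))) has_derivative dflow i j t p) (at (cm i p))"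
proof -
  have "\<psi> t (ci i (cm i p)) \<in> Cd j" using i j by simp
  from flow_chart_smooth[OF cm_in[OF i] this] obtain W where W: "open W" "(cm i p, t) \<in> W"
    and s: "smooth_on (\<lambda>q. cm j (\<psi> (snd q) (ci i (fst q)))) W" by blast
  have d: "((\<lambda>q. cm j (\<psi> (snd q) (ci i (fst q)))) has_derivative
      frechet_derivative (\<lambda>q. cm j (\<psi> (snd q) (ci i (fst q)))) (at (cm i p, t))) (at (cm i p, t))"
    by (rule smooth_on_has_derivative[OF s W(2)])
  have "((\<lambda>z. (z, t)) has_derivative (\<lambda>v. (v, 0))) (at (cm i p))"
    by (auto intro!: derivative_eq_intros)
  from has_derivative_compose[OF this d]
  have "(\<lambda>z. cm j (\<psi> t (ci i z))) differentiable (at (cm i p))"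
    unfolding differentiable_def fst_conv snd_conv by blast
  then show ?thesis unfolding dflow_def by (simp only: frechet_derivative_works)
qed

lemma dflow_linear: "p \<in> Cd i \<Longrightarrow> \<psi> t p \<in> Cd j \<Longrightarrow> linear (dflow i j t p)"
  using dflow_has_derivative has_derivative_linear by blast

lemma dflow_0: "dflow i j 0 p = tchange A i j p"
  unfolding dflow_def tchange_def o_def flow_0[OF \<psi>] ..

lemma flow_vimage_open: "open S \<Longrightarrow> open {z \<in> Cr i. \<psi> t (ci i z) \<in> S}"
proof -
  assume S: "open S"
  have "open {z \<in> Cr i. ci i z \<in> \<psi> t -` S}"
    by (rule open_ci_vimage[OF open_vimage[OF S flow_continuous_on]])
  then show ?thesis by simp
qed

lemma dflow_compose:
  assumes i: "p \<in> Cd i" and j: "\<psi> t p \<in> Cd j" and k: "\<psi> (s + t) p \<in> Cd k"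
  shows "dflow i k (s + t) p v = dflow j k s (\<psi> t p) (dflow i j t p v)"
proof -
  have k': "\<psi> s (\<psi> t p) \<in> Cd k" using k flow_add[OF X \<psi>] by simp
  have "((\<lambda>z. cm k (\<psi> s (ci j z))) has_derivative dflow j k s (\<psi> t p)) (at (cm j (\<psi> t (ci i (cm i p)))))"
    using dflow_has_derivative[OF j k'] i by simp
  from has_derivative_compose[OF dflow_has_derivative[OF i j] this]
  have "((\<lambda>z. cm k (\<psi> (s + t) (ci i z))) has_derivative (\<lambda>v. dflow j k s (\<psi> t p) (dflow i j t p v))) (at (cm i p))"
    by (rule has_derivative_transform_within_open[OF _ flow_vimage_open[OF open_Cd[of j], of i t]])
      (use i j flow_add[OF X \<psi>] in auto)
  from has_derivative_unique[OF dflow_has_derivative[OF i k] this] show ?thesis by metis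
qed

lemma flow_chart_derivative:
  assumes j: "\<psi> t p \<in> Cd j"
  shows "((\<lambda>t. cm j (\<psi> t p)) has_vector_derivative X j (\<psi> t p)) (at t)"
  using flow_curve[OF \<psi>, of p] j unfolding integral_curve_def o_def by simp

text \<open>A flow carries its generator to itself: both sides are the derivative at
  \<open>s = 0\<close> of \<open>\<psi> (t + s) p\<close>, written once as
  \<open>\<psi> t (\<psi> s p)\<close>.\<close>

lemma dflow_field:
  assumes i: "p \<in> Cd i" and j: "\<psi> t p \<in> Cd j"
  shows "dflow i j t p (X i p) = X j (\<psi> t p)"
proof -
  have i0: "\<psi> 0 p \<in> Cd i" using i flow_0[OF \<psi>] by simp
  have "((\<lambda>s. cm i (\<psi> s p)) has_vector_derivative X i (\<psi> 0 p)) (at 0)"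
    by (rule flow_chart_derivative[OF i0])
  then have 1: "((\<lambda>s. cm i (\<psi> s p)) has_vector_derivative X i p) (at 0)"
    by (simp only: flow_0[OF \<psi>])
  have 2: "((\<lambda>z. cm j (\<psi> t (ci i z))) has_derivative dflow i j t p) (at (cm i (\<psi> 0 p)))"
    using dflow_has_derivative[OF i j] by (simp only: flow_0[OF \<psi>])
  have d: "((\<lambda>s. cm j (\<psi> t (ci i (cm i (\<psi> s p))))) has_vector_derivative dflow i j t p (X i p)) (at 0)"
    using vector_derivative_diff_chain_within[of "\<lambda>s. cm i (\<psi> s p)" _ 0 UNIV, OF 1 has_derivative_at_withinI[OF 2]]
    by (simp only: o_def)
  have c: "continuous_on UNIV (\<lambda>s. \<psi> s p)"
    using flow_curve[OF \<psi>] unfolding integral_curve_def by blast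
  have "((\<lambda>s. cm j (\<psi> (t + s) p)) has_vector_derivative dflow i j t p (X i p)) (at 0)"
  proof (rule has_vector_derivative_transform_within_open[OF d open_vimage[OF open_Cd[of i] c]])
    show "0 \<in> (\<lambda>s. \<psi> s p) -` Cd i" using i0 by simp
    show "cm j (\<psi> t (ci i (cm i (\<psi> s p)))) = cm j (\<psi> (t + s) p)" if "s \<in> (\<lambda>s. \<psi> s p) -` Cd i" for s
      using that flow_add[OF X \<psi>, of t s p] by simp
  qed
  moreover have "((\<lambda>s. cm j (\<psi> (t + s) p)) has_vector_derivative X j (\<psi> t p)) (at 0)"
    using flow_chart_derivative[OF j] has_vector_derivative_shift[of "\<lambda>t. cm j (\<psi> t p)" t _ 0] by simp
  ultimately show ?thesis by (rule vector_derivative_unique_at)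
qed

text \<open>The variational equation at time \<open>0\<close>, carried over from the local flow to
  the manifold.\<close>

lemma dflow_time_derivative:
  assumes j: "p \<in> Cd j"
  shows "((\<lambda>s. dflow j j s p v) has_vector_derivative frechet_derivative (\<lambda>x. X j (ci j x)) (at (cm j p)) v) (at 0)"
proof -
  obtain \<delta> W y where \<delta>: "0 < \<delta>" and W: "open W" "p \<in> W" "W \<subseteq> Cd j" "open (cm j ` W)"
    and ys: "smooth_on y (cm j ` W \<times> {-\<delta><..<\<delta>})"
    and y: "\<forall>q\<in>W. \<forall>t. \<bar>t\<bar> < \<delta> \<longrightarrow> y (cm j q, t) \<in> Cr j \<and> \<psi> t q = ci j (y (cm j q, t))"
    and y': "\<forall>v. ((\<lambda>t. frechet_derivative y (at (cm j p, t)) (v, 0)) has_vector_derivative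
        frechet_derivative (\<lambda>x. X j (ci j x)) (at (cm j p)) v) (at 0)"
    using flow_local[OF j] by (elim exE conjE) (rule that)
  have "frechet_derivative y (at (cm j p, s)) (v, 0) = dflow j j s p v" if s: "s \<in> {-\<delta><..<\<delta>}" for s
  proof -
    have s': "\<bar>s\<bar> < \<delta>" using s by auto
    have d: "(y has_derivative frechet_derivative y (at (cm j p, s))) (at (cm j p, s))"
      by (rule smooth_on_has_derivative[OF ys]) (use W s in auto)
    have "((\<lambda>z. (z, s)) has_derivative (\<lambda>v. (v, 0))) (at (cm j p))"
      by (auto intro!: derivative_eq_intros)
    from has_derivative_compose[OF this d]
    have d1: "((\<lambda>z. y (z, s)) has_derivative (\<lambda>v. frechet_derivative y (at (cm j p, s)) (v, 0))) (at (cm j p))" .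
    have "((\<lambda>z. cm j (\<psi> s (ci j z))) has_derivative (\<lambda>v. frechet_derivative y (at (cm j p, s)) (v, 0))) (at (cm j p))"
    proof (rule has_derivative_transform_within_open[OF d1 W(4)])
      show "cm j p \<in> cm j ` W" using W(2) by simp
      fix z assume "z \<in> cm j ` W"
      then obtain q where q: "q \<in> W" "z = cm j q" by blast
      then have "q \<in> Cd j" using W(3) by blast
      then show "y (z, s) = cm j (\<psi> s (ci j z))" using y[rule_format, OF q(1) s'] q(2) by simp
    qed
    from frechet_derivative_eq[OF this] show ?thesis unfolding dflow_def by simp
  qed
  from has_vector_derivative_transform_within_open[OF spec[OF y', of v] open_greaterThanLessThan[of "-\<delta>" \<delta>] _ this]
  show ?thesis using \<delta> by simp
qed

end

end

section \<open>Completeness of vector fields\<close>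

lemma image_shift_Ioo: "(\<lambda>t. t - a) ` {l<..<u} = {l - a<..<u - (a::real)}"
proof (intro set_eqI iffI)
  fix x assume "x \<in> {l - a<..<u - a}"
  then have "x + a \<in> {l<..<u}" by auto
  then show "x \<in> (\<lambda>t. t - a) ` {l<..<u}" by (rule rev_image_eqI) simp
qed auto

context smooth_manifold
begin

lemma curve_local:
  assumes "\<And>t. \<exists>e>0. \<exists>c. curve X {t - e<..<t + e} c \<and> (\<forall>s\<in>{t - e<..<t + e}. \<gamma> s = c s)"
  shows "curve X UNIV \<gamma>"
  unfolding integral_curve_def
proof (intro conjI ballI allI impI)
  have *: "isCont \<gamma> t \<and> (\<forall>i. \<gamma> t \<in> Cd i \<longrightarrow> ((cm i \<circ> \<gamma>) has_vector_derivative X i (\<gamma> t)) (at t))" for t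
  proof -
    obtain e c where e: "0 < e" and c: "curve X {t - e<..<t + e} c" and eq: "\<forall>s\<in>{t - e<..<t + e}. \<gamma> s = c s"
      using assms[of t] by blast
    have t: "t \<in> {t - e<..<t + e}" using e by simp
    have o: "open {t - e<..<t + e}" by simp
    have "continuous_on {t - e<..<t + e} \<gamma>"
      using c eq unfolding integral_curve_def by (metis continuous_on_cong)
    then have "isCont \<gamma> t" using continuous_on_eq_continuous_at[OF o] t by blast
    moreover have "((cm i \<circ> \<gamma>) has_vector_derivative X i (\<gamma> t)) (at t)" if i: "\<gamma> t \<in> Cd i" for i
    proof -
      have ct: "c t = \<gamma> t" using eq t by simp
      have "((cm i \<circ> c) has_vector_derivative X i (c t)) (at t within {t - e<..<t + e})"
      proof -
        have "\<forall>i. c t \<in> Cd i \<longrightarrow> ((cm i \<circ> c) has_vector_derivative X i (c t)) (at t within {t - e<..<t + e})"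
          using c t unfolding integral_curve_def by blast
        then show ?thesis using i ct by simp
      qed
      then have "((cm i \<circ> c) has_vector_derivative X i (\<gamma> t)) (at t)"
        unfolding ct at_within_open[OF t o] .
      then show ?thesis
        by (rule has_vector_derivative_transform_within_open[OF _ o t]) (use eq in simp)
    qed
    ultimately show ?thesis by blast
  qed
  show "continuous_on UNIV \<gamma>" using * by (simp add: continuous_at_imp_continuous_on)
  show "((cm i \<circ> \<gamma>) has_vector_derivative X i (\<gamma> t)) (at t within UNIV)" if "\<gamma> t \<in> Cd i" for t i
    using * that by blast
qed

text \<open>Curves of a fixed length are glued along the multiples of
  \<open>h = \<delta> / 2\<close>. Neighbouring pieces overlap and agree there by uniqueness, so the
  glued curve is an integral curve around the grid times as well.\<close>

lemma uniform_time_imp_flow: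
  assumes X: "vector_field X" and \<delta>: "0 < \<delta>"
    and ex: "\<And>p. \<exists>\<gamma>. \<gamma> 0 = p \<and> curve X {-\<delta><..<\<delta>} \<gamma>"
  shows "\<exists>\<psi>. flow X \<psi>"
proof -
  obtain F where F0: "\<And>p. F p 0 = p" and F: "\<And>p. curve X {-\<delta><..<\<delta>} (F p)"
    using ex by metis
  define h where "h = \<delta> / 2"
  have h: "0 < h" "h < \<delta>" using \<delta> by (auto simp: h_def)
  have overlap: "F p (s + a) = F (F p a) s" if a: "\<bar>a\<bar> < \<delta>" and s: "\<bar>s\<bar> < \<delta>" "\<bar>s + a\<bar> < \<delta>" for p s a
  proof -
    let ?T = "{-\<delta><..<\<delta>} \<inter> {-\<delta> - a<..<\<delta> - a}"
    have sh: "curve X {-\<delta> - a<..<\<delta> - a} (\<lambda>t. F p (t + a))"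
      using integral_curve_shift[OF F[of p], of a] by (simp only: image_shift_Ioo)
    have T: "open ?T" "connected ?T"
      by (auto intro!: convex_connected convex_Int)
    show ?thesis
      by (rule integral_curve_unique[OF X T integral_curve_subset[OF sh] integral_curve_subset[OF F], of 0])
        (use a s \<delta> in \<open>auto simp: F0\<close>)
  qed
  define G where "G p = F p h" for p
  define G' where "G' p = F p (- h)" for p
  have GG': "G (G' p) = p" for p
    using overlap[of "- h" h p] h by (simp add: G_def G'_def F0)
  have "\<exists>\<gamma>. curve X UNIV \<gamma> \<and> \<gamma> 0 = p" for p
  proof -
    \<comment> \<open>Positions at the times \<open>k * h\<close>: forward by \<open>G\<close>,
      backward by its right inverse \<open>G'\<close>.\<close>
    define P where "P k = (if 0 \<le> k then (G ^^ nat k) p else (G' ^^ nat (- k)) p)" for k :: int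
    have PS: "P (k + 1) = G (P k)" for k
    proof (cases "0 \<le> k")
      case True
      then show ?thesis by (simp add: P_def nat_add_distrib)
    next
      case False
      then have "nat (- k) = Suc (nat (- (k + 1)))" by simp
      then have "G (P k) = (G' ^^ nat (- (k + 1))) p" using False GG' by (simp add: P_def)
      then show ?thesis using False by (cases "k = -1") (auto simp: P_def)
    qed
    define K where "K t = \<lfloor>t / h\<rfloor>" for t
    have K: "of_int (K t) * h \<le> t" "t < of_int (K t) * h + h" for t
    proof -
      have "of_int (K t) \<le> t / h" "t / h < of_int (K t) + 1" unfolding K_def by linarith+
      then show "of_int (K t) * h \<le> t" "t < of_int (K t) * h + h" using h by (simp_all add: field_simps)
    qed
    define \<gamma> where "\<gamma> t = F (P (K t)) (t - of_int (K t) * h)" for t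
    \<comment> \<open>The piece based at \<open>P k\<close> serves on both sides of its grid time,
      not only on its own cell; \<open>curve_local\<close> relies on this.\<close>
    have \<gamma>: "\<gamma> t = F (P k) (t - of_int k * h)" if t: "\<bar>t - of_int k * h\<bar> < h" for t k
    proof -
      have "\<bar>of_int (K t) * h - of_int k * h\<bar> < 1 * h + h"
        using K[of t] t by linarith
      then have "of_int (K t) * h < (of_int k + 1) * h" "(of_int k - 2) * h < of_int (K t) * h"
        using K[of t] t by (simp_all add: algebra_simps)
      then have "of_int (K t) < (of_int k + 1 :: real)" "(of_int k - 2 :: real) < of_int (K t)"
        using h mult_less_cancel_right_pos by blast+
      then have "K t = k \<or> k = K t + 1" by linarith
      then show ?thesis
      proof
        assume k: "k = K t + 1"
        have "F (P (K t)) ((t - of_int k * h) + h) = F (F (P (K t)) h) (t - of_int k * h)"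
          by (rule overlap) (use h t K[of t] in \<open>auto simp: k algebra_simps\<close>)
        moreover have "F (P (K t)) h = P k" using PS[of "K t"] by (simp only: k G_def)
        moreover have "t - of_int k * h + h = t - of_int (K t) * h" by (simp add: k algebra_simps)
        ultimately show ?thesis by (simp only: \<gamma>_def)
      qed (simp add: \<gamma>_def)
    qed
    have "curve X UNIV \<gamma>"
    proof (rule curve_local)
      fix t
      define a where "a = of_int (K t) * h"
      have a: "a \<le> t" "t < a + h" using K[of t] by (auto simp: a_def)
      show "\<exists>e>0. \<exists>c. curve X {t - e<..<t + e} c \<and> (\<forall>s\<in>{t - e<..<t + e}. \<gamma> s = c s)"
      proof (intro exI[of _ "min (a + h - t) (t - a + h)"] exI[of _ "\<lambda>s. F (P (K t)) (s - a)"] conjI ballI)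
        let ?e = "min (a + h - t) (t - a + h)"
        show "0 < ?e" using a h by simp
        have "curve X {-\<delta> + a<..<\<delta> + a} (\<lambda>s. F (P (K t)) (s - a))"
          using integral_curve_shift[OF F[of "P (K t)"], of "- a", unfolded image_shift_Ioo]
          by (simp only: diff_minus_eq_add add_uminus_conv_diff)
        then show "curve X {t - ?e<..<t + ?e} (\<lambda>s. F (P (K t)) (s - a))"
          by (rule integral_curve_subset) (use h a in auto)
        show "\<gamma> s = F (P (K t)) (s - a)" if "s \<in> {t - ?e<..<t + ?e}" for s
          unfolding a_def by (rule \<gamma>) (use that a in \<open>auto simp: a_def[symmetric]\<close>)
      qed
    qed
    moreover have "\<gamma> 0 = p" using \<gamma>[of 0 0] h by (simp add: P_def F0)
    ultimately show ?thesis by blast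
  qed
  then obtain \<Gamma> where \<Gamma>: "\<And>p. curve X UNIV (\<Gamma> p) \<and> \<Gamma> p 0 = p" by metis
  have "flow X (\<lambda>t p. \<Gamma> p t)"
    by (rule flowI[OF X]) (simp_all add: \<Gamma>)
  then show ?thesis by blast
qed

text \<open>\<open>K'\<close> is what the unperturbed flow sweeps out of \<open>K\<close> in times
  between \<open>-1\<close> and \<open>1\<close>. An orbit starting outside \<open>K'\<close> stays
  off \<open>K\<close> for \<open>\<bar>t\<bar> < 1\<close> and there is a curve of both fields; on
  the compact set \<open>K'\<close> finitely many local existence times have a positive
  minimum.\<close>

lemma compact_perturbation_imp_flow:
  assumes X: "vector_field X" and \<psi>: "flow X \<psi>" and X': "vector_field X'"
    and K: "compact K" and eq: "\<And>p i. p \<notin> K \<Longrightarrow> p \<in> Cd i \<Longrightarrow> X' i p = X i p"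
  shows "\<exists>\<psi>'. flow X' \<psi>'"
proof -
  define K' where "K' = (\<lambda>q. \<psi> (snd q) (fst q)) ` (K \<times> {-1..1::real})"
  have K': "compact K'"
    unfolding K'_def
    by (intro compact_continuous_image compact_Times K compact_Icc continuous_on_subset[OF flow_continuous[OF X \<psi>]]) auto
  have "\<forall>p. \<exists>W \<delta>. 0 < \<delta> \<and> open W \<and> p \<in> W \<and> (\<forall>q\<in>W. \<exists>\<gamma>. \<gamma> 0 = q \<and> curve X' {-\<delta><..<\<delta>} \<gamma>)"
  proof
    fix p
    obtain i where i: "p \<in> Cd i" using ex_chart by blast
    obtain \<delta> W y where \<delta>: "0 < \<delta>" and W: "open W" "p \<in> W" "W \<subseteq> Cd i"
      and y: "\<forall>q\<in>W. y (cm i q, 0) = cm i q \<and> (\<forall>t. \<bar>t\<bar> < \<delta> \<longrightarrow> y (cm i q, t) \<in> Cr i) \<and>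
      curve X' {-\<delta><..<\<delta>} (\<lambda>t. ci i (y (cm i q, t))) \<and>
      (\<forall>v. ((\<lambda>t. frechet_derivative y (at (cm i q, t)) (v, 0)) has_vector_derivative
        frechet_derivative (\<lambda>x. X' i (ci i x)) (at (cm i q)) v) (at 0))"
      using local_flow_manifold[OF X' i] by (elim exE conjE) (rule that)
    have "\<exists>\<gamma>. \<gamma> 0 = q \<and> curve X' {-\<delta><..<\<delta>} \<gamma>" if q: "q \<in> W" for q
    proof (intro exI[of _ "\<lambda>t. ci i (y (cm i q, t))"] conjI)
      have "q \<in> Cd i" using q W by blast
      then show "ci i (y (cm i q, 0)) = q" using y q by simp
      show "curve X' {-\<delta><..<\<delta>} (\<lambda>t. ci i (y (cm i q, t)))" using y q by blast
    qed
    then show "\<exists>W \<delta>. 0 < \<delta> \<and> open W \<and> p \<in> W \<and> (\<forall>q\<in>W. \<exists>\<gamma>. \<gamma> 0 = q \<and> curve X' {-\<delta><..<\<delta>} \<gamma>)"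
      using \<delta> W by blast
  qed
  then obtain W \<Delta> where W: "\<And>p. open (W p)" "\<And>p. p \<in> W p" and \<Delta>: "\<And>p. 0 < \<Delta> p"
    and ex: "\<And>p q. q \<in> W p \<Longrightarrow> \<exists>\<gamma>. \<gamma> 0 = q \<and> curve X' {-\<Delta> p<..<\<Delta> p} \<gamma>"
    by (metis (no_types, lifting))
  obtain D where D: "D \<subseteq> K'" "finite D" "K' \<subseteq> (\<Union>p\<in>D. W p)"
    using compactE_image[OF K', of K' W] W by blast
  define \<delta> where "\<delta> = Min (insert 1 (\<Delta> ` D))"
  have \<delta>: "0 < \<delta>" "\<delta> \<le> 1" "\<And>p. p \<in> D \<Longrightarrow> \<delta> \<le> \<Delta> p" using D(2) \<Delta> by (auto simp: \<delta>_def)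
  show ?thesis
  proof (rule uniform_time_imp_flow[OF X' \<delta>(1)])
    fix q
    show "\<exists>\<gamma>. \<gamma> 0 = q \<and> curve X' {-\<delta><..<\<delta>} \<gamma>"
    proof (cases "q \<in> K'")
      case True
      then obtain p where p: "p \<in> D" "q \<in> W p" using D by blast
      obtain \<gamma> where \<gamma>: "\<gamma> 0 = q" "curve X' {-\<Delta> p<..<\<Delta> p} \<gamma>" using ex[OF p(2)] by blast
      have "{-\<delta><..<\<delta>} \<subseteq> {-\<Delta> p<..<\<Delta> p}" using \<delta>(3)[OF p(1)] by auto
      from integral_curve_subset[OF \<gamma>(2) this] \<gamma>(1) show ?thesis by blast
    next
      case False
      have nK: "\<psi> t q \<notin> K" if "t \<in> {-\<delta><..<\<delta>}" for t
      proof
        assume "\<psi> t q \<in> K"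
        moreover have "- t \<in> {-1..1}" using that \<delta> by auto
        ultimately have "\<psi> (- t) (\<psi> t q) \<in> K'" unfolding K'_def by force
        then show False using False flow_add[OF X \<psi>, of "- t" t q] flow_0[OF \<psi>] by simp
      qed
      have "curve X {-\<delta><..<\<delta>} (\<lambda>t. \<psi> t q)"
        by (rule integral_curve_subset[OF flow_curve[OF \<psi>] subset_UNIV])
      then have "curve X' {-\<delta><..<\<delta>} (\<lambda>t. \<psi> t q)"
        unfolding integral_curve_def using eq[OF nK] by simp
      then show ?thesis
        by (intro exI[of _ "\<lambda>t. \<psi> t q"] conjI flow_0[OF \<psi>])
    qed
  qed
qed

end

section \<open>Forms and locally Hamiltonian flows\<close>

text \<open>The columns \<open>A c x0\<close> define an injective linear map, bounded below by some
  \<open>B\<close>. The system at \<open>x\<close> is compared with the one at \<open>x0\<close>;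
  the part of the error proportional to \<open>Z x - Z x0\<close> is absorbed once the columns have
  moved by less than \<open>B / 2\<close>.\<close>

lemma nondegenerate_solution_continuous:
  fixes Z :: "'x::euclidean_space \<Rightarrow> 'e::euclidean_space" and A :: "'e \<Rightarrow> 'x \<Rightarrow> 'e"
  assumes S: "open S" and x0: "x0 \<in> S"
    and A: "\<And>c. c \<in> Basis \<Longrightarrow> continuous_on S (A c)" and a: "continuous_on S a"
    and nd: "\<And>u. (\<Sum>c\<in>Basis. (u \<bullet> c) *\<^sub>R A c x0) = 0 \<Longrightarrow> u = 0"
    and Z: "\<And>x. x \<in> S \<Longrightarrow> (\<Sum>c\<in>Basis. (Z x \<bullet> c) *\<^sub>R A c x) = a x"
  shows "isCont Z x0"
proof -
  let ?L = "\<lambda>x u. \<Sum>c\<in>Basis. (u \<bullet> c) *\<^sub>R (A c x :: 'e)"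
  have L: "linear (?L x)" for x
    by (intro linear_compose_sum ballI) (auto intro!: linearI simp: inner_add_left scaleR_add_left)
  have "inj (?L x0)" using nd linear_injective_0[OF L] by blast
  then obtain B where B: "0 < B" "\<And>u. B * norm u \<le> norm (?L x0 u)"
    using linear_inj_bounded_below_pos[OF L] by blast
  define D where "D x = (\<Sum>c\<in>Basis. norm (A c x - A c x0))" for x
  have "continuous_on S D" unfolding D_def by (intro continuous_intros A)
  then have "(D \<longlongrightarrow> D x0) (at x0)"
    using S x0 by (simp add: continuous_on_eq_continuous_at isCont_def)
  moreover have "D x0 = 0" by (simp add: D_def)
  ultimately have D: "(D \<longlongrightarrow> 0) (at x0)" by simp
  have a': "((\<lambda>x. norm (a x - a x0)) \<longlongrightarrow> 0) (at x0)"
    using a S x0 by (auto simp: continuous_on_eq_continuous_at isCont_def intro!: tendsto_eq_intros)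
  have "\<forall>\<^sub>F x in at x0. D x < B / 2" using D B(1) by (intro order_tendstoD) auto
  moreover have "\<forall>\<^sub>F x in at x0. x \<in> S" using S x0 eventually_at_topological by blast
  ultimately have "\<forall>\<^sub>F x in at x0. norm (Z x - Z x0) \<le> (2 / B) * (norm (a x - a x0) + D x * norm (Z x0))"
  proof eventually_elim
    fix x assume D2: "D x < B / 2" and x: "x \<in> S"
    let ?n = "norm (Z x - Z x0)"
    have "?L x0 (Z x - Z x0) = (a x - a x0) - (\<Sum>c\<in>Basis. (Z x \<bullet> c) *\<^sub>R (A c x - A c x0))"
      using Z[OF x] Z[OF x0] by (simp add: inner_diff_left scaleR_diff_left scaleR_diff_right sum_subtractf)
    then have "B * ?n \<le> norm (a x - a x0) + norm (\<Sum>c\<in>Basis. (Z x \<bullet> c) *\<^sub>R (A c x - A c x0))"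
      using B(2)[of "Z x - Z x0"] by (metis norm_triangle_ineq4 order_trans)
    also have "\<dots> \<le> norm (a x - a x0) + D x * norm (Z x)"
      using norm_linear_combination_le[of "Z x" "\<lambda>c. A c x - A c x0"] by (simp add: D_def)
    also have "D x * norm (Z x) \<le> D x * (?n + norm (Z x0))"
      using norm_triangle_sub[of "Z x" "Z x0"] by (intro mult_left_mono) (auto simp: D_def add.commute intro: sum_nonneg)
    also have "\<dots> \<le> B / 2 * ?n + D x * norm (Z x0)"
      using mult_right_mono[OF less_imp_le[OF D2], of ?n] by (simp add: distrib_left)
    finally have "B / 2 * ?n \<le> norm (a x - a x0) + D x * norm (Z x0)" by (simp add: algebra_simps)
    then show "?n \<le> (2 / B) * (norm (a x - a x0) + D x * norm (Z x0))"
      using B(1) by (simp add: field_simps)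
  qed
  moreover have "((\<lambda>x. (2 / B) * (norm (a x - a x0) + D x * norm (Z x0))) \<longlongrightarrow> 0) (at x0)"
    by (rule tendsto_eq_intros refl a' D | simp)+
  ultimately have "((\<lambda>x. norm (Z x - Z x0)) \<longlongrightarrow> 0) (at x0)"
    by (rule tendsto_sandwich[OF always_eventually _ tendsto_const, rotated]) simp
  then show ?thesis by (simp add: isCont_def LIM_zero_iff tendsto_norm_zero_iff)
qed

text \<open>Continuity of \<open>z\<close> suffices because \<open>f\<close> vanishes at
  \<open>x0\<close>, so \<open>(z x - z x0) *\<^sub>R f x\<close> is of smaller order than
  \<open>x - x0\<close>.\<close>

lemma vanishing_product_has_derivative:
  fixes f :: "'x::real_normed_vector \<Rightarrow> 'e::real_normed_vector" and z :: "'x \<Rightarrow> real"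
  assumes f: "(f has_derivative f') (at x0)" "f x0 = 0" and z: "isCont z x0"
  shows "((\<lambda>x. z x *\<^sub>R f x) has_derivative (\<lambda>v. z x0 *\<^sub>R f' v)) (at x0)"
proof -
  have f': "bounded_linear f'" using f(1) by (rule has_derivative_bounded_linear)
  have "((\<lambda>x. z x0 *\<^sub>R f x) has_derivative (\<lambda>v. z x0 *\<^sub>R f' v)) (at x0)"
    by (rule has_derivative_scaleR_right[OF f(1)])
  moreover have "((\<lambda>x. (z x - z x0) *\<^sub>R f x) has_derivative (\<lambda>v. 0)) (at x0)"
    unfolding has_derivative_at_alt
  proof (intro conjI bounded_linear_zero allI impI)
    fix e :: real assume e: "0 < e"
    obtain K where K: "0 < K" "\<And>v. norm (f' v) \<le> norm v * K" using bounded_linear.pos_bounded[OF f'] by blast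
    define e1 where "e1 = e / (K + 1)"
    have e1: "0 < e1" using e K by (simp add: e1_def)
    obtain d1 where d1: "0 < d1" "\<And>x. norm (x - x0) < d1 \<Longrightarrow> norm (f x - f x0 - f' (x - x0)) \<le> 1 * norm (x - x0)"
      using f(1) unfolding has_derivative_at_alt by (metis zero_less_one)
    obtain d2 where d2: "0 < d2" "\<And>x. dist x x0 < d2 \<Longrightarrow> dist (z x) (z x0) < e1"
      using z e1 unfolding continuous_at_eps_delta by blast
    show "\<exists>d>0. \<forall>y. norm (y - x0) < d \<longrightarrow> norm ((z y - z x0) *\<^sub>R f y - (z x0 - z x0) *\<^sub>R f x0 - 0) \<le> e * norm (y - x0)"
    proof (intro exI[of _ "min d1 d2"] conjI allI impI)
      fix y assume y: "norm (y - x0) < min d1 d2"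
      have "norm (f y) \<le> norm (f y - f' (y - x0)) + norm (f' (y - x0))"
        using norm_triangle_ineq[of "f y - f' (y - x0)" "f' (y - x0)"] by simp
      also have "\<dots> \<le> norm (y - x0) + norm (y - x0) * K"
        using d1(2)[of y] y f(2) K(2) by (intro add_mono) auto
      finally have "norm (f y) \<le> (K + 1) * norm (y - x0)" by (simp add: algebra_simps)
      then have "\<bar>z y - z x0\<bar> * norm (f y) \<le> e1 * ((K + 1) * norm (y - x0))"
        using d2(2)[of y] y e1 by (intro mult_mono) (auto simp: dist_norm)
      also have "\<dots> = e * norm (y - x0)" using K by (simp add: e1_def)
      finally show "norm ((z y - z x0) *\<^sub>R f y - (z x0 - z x0) *\<^sub>R f x0 - 0) \<le> e * norm (y - x0)" by simp
    qed (use d1 d2 in auto)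
  qed
  ultimately have "((\<lambda>x. z x0 *\<^sub>R f x + (z x - z x0) *\<^sub>R f x) has_derivative (\<lambda>v. z x0 *\<^sub>R f' v + 0)) (at x0)"
    by (rule has_derivative_add)
  then show ?thesis by (simp add: algebra_simps)
qed

lemma nondegenerate_solution_Ck:
  fixes Z :: "'x::euclidean_space \<Rightarrow> 'e::euclidean_space" and A :: "'e \<Rightarrow> 'x \<Rightarrow> 'e"
  assumes S: "open S"
    and A: "\<And>c. c \<in> Basis \<Longrightarrow> Ck_on k (A c) S" and a: "Ck_on k a S"
    and nd: "\<And>x u. x \<in> S \<Longrightarrow> (\<Sum>c\<in>Basis. (u \<bullet> c) *\<^sub>R A c x) = 0 \<Longrightarrow> u = 0"
    and Z: "\<And>x. x \<in> S \<Longrightarrow> (\<Sum>c\<in>Basis. (Z x \<bullet> c) *\<^sub>R A c x) = a x"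
  shows "Ck_on k Z S"
  using A a Z
proof (induction k arbitrary: a Z)
  case 0
  have "isCont Z x" if "x \<in> S" for x
    by (rule nondegenerate_solution_continuous[OF S that _ _ nd[OF that] 0(3)]) (use 0(1,2) in simp_all)
  then show ?case by (simp add: continuous_at_imp_continuous_on)
next
  case (Suc k)
  note A = Suc.prems(1) and a = Suc.prems(2) and Z = Suc.prems(3)
  have Zk: "Ck_on k Z S" by (rule Suc.IH[OF Ck_on_Suc_imp[OF A] Ck_on_Suc_imp[OF a] Z])
  have Zc: "isCont Z x" if "x \<in> S" for x
    using Ck_on_imp_continuous_on[OF Zk] S that by (simp add: continuous_on_eq_continuous_at)
  have A': "(A c has_derivative frechet_derivative (A c) (at x)) (at x)" if "c \<in> Basis" "x \<in> S" for c x
    by (rule Ck_on_has_derivative[OF A[OF that(1)] that(2)])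
  have a': "(a has_derivative frechet_derivative a (at x)) (at x)" if "x \<in> S" for x
    by (rule Ck_on_has_derivative[OF a that])
  have Zd: "\<exists>Z'. (Z has_derivative Z') (at x0)" if x0: "x0 \<in> S" for x0
  proof -
    let ?L = "\<lambda>u. \<Sum>c\<in>Basis. (u \<bullet> c) *\<^sub>R A c x0"
    have L: "linear ?L"
      by (intro linear_compose_sum ballI) (auto intro!: linearI simp: inner_add_left scaleR_add_left)
    have "inj ?L" using nd[OF x0] linear_injective_0[OF L] by blast
    then obtain M where M: "linear M" "M \<circ> ?L = id" using linear_injective_left_inverse[OF L] by blast
    have "((\<lambda>x. \<Sum>c\<in>Basis. (Z x \<bullet> c) *\<^sub>R (A c x - A c x0)) has_derivative
        (\<lambda>v. \<Sum>c\<in>Basis. (Z x0 \<bullet> c) *\<^sub>R (frechet_derivative (A c) (at x0) v - 0))) (at x0)"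
    proof (rule has_derivative_sum, rule vanishing_product_has_derivative[OF has_derivative_diff[OF A'[OF _ x0] has_derivative_const]])
      show "isCont (\<lambda>x. Z x \<bullet> c) x0" for c using Zc[OF x0] by (intro isCont_inner continuous_const)
    qed simp_all
    from has_derivative_diff[OF a'[OF x0] this]
    have d: "((\<lambda>x. a x - (\<Sum>c\<in>Basis. (Z x \<bullet> c) *\<^sub>R (A c x - A c x0))) has_derivative
        (\<lambda>v. frechet_derivative a (at x0) v - (\<Sum>c\<in>Basis. (Z x0 \<bullet> c) *\<^sub>R (frechet_derivative (A c) (at x0) v - 0)))) (at x0)" .
    have "bounded_linear M" using M(1) by (simp add: linear_conv_bounded_linear)
    from bounded_linear.has_derivative[OF this d]
    have "(Z has_derivative (\<lambda>v. M (frechet_derivative a (at x0) v - (\<Sum>c\<in>Basis. (Z x0 \<bullet> c) *\<^sub>R (frechet_derivative (A c) (at x0) v - 0))))) (at x0)"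
    proof (rule has_derivative_transform_within_open[OF _ S x0])
      fix x assume x: "x \<in> S"
      have "a x - (\<Sum>c\<in>Basis. (Z x \<bullet> c) *\<^sub>R (A c x - A c x0)) = ?L (Z x)"
        using Z[OF x] by (simp add: scaleR_diff_right sum_subtractf)
      then have "M (a x - (\<Sum>c\<in>Basis. (Z x \<bullet> c) *\<^sub>R (A c x - A c x0))) = (M \<circ> ?L) (Z x)"
        by (simp only: comp_apply)
      then show "M (a x - (\<Sum>c\<in>Basis. (Z x \<bullet> c) *\<^sub>R (A c x - A c x0))) = Z x"
        by (simp only: M(2) id_apply)
    qed
    then show ?thesis by blast
  qed
  then have Z': "(Z has_derivative frechet_derivative Z (at x)) (at x)" if "x \<in> S" for x
    using that frechet_derivative_eq by metis
  show ?case
  proof (rule Ck_on_SucI[OF S Z'])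
    fix v
    let ?a = "\<lambda>x. frechet_derivative a (at x) v - (\<Sum>c\<in>Basis. (Z x \<bullet> c) *\<^sub>R frechet_derivative (A c) (at x) v)"
    show "Ck_on k (\<lambda>x. frechet_derivative Z (at x) v) S"
    proof (rule Suc.IH[of ?a])
      show "Ck_on k (A c) S" if "c \<in> Basis" for c by (rule Ck_on_Suc_imp[OF A[OF that]])
      have "Ck_on k (\<lambda>x. frechet_derivative (A c) (at x) v) S" if "c \<in> Basis" for c
        using A[OF that] by (simp only: Ck_on.simps)
      then have "Ck_on k (\<lambda>x. \<Sum>c\<in>Basis. (Z x \<bullet> c) *\<^sub>R frechet_derivative (A c) (at x) v) S"
        by (intro Ck_on_sum Ck_on_scaleR S Ck_on_compose_linear[OF bounded_linear_inner_left] Zk)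
      then have "Ck_on k (\<lambda>x. - (\<Sum>c\<in>Basis. (Z x \<bullet> c) *\<^sub>R frechet_derivative (A c) (at x) v)) S"
        by (rule Ck_on_compose_linear[OF bounded_linear_minus[OF bounded_linear_ident] S])
      moreover have "Ck_on k (\<lambda>x. frechet_derivative a (at x) v) S" using a by (simp only: Ck_on.simps)
      ultimately have "Ck_on k (\<lambda>x. frechet_derivative a (at x) v + - (\<Sum>c\<in>Basis. (Z x \<bullet> c) *\<^sub>R frechet_derivative (A c) (at x) v)) S"
        by (intro Ck_on_add S)
      then show "Ck_on k ?a S" by simp
      fix x assume x: "x \<in> S"
      have "((\<lambda>x. \<Sum>c\<in>Basis. (Z x \<bullet> c) *\<^sub>R A c x) has_derivative (\<lambda>v. \<Sum>c\<in>Basis.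
          (Z x \<bullet> c) *\<^sub>R frechet_derivative (A c) (at x) v + (frechet_derivative Z (at x) v \<bullet> c) *\<^sub>R A c x)) (at x)"
        by (rule has_derivative_sum, rule has_derivative_scaleR[OF has_derivative_inner_left[OF Z'[OF x]] A'[OF _ x]])
      note d1 = this
      have d2: "((\<lambda>x. \<Sum>c\<in>Basis. (Z x \<bullet> c) *\<^sub>R A c x) has_derivative frechet_derivative a (at x)) (at x)"
        by (rule has_derivative_transform_within_open[OF a'[OF x] S x Z[symmetric]])
      from fun_cong[OF has_derivative_unique[OF d1 d2], of v]
      have "(\<Sum>c\<in>Basis. (Z x \<bullet> c) *\<^sub>R frechet_derivative (A c) (at x) v + (frechet_derivative Z (at x) v \<bullet> c) *\<^sub>R A c x)
          = frechet_derivative a (at x) v" .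
      then show "(\<Sum>c\<in>Basis. (frechet_derivative Z (at x) v \<bullet> c) *\<^sub>R A c x) = ?a x"
        by (simp only: sum.distrib eq_diff_eq add.commute)
    qed
  qed
qed

lemma bilinear_expand:
  fixes f :: "'e::euclidean_space \<Rightarrow> 'e \<Rightarrow> real"
  assumes "bilinear f"
  shows "f u v = (\<Sum>b\<in>Basis. \<Sum>c\<in>Basis. (u \<bullet> b) * (v \<bullet> c) * f b c)"
proof -
  have l: "linear (\<lambda>u. f u v)" and r: "linear (f b)" for v b
    using assms by (auto simp: bilinear_def)
  have "f u v = (\<Sum>b\<in>Basis. (u \<bullet> b) *\<^sub>R f b v)"
    by (rule linear_expand_basis[OF l])
  also have "\<dots> = (\<Sum>b\<in>Basis. (u \<bullet> b) *\<^sub>R (\<Sum>c\<in>Basis. (v \<bullet> c) *\<^sub>R f b c))"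
    by (intro sum.cong refl arg_cong2[where f="(*\<^sub>R)"] linear_expand_basis[OF r])
  finally show ?thesis by (simp add: sum_distrib_left mult.assoc)
qed

text \<open>The product rule with three moving arguments; expansion over the basis leaves products
  of real functions of time.\<close>

lemma bilinear_family_has_derivative:
  fixes om :: "'x::euclidean_space \<Rightarrow> 'e::euclidean_space \<Rightarrow> 'e \<Rightarrow> real"
  assumes S: "open S" and om: "\<And>x. x \<in> S \<Longrightarrow> bilinear (om x)"
    and om': "\<And>x u v. x \<in> S \<Longrightarrow> ((\<lambda>x. om x u v) has_derivative om' x u v) (at x)"
    and X: "(X has_vector_derivative x') (at t)" "X t \<in> S"
    and U: "(U has_vector_derivative u') (at t)" and V: "(V has_vector_derivative v') (at t)"
  shows "((\<lambda>t. om (X t) (U t) (V t)) has_real_derivative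
    om' (X t) (U t) (V t) x' + om (X t) u' (V t) + om (X t) (U t) v') (at t)"
proof -
  let ?D = "\<lambda>b c. (U t \<bullet> b) * (V t \<bullet> c) * om' (X t) b c x' + ((u' \<bullet> b) * (V t \<bullet> c) + (v' \<bullet> c) * (U t \<bullet> b)) * om (X t) b c"
  have Ub: "((\<lambda>s. U s \<bullet> b) has_real_derivative u' \<bullet> b) (at t)" for b
    unfolding has_real_derivative_iff_has_vector_derivative
    by (rule bounded_linear.has_vector_derivative[OF bounded_linear_inner_left U])
  have Vb: "((\<lambda>s. V s \<bullet> b) has_real_derivative v' \<bullet> b) (at t)" for b
    unfolding has_real_derivative_iff_has_vector_derivative
    by (rule bounded_linear.has_vector_derivative[OF bounded_linear_inner_left V])
  have Xb: "((\<lambda>s. om (X s) b c) has_real_derivative om' (X t) b c x') (at t)" for b c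
    unfolding has_real_derivative_iff_has_vector_derivative
    using vector_derivative_diff_chain_within[of X x' t UNIV, OF X(1) has_derivative_at_withinI[OF om'[OF X(2)]], of b c]
    by (simp only: o_def)
  have "((\<lambda>s. (U s \<bullet> b) * (V s \<bullet> c) * om (X s) b c) has_real_derivative
      ((u' \<bullet> b) * (V t \<bullet> c) + (v' \<bullet> c) * (U t \<bullet> b)) * om (X t) b c + om' (X t) b c x' * ((U t \<bullet> b) * (V t \<bullet> c))) (at t)" for b c
    by (rule DERIV_mult[OF DERIV_mult[OF Ub Vb] Xb])
  then have "((\<lambda>s. (U s \<bullet> b) * (V s \<bullet> c) * om (X s) b c) has_real_derivative ?D b c) (at t)" for b c
    by (simp only: add.commute mult.commute)
  then have d: "((\<lambda>s. \<Sum>b\<in>Basis. \<Sum>c\<in>Basis. (U s \<bullet> b) * (V s \<bullet> c) * om (X s) b c) has_real_derivative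
      (\<Sum>b\<in>Basis. \<Sum>c\<in>Basis. ?D b c)) (at t)"
    by (intro DERIV_sum)
  have ex: "om x u v = (\<Sum>b\<in>Basis. \<Sum>c\<in>Basis. (u \<bullet> b) * (v \<bullet> c) * om x b c)" if "x \<in> S" for x u v
    by (rule bilinear_expand[OF om[OF that]])
  have "isCont X t" using X(1) by (rule has_vector_derivative_continuous)
  then obtain T where T: "open T" "t \<in> T" "\<And>s. s \<in> T \<Longrightarrow> X s \<in> S"
    using S X(2) unfolding continuous_at_open by metis
  have d1: "((\<lambda>t. om (X t) (U t) (V t)) has_real_derivative (\<Sum>b\<in>Basis. \<Sum>c\<in>Basis. ?D b c)) (at t)"
    by (rule has_field_derivative_transform_within_open[OF d T(1,2) ex[OF T(3), symmetric]])
  have "((\<lambda>x. \<Sum>b\<in>Basis. \<Sum>c\<in>Basis. (U t \<bullet> b) * (V t \<bullet> c) * om x b c) has_derivative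
      (\<lambda>h. \<Sum>b\<in>Basis. \<Sum>c\<in>Basis. (U t \<bullet> b) * (V t \<bullet> c) * om' (X t) b c h)) (at (X t))"
    by (rule has_derivative_sum, rule has_derivative_sum, rule has_derivative_mult_right[OF om'[OF X(2)]])
  then have "((\<lambda>x. om x (U t) (V t)) has_derivative
      (\<lambda>h. \<Sum>b\<in>Basis. \<Sum>c\<in>Basis. (U t \<bullet> b) * (V t \<bullet> c) * om' (X t) b c h)) (at (X t))"
    by (rule has_derivative_transform_within_open[OF _ S X(2) ex[symmetric]])
  from fun_cong[OF has_derivative_unique[OF this om'[OF X(2)]], of x']
  have e1: "(\<Sum>b\<in>Basis. \<Sum>c\<in>Basis. (U t \<bullet> b) * (V t \<bullet> c) * om' (X t) b c x') = om' (X t) (U t) (V t) x'" .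
  have "(\<Sum>b\<in>Basis. \<Sum>c\<in>Basis. ?D b c) = om' (X t) (U t) (V t) x' + (om (X t) u' (V t) + om (X t) (U t) v')"
    unfolding ex[OF X(2), of u'] ex[OF X(2), of "U t" v'] e1[symmetric]
    by (simp only: sum.distrib[symmetric]) (simp add: algebra_simps)
  then show ?thesis using d1 by (simp only: add.assoc)
qed

section \<open>One-forms and differentials of functions\<close>

context smooth_manifold
begin

lemma one_form_linear: "one_form A \<alpha> \<Longrightarrow> p \<in> Cd i \<Longrightarrow> linear (\<alpha> i p)"
  and one_form_tchange: "one_form A \<alpha> \<Longrightarrow> p \<in> Cd i \<Longrightarrow> p \<in> Cd j \<Longrightarrow> \<alpha> j p (tchange A i j p v) = \<alpha> i p v"
  and one_form_smooth: "one_form A \<alpha> \<Longrightarrow> smooth_on (\<lambda>x. \<alpha> i (ci i x) v) (Cr i)"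
  unfolding one_form_def by auto

lemma smooth_fun_chart: "smooth_fun A f \<Longrightarrow> smooth_on (\<lambda>x. f (ci i x)) (Cr i)"
  unfolding smooth_fun_def o_def by blast

lemma differential_has_derivative:
  assumes "smooth_fun A f" "p \<in> Cd i"
  shows "((\<lambda>x. f (ci i x)) has_derivative differential A f i p) (at (cm i p))"
  unfolding differential_def o_def
  by (rule smooth_on_has_derivative[OF smooth_fun_chart[OF assms(1)] cm_in[OF assms(2)]])

lemma smooth_fun_continuous:
  assumes "smooth_fun A f"
  shows "continuous_on UNIV f"
proof (rule continuous_at_imp_continuous_on, rule ballI)
  fix p
  obtain i where i: "p \<in> Cd i" using ex_chart by blast
  have "continuous_on (Cd i) (\<lambda>p. f (ci i (cm i p)))"
    by (rule continuous_on_compose2[OF smooth_on_imp_continuous_on[OF smooth_fun_chart[OF assms]] continuous_on_cm]) simp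
  then have "continuous_on (Cd i) f" by (rule continuous_on_eq) simp
  then show "isCont f p" using i open_Cd by (simp add: continuous_on_eq_continuous_at)
qed

lemma differential_one_form:
  assumes f: "smooth_fun A f"
  shows "one_form A (differential A f)"
  unfolding one_form_def
proof (intro conjI allI ballI)
  show "linear (differential A f i p)" if "p \<in> Cd i" for i p
    using differential_has_derivative[OF f that] by (rule has_derivative_linear)
  show "differential A f j p (tchange A i j p v) = differential A f i p v" if "p \<in> Cd i \<inter> Cd j" for i j p v
  proof -
    have p: "p \<in> Cd i" "p \<in> Cd j" using that by auto
    have "((\<lambda>x. f (ci j x)) has_derivative differential A f j p) (at ((cm j \<circ> ci i) (cm i p)))"
      using differential_has_derivative[OF f p(2)] p by simp
    from has_derivative_compose[OF tchange_has_derivative[OF p] this]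
    have "((\<lambda>x. f (ci i x)) has_derivative (\<lambda>v. differential A f j p (tchange A i j p v))) (at (cm i p))"
      by (rule has_derivative_transform_within_open[OF _ open_overlap[of i j]]) (use p in auto)
    from fun_cong[OF has_derivative_unique[OF this differential_has_derivative[OF f p(1)]], of v]
    show ?thesis .
  qed
  show "smooth_on (\<lambda>x. differential A f i (ci i x) v) (Cr i)" for i v
    by (rule smooth_on_cong[OF open_Cr _ smooth_on_frechet_derivative[OF smooth_fun_chart[OF f]]])
      (simp add: differential_def o_def)
qed

lemma one_form_add:
  assumes "one_form A \<alpha>" "one_form A \<beta>"
  shows "one_form A (\<lambda>i p v. \<alpha> i p v + \<beta> i p v)"
  unfolding one_form_def
proof (intro conjI allI ballI)
  show "linear (\<lambda>v. \<alpha> i p v + \<beta> i p v)" if "p \<in> Cd i" for i p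
    by (intro linear_compose_add one_form_linear[OF assms(1) that] one_form_linear[OF assms(2) that])
  show "\<alpha> j p (tchange A i j p v) + \<beta> j p (tchange A i j p v) = \<alpha> i p v + \<beta> i p v" if "p \<in> Cd i \<inter> Cd j" for i j p v
    using that one_form_tchange[OF assms(1)] one_form_tchange[OF assms(2)] by simp
  show "smooth_on (\<lambda>x. \<alpha> i (ci i x) v + \<beta> i (ci i x) v) (Cr i)" for i v
    by (intro smooth_on_add open_Cr one_form_smooth assms)
qed

lemma one_form_minus:
  assumes "one_form A \<alpha>"
  shows "one_form A (\<lambda>i p v. - \<alpha> i p v)"
  unfolding one_form_def
proof (intro conjI allI ballI)
  show "linear (\<lambda>v. - \<alpha> i p v)" if "p \<in> Cd i" for i p
    by (intro linear_compose_neg one_form_linear[OF assms that])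
  show "- \<alpha> j p (tchange A i j p v) = - \<alpha> i p v" if "p \<in> Cd i \<inter> Cd j" for i j p v
    using that one_form_tchange[OF assms] by simp
  show "smooth_on (\<lambda>x. - \<alpha> i (ci i x) v) (Cr i)" for i v
    by (intro smooth_on_minus open_Cr one_form_smooth assms)
qed

end

section \<open>Symplectic gradients and invariance of the symplectic form\<close>

locale symplectic_mfd = smooth_manifold A
  for A :: "('i, 'a::{second_countable_topology,t2_space}, 'e::euclidean_space) atlas" +
  fixes \<omega> :: "('i, 'a, 'e) form2"
  assumes symplectic: "symplectic_manifold A \<omega>"
begin

lemma om_bilinear: "p \<in> Cd i \<Longrightarrow> bilinear (\<omega> i p)"
  and om_alternating: "p \<in> Cd i \<Longrightarrow> \<omega> i p v v = 0"
  and om_tchange: "p \<in> Cd i \<Longrightarrow> p \<in> Cd j \<Longrightarrow> \<omega> j p (tchange A i j p v) (tchange A i j p w) = \<omega> i p v w"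
  and om_smooth: "smooth_on (\<lambda>x. \<omega> i (ci i x) v w) (Cr i)"
  and om_closed: "x \<in> Cr i \<Longrightarrow> frechet_derivative (\<lambda>y. \<omega> i (ci i y) v w) (at x) u
      + frechet_derivative (\<lambda>y. \<omega> i (ci i y) w u) (at x) v
      + frechet_derivative (\<lambda>y. \<omega> i (ci i y) u v) (at x) w = 0"
  and om_nondegenerate: "p \<in> Cd i \<Longrightarrow> (\<And>v. \<omega> i p u v = 0) \<Longrightarrow> u = 0"
  using symplectic unfolding symplectic_manifold_def closed_two_form_def two_form_def by auto

lemma om_antisym:
  assumes p: "p \<in> Cd i"
  shows "\<omega> i p u v = - \<omega> i p v u"
proof -
  have "\<omega> i p (u + v) (u + v) = \<omega> i p u u + \<omega> i p u v + (\<omega> i p v u + \<omega> i p v v)"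
    by (simp add: bilinear_ladd[OF om_bilinear[OF p]] bilinear_radd[OF om_bilinear[OF p]])
  then show ?thesis by (simp add: om_alternating[OF p])
qed

lemma om_eqI:
  assumes p: "p \<in> Cd i" and eq: "\<And>v. \<omega> i p u v = \<omega> i p u' v"
  shows "u = u'"
proof -
  have "\<omega> i p (u - u') v = 0" for v
    using eq[of v] by (simp add: bilinear_lsub[OF om_bilinear[OF p]])
  then have "u - u' = 0" by (rule om_nondegenerate[OF p])
  then show ?thesis by simp
qed

text \<open>Nondegeneracy makes the map from \<open>u\<close> to \<open>\<omega> i p u\<close>
  injective, hence by dimension every linear form has a unique preimage; so the definite description
  in \<open>sgrad\<close> denotes the solution.\<close>

lemma sgrad_eq:
  assumes p: "p \<in> Cd i" and \<alpha>: "linear (\<alpha> i p)"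
  shows "\<omega> i p (sgrad \<omega> \<alpha> i p) v = \<alpha> i p v"
proof -
  let ?L = "\<lambda>u. \<Sum>b\<in>Basis. \<omega> i p u b *\<^sub>R b"
  have lin: "linear (\<omega> i p u)" for u using om_bilinear[OF p] by (simp add: bilinear_def)
  have lin1: "linear (\<lambda>u. \<omega> i p u b)" for b using om_bilinear[OF p] by (simp add: bilinear_def)
  have L: "linear ?L"
  proof (rule linearI)
    show "?L (u + w) = ?L u + ?L w" for u w
      by (simp add: linear_add[OF lin1] scaleR_add_left sum.distrib)
    show "?L (r *\<^sub>R u) = r *\<^sub>R ?L u" for r u
      by (simp add: linear_scale[OF lin1] scaleR_sum_right)
  qed
  have Lb: "?L u \<bullet> b = \<omega> i p u b" if "b \<in> Basis" for u b
    using that by (simp add: inner_sum_left_Basis)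
  have "u = 0" if "?L u = 0" for u
  proof (rule om_nondegenerate[OF p])
    fix v
    have "\<omega> i p u b = 0" if "b \<in> Basis" for b using Lb[OF that, of u] \<open>?L u = 0\<close> by simp
    then show "\<omega> i p u v = 0" using linear_expand_basis[OF lin, of u v] by simp
  qed
  then have "inj ?L" using linear_injective_0[OF L] by blast
  then have "surj ?L" by (rule linear_injective_imp_surjective[OF L _ refl])
  then obtain u where u': "(\<Sum>b\<in>Basis. \<alpha> i p b *\<^sub>R b) = ?L u" by (rule surjE)
  note u = u'[symmetric]
  have "\<omega> i p u b = \<alpha> i p b" if "b \<in> Basis" for b
    using Lb[OF that, of u] that unfolding u by (simp add: inner_sum_left_Basis)
  then have ex: "\<omega> i p u v = \<alpha> i p v" for v
    using linear_expand_basis[OF lin, of u v] linear_expand_basis[OF \<alpha>, of v] by simp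
  have "\<forall>v. \<omega> i p (THE u. \<forall>v. \<omega> i p u v = \<alpha> i p v) v = \<alpha> i p v"
  proof (rule theI2[of "\<lambda>u. \<forall>v. \<omega> i p u v = \<alpha> i p v" u])
    show "\<forall>v. \<omega> i p u v = \<alpha> i p v" using ex by blast
    show "x = u" if "\<forall>v. \<omega> i p x v = \<alpha> i p v" for x
      by (rule om_eqI[OF p]) (simp add: ex that)
  qed
  then show ?thesis unfolding sgrad_def by blast
qed

lemma sgrad_unique:
  assumes p: "p \<in> Cd i" and \<alpha>: "linear (\<alpha> i p)" and u: "\<And>v. \<omega> i p u v = \<alpha> i p v"
  shows "sgrad \<omega> \<alpha> i p = u"
  by (rule om_eqI[OF p]) (simp add: sgrad_eq[of p i \<alpha>, OF p \<alpha>] u)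

lemma tchange_surj:
  assumes p: "p \<in> Cd i" "p \<in> Cd j"
  shows "tchange A i j p (tchange A j i p v) = v"
  using tchange_compose[OF p(2,1,2), of v] tchange_self[OF p(2)] by simp

text \<open>Smoothness comes from \<open>nondegenerate_solution_Ck\<close> applied to the matrix of
  \<omega> in a chart, compatibility under changes of charts from uniqueness of the
  solution.\<close>

lemma sgrad_vector_field:
  assumes \<alpha>: "one_form A \<alpha>"
  shows "vector_field (sgrad \<omega> \<alpha>)"
  unfolding vector_field_def
proof (intro conjI allI ballI)
  fix i
  let ?A = "\<lambda>c x. \<Sum>b\<in>Basis. \<omega> i (ci i x) c b *\<^sub>R b" and ?a = "\<lambda>x. \<Sum>b\<in>Basis. \<alpha> i (ci i x) b *\<^sub>R b"
  have lin1: "linear (\<lambda>u. \<omega> i (ci i x) u b)" and lin: "linear (\<omega> i (ci i x) u)" if "x \<in> Cr i" for x b u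
    using om_bilinear[OF ci_in[OF that]] by (auto simp: bilinear_def)
  have comb: "(\<Sum>c\<in>Basis. (u \<bullet> c) *\<^sub>R ?A c x) = (\<Sum>b\<in>Basis. \<omega> i (ci i x) u b *\<^sub>R b)" if x: "x \<in> Cr i" for x u
  proof -
    have "(\<Sum>c\<in>Basis. (u \<bullet> c) *\<^sub>R ?A c x) = (\<Sum>c\<in>Basis. \<Sum>b\<in>Basis. ((u \<bullet> c) * \<omega> i (ci i x) c b) *\<^sub>R b)"
      by (simp add: scaleR_sum_right)
    also have "\<dots> = (\<Sum>b\<in>Basis. (\<Sum>c\<in>Basis. (u \<bullet> c) * \<omega> i (ci i x) c b) *\<^sub>R b)"
      by (subst sum.swap) (simp add: scaleR_sum_left)
    also have "\<dots> = (\<Sum>b\<in>Basis. \<omega> i (ci i x) u b *\<^sub>R b)"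
      by (rule sum.cong[OF refl]) (simp add: linear_expand_basis[OF lin1[OF x], of u])
    finally show ?thesis .
  qed
  have "Ck_on k (\<lambda>x. sgrad \<omega> \<alpha> i (ci i x)) (Cr i)" for k
  proof (rule nondegenerate_solution_Ck[OF open_Cr, where A="?A" and a="?a"])
    show "Ck_on k (?A c) (Cr i)" for c
      by (intro Ck_on_sum open_Cr Ck_on_scaleR Ck_on_const) (use om_smooth in \<open>simp add: smooth_on_def\<close>)
    show "Ck_on k ?a (Cr i)"
      by (intro Ck_on_sum open_Cr Ck_on_scaleR Ck_on_const) (use one_form_smooth[OF \<alpha>] in \<open>simp add: smooth_on_def\<close>)
    fix x assume x: "x \<in> Cr i"
    show "u = 0" if "(\<Sum>c\<in>Basis. (u \<bullet> c) *\<^sub>R ?A c x) = 0" for u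
    proof (rule om_nondegenerate[OF ci_in[OF x]])
      fix v
      have "(\<Sum>b\<in>Basis. \<omega> i (ci i x) u b *\<^sub>R b) \<bullet> b = 0" for b
        using that comb[OF x] by simp
      then have "\<omega> i (ci i x) u b = 0" if "b \<in> Basis" for b
        using that by (metis inner_sum_left_Basis)
      then show "\<omega> i (ci i x) u v = 0" using linear_expand_basis[OF lin[OF x], of u v] by simp
    qed
    show "(\<Sum>c\<in>Basis. (sgrad \<omega> \<alpha> i (ci i x) \<bullet> c) *\<^sub>R ?A c x) = ?a x"
      unfolding comb[OF x] using sgrad_eq[of "ci i x" i \<alpha>, OF ci_in[OF x] one_form_linear[OF \<alpha> ci_in[OF x]]] by simp
  qed
  then show "smooth_on (\<lambda>x. sgrad \<omega> \<alpha> i (ci i x)) (Cr i)" by (simp add: smooth_on_def)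
next
  fix i j p assume "p \<in> Cd i \<inter> Cd j"
  then have p: "p \<in> Cd i" "p \<in> Cd j" by auto
  show "tchange A i j p (sgrad \<omega> \<alpha> i p) = sgrad \<omega> \<alpha> j p"
  proof (rule sgrad_unique[of p j \<alpha>, OF p(2) one_form_linear[OF \<alpha> p(2)], symmetric])
    fix v
    have "\<omega> j p (tchange A i j p (sgrad \<omega> \<alpha> i p)) (tchange A i j p (tchange A j i p v)) = \<alpha> i p (tchange A j i p v)"
      unfolding om_tchange[OF p] by (rule sgrad_eq[of p i \<alpha>, OF p(1) one_form_linear[OF \<alpha> p(1)]])
    then show "\<omega> j p (tchange A i j p (sgrad \<omega> \<alpha> i p)) v = \<alpha> j p v"
      by (simp only: tchange_surj[OF p] one_form_tchange[OF \<alpha> p(2,1)])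
  qed
qed

text \<open>This is the Lie derivative of \<omega> along \<open>sgrad \<omega> \<beta>\<close> in a
  chart. By Cartan's formula it is \<open>d\<beta>\<close> plus the contraction of
  \<open>d\<omega>\<close>, and both vanish.\<close>

lemma locally_hamiltonian_infinitesimal:
  assumes \<beta>: "closed_one_form A \<beta>" and x: "x \<in> Cr j"
  defines "f \<equiv> \<lambda>x. sgrad \<omega> \<beta> j (ci j x)"
  shows "frechet_derivative (\<lambda>y. \<omega> j (ci j y) u v) (at x) (f x)
    + \<omega> j (ci j x) (frechet_derivative f (at x) u) v + \<omega> j (ci j x) u (frechet_derivative f (at x) v) = 0"
proof -
  let ?W = "\<lambda>v w h. frechet_derivative (\<lambda>y. \<omega> j (ci j y) v w) (at x) h"
  let ?f' = "frechet_derivative f (at x)"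
  have \<beta>1: "one_form A \<beta>" using \<beta> by (simp add: closed_one_form_def)
  have fs: "smooth_on f (Cr j)"
    using sgrad_vector_field[OF \<beta>1] unfolding vector_field_def f_def by blast
  have W: "((\<lambda>y. \<omega> j (ci j y) v w) has_derivative frechet_derivative (\<lambda>y. \<omega> j (ci j y) v w) (at y)) (at y)"
    if "y \<in> Cr j" for v w y
    by (rule smooth_on_has_derivative[OF om_smooth that])
  have anti: "?W v w h = - ?W w v h" for v w h
  proof -
    have "((\<lambda>y. \<omega> j (ci j y) v w) has_derivative (\<lambda>h. - ?W w v h)) (at x)"
      by (rule has_derivative_transform_within_open[OF has_derivative_minus[OF W[OF x]] open_Cr x])
        (simp add: om_antisym[of _ j v w])
    from fun_cong[OF has_derivative_unique[OF W[OF x] this], of h] show ?thesis .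
  qed
  have d\<beta>: "frechet_derivative (\<lambda>y. \<beta> j (ci j y) v) (at x) u = ?W (f x) v u + \<omega> j (ci j x) (?f' u) v" for u v
  proof -
    have l: "((\<lambda>h. x + h *\<^sub>R u) has_vector_derivative u) (at 0)"
      by (auto intro!: derivative_eq_intros)
    have f': "(f has_derivative ?f') (at (x + 0 *\<^sub>R u))"
      using smooth_on_has_derivative[OF fs x] by simp
    have fl: "((\<lambda>h. f (x + h *\<^sub>R u)) has_vector_derivative ?f' u) (at 0)"
      using vector_derivative_diff_chain_within[of "\<lambda>h. x + h *\<^sub>R u" u 0 UNIV, OF l has_derivative_at_withinI[OF f']]
      by (simp only: o_def)
    have x0: "x + 0 *\<^sub>R u \<in> Cr j" using x by simp
    have bl: "bilinear (\<omega> j (ci j y))" if "y \<in> Cr j" for y by (rule om_bilinear[OF ci_in[OF that]])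
    have 1: "((\<lambda>h. \<omega> j (ci j (x + h *\<^sub>R u)) (f (x + h *\<^sub>R u)) v) has_real_derivative
        ?W (f x) v u + \<omega> j (ci j x) (?f' u) v + \<omega> j (ci j x) (f x) 0) (at 0)"
      using bilinear_family_has_derivative[OF open_Cr bl W l x0 fl has_vector_derivative_const[of v]] by simp
    have "\<omega> j (ci j x) (f x) 0 = 0" by (rule bilinear_rzero[OF om_bilinear[OF ci_in[OF x]]])
    with 1 have 1: "((\<lambda>h. \<omega> j (ci j (x + h *\<^sub>R u)) (f (x + h *\<^sub>R u)) v) has_vector_derivative
        ?W (f x) v u + \<omega> j (ci j x) (?f' u) v) (at 0)"
      by (simp add: has_real_derivative_iff_has_vector_derivative)
    have "((\<lambda>y. \<beta> j (ci j y) v) has_derivative frechet_derivative (\<lambda>y. \<beta> j (ci j y) v) (at x)) (at (x + 0 *\<^sub>R u))"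
      using smooth_on_has_derivative[OF one_form_smooth[OF \<beta>1] x] by simp
    from vector_derivative_diff_chain_within[of "\<lambda>h. x + h *\<^sub>R u" u 0 UNIV, OF l has_derivative_at_withinI[OF this]]
    have 2: "((\<lambda>h. \<beta> j (ci j (x + h *\<^sub>R u)) v) has_vector_derivative frechet_derivative (\<lambda>y. \<beta> j (ci j y) v) (at x) u) (at 0)"
      by (simp only: o_def)
    have lc: "continuous_on UNIV (\<lambda>h. x + h *\<^sub>R u)" by (intro continuous_intros)
    have 3: "((\<lambda>h. \<omega> j (ci j (x + h *\<^sub>R u)) (f (x + h *\<^sub>R u)) v) has_vector_derivative frechet_derivative (\<lambda>y. \<beta> j (ci j y) v) (at x) u) (at 0)"
    proof (rule has_vector_derivative_transform_within_open[OF 2 open_vimage[OF open_Cr[of j] lc]])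
      show "0 \<in> (\<lambda>h. x + h *\<^sub>R u) -` Cr j" using x by simp
      fix h assume "h \<in> (\<lambda>h. x + h *\<^sub>R u) -` Cr j"
      then have c: "ci j (x + h *\<^sub>R u) \<in> Cd j" by (intro ci_in) (rule vimageD)
      show "\<beta> j (ci j (x + h *\<^sub>R u)) v = \<omega> j (ci j (x + h *\<^sub>R u)) (f (x + h *\<^sub>R u)) v"
        unfolding f_def by (rule sgrad_eq[of _ j \<beta>, OF c one_form_linear[OF \<beta>1 c], symmetric])
    qed
    show ?thesis by (rule vector_derivative_unique_at[OF 3 1])
  qed
  have "frechet_derivative (\<lambda>y. \<beta> j (ci j y) v) (at x) u - frechet_derivative (\<lambda>y. \<beta> j (ci j y) u) (at x) v = 0"
    using \<beta> x unfolding closed_one_form_def by blast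
  then have "?W (f x) v u + \<omega> j (ci j x) (?f' u) v - (?W (f x) u v + \<omega> j (ci j x) (?f' v) u) = 0"
    by (simp only: d\<beta>)
  moreover have "?W u v (f x) + ?W v (f x) u + ?W (f x) u v = 0"
    by (rule om_closed[OF x])
  moreover have "?W v (f x) u = - ?W (f x) v u" by (rule anti)
  moreover have "\<omega> j (ci j x) (?f' v) u = - \<omega> j (ci j x) u (?f' v)"
    by (rule om_antisym[OF ci_in[OF x]])
  ultimately show ?thesis by linarith
qed

text \<open>The pulled-back value \<open>Q t\<close> is constant in time: the group law moves its
  derivative at \<open>t\<close> to time \<open>0\<close> at the point \<open>\<psi> t p\<close>,
  where it is the expression in \<open>locally_hamiltonian_infinitesimal\<close>.\<close>

lemma locally_hamiltonian_flow_symplectic: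
  assumes \<beta>: "closed_one_form A \<beta>" and \<psi>: "flow (sgrad \<omega> \<beta>) \<psi>"
    and i: "p \<in> Cd i" and j: "\<psi> t p \<in> Cd j"
  shows "\<omega> j (\<psi> t p) (dflow \<psi> i j t p u) (dflow \<psi> i j t p v) = \<omega> i p u v"
proof -
  let ?Z = "sgrad \<omega> \<beta>"
  have \<beta>1: "one_form A \<beta>" using \<beta> by (simp add: closed_one_form_def)
  have Z: "vector_field ?Z" by (rule sgrad_vector_field[OF \<beta>1])
  \<comment> \<open>A chart is chosen anew at each time, since the orbit may leave any single one;
    by \<open>Qj\<close> the value does not depend on the choice.\<close>
  define c where "c t = (SOME j. \<psi> t p \<in> Cd j)" for t
  have c: "\<psi> t p \<in> Cd (c t)" for t unfolding c_def by (rule someI_ex[OF ex_chart])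
  define Q where "Q t = \<omega> (c t) (\<psi> t p) (dflow \<psi> i (c t) t p u) (dflow \<psi> i (c t) t p v)" for t
  have Qj: "Q t = \<omega> j (\<psi> t p) (dflow \<psi> i j t p u) (dflow \<psi> i j t p v)" if j: "\<psi> t p \<in> Cd j" for t j
  proof -
    have j0: "\<psi> (0 + t) p \<in> Cd j" using j by simp
    have "dflow \<psi> i j t p w = tchange A (c t) j (\<psi> t p) (dflow \<psi> i (c t) t p w)" for w
      using dflow_compose[OF Z \<psi> i c[of t] j0, of w] dflow_0[OF Z \<psi>] by simp
    then show ?thesis by (simp only: Q_def om_tchange[OF c j])
  qed
  have "(Q has_real_derivative 0) (at t)" for t
  proof -
    obtain j where j: "\<psi> t p \<in> Cd j" using ex_chart by blast
    let ?q = "\<psi> t p" and ?f = "\<lambda>x. ?Z j (ci j x)"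
    let ?D = "\<lambda>w s. dflow \<psi> j j s ?q (dflow \<psi> i j t p w)"
    have q0: "\<psi> 0 ?q \<in> Cd j" using j flow_0[OF \<psi>] by simp
    have x: "((\<lambda>s. cm j (\<psi> s ?q)) has_vector_derivative ?f (cm j ?q)) (at 0)"
      using flow_chart_derivative[OF Z \<psi> q0] j by (simp add: flow_0[OF \<psi>])
    have D: "(?D w has_vector_derivative frechet_derivative ?f (at (cm j ?q)) (dflow \<psi> i j t p w)) (at 0)" for w
      by (rule dflow_time_derivative[OF Z \<psi> j])
    have D0: "?D w 0 = dflow \<psi> i j t p w" for w
      by (simp add: dflow_0[OF Z \<psi>] tchange_self[OF j])
    have bl: "bilinear (\<omega> j (ci j y))" if "y \<in> Cr j" for y by (rule om_bilinear[OF ci_in[OF that]])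
    have W: "((\<lambda>y. \<omega> j (ci j y) v w) has_derivative frechet_derivative (\<lambda>y. \<omega> j (ci j y) v w) (at y)) (at y)"
      if "y \<in> Cr j" for v w y
      by (rule smooth_on_has_derivative[OF om_smooth that])
    have c0: "cm j (\<psi> 0 ?q) \<in> Cr j" using q0 by simp
    have "((\<lambda>s. \<omega> j (ci j (cm j (\<psi> s ?q))) (?D u s) (?D v s)) has_real_derivative 0) (at 0)"
      using bilinear_family_has_derivative[OF open_Cr bl W x c0 D[of u] D[of v]]
      unfolding D0 flow_0[OF \<psi>] locally_hamiltonian_infinitesimal[OF \<beta> cm_in[OF j]] .
    then have d: "((\<lambda>s. \<omega> j (ci j (cm j (\<psi> s ?q))) (?D u s) (?D v s)) has_vector_derivative 0) (at 0)"
      by (simp add: has_real_derivative_iff_has_vector_derivative)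
    have ct: "continuous_on UNIV (\<lambda>s. \<psi> s ?q)"
      using flow_curve[OF \<psi>] unfolding integral_curve_def by blast
    have "((\<lambda>s. Q (t + s)) has_vector_derivative 0) (at 0)"
    proof (rule has_vector_derivative_transform_within_open[OF d open_vimage[OF open_Cd[of j] ct]])
      show "0 \<in> (\<lambda>s. \<psi> s ?q) -` Cd j" using q0 by simp
      fix s assume "s \<in> (\<lambda>s. \<psi> s ?q) -` Cd j"
      then have s: "\<psi> s ?q \<in> Cd j" by (rule vimageD)
      then have s': "\<psi> (s + t) p \<in> Cd j" by (simp add: flow_add[OF Z \<psi>])
      have "?D w s = dflow \<psi> i j (s + t) p w" for w
        by (rule dflow_compose[OF Z \<psi> i j s', symmetric])
      then show "\<omega> j (ci j (cm j (\<psi> s ?q))) (?D u s) (?D v s) = Q (t + s)"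
        using s Qj[OF s'] by (simp add: flow_add[OF Z \<psi>] add.commute)
    qed
    then show ?thesis
      by (simp add: has_vector_derivative_shift has_real_derivative_iff_has_vector_derivative)
  qed
  then have "Q t = Q 0" by (rule DERIV_isconst_all[OF allI])
  moreover have "Q 0 = \<omega> i p u v"
  proof -
    have "\<psi> 0 p \<in> Cd i" using i flow_0[OF \<psi>] by simp
    from Qj[OF this] show ?thesis by (simp add: dflow_0[OF Z \<psi>] tchange_self[OF i] flow_0[OF \<psi>])
  qed
  ultimately show ?thesis using Qj[OF j] by simp
qed

end

section \<open>Product manifolds and Hamiltonian isotopies\<close>

lemma cdom_prod_atlas: "cdom (prod_atlas A B (i, j)) = cdom (A i) \<times> cdom (B j)"
  and cmap_prod_atlas: "cmap (prod_atlas A B (i, j)) (p, q) = (cmap (A i) p, cmap (B j) q)"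
  and crange_prod_atlas: "crange (prod_atlas A B (i, j)) = crange (A i) \<times> crange (B j)"
  by (auto simp: prod_atlas_def image_iff)

lemma cmap_prod_atlas_image:
  "cmap (prod_atlas A B (i, j)) ` (S \<times> T) = cmap (A i) ` S \<times> cmap (B j) ` T"
  unfolding prod_atlas_def by force

text \<open>\<open>cinv\<close> is a choice of preimage, so the product chart has to be injective
  before it can be evaluated.\<close>

lemma cinv_prod_atlas:
  assumes A: "smooth_atlas A" and B: "smooth_atlas B" and x: "x \<in> crange (A i)" and y: "y \<in> crange (B j)"
  shows "cinv (prod_atlas A B (i, j)) (x, y) = (cinv (A i) x, cinv (B j) y)"
proof -
  interpret A: smooth_manifold A by (rule smooth_manifold.intro[OF A])
  interpret B: smooth_manifold B by (rule smooth_manifold.intro[OF B])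
  have "inj_on (cmap (prod_atlas A B (i, j))) (cdom (prod_atlas A B (i, j)))"
  proof (rule inj_onI)
    fix a b assume ab: "a \<in> cdom (prod_atlas A B (i, j))" "b \<in> cdom (prod_atlas A B (i, j))"
      and eq: "cmap (prod_atlas A B (i, j)) a = cmap (prod_atlas A B (i, j)) b"
    obtain p q p' q' where [simp]: "a = (p, q)" "b = (p', q')" by (cases a, cases b)
    have "p \<in> cdom (A i)" "p' \<in> cdom (A i)" "q \<in> cdom (B j)" "q' \<in> cdom (B j)"
      using ab by (auto simp: cdom_prod_atlas)
    moreover have "cmap (A i) p = cmap (A i) p'" "cmap (B j) q = cmap (B j) q'"
      using eq by (auto simp: cmap_prod_atlas)
    ultimately show "a = b" by (metis A.ci_cm B.ci_cm \<open>a = (p, q)\<close> \<open>b = (p', q')\<close>)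
  qed
  then show ?thesis
    unfolding cinv_def[of "prod_atlas A B (i, j)"]
    by (rule inv_into_f_eq) (use x y in \<open>simp_all only: cdom_prod_atlas cmap_prod_atlas mem_Sigma_iff A.ci_in B.ci_in A.cm_ci B.cm_ci simp_thms\<close>)
qed

lemma smooth_on_prod_map:
  assumes "open S" "open T" "smooth_on f S" "smooth_on g T"
  shows "smooth_on (\<lambda>z. (f (fst z), g (snd z))) (S \<times> T)"
proof (rule smooth_on_Pair)
  show o: "open (S \<times> T)" using assms by (intro open_Times)
  show "smooth_on (\<lambda>z. f (fst z)) (S \<times> T)" by (rule smooth_on_fst_compose[OF assms(1,2,3)])
  show "smooth_on (\<lambda>z. g (snd z)) (S \<times> T)"
    by (rule smooth_on_compose[OF o assms(2) _ smooth_on_bounded_linear[OF o bounded_linear_snd] assms(4)]) auto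
qed

lemma smooth_atlas_prod:
  fixes A :: "('i, 'a::{second_countable_topology,t2_space}, 'e::euclidean_space) atlas"
    and B :: "('j, 'b::{second_countable_topology,t2_space}, 'f::euclidean_space) atlas"
  assumes A: "smooth_atlas A" and B: "smooth_atlas B"
  shows "smooth_atlas (prod_atlas A B)"
proof -
  interpret A: smooth_manifold A by (rule smooth_manifold.intro[OF A])
  interpret B: smooth_manifold B by (rule smooth_manifold.intro[OF B])
  note inv = cinv_prod_atlas[OF A B]
  show ?thesis
    unfolding smooth_atlas_def
  proof (intro conjI allI)
    show "(\<Union>k. cdom (prod_atlas A B k)) = UNIV"
    proof (intro set_eqI iffI UNIV_I)
      fix z :: "'a \<times> 'b"
      obtain p q where z: "z = (p, q)" by (cases z)
      obtain i j where "p \<in> cdom (A i)" "q \<in> cdom (B j)" using A.ex_chart B.ex_chart by blast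
      then have "z \<in> cdom (prod_atlas A B (i, j))" by (simp add: z cdom_prod_atlas)
      then show "z \<in> (\<Union>k. cdom (prod_atlas A B k))" by blast
    qed
    fix k :: "'i \<times> 'j"
    obtain i j where k: "k = (i, j)" by (cases k)
    let ?D = "cdom (A i) \<times> cdom (B j)" and ?R = "crange (A i) \<times> crange (B j)"
    show "open (cdom (prod_atlas A B k))" by (simp add: k cdom_prod_atlas open_Times A.open_Cd B.open_Cd)
    show "open (crange (prod_atlas A B k))" unfolding k crange_prod_atlas by (intro open_Times A.open_Cr B.open_Cr)
    show "homeomorphism (cdom (prod_atlas A B k)) (crange (prod_atlas A B k)) (cmap (prod_atlas A B k)) (cinv (prod_atlas A B k))"
      unfolding k crange_prod_atlas
      unfolding cdom_prod_atlas
    proof (rule homeomorphismI)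
      have "continuous_on ?D (\<lambda>z. (cmap (A i) (fst z), cmap (B j) (snd z)))"
        by (intro continuous_intros continuous_on_compose2[OF A.continuous_on_cm] continuous_on_compose2[OF B.continuous_on_cm]) auto
      then show "continuous_on ?D (cmap (prod_atlas A B (i, j)))"
        by (rule continuous_on_eq) (auto simp: cmap_prod_atlas)
      have "continuous_on ?R (\<lambda>z. (cinv (A i) (fst z), cinv (B j) (snd z)))"
        by (intro continuous_intros continuous_on_compose2[OF A.continuous_on_ci] continuous_on_compose2[OF B.continuous_on_ci]) auto
      then show "continuous_on ?R (cinv (prod_atlas A B (i, j)))"
      proof (rule continuous_on_eq)
        fix z assume "z \<in> ?R"
        then show "(cinv (A i) (fst z), cinv (B j) (snd z)) = cinv (prod_atlas A B (i, j)) z"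
          by (cases z) (simp only: mem_Sigma_iff inv fst_conv snd_conv)
      qed
      show "cmap (prod_atlas A B (i, j)) ` ?D \<subseteq> ?R"
        by (auto simp: cmap_prod_atlas)
      show "cinv (prod_atlas A B (i, j)) ` ?R \<subseteq> ?D"
      proof (rule image_subsetI)
        fix z assume z: "z \<in> ?R"
        obtain x y where xy: "z = (x, y)" by (cases z)
        have xr: "x \<in> crange (A i)" "y \<in> crange (B j)" using z unfolding xy by blast+
        show "cinv (prod_atlas A B (i, j)) z \<in> ?D"
          unfolding xy inv[OF xr] using A.ci_in[OF xr(1)] B.ci_in[OF xr(2)] by simp
      qed
      show "cinv (prod_atlas A B (i, j)) (cmap (prod_atlas A B (i, j)) z) = z" if z: "z \<in> ?D" for z
      proof -
        obtain p q where pq: "z = (p, q)" by (cases z)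
        have d: "p \<in> cdom (A i)" "q \<in> cdom (B j)" using z by (simp_all add: pq)
        show ?thesis unfolding pq cmap_prod_atlas inv[OF A.cm_in[OF d(1)] B.cm_in[OF d(2)]] using d by simp
      qed
      show "cmap (prod_atlas A B (i, j)) (cinv (prod_atlas A B (i, j)) z) = z" if z: "z \<in> ?R" for z
      proof -
        obtain x y where xy: "z = (x, y)" by (cases z)
        have xr: "x \<in> crange (A i)" "y \<in> crange (B j)" using z unfolding xy by blast+
        show ?thesis unfolding xy inv[OF xr] cmap_prod_atlas A.cm_ci[OF xr(1)] B.cm_ci[OF xr(2)] ..
      qed
    qed
    fix l :: "'i \<times> 'j"
    obtain i' j' where l: "l = (i', j')" by (cases l)
    let ?O = "cmap (A i) ` (cdom (A i) \<inter> cdom (A i')) \<times> cmap (B j) ` (cdom (B j) \<inter> cdom (B j'))"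
    have img: "cmap (prod_atlas A B k) ` (cdom (prod_atlas A B k) \<inter> cdom (prod_atlas A B l)) = ?O"
      unfolding k l cdom_prod_atlas Times_Int_Times cmap_prod_atlas_image ..
    have o: "open ?O" by (intro open_Times A.open_overlap B.open_overlap)
    have sm: "smooth_on (\<lambda>z. ((cmap (A i') \<circ> cinv (A i)) (fst z), (cmap (B j') \<circ> cinv (B j)) (snd z))) ?O"
      by (rule smooth_on_prod_map[OF A.open_overlap B.open_overlap A.transition_smooth B.transition_smooth])
    show "smooth_on (cmap (prod_atlas A B l) \<circ> cinv (prod_atlas A B k)) (cmap (prod_atlas A B k) ` (cdom (prod_atlas A B k) \<inter> cdom (prod_atlas A B l)))"
      unfolding img
    proof (rule smooth_on_cong[OF o _ sm])
      fix z assume z: "z \<in> ?O"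
      obtain x y where xy: "z = (x, y)" by (cases z)
      have xr: "x \<in> crange (A i)" "y \<in> crange (B j)" using z unfolding xy by blast+
      show "((cmap (A i') \<circ> cinv (A i)) (fst z), (cmap (B j') \<circ> cinv (B j)) (snd z)) = (cmap (prod_atlas A B l) \<circ> cinv (prod_atlas A B k)) z"
        unfolding xy k l comp_apply inv[OF xr] cmap_prod_atlas by simp
    qed
  qed
qed

lemma smooth_fun_prod_iff:
  assumes A: "smooth_atlas A" and B: "smooth_atlas B"
  shows "smooth_fun (prod_atlas A B) f \<longleftrightarrow>
    (\<forall>i j. smooth_on (\<lambda>z. f (cinv (A i) (fst z), cinv (B j) (snd z))) (crange (A i) \<times> crange (B j)))"
proof -
  interpret A: smooth_manifold A by (rule smooth_manifold.intro[OF A])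
  interpret B: smooth_manifold B by (rule smooth_manifold.intro[OF B])
  have o: "open (crange (A i) \<times> crange (B j))" for i j by (intro open_Times A.open_Cr B.open_Cr)
  have e: "f (cinv (A i) (fst z), cinv (B j) (snd z)) = (f \<circ> cinv (prod_atlas A B (i, j))) z"
    if z: "z \<in> crange (A i) \<times> crange (B j)" for i j z
  proof -
    obtain x y where xy: "z = (x, y)" by (cases z)
    have xr: "x \<in> crange (A i)" "y \<in> crange (B j)" using z unfolding xy by blast+
    show ?thesis unfolding xy comp_apply cinv_prod_atlas[OF A B xr] by simp
  qed
  have "smooth_on (f \<circ> cinv (prod_atlas A B (i, j))) (crange (prod_atlas A B (i, j))) \<longleftrightarrow>
    smooth_on (\<lambda>z. f (cinv (A i) (fst z), cinv (B j) (snd z))) (crange (A i) \<times> crange (B j))" for i j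
    unfolding crange_prod_atlas
  proof
    let ?f = "f \<circ> cinv (prod_atlas A B (i, j))" and ?g = "\<lambda>z. f (cinv (A i) (fst z), cinv (B j) (snd z))"
    show "smooth_on ?g (crange (A i) \<times> crange (B j))" if "smooth_on ?f (crange (A i) \<times> crange (B j))"
      by (rule smooth_on_cong[OF o _ that]) (rule e[symmetric])
    show "smooth_on ?f (crange (A i) \<times> crange (B j))" if "smooth_on ?g (crange (A i) \<times> crange (B j))"
      by (rule smooth_on_cong[OF o _ that]) (rule e)
  qed
  then show ?thesis by (simp only: smooth_fun_def split_paired_All)
qed

lemma tchange_prod_atlas:
  assumes A: "smooth_atlas A" and B: "smooth_atlas B"
    and p: "p \<in> cdom (A i)" "p \<in> cdom (A i')" and q: "q \<in> cdom (B j)" "q \<in> cdom (B j')"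
  shows "tchange (prod_atlas A B) (i, j) (i', j') (p, q) (v, w) = (tchange A i i' p v, tchange B j j' q w)"
proof -
  interpret A: smooth_manifold A by (rule smooth_manifold.intro[OF A])
  interpret B: smooth_manifold B by (rule smooth_manifold.intro[OF B])
  let ?z = "(cmap (A i) p, cmap (B j) q)"
  have dA: "((cmap (A i') \<circ> cinv (A i)) has_derivative tchange A i i' p) (at (fst ?z))"
    using A.tchange_has_derivative[OF p] by simp
  have dB: "((cmap (B j') \<circ> cinv (B j)) has_derivative tchange B j j' q) (at (snd ?z))"
    using B.tchange_has_derivative[OF q] by simp
  have "((\<lambda>z. ((cmap (A i') \<circ> cinv (A i)) (fst z), (cmap (B j') \<circ> cinv (B j)) (snd z))) has_derivative
      (\<lambda>h. (tchange A i i' p (fst h), tchange B j j' q (snd h)))) (at ?z)"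
    by (rule has_derivative_Pair[OF has_derivative_compose[OF has_derivative_fst[OF has_derivative_ident] dA]
        has_derivative_compose[OF has_derivative_snd[OF has_derivative_ident] dB]])
  then have "((cmap (prod_atlas A B (i', j')) \<circ> cinv (prod_atlas A B (i, j))) has_derivative
      (\<lambda>h. (tchange A i i' p (fst h), tchange B j j' q (snd h)))) (at ?z)"
  proof (rule has_derivative_transform_within_open)
    show "open (crange (A i) \<times> crange (B j))" by (intro open_Times A.open_Cr B.open_Cr)
    show "?z \<in> crange (A i) \<times> crange (B j)" using A.cm_in[OF p(1)] B.cm_in[OF q(1)] by blast
    fix z assume z: "z \<in> crange (A i) \<times> crange (B j)"
    obtain x y where xy: "z = (x, y)" by (cases z)
    have xr: "x \<in> crange (A i)" "y \<in> crange (B j)" using z unfolding xy by blast+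
    show "((cmap (A i') \<circ> cinv (A i)) (fst z), (cmap (B j') \<circ> cinv (B j)) (snd z)) = (cmap (prod_atlas A B (i', j')) \<circ> cinv (prod_atlas A B (i, j))) z"
      unfolding xy comp_apply cinv_prod_atlas[OF A B xr] cmap_prod_atlas by simp
  qed
  from frechet_derivative_eq[OF this] show ?thesis
    unfolding tchange_def[of "prod_atlas A B"] cmap_prod_atlas by simp
qed

lemma cdom_real_atlas: "cdom (real_atlas u) = UNIV"
  and cmap_real_atlas: "cmap (real_atlas u) = id"
  and crange_real_atlas: "crange (real_atlas u) = UNIV"
  and cinv_real_atlas: "cinv (real_atlas u) = id"
proof -
  show "cdom (real_atlas u) = UNIV" "cmap (real_atlas u) = id" "crange (real_atlas u) = UNIV"
    by (simp_all add: real_atlas_def)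
  have "inv_into UNIV (\<lambda>x::real. x) = id" by (rule inv_unique_comp) auto
  then show "cinv (real_atlas u) = id"
    by (simp add: real_atlas_def cinv_def id_def)
qed

lemma smooth_atlas_real: "smooth_atlas real_atlas"
  unfolding smooth_atlas_def cdom_real_atlas cmap_real_atlas cinv_real_atlas
  by (auto simp: homeomorphism_def intro!: smooth_on_bounded_linear bounded_linear_ident[folded id_def])

section \<open>Functions transported by a flow\<close>

context smooth_manifold
begin

context
  fixes X \<psi>
  assumes X: "vector_field X" and \<psi>: "flow X \<psi>"
begin

text \<open>The isotopy constructed below moves the point and the time together, which calls for the
  total derivative: \<open>dflow\<close> in space and the generator in time.\<close>

lemma flow_chart_has_derivative:
  assumes j: "q \<in> Cd j" and k: "\<psi> \<tau> q \<in> Cd k"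
  shows "((\<lambda>w. cm k (\<psi> (snd w) (ci j (fst w)))) has_derivative
    (\<lambda>w. dflow \<psi> j k \<tau> q (fst w) + snd w *\<^sub>R X k (\<psi> \<tau> q))) (at (cm j q, \<tau>))"
proof -
  let ?R = "\<lambda>w. cm k (\<psi> (snd w) (ci j (fst w)))"
  have "\<psi> \<tau> (ci j (cm j q)) \<in> Cd k" using j k by simp
  from flow_chart_smooth[OF X \<psi> cm_in[OF j] this] obtain W where W: "open W" "(cm j q, \<tau>) \<in> W"
    and s: "smooth_on ?R W" by blast
  let ?D = "frechet_derivative ?R (at (cm j q, \<tau>))"
  have d: "(?R has_derivative ?D) (at (cm j q, \<tau>))" by (rule smooth_on_has_derivative[OF s W(2)])
  have lin: "linear ?D" using d by (rule has_derivative_linear)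
  have "((\<lambda>z. (z, \<tau>)) has_derivative (\<lambda>v. (v, 0))) (at (cm j q))"
    by (auto intro!: derivative_eq_intros)
  from has_derivative_compose[OF this d]
  have "((\<lambda>z. cm k (\<psi> \<tau> (ci j z))) has_derivative (\<lambda>v. ?D (v, 0))) (at (cm j q))" by simp
  from fun_cong[OF has_derivative_unique[OF dflow_has_derivative[OF X \<psi> j k] this]]
  have 1: "dflow \<psi> j k \<tau> q v = ?D (v, 0)" for v .
  have l: "((\<lambda>s. (cm j q, s)) has_vector_derivative (0, 1)) (at \<tau>)"
    by (auto intro!: derivative_eq_intros simp: has_vector_derivative_def)
  from vector_derivative_diff_chain_within[of "\<lambda>s. (cm j q, s)" "(0, 1)" \<tau> UNIV, OF l has_derivative_at_withinI[OF d]]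
  have 2: "((\<lambda>s. cm k (\<psi> s q)) has_vector_derivative ?D (0, 1)) (at \<tau>)"
    using j by (simp add: o_def)
  have 3: "X k (\<psi> \<tau> q) = ?D (0, 1)"
    by (rule vector_derivative_unique_at[OF flow_chart_derivative[OF X \<psi> k] 2])
  have "?D w = dflow \<psi> j k \<tau> q (fst w) + snd w *\<^sub>R X k (\<psi> \<tau> q)" for w
  proof -
    have "w = (fst w, 0) + snd w *\<^sub>R (0, 1)" by (simp add: prod_eq_iff)
    then have "?D w = ?D ((fst w, 0) + snd w *\<^sub>R (0, 1))" by (rule arg_cong)
    then show ?thesis by (simp only: linear_add[OF lin] linear_scale[OF lin] 1 3)
  qed
  then have "?D = (\<lambda>w. dflow \<psi> j k \<tau> q (fst w) + snd w *\<^sub>R X k (\<psi> \<tau> q))" by (rule ext)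
  with d show ?thesis by simp
qed

text \<open>The affine time \<open>a + b * t\<close> covers two uses: the generator of the isotopy,
  at time \<open>1 - t\<close>, and the integrand of the weighted average, at time
  \<open>t\<close>.\<close>

lemma smooth_fun_flow:
  assumes g: "smooth_fun A g"
  shows "smooth_fun (prod_atlas A real_atlas) (\<lambda>(p, t). g (\<psi> (a + b * t) p))"
proof -
  have "smooth_on (\<lambda>z. g (\<psi> (a + b * snd z) (ci i (fst z)))) (Cr i \<times> UNIV)" for i
  proof (rule smooth_on_local)
    fix z0 :: "'e \<times> real" assume z0: "z0 \<in> Cr i \<times> UNIV"
    obtain x t where xt: "z0 = (x, t)" by (cases z0)
    have x: "x \<in> Cr i" using z0 unfolding xt by blast
    obtain j where j: "\<psi> (a + b * t) (ci i x) \<in> Cd j" using ex_chart by blast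
    obtain W where W: "open W" "(x, a + b * t) \<in> W" "\<forall>q\<in>W. fst q \<in> Cr i \<and> \<psi> (snd q) (ci i (fst q)) \<in> Cd j"
      and s: "smooth_on (\<lambda>q. cm j (\<psi> (snd q) (ci i (fst q)))) W"
      using flow_chart_smooth[OF X \<psi> x j] by blast
    have "smooth_on (\<lambda>q. g (ci j (cm j (\<psi> (snd q) (ci i (fst q)))))) W"
      by (rule smooth_on_compose[OF W(1) open_Cr _ s smooth_fun_chart[OF g]]) (use W(3) in simp)
    then have s1: "smooth_on (\<lambda>q. g (\<psi> (snd q) (ci i (fst q)))) W"
      by (rule smooth_on_cong[OF W(1), rotated]) (use W(3) in simp)
    let ?m = "\<lambda>z::'e \<times> real. (fst z, a + b * snd z)"
    let ?V = "?m -` W"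
    have V: "open ?V" by (rule open_vimage[OF W(1)]) (intro continuous_intros)
    have "smooth_on (\<lambda>z::'e \<times> real. a + b * snd z) ?V"
      by (intro smooth_on_add V smooth_on_const smooth_on_mult smooth_on_bounded_linear bounded_linear_snd)
    then have "smooth_on ?m ?V"
      by (rule smooth_on_Pair[OF V smooth_on_bounded_linear[OF V bounded_linear_fst]])
    from smooth_on_compose[OF V W(1) _ this s1]
    have "smooth_on (\<lambda>z. g (\<psi> (a + b * snd z) (ci i (fst z)))) ?V" by simp
    moreover have "z0 \<in> ?V" using W(2) by (simp add: xt)
    ultimately show "\<exists>T. open T \<and> z0 \<in> T \<and> smooth_on (\<lambda>z. g (\<psi> (a + b * snd z) (ci i (fst z)))) T"
      using V by blast
  qed
  then show ?thesis
    unfolding smooth_fun_prod_iff[OF atlas smooth_atlas_real] cinv_real_atlas crange_real_atlas by simp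
qed

end

end

section \<open>The Hamiltonian isotopy between flows of cohomologous forms\<close>

context symplectic_mfd
begin

text \<open>The isotopy \<open>\<theta>\<^sub>t = \<psi>\<^sub>t\<^sub>-\<^sub>1 \<psi>'\<^sub>1\<^sub>-\<^sub>t (\<psi>'\<^sub>1)\<^sup>-\<^sup>1 \<psi>\<^sub>1\<close> runs from \<open>id\<close> to \<open>(\<psi>'\<^sub>1)\<^sup>-\<^sup>1 \<psi>\<^sub>1\<close>. Its velocity is the image of
  \<open>sgrad \<beta> - sgrad (\<beta> + dg)\<close> under the symplectic map \<open>\<psi>\<^sub>t\<^sub>-\<^sub>1\<close>, so it is generated by \<open>g \<circ> \<psi>\<^sub>1\<^sub>-\<^sub>t\<close>.\<close>

theorem hamiltonian_isotopy:
  assumes \<beta>: "closed_one_form A \<beta>" and \<psi>: "flow (sgrad \<omega> \<beta>) \<psi>" and g: "smooth_fun A g"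
    and \<psi>': "flow (sgrad \<omega> (\<lambda>i p v. \<beta> i p v + differential A g i p v)) \<psi>'"
  shows "hamiltonian_diffeo A \<omega> (inv (\<psi>' 1) \<circ> \<psi> 1)"
proof -
  let ?\<beta>' = "\<lambda>i p v. \<beta> i p v + differential A g i p v"
  let ?Z = "sgrad \<omega> \<beta>" and ?Z' = "sgrad \<omega> ?\<beta>'"
  have \<beta>1: "one_form A \<beta>" using \<beta> by (simp add: closed_one_form_def)
  have \<beta>': "one_form A ?\<beta>'" by (rule one_form_add[OF \<beta>1 differential_one_form[OF g]])
  have Z: "vector_field ?Z" by (rule sgrad_vector_field[OF \<beta>1])
  have Z': "vector_field ?Z'" by (rule sgrad_vector_field[OF \<beta>'])
  define H where "H = (\<lambda>(p, t). g (\<psi> (1 + (-1) * t) p))"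
  have H: "smooth_fun (prod_atlas A real_atlas) H"
    unfolding H_def by (rule smooth_fun_flow[OF Z \<psi> g])
  have bij\<psi>: "bij (\<psi> t)" and bij\<psi>': "bij (\<psi>' t)" for t
    using \<psi> \<psi>' by (simp_all add: is_flow_def)
  \<comment> \<open>Base point of the reversed orbit, placed so that the isotopy starts at the
    identity.\<close>
  define y where "y x = inv (\<psi>' 1) (\<psi> 1 x)" for x
  define \<theta> where "\<theta> t x = \<psi> (t - 1) (\<psi>' (1 - t) (y x))" for t x
  have bijy: "bij y" unfolding y_def using bij_comp[OF bij\<psi>[of 1] bij_imp_bij_inv[OF bij\<psi>'[of 1]]] by (simp add: o_def)
  have "is_flow A (\<lambda>t. sgrad_fun A \<omega> (\<lambda>x. H (x, t))) {0..1} \<theta>"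
    unfolding is_flow_def
  proof (intro conjI allI ballI)
    show "\<theta> 0 = id"
    proof
      fix x
      have "\<psi>' 1 (y x) = \<psi> 1 x" unfolding y_def by (rule surj_f_inv_f[OF bij_is_surj[OF bij\<psi>']])
      then show "\<theta> 0 x = id x" using flow_add[OF Z \<psi>, of "-1" 1 x] flow_0[OF \<psi>] by (simp add: \<theta>_def)
    qed
    show "bij (\<theta> t)" for t
      using bij_comp[OF bijy bij_comp[OF bij\<psi>'[of "1 - t"] bij\<psi>[of "t - 1"]]] by (simp add: \<theta>_def[abs_def] o_def)
    show "integral_curve A (\<lambda>t. sgrad_fun A \<omega> (\<lambda>x. H (x, t))) {0..1} (\<lambda>t. \<theta> t x)" for x
      unfolding integral_curve_def
    proof (intro conjI ballI allI impI)
      have c': "continuous_on UNIV (\<lambda>s. \<psi>' s (y x))"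
        using flow_curve[OF \<psi>'] unfolding integral_curve_def by blast
      have c1: "continuous_on {0..1} (\<lambda>t. \<psi>' (1 - t) (y x))"
        by (rule continuous_on_compose2[OF c']) (auto intro!: continuous_intros)
      have "continuous_on {0..1} (\<lambda>t. \<psi> (snd (\<psi>' (1 - t) (y x), t - 1)) (fst (\<psi>' (1 - t) (y x), t - 1)))"
        by (rule continuous_on_compose2[OF flow_continuous[OF Z \<psi>]]) (auto intro!: continuous_intros c1)
      then show "continuous_on {0..1} (\<lambda>t. \<theta> t x)" by (simp add: \<theta>_def)
      fix t k assume k: "\<theta> t x \<in> Cd k"
      let ?q = "\<psi>' (1 - t) (y x)"
      obtain j where j: "?q \<in> Cd j" using ex_chart by blast
      have k': "\<psi> (t - 1) ?q \<in> Cd k" using k by (simp add: \<theta>_def)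
      have return: "\<psi> (1 - t) (\<theta> t x) = ?q"
        using flow_add[OF Z \<psi>, of "1 - t" "t - 1" ?q] flow_0[OF \<psi>] by (simp add: \<theta>_def)
      let ?T = "dflow \<psi> j k (t - 1) ?q"
      have T: "linear ?T" by (rule dflow_linear[OF Z \<psi> j k'])
      let ?v = "?T (?Z j ?q - ?Z' j ?q)"
      have "((\<lambda>s. cm j (\<psi>' s (y x))) has_vector_derivative ?Z' j ?q) (at (1 - t))"
        by (rule flow_chart_derivative[OF Z' \<psi>' j])
      moreover have "((\<lambda>s. 1 - s) has_vector_derivative -1) (at t)" by (auto intro!: derivative_eq_intros)
      ultimately have "((\<lambda>s. cm j (\<psi>' (1 - s) (y x))) has_vector_derivative - ?Z' j ?q) (at t)"
        using vector_diff_chain_at[of "\<lambda>s. 1 - s" "-1" t "\<lambda>s. cm j (\<psi>' s (y x))"] by (simp add: o_def)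
      moreover have "((\<lambda>s. s - 1) has_vector_derivative 1) (at t)" by (auto intro!: derivative_eq_intros)
      ultimately have d1: "((\<lambda>s. (cm j (\<psi>' (1 - s) (y x)), s - 1)) has_vector_derivative (- ?Z' j ?q, 1)) (at t)"
        by (rule has_vector_derivative_Pair)
      from vector_derivative_diff_chain_within[of "\<lambda>s. (cm j (\<psi>' (1 - s) (y x)), s - 1)" _ t UNIV,
          OF d1 has_derivative_at_withinI[OF flow_chart_has_derivative[OF Z \<psi> j k']]]
      have "((\<lambda>s. cm k (\<psi> (s - 1) (ci j (cm j (\<psi>' (1 - s) (y x)))))) has_vector_derivative
          ?T (- ?Z' j ?q) + 1 *\<^sub>R ?Z k (\<psi> (t - 1) ?q)) (at t)"
        by (simp only: o_def fst_conv snd_conv)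
      \<comment> \<open>The outer flow contributes its generator at the endpoint, which by
        \<open>dflow_field\<close> is the image under \<open>?T\<close> of the generator at
        \<open>?q\<close>.\<close>
      also have "?T (- ?Z' j ?q) + 1 *\<^sub>R ?Z k (\<psi> (t - 1) ?q) = ?v"
        by (simp only: dflow_field[OF Z \<psi> j k', symmetric] scaleR_one linear_diff[OF T] linear_neg[OF T] uminus_add_conv_diff)
      finally have d2: "((\<lambda>s. cm k (\<psi> (s - 1) (ci j (cm j (\<psi>' (1 - s) (y x)))))) has_vector_derivative ?v) (at t)" .
      have cc: "continuous_on UNIV (\<lambda>s. \<psi>' (1 - s) (y x))"
        by (rule continuous_on_compose2[OF c']) (auto intro!: continuous_intros)
      have d3: "((\<lambda>s. cm k (\<theta> s x)) has_vector_derivative ?v) (at t)"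
      proof (rule has_vector_derivative_transform_within_open[OF d2 open_vimage[OF open_Cd[of j] cc]])
        show "t \<in> (\<lambda>s. \<psi>' (1 - s) (y x)) -` Cd j" using j by simp
        show "cm k (\<psi> (s - 1) (ci j (cm j (\<psi>' (1 - s) (y x))))) = cm k (\<theta> s x)"
          if "s \<in> (\<lambda>s. \<psi>' (1 - s) (y x)) -` Cd j" for s
          using that by (simp add: \<theta>_def)
      qed
      let ?h = "\<lambda>p. g (\<psi> (1 - t) p)"
      let ?S = "dflow \<psi> k j (1 - t) (\<theta> t x)"
      have jb: "\<psi> (1 - t) (\<theta> t x) \<in> Cd j" using j return by simp
      have "((\<lambda>z. g (ci j z)) has_derivative differential A g j ?q) (at (cm j (\<psi> (1 - t) (ci k (cm k (\<theta> t x))))))"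
        using differential_has_derivative[OF g j] k return by simp
      from has_derivative_compose[OF dflow_has_derivative[OF Z \<psi> k jb] this]
      have dh: "((\<lambda>z. g (ci j (cm j (\<psi> (1 - t) (ci k z))))) has_derivative (\<lambda>v. differential A g j ?q (?S v))) (at (cm k (\<theta> t x)))" .
      have "(?h \<circ> ci k has_derivative (\<lambda>v. differential A g j ?q (?S v))) (at (cm k (\<theta> t x)))"
      proof (rule has_derivative_transform_within_open[OF dh flow_vimage_open[OF Z \<psi> open_Cd[of j], of k "1 - t"]])
        show "cm k (\<theta> t x) \<in> {z \<in> Cr k. \<psi> (1 - t) (ci k z) \<in> Cd j}" using k jb by simp
        show "g (ci j (cm j (\<psi> (1 - t) (ci k z)))) = (?h \<circ> ci k) z" if "z \<in> {z \<in> Cr k. \<psi> (1 - t) (ci k z) \<in> Cd j}" for z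
          using that by simp
      qed
      from frechet_derivative_eq[OF this]
      have dh': "differential A ?h k (\<theta> t x) v = differential A g j ?q (?S v)" for v
        unfolding differential_def by simp
      have lin_h: "linear (\<lambda>v. - differential A ?h k (\<theta> t x) v)"
        unfolding dh'
        using linear_compose_neg[OF linear_compose[OF dflow_linear[OF Z \<psi> k jb] one_form_linear[OF differential_one_form[OF g] j]]]
        by (simp only: o_def)
      have sg: "sgrad \<omega> (\<lambda>i p v. - differential A ?h i p v) k (\<theta> t x) = ?v"
      proof (rule sgrad_unique[of "\<theta> t x" k "\<lambda>i p v. - differential A ?h i p v", OF k lin_h])
        fix v
        have kk: "\<psi> ((t - 1) + (1 - t)) (\<theta> t x) \<in> Cd k" using k flow_0[OF \<psi>] by simp
        \<comment> \<open>Every tangent vector \<open>v\<close> at \<open>\<theta> t x\<close> is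
          the image of \<open>?S v\<close> under \<open>?T\<close>. By invariance \<omega> may then
          be evaluated at \<open>?q\<close>, where the difference of the two gradients pairs to
          minus the differential of \<open>g\<close>.\<close>
        have "dflow \<psi> k k ((t - 1) + (1 - t)) (\<theta> t x) v = dflow \<psi> j k (t - 1) (\<psi> (1 - t) (\<theta> t x)) (?S v)"
          by (rule dflow_compose[OF Z \<psi> k jb kk])
        then have v: "?T (?S v) = v" by (simp add: return dflow_0[OF Z \<psi>] tchange_self[OF k])
        have "\<omega> k (\<psi> (t - 1) ?q) ?v (?T (?S v)) = \<omega> j ?q (?Z j ?q - ?Z' j ?q) (?S v)"
          by (rule locally_hamiltonian_flow_symplectic[OF \<beta> \<psi> j k'])
        also have "\<dots> = \<beta> j ?q (?S v) - ?\<beta>' j ?q (?S v)"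
          unfolding bilinear_lsub[OF om_bilinear[OF j]]
          using sgrad_eq[of ?q j \<beta>, OF j one_form_linear[OF \<beta>1 j]] sgrad_eq[of ?q j ?\<beta>', OF j one_form_linear[OF \<beta>' j]] by simp
        finally show "\<omega> k (\<theta> t x) ?v v = - differential A ?h k (\<theta> t x) v"
          unfolding v dh' by (simp add: \<theta>_def)
      qed
      have "(\<lambda>p. H (p, t)) = ?h" by (simp add: H_def)
      then have "sgrad_fun A \<omega> (\<lambda>p. H (p, t)) k (\<theta> t x) = ?v"
        unfolding sgrad_fun_def using sg by simp
      then show "((cm k \<circ> (\<lambda>t. \<theta> t x)) has_vector_derivative sgrad_fun A \<omega> (\<lambda>x. H (x, t)) k (\<theta> t x)) (at t within {0..1})"
        using has_vector_derivative_at_within[OF d3] by (simp only: o_def)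
    qed
  qed
  moreover have "\<theta> 1 = inv (\<psi>' 1) \<circ> \<psi> 1"
    by (auto simp: \<theta>_def y_def flow_0[OF \<psi>] flow_0[OF \<psi>'])
  ultimately show ?thesis unfolding hamiltonian_diffeo_def using H by metis
qed

end

section \<open>The circle and the stabilization\<close>

lemma inj_on_circle_of: "inj_on circle_of {a<..<a + 1}"
proof (rule inj_onI)
  fix x y assume xy: "x \<in> {a<..<a + 1}" "y \<in> {a<..<a + 1}" and eq: "circle_of x = circle_of y"
  from eq obtain n :: int where n: "x - y = of_int n"
    unfolding circle_of_eq_iff by (auto elim: Ints_cases)
  have "\<bar>x - y\<bar> < 1" using xy by auto
  then have "n = 0" unfolding n by linarith
  then show "x = y" using n by simp
qed

lemma cdom_circle_atlas: "cdom (circle_atlas a) = circle_of ` {a<..<a + 1}"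
  and cmap_circle_atlas: "cmap (circle_atlas a) = inv_into {a<..<a + 1} circle_of"
  by (simp_all add: circle_atlas_def)

lemma cmap_circle_of [simp]: "x \<in> {a<..<a + 1} \<Longrightarrow> cmap (circle_atlas a) (circle_of x) = x"
  unfolding cmap_circle_atlas by (rule inv_into_f_f[OF inj_on_circle_of])

lemma crange_circle_atlas: "crange (circle_atlas a) = {a<..<a + 1}"
  unfolding cdom_circle_atlas image_image by (simp cong: image_cong del: greaterThanLessThan_iff)

lemma cinv_circle_atlas: "x \<in> {a<..<a + 1} \<Longrightarrow> cinv (circle_atlas a) x = circle_of x"
  unfolding cinv_def
proof (rule inv_into_f_eq)
  show "inj_on (cmap (circle_atlas a)) (cdom (circle_atlas a))"
    unfolding cdom_circle_atlas
  proof (rule inj_onI)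
    fix p q assume "p \<in> circle_of ` {a<..<a + 1}" "q \<in> circle_of ` {a<..<a + 1}"
      and "cmap (circle_atlas a) p = cmap (circle_atlas a) q"
    then show "p = q" by (metis cmap_circle_of imageE)
  qed
qed (auto simp: cdom_circle_atlas)

lemma circle_homeomorphism:
  "homeomorphism (cdom (circle_atlas a)) (crange (circle_atlas a)) (cmap (circle_atlas a)) (cinv (circle_atlas a))"
proof (rule homeomorphismI)
  let ?I = "{a<..<a + 1}"
  show "cmap (circle_atlas a) ` cdom (circle_atlas a) \<subseteq> crange (circle_atlas a)" ..
  show "cinv (circle_atlas a) ` crange (circle_atlas a) \<subseteq> cdom (circle_atlas a)"
    unfolding crange_circle_atlas cdom_circle_atlas by (auto simp: cinv_circle_atlas)
  show "continuous_on (crange (circle_atlas a)) (cinv (circle_atlas a))"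
    unfolding crange_circle_atlas
    by (rule continuous_on_eq[OF continuous_on_circle_of]) (simp add: cinv_circle_atlas)
  show "cinv (circle_atlas a) (cmap (circle_atlas a) p) = p" if p: "p \<in> cdom (circle_atlas a)" for p
  proof -
    obtain x where x: "p = circle_of x" "x \<in> ?I" using p unfolding cdom_circle_atlas by (rule imageE)
    show ?thesis unfolding x(1) cmap_circle_of[OF x(2)] by (rule cinv_circle_atlas[OF x(2)])
  qed
  show "cmap (circle_atlas a) (cinv (circle_atlas a) x) = x" if x: "x \<in> crange (circle_atlas a)" for x
    using x unfolding crange_circle_atlas by (simp only: cinv_circle_atlas cmap_circle_of)
  show "continuous_on (cdom (circle_atlas a)) (cmap (circle_atlas a))"
    unfolding continuous_on_topological
  proof (intro ballI allI impI)
    fix p B assume p: "p \<in> cdom (circle_atlas a)" and B: "open B" "cmap (circle_atlas a) p \<in> B"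
    obtain x where x: "p = circle_of x" "x \<in> ?I" using p unfolding cdom_circle_atlas by (rule imageE)
    have "open (circle_of ` (B \<inter> ?I))" using B(1) by (intro open_circle_of_image open_Int) auto
    moreover have "p \<in> circle_of ` (B \<inter> ?I)" using x B(2) by (simp del: greaterThanLessThan_iff)
    moreover have "cmap (circle_atlas a) q \<in> B" if "q \<in> circle_of ` (B \<inter> ?I)" for q
      using that by (auto simp del: greaterThanLessThan_iff)
    ultimately show "\<exists>C. open C \<and> p \<in> C \<and> (\<forall>q\<in>cdom (circle_atlas a). q \<in> C \<longrightarrow> cmap (circle_atlas a) q \<in> B)"
      by blast
  qed
qed

text \<open>Two lifts of a point of the circle differ by an integer. On an overlap with two
  components the integer may change from one to the other, so the translation is stated
  locally.\<close>

lemma circle_transition: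
  assumes x: "x \<in> {a<..<a + 1}" and xb: "circle_of x \<in> cdom (circle_atlas b)"
  shows "\<exists>n e. 0 < e \<and> (\<forall>y. \<bar>y - x\<bar> < e \<longrightarrow> y \<in> {a<..<a + 1} \<and> circle_of y \<in> cdom (circle_atlas b) \<and>
    cmap (circle_atlas b) (circle_of y) = y + of_int n)"
proof -
  obtain x' where x': "circle_of x = circle_of x'" "x' \<in> {b<..<b + 1}" using xb unfolding cdom_circle_atlas by (rule imageE)
  from x'(1) have "x' - x \<in> \<int>" by (simp add: circle_of_eq_iff[symmetric])
  then obtain n :: int where "x' - x = of_int n" by (rule Ints_cases)
  then have n: "x' = x + of_int n" by simp
  have "open ({a<..<a + 1} \<inter> {b - of_int n<..<b + 1 - of_int n})" by (intro open_Int) auto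
  moreover have "x \<in> {a<..<a + 1} \<inter> {b - of_int n<..<b + 1 - of_int n}" using x x' n by auto
  ultimately obtain e where e: "0 < e" "ball x e \<subseteq> {a<..<a + 1} \<inter> {b - of_int n<..<b + 1 - of_int n}"
    using open_contains_ball by blast
  have "y \<in> {a<..<a + 1} \<and> circle_of y \<in> cdom (circle_atlas b) \<and> cmap (circle_atlas b) (circle_of y) = y + of_int n"
    if y: "\<bar>y - x\<bar> < e" for y
  proof -
    have "y \<in> ball x e" using y by (simp add: dist_real_def abs_minus_commute)
    then have 1: "y \<in> {a<..<a + 1}" "y + of_int n \<in> {b<..<b + 1}" using e(2) by auto
    have "circle_of y = circle_of (y + of_int n)" by (simp add: circle_of_eq_iff)
    then show ?thesis using 1(1) cmap_circle_of[OF 1(2)] 1(2) unfolding cdom_circle_atlas by (simp del: greaterThanLessThan_iff)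
  qed
  then show ?thesis using e(1) by blast
qed

lemma circle_transition_image:
  "cmap (circle_atlas a) ` (cdom (circle_atlas a) \<inter> S) = {x \<in> {a<..<a + 1}. circle_of x \<in> S}"
proof (intro set_eqI iffI)
  fix x assume "x \<in> cmap (circle_atlas a) ` (cdom (circle_atlas a) \<inter> S)"
  then obtain p where p: "x = cmap (circle_atlas a) p" "p \<in> cdom (circle_atlas a)" "p \<in> S" by blast
  obtain y where y: "p = circle_of y" "y \<in> {a<..<a + 1}" using p(2) unfolding cdom_circle_atlas by (rule imageE)
  have "x = y" unfolding p(1) y(1) by (rule cmap_circle_of[OF y(2)])
  then show "x \<in> {x \<in> {a<..<a + 1}. circle_of x \<in> S}" using y p(3) by blast
next
  fix x assume "x \<in> {x \<in> {a<..<a + 1}. circle_of x \<in> S}"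
  then have x: "x \<in> {a<..<a + 1}" "circle_of x \<in> S" by blast+
  show "x \<in> cmap (circle_atlas a) ` (cdom (circle_atlas a) \<inter> S)"
    by (rule image_eqI[of _ _ "circle_of x"]) (use x in \<open>simp_all add: cdom_circle_atlas del: greaterThanLessThan_iff\<close>)
qed

lemma smooth_atlas_circle: "smooth_atlas circle_atlas"
  unfolding smooth_atlas_def
proof (intro conjI allI)
  show "(\<Union>a. cdom (circle_atlas a)) = UNIV"
  proof (intro set_eqI iffI UNIV_I)
    fix p
    obtain t where "p = circle_of t" by (rule circle_of_cases)
    then have "p \<in> cdom (circle_atlas (t - 1/2))" unfolding cdom_circle_atlas by auto
    then show "p \<in> (\<Union>a. cdom (circle_atlas a))" by blast
  qed
  show "open (cdom (circle_atlas a))" for a unfolding cdom_circle_atlas by (intro open_circle_of_image) auto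
  show "open (crange (circle_atlas a))" for a unfolding crange_circle_atlas by simp
  show "homeomorphism (cdom (circle_atlas a)) (crange (circle_atlas a)) (cmap (circle_atlas a)) (cinv (circle_atlas a))" for a
    by (rule circle_homeomorphism)
  show "smooth_on (cmap (circle_atlas b) \<circ> cinv (circle_atlas a)) (cmap (circle_atlas a) ` (cdom (circle_atlas a) \<inter> cdom (circle_atlas b)))" for a b
    unfolding circle_transition_image
  proof (rule smooth_on_local)
    fix x assume "x \<in> {x \<in> {a<..<a + 1}. circle_of x \<in> cdom (circle_atlas b)}"
    then have x: "x \<in> {a<..<a + 1}" "circle_of x \<in> cdom (circle_atlas b)" by blast+
    from circle_transition[OF this] obtain n e where e: "0 < e"
      "\<forall>y. \<bar>y - x\<bar> < e \<longrightarrow> y \<in> {a<..<a + 1} \<and> circle_of y \<in> cdom (circle_atlas b) \<and>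
         cmap (circle_atlas b) (circle_of y) = y + of_int n" by blast
    have "smooth_on (cmap (circle_atlas b) \<circ> cinv (circle_atlas a)) (ball x e)"
    proof (rule smooth_on_cong[OF open_ball])
      show "smooth_on (\<lambda>y. y + of_int n) (ball x e)"
        by (rule smooth_on_add[OF open_ball smooth_on_bounded_linear[OF open_ball bounded_linear_ident] smooth_on_const[OF open_ball]])
      fix y assume "y \<in> ball x e"
      then have y: "\<bar>y - x\<bar> < e" by (simp add: dist_real_def abs_minus_commute)
      have "y \<in> {a<..<a + 1}" "cmap (circle_atlas b) (circle_of y) = y + of_int n" using e(2) y by blast+
      then show "y + of_int n = (cmap (circle_atlas b) \<circ> cinv (circle_atlas a)) y"
        by (simp only: comp_apply cinv_circle_atlas)
    qed
    then show "\<exists>T. open T \<and> x \<in> T \<and> smooth_on (cmap (circle_atlas b) \<circ> cinv (circle_atlas a)) T"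
      using e(1) by (intro exI[of _ "ball x e"]) simp
  qed
qed

lemma tchange_circle_atlas:
  assumes s: "s \<in> cdom (circle_atlas a)" "s \<in> cdom (circle_atlas b)"
  shows "tchange circle_atlas a b s = (\<lambda>v. v)"
proof -
  obtain x where x: "s = circle_of x" "x \<in> {a<..<a + 1}" using s(1) unfolding cdom_circle_atlas by (rule imageE)
  from circle_transition[OF x(2)] s(2) x(1) obtain n e where e: "0 < e"
    "\<forall>y. \<bar>y - x\<bar> < e \<longrightarrow> y \<in> {a<..<a + 1} \<and> circle_of y \<in> cdom (circle_atlas b) \<and>
       cmap (circle_atlas b) (circle_of y) = y + of_int n" by blast
  have "((\<lambda>y. y + of_int n) has_derivative (\<lambda>v. v)) (at x)" by (auto intro!: derivative_eq_intros)
  then have "((cmap (circle_atlas b) \<circ> cinv (circle_atlas a)) has_derivative (\<lambda>v. v)) (at x)"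
  proof (rule has_derivative_transform_within_open[OF _ open_ball[of x e]])
    show "x \<in> ball x e" using e(1) by simp
    fix y assume "y \<in> ball x e"
    then have y: "\<bar>y - x\<bar> < e" by (simp add: dist_real_def abs_minus_commute)
    have "y \<in> {a<..<a + 1}" "cmap (circle_atlas b) (circle_of y) = y + of_int n" using e(2) y by blast+
    then show "y + of_int n = (cmap (circle_atlas b) \<circ> cinv (circle_atlas a)) y"
      by (simp only: comp_apply cinv_circle_atlas)
  qed
  from frechet_derivative_eq[OF this] show ?thesis
    unfolding tchange_def x(1) cmap_circle_of[OF x(2)] .
qed

lemma tchange_real_atlas: "tchange real_atlas u u' r = (\<lambda>v. v)"
  unfolding tchange_def cmap_real_atlas cinv_real_atlas
  using frechet_derivative_eq[OF has_derivative_ident] by (simp add: o_def id_def)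

lemma smooth_atlas_cot_circle: "smooth_atlas cot_circle_atlas"
  unfolding cot_circle_atlas_def by (rule smooth_atlas_prod[OF smooth_atlas_real smooth_atlas_circle])

section \<open>Atlas and symplectic form of the stabilization\<close>

lemma smooth_atlas_stab: "smooth_atlas A \<Longrightarrow> smooth_atlas (stab_atlas A)"
  unfolding stab_atlas_def by (rule smooth_atlas_prod[OF _ smooth_atlas_cot_circle])

lemma cdom_stab_atlas: "cdom (stab_atlas A (i, u, a)) = cdom (A i) \<times> UNIV \<times> circle_of ` {a<..<a + 1}"
  and crange_stab_atlas: "crange (stab_atlas A (i, u, a)) = crange (A i) \<times> UNIV \<times> {a<..<a + 1}"
  and cmap_stab_atlas: "cmap (stab_atlas A (i, u, a)) (p, r, s) = (cmap (A i) p, r, cmap (circle_atlas a) s)"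
proof -
  show "cdom (stab_atlas A (i, u, a)) = cdom (A i) \<times> UNIV \<times> circle_of ` {a<..<a + 1}"
    unfolding stab_atlas_def cot_circle_atlas_def cdom_prod_atlas cdom_real_atlas cdom_circle_atlas ..
  show "crange (stab_atlas A (i, u, a)) = crange (A i) \<times> UNIV \<times> {a<..<a + 1}"
    unfolding stab_atlas_def cot_circle_atlas_def crange_prod_atlas crange_real_atlas crange_circle_atlas ..
  show "cmap (stab_atlas A (i, u, a)) (p, r, s) = (cmap (A i) p, r, cmap (circle_atlas a) s)"
    unfolding stab_atlas_def cot_circle_atlas_def cmap_prod_atlas cmap_real_atlas id_apply ..
qed

lemma cinv_stab_atlas:
  assumes A: "smooth_atlas A" and x: "x \<in> crange (A i)" and t: "t \<in> {a<..<a + 1}"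
  shows "cinv (stab_atlas A (i, u, a)) (x, r, t) = (cinv (A i) x, r, circle_of t)"
proof -
  have r: "r \<in> crange (real_atlas u)" and t': "t \<in> crange (circle_atlas a)"
    using t by (simp_all only: crange_real_atlas crange_circle_atlas UNIV_I)
  have rt: "(r, t) \<in> crange (cot_circle_atlas (u, a))"
    unfolding cot_circle_atlas_def crange_prod_atlas using r t' by (rule SigmaI)
  show ?thesis
    unfolding stab_atlas_def cinv_prod_atlas[OF A smooth_atlas_cot_circle x rt]
    unfolding cot_circle_atlas_def cinv_prod_atlas[OF smooth_atlas_real smooth_atlas_circle r t']
      cinv_real_atlas cinv_circle_atlas[OF t] id_apply ..
qed

text \<open>The real line has the identity chart and circle charts differ by translations, so only
  the component in \<open>M\<close> is transformed.\<close>

lemma tchange_stab_atlas: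
  assumes A: "smooth_atlas A" and p: "p \<in> cdom (A i)" "p \<in> cdom (A j)"
    and s: "s \<in> cdom (circle_atlas a)" "s \<in> cdom (circle_atlas b)"
  shows "tchange (stab_atlas A) (i, u, a) (j, u', b) (p, r, s) (v, w) = (tchange A i j p v, w)"
proof -
  obtain w1 w2 where w: "w = (w1, w2)" by (cases w)
  have r: "r \<in> cdom (real_atlas u)" "r \<in> cdom (real_atlas u')" by (simp_all only: cdom_real_atlas UNIV_I)
  have rs: "(r, s) \<in> cdom (cot_circle_atlas (u, a))" "(r, s) \<in> cdom (cot_circle_atlas (u', b))"
    unfolding cot_circle_atlas_def cdom_prod_atlas using r s by (auto intro: SigmaI)
  show ?thesis
    unfolding stab_atlas_def tchange_prod_atlas[OF A smooth_atlas_cot_circle p rs]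
    unfolding w cot_circle_atlas_def tchange_prod_atlas[OF smooth_atlas_real smooth_atlas_circle r s]
      tchange_real_atlas tchange_circle_atlas[OF s] ..
qed

lemma stab_form_apply:
  "stab_form \<omega> (i, u, a) (p, q) (v, vr, vs) (w, wr, ws) = \<omega> i p v w + (vr * ws - vs * wr)"
  by (simp add: stab_form_def dr_ds_def)

lemma has_derivative_fst_compose:
  assumes "(f has_derivative f') (at (fst z))"
  shows "((\<lambda>y. f (fst y)) has_derivative (\<lambda>h. f' (fst h))) (at z)"
  by (rule has_derivative_compose[OF has_derivative_fst[OF has_derivative_ident] assms])

lemma in_cdom_stab_iff: "(p, r, s) \<in> cdom (stab_atlas A (i, u, a)) \<longleftrightarrow> p \<in> cdom (A i) \<and> s \<in> cdom (circle_atlas a)"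
  unfolding cdom_stab_atlas cdom_circle_atlas by simp

text \<open>In every chart \<open>dr \<and> ds\<close> has constant coefficients and only adds a
  constant to the coefficients of \<omega>, so that closedness is inherited.\<close>

lemma symplectic_manifold_stab:
  fixes A :: "('i, 'a::{second_countable_topology,t2_space}, 'e::euclidean_space) atlas"
  assumes M: "symplectic_manifold A \<omega>"
  shows "symplectic_manifold (stab_atlas A) (stab_form \<omega>)"
proof -
  have A: "smooth_atlas A" using M by (simp add: symplectic_manifold_def)
  interpret symplectic_mfd A \<omega>
    by (intro symplectic_mfd.intro smooth_manifold.intro symplectic_mfd_axioms.intro A M)
  interpret N: smooth_manifold "stab_atlas A" by (rule smooth_manifold.intro[OF smooth_atlas_stab[OF A]])
  have bil: "bilinear (stab_form \<omega> (i, u, a) (p, q))" and alt: "stab_form \<omega> (i, u, a) (p, q) v v = 0"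
    if p: "p \<in> cdom (A i)" for i u a p q v
  proof -
    note b = om_bilinear[OF p]
    show "bilinear (stab_form \<omega> (i, u, a) (p, q))"
      unfolding bilinear_def
      by (intro conjI allI linearI)
        (auto simp: stab_form_apply bilinear_ladd[OF b] bilinear_radd[OF b] bilinear_lmul[OF b] bilinear_rmul[OF b] algebra_simps)
    obtain v1 vr vs where "v = (v1, vr, vs)" by (cases v)
    then show "stab_form \<omega> (i, u, a) (p, q) v v = 0"
      by (simp add: stab_form_apply om_alternating[OF p])
  qed
  have rep: "stab_form \<omega> (i, u, a) (cinv (stab_atlas A (i, u, a)) y) (v, vr, vs) (w, wr, ws)
      = \<omega> i (cinv (A i) (fst y)) v w + (vr * ws - vs * wr)"
    if y: "y \<in> crange (stab_atlas A (i, u, a))" for i u a y v vr vs w wr ws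
  proof -
    obtain x r t where y': "y = (x, r, t)" by (cases y)
    have "x \<in> crange (A i)" "t \<in> {a<..<a + 1}" using y unfolding y' crange_stab_atlas by blast+
    then show ?thesis unfolding y' by (simp only: cinv_stab_atlas[OF A] stab_form_apply fst_conv)
  qed
  have sm: "smooth_on (\<lambda>y. stab_form \<omega> (i, u, a) (cinv (stab_atlas A (i, u, a)) y) (v, vr, vs) (w, wr, ws)) (crange (stab_atlas A (i, u, a)))"
    for i u a v vr vs w wr ws
  proof (rule smooth_on_cong[OF N.open_Cr rep[symmetric]])
    have "smooth_on (\<lambda>y::'e \<times> real \<times> real. \<omega> i (cinv (A i) (fst y)) v w) (crange (A i) \<times> (UNIV \<times> {a<..<a + 1}))"
      by (rule smooth_on_fst_compose[OF open_Cr _ om_smooth]) (intro open_Times open_UNIV open_greaterThanLessThan)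
    then show "smooth_on (\<lambda>y. \<omega> i (cinv (A i) (fst y)) v w + (vr * ws - vs * wr)) (crange (stab_atlas A (i, u, a)))"
      unfolding crange_stab_atlas
      by (intro smooth_on_add smooth_on_const open_Times open_Cr open_UNIV open_greaterThanLessThan)
  qed
  have der: "frechet_derivative (\<lambda>y. stab_form \<omega> (i, u, a) (cinv (stab_atlas A (i, u, a)) y) (v, vr, vs) (w, wr, ws)) (at x) h
      = frechet_derivative (\<lambda>y. \<omega> i (cinv (A i) y) v w) (at (fst x)) (fst h)"
    if x: "x \<in> crange (stab_atlas A (i, u, a))" for i u a x v vr vs w wr ws h
  proof -
    have x1: "fst x \<in> crange (A i)" using x unfolding crange_stab_atlas by (rule mem_Times_iff[THEN iffD1, THEN conjunct1])
    have d1: "((\<lambda>y. \<omega> i (cinv (A i) (fst y)) v w + (vr * ws - vs * wr)) has_derivative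
        (\<lambda>h. frechet_derivative (\<lambda>y. \<omega> i (cinv (A i) y) v w) (at (fst x)) (fst h) + 0)) (at x)"
      by (rule has_derivative_add[OF has_derivative_fst_compose[OF smooth_on_has_derivative[OF om_smooth x1]] has_derivative_const])
    from frechet_derivative_eq[OF has_derivative_transform_within_open[OF d1 N.open_Cr x rep[symmetric]]]
    show ?thesis by simp
  qed
  show ?thesis
    unfolding symplectic_manifold_def closed_two_form_def two_form_def
  proof (intro conjI allI ballI impI)
    show "smooth_atlas (stab_atlas A)" by (rule smooth_atlas_stab[OF A])
    fix k :: "'i \<times> unit \<times> real"
    obtain i u a where k: "k = (i, u, a)" by (cases k)
    show "smooth_on (\<lambda>x. stab_form \<omega> k (cinv (stab_atlas A k) x) v w) (crange (stab_atlas A k))" for v w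
      using sm[of i u a "fst v" "fst (snd v)" "snd (snd v)" "fst w" "fst (snd w)" "snd (snd w)"] by (simp only: k prod.collapse)
    show "frechet_derivative (\<lambda>y. stab_form \<omega> k (cinv (stab_atlas A k) y) v w) (at x) h
      + frechet_derivative (\<lambda>y. stab_form \<omega> k (cinv (stab_atlas A k) y) w h) (at x) v
      + frechet_derivative (\<lambda>y. stab_form \<omega> k (cinv (stab_atlas A k) y) h v) (at x) w = 0"
      if x: "x \<in> crange (stab_atlas A k)" for x h v w
    proof -
      note x' = x[unfolded k]
      have x1: "fst x \<in> crange (A i)" using x' unfolding crange_stab_atlas by (rule mem_Times_iff[THEN iffD1, THEN conjunct1])
      note d = der[OF x', of "fst v" "fst (snd v)" "snd (snd v)" "fst w" "fst (snd w)" "snd (snd w)" h, unfolded prod.collapse]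
        der[OF x', of "fst w" "fst (snd w)" "snd (snd w)" "fst h" "fst (snd h)" "snd (snd h)" v, unfolded prod.collapse]
        der[OF x', of "fst h" "fst (snd h)" "snd (snd h)" "fst v" "fst (snd v)" "snd (snd v)" w, unfolded prod.collapse]
      show ?thesis unfolding k d by (rule om_closed[OF x1])
    qed
    show "bilinear (stab_form \<omega> k P)" "stab_form \<omega> k P v v = 0" if P: "P \<in> cdom (stab_atlas A k)"
      for P :: "'a \<times> real \<times> circle" and v :: "'e \<times> real \<times> real"
    proof -
      obtain p q where pq: "P = (p, q)" by (cases P)
      have "p \<in> cdom (A i)" using P unfolding k pq cdom_stab_atlas by blast
      then show "bilinear (stab_form \<omega> k P)" "stab_form \<omega> k P v v = 0" unfolding k pq by (rule bil, rule alt)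
    qed
    show "v = 0" if P: "P \<in> cdom (stab_atlas A k)" and z: "\<forall>w. stab_form \<omega> k P v w = 0"
      for P :: "'a \<times> real \<times> circle" and v :: "'e \<times> real \<times> real"
    proof -
      obtain p q where pq: "P = (p, q)" by (cases P)
      obtain v1 vr vs where v: "v = (v1, vr, vs)" by (cases v)
      have p: "p \<in> cdom (A i)" using P unfolding k pq cdom_stab_atlas by blast
      have zz: "\<omega> i p v1 w + (vr * ws - vs * wr) = 0" for w wr ws
        using spec[OF z, of "(w, wr, ws)"] unfolding k pq v stab_form_apply .
      have z0: "\<omega> i p v1 0 = 0" by (rule bilinear_rzero[OF om_bilinear[OF p]])
      have "v1 = 0" by (rule om_nondegenerate[OF p]) (use zz[of _ 0 0] in simp)
      moreover have "vr = 0" using zz[of 0 1 0] z0 by simp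
      moreover have "vs = 0" using zz[of 0 0 1] z0 by simp
      ultimately show ?thesis by (simp add: v zero_prod_def)
    qed
    fix l :: "'i \<times> unit \<times> real" and P :: "'a \<times> real \<times> circle" and v w :: "'e \<times> real \<times> real"
    assume P: "P \<in> cdom (stab_atlas A k) \<inter> cdom (stab_atlas A l)"
    obtain j u' b where l: "l = (j, u', b)" by (cases l)
    obtain p r s where P': "P = (p, r, s)" by (cases P)
    obtain v1 vr vs where v: "v = (v1, vr, vs)" by (cases v)
    obtain w1 wr ws where w: "w = (w1, wr, ws)" by (cases w)
    have p: "p \<in> cdom (A i)" "p \<in> cdom (A j)" and s: "s \<in> cdom (circle_atlas a)" "s \<in> cdom (circle_atlas b)"
      using P unfolding k l P' by (simp_all add: in_cdom_stab_iff)
    show "stab_form \<omega> l P (tchange (stab_atlas A) k l P v) (tchange (stab_atlas A) k l P w) = stab_form \<omega> k P v w"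
      unfolding k l P' v w tchange_stab_atlas[OF A p s] stab_form_apply om_tchange[OF p] ..
  qed
qed

section \<open>Averaging along a Hamiltonian flow\<close>

text \<open>Differentiation under the integral sign, one space direction at a time; the partial
  derivatives are integrals of the same kind, to which the induction hypothesis applies.\<close>

lemma Ck_on_integral:
  fixes b :: "'a::euclidean_space \<times> real \<Rightarrow> real"
  assumes S: "open S" and b: "Ck_on k b (S \<times> UNIV)"
  shows "Ck_on k (\<lambda>z. integral {0..T} (\<lambda>\<tau>. b (z, \<tau>))) S"
  using b
proof (induction k arbitrary: b)
  case 0
  have "continuous_on (S \<times> cbox 0 T) b"
    by (rule continuous_on_subset[of "S \<times> UNIV"]) (use 0 in auto)
  then have "continuous_on (S \<times> cbox 0 T) (\<lambda>(z, \<tau>). b (z, \<tau>))" by (simp only: case_prod_eta)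
  from integral_continuous_on_param[OF this] show ?case by (simp add: cbox_interval)
next
  case (Suc k)
  let ?D = "\<lambda>e q. frechet_derivative b (at q) (e, 0)"
  have Dk: "Ck_on k (?D e) (S \<times> UNIV)" for e using Suc.prems by (simp only: Ck_on.simps)
  have bc: "continuous_on (S \<times> UNIV) b" by (rule Ck_on_imp_continuous_on[OF Suc.prems])
  have bd: "(b has_derivative frechet_derivative b (at q)) (at q)" if "q \<in> S \<times> UNIV" for q
    by (rule Ck_on_has_derivative[OF Suc.prems that])
  show ?case
  proof (rule Ck_on_Suc_partials[OF S, where g="\<lambda>e z. integral {0..T} (\<lambda>\<tau>. ?D e (z, \<tau>))"])
    show "Ck_on k (\<lambda>z. integral {0..T} (\<lambda>\<tau>. ?D e (z, \<tau>))) S" for e by (rule Suc.IH[OF Dk])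
    fix e z :: 'a assume z: "z \<in> S"
    have cl: "continuous_on UNIV (\<lambda>h. z + h *\<^sub>R e)" by (intro continuous_intros)
    have "open ((\<lambda>h. z + h *\<^sub>R e) -` S)" by (rule open_vimage[OF S cl])
    moreover have "0 \<in> (\<lambda>h. z + h *\<^sub>R e) -` S" using z by simp
    ultimately obtain r where r: "0 < r" "ball 0 r \<subseteq> (\<lambda>h. z + h *\<^sub>R e) -` S"
      using open_contains_ball by blast
    have zh: "z + h *\<^sub>R e \<in> S" if "h \<in> ball 0 r" for h using r(2) that by blast
    have "((\<lambda>h. integral (cbox 0 T) (\<lambda>\<tau>. b (z + h *\<^sub>R e, \<tau>))) has_vector_derivative
        integral (cbox 0 T) (\<lambda>\<tau>. ?D e (z + 0 *\<^sub>R e, \<tau>))) (at 0 within ball 0 r)"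
    proof (rule leibniz_rule_vector_derivative[where f="\<lambda>h \<tau>. b (z + h *\<^sub>R e, \<tau>)" and fx="\<lambda>h \<tau>. ?D e (z + h *\<^sub>R e, \<tau>)"])
      fix h \<tau> :: real assume h: "h \<in> ball 0 r"
      have l: "((\<lambda>h. (z + h *\<^sub>R e, \<tau>)) has_vector_derivative (e, 0)) (at h)"
        by (auto intro!: derivative_eq_intros simp: has_vector_derivative_def)
      have "(b has_derivative frechet_derivative b (at (z + h *\<^sub>R e, \<tau>))) (at (z + h *\<^sub>R e, \<tau>))"
        by (rule bd) (use zh[OF h] in blast)
      from vector_derivative_diff_chain_within[of "\<lambda>h. (z + h *\<^sub>R e, \<tau>)" "(e, 0)" h UNIV, OF l has_derivative_at_withinI[OF this]]
      have "((\<lambda>h. b (z + h *\<^sub>R e, \<tau>)) has_vector_derivative ?D e (z + h *\<^sub>R e, \<tau>)) (at h)"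
        by (simp only: o_def)
      then show "((\<lambda>h. b (z + h *\<^sub>R e, \<tau>)) has_vector_derivative ?D e (z + h *\<^sub>R e, \<tau>)) (at h within ball 0 r)"
        by (rule has_vector_derivative_at_within)
    next
      fix h :: real assume h: "h \<in> ball 0 r"
      have "continuous_on (cbox 0 T) (\<lambda>\<tau>. b (z + h *\<^sub>R e, \<tau>))"
        by (rule continuous_on_compose2[OF bc]) (use zh[OF h] in \<open>auto intro!: continuous_intros\<close>)
      then show "(\<lambda>\<tau>. b (z + h *\<^sub>R e, \<tau>)) integrable_on cbox 0 T" by (rule integrable_continuous)
    next
      have "continuous_on (ball 0 r \<times> cbox 0 T) (\<lambda>q. ?D e (z + fst q *\<^sub>R e, snd q))"
      proof (rule continuous_on_compose2[OF Ck_on_imp_continuous_on[OF Dk]])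
        show "continuous_on (ball 0 r \<times> cbox 0 T) (\<lambda>q. (z + fst q *\<^sub>R e, snd q))" by (intro continuous_intros)
        show "(\<lambda>q. (z + fst q *\<^sub>R e, snd q)) ` (ball 0 r \<times> cbox 0 T) \<subseteq> S \<times> UNIV"
          using zh by (intro image_subsetI) (simp add: mem_Times_iff del: mem_ball)
      qed
      then show "continuous_on (ball 0 r \<times> cbox 0 T) (\<lambda>(h, \<tau>). ?D e (z + h *\<^sub>R e, \<tau>))" by (simp only: split_def)
    qed (use r(1) in auto)
    then show "((\<lambda>h. integral {0..T} (\<lambda>\<tau>. b (z + h *\<^sub>R e, \<tau>))) has_vector_derivative integral {0..T} (\<lambda>\<tau>. ?D e (z, \<tau>))) (at 0)"
      using r(1) by (simp add: cbox_interval at_within_open[of 0 "ball 0 r"])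
  qed
qed

lemma smooth_on_integral:
  fixes b :: "'a::euclidean_space \<times> real \<Rightarrow> real"
  shows "open S \<Longrightarrow> smooth_on b (S \<times> UNIV) \<Longrightarrow> smooth_on (\<lambda>z. integral {0..T} (\<lambda>\<tau>. b (z, \<tau>))) S"
  by (simp add: smooth_on_def Ck_on_integral)

lemma antiderivative_real:
  fixes h :: "real \<Rightarrow> real"
  assumes "continuous_on UNIV h"
  shows "\<exists>F. \<forall>t. (F has_real_derivative h t) (at t)"
proof -
  have "\<And>x. isCont h x" using assms by (simp add: continuous_on_eq_continuous_at)
  then have "\<exists>F. \<forall>x. (-\<infinity>::ereal) < ereal x \<longrightarrow> ereal x < \<infinity> \<longrightarrow> (F has_vector_derivative h x) (at x)"
    by (intro einterval_antiderivative) auto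
  then show ?thesis by (simp add: has_real_derivative_iff_has_vector_derivative)
qed

text \<open>Two successive primitives \<open>F\<close> and \<open>G\<close> of \<open>h\<close>
  evaluate the integral by parts as \<open>G (s + T) - T * F s - G s\<close>, which is
  differentiable although \<open>h\<close> is merely continuous.\<close>

lemma weighted_integral_derivative:
  fixes h :: "real \<Rightarrow> real"
  assumes h: "continuous_on UNIV h" and T: "0 \<le> T"
  shows "((\<lambda>s. integral {0..T} (\<lambda>\<tau>. (T - \<tau>) * h (\<tau> + s))) has_real_derivative integral {0..T} h - T * h 0) (at 0)"
proof -
  obtain F where F: "\<And>t. (F has_real_derivative h t) (at t)" using antiderivative_real[OF h] by blast
  then have "continuous_on UNIV F" by (intro continuous_at_imp_continuous_on ballI) (rule DERIV_isCont)
  then obtain G where G: "\<And>t. (G has_real_derivative F t) (at t)" using antiderivative_real by blast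
  have Fs: "((\<lambda>\<tau>. F (\<tau> + s)) has_real_derivative h (\<tau> + s)) (at \<tau> within S)" for \<tau> s S
    by (rule has_field_derivative_at_within[OF DERIV_shift[THEN iffD1, OF F]])
  have Gs: "((\<lambda>\<tau>. G (\<tau> + s)) has_real_derivative F (\<tau> + s)) (at \<tau> within S)" for \<tau> s S
    by (rule has_field_derivative_at_within[OF DERIV_shift[THEN iffD1, OF G]])
  have I: "((\<lambda>\<tau>. (T - \<tau>) * h (\<tau> + s)) has_integral
      ((T - T) * F (T + s) + G (T + s)) - ((T - 0) * F (0 + s) + G (0 + s))) {0..T}" for s
  proof (rule fundamental_theorem_of_calculus[OF T])
    fix \<tau>
    have "((\<lambda>\<tau>. (T - \<tau>) * F (\<tau> + s) + G (\<tau> + s)) has_real_derivative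
        (0 - 1) * F (\<tau> + s) + h (\<tau> + s) * (T - \<tau>) + F (\<tau> + s)) (at \<tau> within {0..T})"
      by (rule DERIV_add[OF DERIV_mult[OF DERIV_diff[OF DERIV_const DERIV_ident] Fs] Gs])
    then show "((\<lambda>\<tau>. (T - \<tau>) * F (\<tau> + s) + G (\<tau> + s)) has_vector_derivative (T - \<tau>) * h (\<tau> + s)) (at \<tau> within {0..T})"
      by (simp add: has_real_derivative_iff_has_vector_derivative mult.commute)
  qed
  have e: "integral {0..T} (\<lambda>\<tau>. (T - \<tau>) * h (\<tau> + s)) = G (s + T) - T * F s - G s" for s
    using integral_unique[OF I[of s]] by (simp add: add.commute)
  have d: "((\<lambda>s. G (s + T) - T * F s - G s) has_real_derivative F (0 + T) - T * h 0 - F 0) (at 0)"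
    by (rule DERIV_diff[OF DERIV_diff[OF Gs DERIV_cmult[OF F]] G])
  have "(h has_integral F T - F 0) {0..T}"
    by (rule fundamental_theorem_of_calculus[OF T])
      (use F in \<open>simp add: has_real_derivative_iff_has_vector_derivative has_vector_derivative_at_within\<close>)
  then have FT: "integral {0..T} h = F T - F 0" by (rule integral_unique)
  show ?thesis unfolding e FT using d by (simp add: algebra_simps)
qed

context smooth_manifold
begin

lemma contract_chart:
  assumes \<theta>: "one_form A \<theta>" and X: "vector_field X" and p: "p \<in> Cd i"
  shows "contract A \<theta> X p = \<theta> i p (X i p)"
proof -
  define j where "j = (SOME i. p \<in> Cd i)"
  have j: "p \<in> Cd j" unfolding j_def by (rule someI_ex[OF ex_chart])
  have "X i p = tchange A j i p (X j p)" using X j p by (simp add: vector_field_def)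
  then have "\<theta> i p (X i p) = \<theta> j p (X j p)" using one_form_tchange[OF \<theta> j p] by simp
  then show ?thesis by (simp add: contract_def Let_def j_def[symmetric])
qed

lemma contract_smooth:
  assumes \<theta>: "one_form A \<theta>" and X: "vector_field X"
  shows "smooth_fun A (contract A \<theta> X)"
  unfolding smooth_fun_def
proof
  fix i
  have Xs: "smooth_on (\<lambda>x. X i (ci i x)) (Cr i)" using X by (simp add: vector_field_def)
  have "smooth_on (\<lambda>x. \<Sum>b\<in>Basis. (X i (ci i x) \<bullet> b) * \<theta> i (ci i x) b) (Cr i)"
    by (intro smooth_on_sum smooth_on_mult open_Cr one_form_smooth[OF \<theta>] smooth_on_compose_linear[OF bounded_linear_inner_left open_Cr Xs])
  then show "smooth_on (contract A \<theta> X \<circ> ci i) (Cr i)"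
  proof (rule smooth_on_cong[OF open_Cr, rotated])
    fix x assume x: "x \<in> Cr i"
    have "contract A \<theta> X (ci i x) = \<theta> i (ci i x) (X i (ci i x))"
      by (rule contract_chart[OF \<theta> X ci_in[OF x]])
    also have "\<dots> = (\<Sum>b\<in>Basis. (X i (ci i x) \<bullet> b) *\<^sub>R \<theta> i (ci i x) b)"
      by (rule linear_expand_basis[OF one_form_linear[OF \<theta> ci_in[OF x]]])
    finally show "(\<Sum>b\<in>Basis. (X i (ci i x) \<bullet> b) * \<theta> i (ci i x) b) = (contract A \<theta> X \<circ> ci i) x"
      by simp
  qed
qed

lemma smooth_fun_along_curve:
  assumes f: "smooth_fun A f" and \<gamma>: "integral_curve A X UNIV \<gamma>" and i: "\<gamma> t \<in> Cd i"
  shows "((\<lambda>s. f (\<gamma> s)) has_real_derivative differential A f i (\<gamma> t) (X t i (\<gamma> t))) (at t)"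
proof -
  obtain e where e: "0 < e" "\<And>s. \<bar>s - t\<bar> < e \<Longrightarrow> s \<in> UNIV \<and> \<gamma> s \<in> Cd i \<and>
      ((\<lambda>s. cm i (\<gamma> s)) has_vector_derivative X s i (\<gamma> s)) (at s)"
    by (rule integral_curve_chart[OF \<gamma> open_UNIV, of t i]) (use i in auto)
  have d: "((\<lambda>s. cm i (\<gamma> s)) has_vector_derivative X t i (\<gamma> t)) (at t)" using e by simp
  have df: "((\<lambda>x. f (ci i x)) has_derivative differential A f i (\<gamma> t)) (at (cm i (\<gamma> t)))"
    by (rule differential_has_derivative[OF f i])
  from vector_derivative_diff_chain_within[of "\<lambda>s. cm i (\<gamma> s)" _ t UNIV, OF d has_derivative_at_withinI[OF df]]
  have d2: "((\<lambda>s. f (ci i (cm i (\<gamma> s)))) has_vector_derivative differential A f i (\<gamma> t) (X t i (\<gamma> t))) (at t)"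
    by (simp only: o_def)
  have "((\<lambda>s. f (\<gamma> s)) has_vector_derivative differential A f i (\<gamma> t) (X t i (\<gamma> t))) (at t)"
  proof (rule has_vector_derivative_transform_within_open[OF d2 open_ball[of t e]])
    fix s assume "s \<in> ball t e"
    then have "\<bar>s - t\<bar> < e" by (simp add: dist_real_def abs_minus_commute)
    then show "f (ci i (cm i (\<gamma> s))) = f (\<gamma> s)" using e(2) by simp
  qed (use e(1) in simp)
  then show ?thesis by (simp add: has_real_derivative_iff_has_vector_derivative)
qed

context
  fixes X \<psi>
  assumes X: "vector_field X" and \<psi>: "flow X \<psi>"
begin

text \<open>The weights are chosen such that the derivative along the flow is the time average of \<open>a\<close> minus \<open>a\<close>.\<close>

definition weighted_average :: "('a \<Rightarrow> real) \<Rightarrow> real \<Rightarrow> 'a \<Rightarrow> real" where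
  "weighted_average a T p = (1 / T) * integral {0..T} (\<lambda>\<tau>. (T - \<tau>) * a (\<psi> \<tau> p))"

lemma weighted_average_smooth:
  assumes a: "smooth_fun A a"
  shows "smooth_fun A (weighted_average a T)"
  unfolding smooth_fun_def
proof
  fix i
  have o: "open (Cr i \<times> (UNIV :: real set))" by (intro open_Times open_Cr open_UNIV)
  have "smooth_fun (prod_atlas A real_atlas) (\<lambda>(p, t). a (\<psi> (0 + 1 * t) p))"
    by (rule smooth_fun_flow[OF X \<psi> a])
  then have s: "smooth_on (\<lambda>z. a (\<psi> (snd z) (ci i (fst z)))) (Cr i \<times> UNIV)"
    unfolding smooth_fun_prod_iff[OF atlas smooth_atlas_real] cinv_real_atlas crange_real_atlas by simp
  have "smooth_on (\<lambda>z::'e \<times> real. T + (- snd z)) (Cr i \<times> UNIV)"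
    by (intro smooth_on_add smooth_on_const smooth_on_minus smooth_on_bounded_linear bounded_linear_snd o)
  from smooth_on_mult[OF o this s]
  have "smooth_on (\<lambda>z. integral {0..T} (\<lambda>\<tau>. (T + - snd (z, \<tau>)) * a (\<psi> (snd (z, \<tau>)) (ci i (fst (z, \<tau>)))))) (Cr i)"
    by (rule smooth_on_integral[OF open_Cr])
  then have "smooth_on (\<lambda>z. (1 / T) * integral {0..T} (\<lambda>\<tau>. (T + - snd (z, \<tau>)) * a (\<psi> (snd (z, \<tau>)) (ci i (fst (z, \<tau>)))))) (Cr i)"
    by (intro smooth_on_mult smooth_on_const open_Cr)
  then show "smooth_on (weighted_average a T \<circ> ci i) (Cr i)"
    by (simp add: weighted_average_def[abs_def] o_def)
qed

lemma flow_orbit_continuous: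
  assumes a: "smooth_fun A a"
  shows "continuous_on S (\<lambda>\<tau>. a (\<psi> \<tau> p))"
proof -
  have "continuous_on UNIV (\<lambda>\<tau>. \<psi> \<tau> p)"
    using flow_curve[OF \<psi>] unfolding integral_curve_def by blast
  then have "continuous_on UNIV (\<lambda>\<tau>. a (\<psi> \<tau> p))"
    by (rule continuous_on_compose2[OF smooth_fun_continuous[OF a]]) simp
  then show ?thesis by (rule continuous_on_subset) simp
qed

text \<open>Moving the point by \<open>\<psi> s\<close> shifts the time in the integrand by
  \<open>s\<close>, which reduces the claim to \<open>weighted_integral_derivative\<close>.\<close>

lemma weighted_average_derivative:
  assumes a: "smooth_fun A a" and T: "0 < T" and p: "p \<in> Cd i"
  shows "differential A (weighted_average a T) i p (X i p) = (1 / T) * integral {0..T} (\<lambda>\<tau>. a (\<psi> \<tau> p)) - a p"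
proof -
  have p0: "\<psi> 0 p \<in> Cd i" using p flow_0[OF \<psi>] by simp
  have 1: "((\<lambda>s. weighted_average a T (\<psi> s p)) has_real_derivative
      differential A (weighted_average a T) i p (X i p)) (at 0)"
    using smooth_fun_along_curve[OF weighted_average_smooth[OF a] flow_curve[OF \<psi>] p0]
    by (simp only: flow_0[OF \<psi>])
  have "((\<lambda>s. (1 / T) * integral {0..T} (\<lambda>\<tau>. (T - \<tau>) * a (\<psi> (\<tau> + s) p))) has_real_derivative
      (1 / T) * (integral {0..T} (\<lambda>\<tau>. a (\<psi> \<tau> p)) - T * a (\<psi> 0 p))) (at 0)"
    by (rule DERIV_cmult[OF weighted_integral_derivative[OF flow_orbit_continuous[OF a] less_imp_le[OF T]]])
  then have 2: "((\<lambda>s. weighted_average a T (\<psi> s p)) has_real_derivative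
      (1 / T) * (integral {0..T} (\<lambda>\<tau>. a (\<psi> \<tau> p)) - T * a p)) (at 0)"
    by (simp add: weighted_average_def flow_add[OF X \<psi>] flow_0[OF \<psi>])
  from DERIV_unique[OF 1 2] T show ?thesis by (simp add: right_diff_distrib)
qed

end

end

section \<open>Growth of an autonomous Hamiltonian\<close>

context symplectic_mfd
begin

lemma sgrad_fun_vector_field: "smooth_fun A H \<Longrightarrow> vector_field (sgrad_fun A \<omega> H)"
  unfolding sgrad_fun_def by (intro sgrad_vector_field one_form_minus differential_one_form)

lemma sgrad_fun_eq:
  assumes "smooth_fun A H" "p \<in> Cd i"
  shows "\<omega> i p (sgrad_fun A \<omega> H i p) v = - differential A H i p v"
  unfolding sgrad_fun_def
  by (rule sgrad_eq[of p i "\<lambda>i p v. - differential A H i p v", OF assms(2)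
    one_form_linear[OF one_form_minus[OF differential_one_form[OF assms(1)]] assms(2)]])

text \<open>For \<open>\<theta> = inv (\<psi>' 1) \<circ> \<psi> 1\<close> the point
  \<open>\<psi> 1 y\<close> is reached from \<open>\<theta> y\<close> by following \<psi>' for unit
  time, and along \<psi>' the function \<open>H\<close> grows at the time average of
  \<open>a\<close> over an orbit of \<Phi>, which is below \<open>1\<close>. The mean value theorem
  turns this strict pointwise rate into a strict inequality, so no bound uniform over the manifold
  enters.\<close>

theorem hamiltonian_diffeo_averaging:
  assumes \<beta>: "closed_one_form A \<beta>" and \<psi>: "flow (sgrad \<omega> \<beta>) \<psi>" and H: "smooth_fun A H"
    and \<Phi>: "flow (sgrad_fun A \<omega> H) \<Phi>" and T: "0 < T"
  defines "a \<equiv> contract A \<beta> (sgrad_fun A \<omega> H)"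
  assumes avg: "\<And>p. integral {0..T} (\<lambda>\<tau>. a (\<Phi> \<tau> p)) < T"
    and \<psi>': "flow (sgrad \<omega> (\<lambda>i p v. \<beta> i p v + differential A (weighted_average \<Phi> a T) i p v)) \<psi>'"
  shows "\<exists>\<theta>. hamiltonian_diffeo A \<omega> \<theta> \<and> (\<forall>y. H (\<psi> 1 y) - H (\<theta> y) < 1)"
proof -
  let ?V = "sgrad_fun A \<omega> H" and ?g = "weighted_average \<Phi> a T"
  let ?\<beta>' = "\<lambda>i p v. \<beta> i p v + differential A ?g i p v"
  let ?Z' = "sgrad \<omega> ?\<beta>'"
  have \<beta>1: "one_form A \<beta>" using \<beta> by (simp add: closed_one_form_def)
  have V: "vector_field ?V" by (rule sgrad_fun_vector_field[OF H])
  have a: "smooth_fun A a" unfolding a_def by (rule contract_smooth[OF \<beta>1 V])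
  have g: "smooth_fun A ?g" by (rule weighted_average_smooth[OF V \<Phi> a])
  have \<beta>': "one_form A ?\<beta>'" by (rule one_form_add[OF \<beta>1 differential_one_form[OF g]])
  have rate: "differential A H i p (?Z' i p) < 1" if p: "p \<in> Cd i" for i p
  proof -
    have "differential A H i p (?Z' i p) = \<omega> i p (?Z' i p) (?V i p)"
      using sgrad_fun_eq[OF H p, of "?Z' i p"] om_antisym[OF p, of "?V i p" "?Z' i p"] by simp
    also have "\<dots> = \<beta> i p (?V i p) + differential A ?g i p (?V i p)"
      by (rule sgrad_eq[of p i ?\<beta>', OF p one_form_linear[OF \<beta>' p]])
    also have "\<beta> i p (?V i p) = a p" unfolding a_def by (rule contract_chart[OF \<beta>1 V p, symmetric])
    also have "a p + differential A ?g i p (?V i p) = (1 / T) * integral {0..T} (\<lambda>\<tau>. a (\<Phi> \<tau> p))"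
      using weighted_average_derivative[OF V \<Phi> a T p] by simp
    also have "\<dots> < 1" using avg[of p] T by (simp add: field_simps)
    finally show ?thesis .
  qed
  have "H (\<psi> 1 y) - H ((inv (\<psi>' 1) \<circ> \<psi> 1) y) < 1" for y
  proof -
    define x where "x = inv (\<psi>' 1) (\<psi> 1 y)"
    have "bij (\<psi>' 1)" using \<psi>' by (simp add: is_flow_def)
    then have x: "\<psi>' 1 x = \<psi> 1 y" unfolding x_def by (rule surj_f_inv_f[OF bij_is_surj])
    \<comment> \<open>The mean value theorem asks for the derivative as one function of time, so a
      chart is chosen at each time.\<close>
    define c where "c t = (SOME i. \<psi>' t x \<in> Cd i)" for t
    have c: "\<psi>' t x \<in> Cd (c t)" for t unfolding c_def by (rule someI_ex[OF ex_chart])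
    have d: "((\<lambda>t. H (\<psi>' t x)) has_real_derivative differential A H (c t) (\<psi>' t x) (?Z' (c t) (\<psi>' t x))) (at t)" for t
      by (rule smooth_fun_along_curve[OF H flow_curve[OF \<psi>'] c])
    have "\<exists>z>0. z < 1 \<and> H (\<psi>' 1 x) - H (\<psi>' 0 x) = (1 - 0) * differential A H (c z) (\<psi>' z x) (?Z' (c z) (\<psi>' z x))"
      by (rule MVT2[OF zero_less_one d])
    then obtain z where "H (\<psi>' 1 x) - H (\<psi>' 0 x) = (1 - 0) * differential A H (c z) (\<psi>' z x) (?Z' (c z) (\<psi>' z x))"
      by (elim exE conjE)
    then show ?thesis using rate[OF c, of z] x flow_0[OF \<psi>'] by (simp add: x_def)
  qed
  then have "\<forall>y. H (\<psi> 1 y) - H ((inv (\<psi>' 1) \<circ> \<psi> 1) y) < 1" ..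
  from conjI[OF hamiltonian_isotopy[OF \<beta> \<psi> g \<psi>'] this] show ?thesis
    by (rule exI[where x="inv (\<psi>' 1) \<circ> \<psi> 1"])
qed

end

section \<open>Dynamics on the stabilization\<close>

text \<open>Pull-back along the projection from \<open>N\<close> to \<open>M\<close>.\<close>

definition lift_form :: "('i, 'a, 'e) form1 \<Rightarrow> ('i \<times> unit \<times> real, 'a \<times> real \<times> circle, 'e \<times> real \<times> real) form1" where
  "lift_form \<alpha> = (\<lambda>k P V. \<alpha> (fst k) (fst P) (fst V))"

text \<open>\<open>c = 1\<close> is the suspension \<open>F + r\<close> of a time-dependent Hamiltonian, \<open>c = 0\<close> the pull-back of a function.\<close>

definition lift_fun :: "('a \<times> circle \<Rightarrow> real) \<Rightarrow> real \<Rightarrow> 'a \<times> real \<times> circle \<Rightarrow> real" where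
  "lift_fun f c = (\<lambda>P. f (fst P, snd (snd P)) + c * fst (snd P))"

definition time_derivative :: "('a \<times> circle \<Rightarrow> real) \<Rightarrow> 'a \<Rightarrow> real \<Rightarrow> real" where
  "time_derivative f p t = deriv (\<lambda>t. at_time f t p) t"

lemma time_derivative_periodic:
  assumes "circle_of t = circle_of t'"
  shows "time_derivative f p t = time_derivative f p t'"
proof -
  obtain n :: int where n: "t - t' = of_int n" using assms unfolding circle_of_eq_iff by (rule Ints_cases)
  have "circle_of (s + of_int n) = circle_of s" for s by (simp add: circle_of_eq_iff)
  then have eq: "(\<lambda>s. at_time f (s + of_int n) p) = (\<lambda>s. at_time f s p)" by (simp add: at_time_def)
  have "((\<lambda>s. at_time f s p) has_field_derivative d) (at (t' + of_int n)) \<longleftrightarrow>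
      ((\<lambda>s. at_time f s p) has_field_derivative d) (at t')" for d
    using DERIV_shift[of "\<lambda>s. at_time f s p" d t' "of_int n"] unfolding eq .
  moreover have "t = t' + of_int n" using n by simp
  ultimately show ?thesis by (simp only: time_derivative_def deriv_def)
qed

lemma circle_rep: "\<exists>x. 0 \<le> x \<and> x < 1 \<and> circle_of x = s"
proof -
  obtain t where t: "s = circle_of t" by (rule circle_of_cases)
  have "t - frac t \<in> \<int>" by (simp add: frac_def)
  then have "circle_of (frac t) = s" unfolding t by (metis circle_of_eq_iff)
  then show ?thesis using frac_ge_0 frac_lt_1 by blast
qed

text \<open>This choice jumps at the class of \<open>0\<close>. Regularity of the flows written with
  it is drawn from their generating fields, not from the formula.\<close>

definition circle_rep :: "circle \<Rightarrow> real" where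
  "circle_rep s = (SOME x. 0 \<le> x \<and> x < 1 \<and> circle_of x = s)"

lemma circle_rep_ge_0: "0 \<le> circle_rep s" and circle_rep_lt_1: "circle_rep s < 1"
  and circle_of_circle_rep [simp]: "circle_of (circle_rep s) = s"
  using someI_ex[OF circle_rep, of s] unfolding circle_rep_def by auto

lemma cmap_circle_curve_derivative:
  assumes a: "circle_of (\<sigma> + c * t) \<in> cdom (circle_atlas a)"
  shows "((\<lambda>t. cmap (circle_atlas a) (circle_of (\<sigma> + c * t))) has_vector_derivative c) (at t)"
proof -
  let ?x = "\<sigma> + c * t"
  have "?x \<in> {?x - 1/2<..<?x - 1/2 + 1}" by simp
  from circle_transition[OF this a] obtain n e where e: "0 < e"
    "\<forall>y. \<bar>y - ?x\<bar> < e \<longrightarrow> y \<in> {?x - 1/2<..<?x - 1/2 + 1} \<and> circle_of y \<in> cdom (circle_atlas a) \<and>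
       cmap (circle_atlas a) (circle_of y) = y + of_int n" by blast
  have d: "((\<lambda>t. \<sigma> + c * t + of_int n) has_vector_derivative c) (at t)"
    by (auto intro!: derivative_eq_intros simp: has_real_derivative_iff_has_vector_derivative[symmetric])
  have l: "continuous_on UNIV (\<lambda>t. \<sigma> + c * t)" by (intro continuous_intros)
  show ?thesis
  proof (rule has_vector_derivative_transform_within_open[OF d open_vimage[OF open_ball[of ?x e] l]])
    fix s assume "s \<in> (\<lambda>t. \<sigma> + c * t) -` ball ?x e"
    then have "\<bar>(\<sigma> + c * s) - ?x\<bar> < e" by (simp add: dist_real_def abs_minus_commute)
    then show "\<sigma> + c * s + of_int n = cmap (circle_atlas a) (circle_of (\<sigma> + c * s))" using e(2) by simp
  qed (use e(1) in simp)
qed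

context symplectic_mfd
begin

interpretation N: symplectic_mfd "stab_atlas A" "stab_form \<omega>"
  by (intro symplectic_mfd.intro smooth_manifold.intro symplectic_mfd_axioms.intro
      smooth_atlas_stab[OF atlas] symplectic_manifold_stab[OF symplectic])

lemma crange_stab_cases:
  assumes "x \<in> N.Cr k"
  obtains i u a z \<rho> \<tau> where "k = (i, u, a)" "x = (z, \<rho>, \<tau>)" "z \<in> Cr i" "\<tau> \<in> {a<..<a + 1}"
    "N.ci k x = (ci i z, \<rho>, circle_of \<tau>)"
proof -
  obtain i u a where k: "k = (i, u, a)" by (cases k)
  obtain z \<rho> \<tau> where x: "x = (z, \<rho>, \<tau>)" by (cases x)
  have z: "z \<in> Cr i" "\<tau> \<in> {a<..<a + 1}" using assms unfolding k x crange_stab_atlas by blast+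
  show ?thesis by (rule that[OF k x z]) (unfold k x, rule cinv_stab_atlas[OF atlas z])
qed

lemma cdom_stab_cases:
  assumes "P \<in> N.Cd k"
  obtains i u a p r s where "k = (i, u, a)" "P = (p, r, s)" "p \<in> Cd i" "s \<in> cdom (circle_atlas a)"
proof -
  obtain i u a where k: "k = (i, u, a)" by (cases k)
  obtain p r s where P: "P = (p, r, s)" by (cases P)
  show ?thesis using that[OF k P] assms unfolding k P in_cdom_stab_iff by blast
qed

lemma lift_form_closed:
  assumes \<alpha>: "closed_one_form A \<alpha>"
  shows "closed_one_form (stab_atlas A) (lift_form \<alpha>)"
proof -
  have \<alpha>1: "one_form A \<alpha>" using \<alpha> by (simp add: closed_one_form_def)
  have rep: "lift_form \<alpha> k (N.ci k x) v = \<alpha> (fst k) (ci (fst k) (fst x)) (fst v)"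
    and rng: "fst x \<in> Cr (fst k)" if x: "x \<in> N.Cr k" for k x v
    using crange_stab_cases[OF x] by (metis fst_conv lift_form_def)+
  have der: "frechet_derivative (\<lambda>y. lift_form \<alpha> k (N.ci k y) v) (at x) h =
      frechet_derivative (\<lambda>y. \<alpha> (fst k) (ci (fst k) y) (fst v)) (at (fst x)) (fst h)"
    if x: "x \<in> N.Cr k" for k x v h
  proof -
    have "((\<lambda>y. \<alpha> (fst k) (ci (fst k) (fst y)) (fst v)) has_derivative
        (\<lambda>h. frechet_derivative (\<lambda>y. \<alpha> (fst k) (ci (fst k) y) (fst v)) (at (fst x)) (fst h))) (at x)"
      by (rule has_derivative_fst_compose[OF smooth_on_has_derivative[OF one_form_smooth[OF \<alpha>1] rng[OF x]]])
    from frechet_derivative_eq[OF has_derivative_transform_within_open[OF this N.open_Cr x rep[symmetric]]]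
    show ?thesis by simp
  qed
  show ?thesis
    unfolding closed_one_form_def one_form_def
  proof (intro conjI allI ballI)
    show "linear (lift_form \<alpha> k P)" if "P \<in> N.Cd k" for k P
      using that
    proof (rule cdom_stab_cases)
      fix i u a p r s assume k: "k = (i, u, a)" "P = (p, r, s)" "p \<in> Cd i"
      show "linear (lift_form \<alpha> k P)"
        using linear_compose[OF linear_fst one_form_linear[OF \<alpha>1 k(3)]] by (simp add: lift_form_def k o_def)
    qed
    show "lift_form \<alpha> l P (tchange (stab_atlas A) k l P v) = lift_form \<alpha> k P v"
      if P: "P \<in> N.Cd k \<inter> N.Cd l" for k l P v
    proof -
      obtain i u a where k: "k = (i, u, a)" by (cases k)
      obtain j u' b where l: "l = (j, u', b)" by (cases l)
      obtain p r s where P': "P = (p, r, s)" by (cases P)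
      obtain v1 v2 where v: "v = (v1, v2)" by (cases v)
      have p: "p \<in> Cd i" "p \<in> Cd j" and s: "s \<in> cdom (circle_atlas a)" "s \<in> cdom (circle_atlas b)"
        using P unfolding k l P' by (simp_all add: in_cdom_stab_iff)
      show ?thesis
        unfolding k l P' v tchange_stab_atlas[OF atlas p s] lift_form_def fst_conv by (rule one_form_tchange[OF \<alpha>1 p])
    qed
    show "smooth_on (\<lambda>x. lift_form \<alpha> k (N.ci k x) v) (N.Cr k)" for k v
    proof (rule smooth_on_cong[OF N.open_Cr rep[symmetric]])
      obtain i u a where k: "k = (i, u, a)" by (cases k)
      have "smooth_on (\<lambda>y::'e \<times> real \<times> real. \<alpha> i (ci i (fst y)) (fst v)) (Cr i \<times> (UNIV \<times> {a<..<a + 1}))"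
        by (rule smooth_on_fst_compose[OF open_Cr _ one_form_smooth[OF \<alpha>1]])
          (intro open_Times open_UNIV open_greaterThanLessThan)
      then show "smooth_on (\<lambda>x. \<alpha> (fst k) (ci (fst k) (fst x)) (fst v)) (N.Cr k)"
        unfolding k crange_stab_atlas fst_conv .
    qed
    show "frechet_derivative (\<lambda>y. lift_form \<alpha> k (N.ci k y) v) (at x) u
      - frechet_derivative (\<lambda>y. lift_form \<alpha> k (N.ci k y) u) (at x) v = 0"
      if x: "x \<in> N.Cr k" for k x u v
      unfolding der[OF x] using \<alpha> rng[OF x] unfolding closed_one_form_def by blast
  qed
qed

text \<open>The form \<open>dr \<and> ds\<close> pairs \<open>(zr, zs)\<close> with
  \<open>(vr, vs)\<close> to \<open>zr * vs - zs * vr\<close>, so the coefficient of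
  \<open>ds\<close> becomes the \<open>r\<close>-component and the coefficient of \<open>dr\<close>,
  negated, the \<open>s\<close>-component.\<close>

lemma stab_sgradI:
  assumes p: "p \<in> Cd i" and s: "s \<in> cdom (circle_atlas a)" and lin: "linear (\<theta> (i, u, a) (p, r, s))"
    and \<theta>: "\<And>v vr vs. \<theta> (i, u, a) (p, r, s) (v, vr, vs) = b v + br * vr + bs * vs"
    and z: "\<And>v. \<omega> i p z v = b v"
  shows "sgrad (stab_form \<omega>) \<theta> (i, u, a) (p, r, s) = (z, bs, - br)"
proof (rule N.sgrad_unique[of "(p, r, s)" "(i, u, a)" \<theta>, OF _ lin])
  show "(p, r, s) \<in> N.Cd (i, u, a)" using p s by (simp add: in_cdom_stab_iff)
  fix V :: "'e \<times> real \<times> real"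
  obtain v vr vs where V: "V = (v, vr, vs)" by (cases V)
  show "stab_form \<omega> (i, u, a) (p, r, s) (z, bs, - br) V = \<theta> (i, u, a) (p, r, s) V"
    unfolding V stab_form_apply \<theta> z by simp
qed

lemma sgrad_lift_form:
  assumes \<alpha>: "closed_one_form A \<alpha>" and p: "p \<in> Cd i" and s: "s \<in> cdom (circle_atlas a)"
  shows "sgrad (stab_form \<omega>) (lift_form \<alpha>) (i, u, a) (p, r, s) = (sgrad \<omega> \<alpha> i p, 0, 0)"
proof -
  have 1: "one_form A \<alpha>" "one_form (stab_atlas A) (lift_form \<alpha>)"
    using \<alpha> lift_form_closed[OF \<alpha>] by (simp_all add: closed_one_form_def)
  have P: "(p, r, s) \<in> N.Cd (i, u, a)" using p s by (simp add: in_cdom_stab_iff)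
  have "sgrad (stab_form \<omega>) (lift_form \<alpha>) (i, u, a) (p, r, s) = (sgrad \<omega> \<alpha> i p, 0, - 0)"
  proof (rule stab_sgradI[of p i s a "lift_form \<alpha>", OF p s, where b="\<alpha> i p"])
    show "linear (lift_form \<alpha> (i, u, a) (p, r, s))" by (rule N.one_form_linear[OF 1(2) P])
    show "lift_form \<alpha> (i, u, a) (p, r, s) (v, vr, vs) = \<alpha> i p v + 0 * vr + 0 * vs" for v vr vs
      by (simp add: lift_form_def)
    show "\<omega> i p (sgrad \<omega> \<alpha> i p) v = \<alpha> i p v" for v
      by (rule sgrad_eq[of p i \<alpha>, OF p one_form_linear[OF 1(1) p]])
  qed
  then show ?thesis by simp
qed

context
  fixes f :: "'a \<times> circle \<Rightarrow> real"
  assumes f: "smooth_fun (prod_atlas A circle_atlas) f"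
begin

text \<open>Smoothness in time is tested in the circle chart centred at the given time, where the
  coordinate is the real time itself.\<close>

lemma chart_time_smooth: "smooth_on (\<lambda>w. at_time f (snd w) (ci i (fst w))) (Cr i \<times> UNIV)"
proof (rule smooth_on_local)
  fix w :: "'e \<times> real" assume w: "w \<in> Cr i \<times> UNIV"
  define a where "a = snd w - 1/2"
  let ?S = "Cr i \<times> {a<..<a + 1}"
  have o: "open ?S" by (intro open_Times open_Cr open_greaterThanLessThan)
  have "smooth_on (\<lambda>w. f (ci i (fst w), cinv (circle_atlas a) (snd w))) ?S"
    using f unfolding smooth_fun_prod_iff[OF atlas smooth_atlas_circle] crange_circle_atlas by blast
  then have "smooth_on (\<lambda>w. at_time f (snd w) (ci i (fst w))) ?S"
  proof (rule smooth_on_cong[OF o, rotated])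
    fix y assume "y \<in> ?S"
    then have "snd y \<in> {a<..<a + 1}" by (rule mem_Times_iff[THEN iffD1, THEN conjunct2])
    then show "f (ci i (fst y), cinv (circle_atlas a) (snd y)) = at_time f (snd y) (ci i (fst y))"
      by (simp only: at_time_def cinv_circle_atlas)
  qed
  moreover have "w \<in> ?S" using w by (simp add: mem_Times_iff a_def)
  ultimately show "\<exists>T. open T \<and> w \<in> T \<and> smooth_on (\<lambda>w. at_time f (snd w) (ci i (fst w))) T" using o by blast
qed

lemma at_time_smooth: "smooth_fun A (at_time f t)"
  unfolding smooth_fun_def
proof
  fix i
  have o: "open (Cr i \<times> (UNIV :: real set))" by (intro open_Times open_Cr open_UNIV)
  have "smooth_on (\<lambda>z. (z, t)) (Cr i)"
    by (rule smooth_on_Pair[OF open_Cr smooth_on_bounded_linear[OF open_Cr bounded_linear_ident] smooth_on_const[OF open_Cr]])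
  from smooth_on_compose[OF open_Cr o _ this chart_time_smooth]
  show "smooth_on (at_time f t \<circ> ci i) (Cr i)" by (simp add: o_def)
qed

lemma chart_time_has_derivative:
  assumes p: "p \<in> Cd i"
  shows "((\<lambda>w. at_time f (snd w) (ci i (fst w))) has_derivative
    (\<lambda>h. differential A (at_time f t) i p (fst h) + snd h * time_derivative f p t)) (at (cm i p, t))"
proof -
  let ?R = "\<lambda>w. at_time f (snd w) (ci i (fst w))"
  let ?D = "frechet_derivative ?R (at (cm i p, t))"
  have d: "(?R has_derivative ?D) (at (cm i p, t))"
    by (rule smooth_on_has_derivative[OF chart_time_smooth]) (use p in simp)
  have lin: "linear ?D" using d by (rule has_derivative_linear)
  have "((\<lambda>z. (z, t)) has_derivative (\<lambda>v. (v, 0))) (at (cm i p))" by (auto intro!: derivative_eq_intros)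
  from has_derivative_compose[OF this d]
  have "((\<lambda>z. at_time f t (ci i z)) has_derivative (\<lambda>v. ?D (v, 0))) (at (cm i p))" by simp
  from fun_cong[OF has_derivative_unique[OF differential_has_derivative[OF at_time_smooth p] this]]
  have 1: "differential A (at_time f t) i p v = ?D (v, 0)" for v .
  have l: "((\<lambda>s. (cm i p, s)) has_vector_derivative (0, 1)) (at t)"
    by (auto intro!: derivative_eq_intros simp: has_vector_derivative_def)
  from vector_derivative_diff_chain_within[of "\<lambda>s. (cm i p, s)" "(0, 1)" t UNIV, OF l has_derivative_at_withinI[OF d]]
  have "((\<lambda>s. at_time f s p) has_real_derivative ?D (0, 1)) (at t)"
    using p by (simp add: o_def has_real_derivative_iff_has_vector_derivative)
  then have 2: "time_derivative f p t = ?D (0, 1)" unfolding time_derivative_def by (rule DERIV_imp_deriv)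
  have "?D h = differential A (at_time f t) i p (fst h) + snd h * time_derivative f p t" for h
  proof -
    have "h = (fst h, 0) + snd h *\<^sub>R (0, 1)" by (simp add: prod_eq_iff)
    then have "?D h = ?D ((fst h, 0) + snd h *\<^sub>R (0, 1))" by (rule arg_cong)
    then show ?thesis by (simp only: linear_add[OF lin] linear_scale[OF lin] 1 2 real_scaleR_def)
  qed
  then have "?D = (\<lambda>h. differential A (at_time f t) i p (fst h) + snd h * time_derivative f p t)" by (rule ext)
  with d show ?thesis by simp
qed

lemma time_derivative_continuous: "continuous_on UNIV (\<lambda>p. time_derivative f p t)"
proof (rule continuous_at_imp_continuous_on, rule ballI)
  fix p
  obtain i where i: "p \<in> Cd i" using ex_chart by blast
  let ?R = "\<lambda>w. at_time f (snd w) (ci i (fst w))"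
  have td: "frechet_derivative ?R (at (cm i q, t)) (0, 1) = time_derivative f q t" if q: "q \<in> Cd i" for q
    unfolding frechet_derivative_eq[OF chart_time_has_derivative[OF q]]
    using linear_0[OF one_form_linear[OF differential_one_form[OF at_time_smooth] q]] by simp
  have "continuous_on (Cd i) (\<lambda>q. frechet_derivative ?R (at (cm i q, t)) (0, 1))"
    by (rule continuous_on_compose2[OF smooth_on_imp_continuous_on[OF smooth_on_frechet_derivative[OF chart_time_smooth]]])
      (auto intro!: continuous_intros continuous_on_cm)
  then have "continuous_on (Cd i) (\<lambda>q. time_derivative f q t)" by (rule continuous_on_eq) (rule td)
  then show "isCont (\<lambda>q. time_derivative f q t) p" using i open_Cd by (simp add: continuous_on_eq_continuous_at)
qed

lemma lift_fun_smooth: "smooth_fun (stab_atlas A) (lift_fun f c)"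
  unfolding smooth_fun_def
proof
  fix k :: "'i \<times> unit \<times> real"
  obtain i u a where k: "k = (i, u, a)" by (cases k)
  have o: "open (Cr i \<times> (UNIV :: real set))" by (intro open_Times open_Cr open_UNIV)
  have bl: "bounded_linear (\<lambda>x::'e \<times> real \<times> real. (fst x, snd (snd x)))" "bounded_linear (\<lambda>x::'e \<times> real \<times> real. fst (snd x))"
    by (intro bounded_linear_intros)+
  have "smooth_on (\<lambda>x. at_time f (snd (fst x, snd (snd x))) (ci i (fst (fst x, snd (snd x))))) (N.Cr k)"
    by (rule smooth_on_compose[OF N.open_Cr o _ smooth_on_bounded_linear[OF N.open_Cr bl(1)] chart_time_smooth])
      (auto simp: k crange_stab_atlas)
  then have "smooth_on (\<lambda>x. at_time f (snd (snd x)) (ci i (fst x)) + c * fst (snd x)) (N.Cr k)"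
    unfolding fst_conv snd_conv
    by (intro smooth_on_add smooth_on_mult smooth_on_const smooth_on_bounded_linear[OF _ bl(2)] N.open_Cr)
  then show "smooth_on (lift_fun f c \<circ> N.ci k) (N.Cr k)"
  proof (rule smooth_on_cong[OF N.open_Cr, rotated])
    fix x assume "x \<in> N.Cr k"
    then show "at_time f (snd (snd x)) (ci i (fst x)) + c * fst (snd x) = (lift_fun f c \<circ> N.ci k) x"
      by (rule crange_stab_cases) (simp add: k lift_fun_def at_time_def)
  qed
qed

lemma differential_lift_fun:
  assumes p: "p \<in> Cd i" and s: "s \<in> cdom (circle_atlas a)" and t: "circle_of t = s"
  shows "differential (stab_atlas A) (lift_fun f c) (i, u, a) (p, r, s) (v, vr, vs)
    = differential A (at_time f t) i p v + c * vr + vs * time_derivative f p t"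
proof -
  let ?\<tau> = "cmap (circle_atlas a) s" and ?k = "(i, u, a)"
  obtain y where y: "s = circle_of y" "y \<in> {a<..<a + 1}" using s unfolding cdom_circle_atlas by (rule imageE)
  have \<tau>: "?\<tau> = y" unfolding y(1) by (rule cmap_circle_of[OF y(2)])
  have ct: "circle_of ?\<tau> = circle_of t" using \<tau> t y(1) by simp
  have P: "(p, r, s) \<in> N.Cd ?k" using p s by (simp add: in_cdom_stab_iff)
  let ?x = "(cm i p, r, ?\<tau>)"
  have x: "N.cm ?k (p, r, s) = ?x" by (rule cmap_stab_atlas)
  have xr: "?x \<in> N.Cr ?k" unfolding x[symmetric] by (rule N.cm_in[OF P])
  let ?m = "\<lambda>x::'e \<times> real \<times> real. (fst x, snd (snd x))"
  have m: "(?m has_derivative ?m) (at ?x)"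
    by (intro bounded_linear_imp_has_derivative bounded_linear_intros)
  have d: "((\<lambda>w. at_time f (snd w) (ci i (fst w))) has_derivative
    (\<lambda>h. differential A (at_time f ?\<tau>) i p (fst h) + snd h * time_derivative f p ?\<tau>)) (at (?m ?x))"
    using chart_time_has_derivative[OF p, of ?\<tau>] by simp
  have r: "((\<lambda>x::'e \<times> real \<times> real. c * fst (snd x)) has_derivative (\<lambda>h. c * fst (snd h))) (at ?x)"
    by (intro bounded_linear_imp_has_derivative bounded_linear_intros)
  have "((\<lambda>x. at_time f (snd (?m x)) (ci i (fst (?m x))) + c * fst (snd x)) has_derivative
      (\<lambda>h. (differential A (at_time f ?\<tau>) i p (fst (?m h)) + snd (?m h) * time_derivative f p ?\<tau>) + c * fst (snd h))) (at ?x)"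
    by (rule has_derivative_add[OF has_derivative_compose[OF m d] r])
  then have "(lift_fun f c \<circ> N.ci ?k has_derivative
      (\<lambda>h. (differential A (at_time f ?\<tau>) i p (fst (?m h)) + snd (?m h) * time_derivative f p ?\<tau>) + c * fst (snd h))) (at ?x)"
  proof (rule has_derivative_transform_within_open[OF _ N.open_Cr xr])
    fix x assume "x \<in> N.Cr ?k"
    then show "at_time f (snd (?m x)) (ci i (fst (?m x))) + c * fst (snd x) = (lift_fun f c \<circ> N.ci ?k) x"
      by (rule crange_stab_cases) (simp add: lift_fun_def at_time_def)
  qed
  from frechet_derivative_eq[OF this]
  have "differential (stab_atlas A) (lift_fun f c) ?k (p, r, s) (v, vr, vs) =
      (differential A (at_time f ?\<tau>) i p v + vs * time_derivative f p ?\<tau>) + c * vr"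
    unfolding differential_def[of "stab_atlas A"] x by simp
  moreover have "at_time f ?\<tau> = at_time f t" using ct by (simp add: at_time_def fun_eq_iff)
  ultimately show ?thesis using time_derivative_periodic[OF ct, of f p] by simp
qed

text \<open>For \<open>c = 1\<close> the circle coordinate advances at unit speed and plays the part
  of time, so orbits project to orbits of the time-dependent field on \<open>M\<close>.\<close>

lemma sgrad_fun_lift_fun:
  assumes p: "p \<in> Cd i" and s: "s \<in> cdom (circle_atlas a)" and t: "circle_of t = s"
  shows "sgrad_fun (stab_atlas A) (stab_form \<omega>) (lift_fun f c) (i, u, a) (p, r, s)
    = (sgrad_fun A \<omega> (at_time f t) i p, - time_derivative f p t, c)"
proof -
  have P: "(p, r, s) \<in> N.Cd (i, u, a)" using p s by (simp add: in_cdom_stab_iff)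
  let ?\<theta> = "\<lambda>k P V. - differential (stab_atlas A) (lift_fun f c) k P V"
  have "sgrad (stab_form \<omega>) ?\<theta> (i, u, a) (p, r, s) = (sgrad_fun A \<omega> (at_time f t) i p, - time_derivative f p t, - (- c))"
  proof (rule stab_sgradI[of p i s a ?\<theta>, OF p s, where b="\<lambda>v. - differential A (at_time f t) i p v"])
    show "linear (\<lambda>V. - differential (stab_atlas A) (lift_fun f c) (i, u, a) (p, r, s) V)"
      by (rule N.one_form_linear[OF N.one_form_minus[OF N.differential_one_form[OF lift_fun_smooth]] P])
    show "- differential (stab_atlas A) (lift_fun f c) (i, u, a) (p, r, s) (v, vr, vs) =
        - differential A (at_time f t) i p v + - c * vr + - time_derivative f p t * vs" for v vr vs
      unfolding differential_lift_fun[OF p s t] by simp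
    show "\<omega> i p (sgrad_fun A \<omega> (at_time f t) i p) v = - differential A (at_time f t) i p v" for v
      by (rule sgrad_fun_eq[OF at_time_smooth p])
  qed
  then show ?thesis by (simp add: sgrad_fun_def)
qed

text \<open>Neither \<alpha> nor \<open>f\<close> involves \<open>r\<close>, so the circle
  coordinate stands still. For each \<open>s\<close> the motion in \<open>M\<close> is therefore
  that of a time-independent form, and \<open>r\<close> follows by integration.\<close>

lemma sgrad_perturbed_lift_form:
  assumes \<alpha>: "closed_one_form A \<alpha>" and p: "p \<in> Cd i" and s: "s \<in> cdom (circle_atlas a)" and t: "circle_of t = s"
  shows "sgrad (stab_form \<omega>) (\<lambda>k P V. lift_form \<alpha> k P V + differential (stab_atlas A) (lift_fun f 0) k P V) (i, u, a) (p, r, s)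
    = (sgrad \<omega> (\<lambda>i p v. \<alpha> i p v + differential A (at_time f t) i p v) i p, time_derivative f p t, 0)"
proof -
  have 1: "one_form A \<alpha>" "one_form (stab_atlas A) (lift_form \<alpha>)"
    using \<alpha> lift_form_closed[OF \<alpha>] by (simp_all add: closed_one_form_def)
  have P: "(p, r, s) \<in> N.Cd (i, u, a)" using p s by (simp add: in_cdom_stab_iff)
  let ?\<theta> = "\<lambda>k P V. lift_form \<alpha> k P V + differential (stab_atlas A) (lift_fun f 0) k P V"
  let ?\<beta> = "\<lambda>i p v. \<alpha> i p v + differential A (at_time f t) i p v"
  have \<beta>: "one_form A ?\<beta>" by (rule one_form_add[OF 1(1) differential_one_form[OF at_time_smooth]])
  have "sgrad (stab_form \<omega>) ?\<theta> (i, u, a) (p, r, s) = (sgrad \<omega> ?\<beta> i p, time_derivative f p t, - 0)"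
  proof (rule stab_sgradI[of p i s a ?\<theta>, OF p s, where b="?\<beta> i p"])
    show "linear (\<lambda>V. lift_form \<alpha> (i, u, a) (p, r, s) V + differential (stab_atlas A) (lift_fun f 0) (i, u, a) (p, r, s) V)"
      by (rule N.one_form_linear[OF N.one_form_add[OF 1(2) N.differential_one_form[OF lift_fun_smooth]] P])
    show "lift_form \<alpha> (i, u, a) (p, r, s) (v, vr, vs) + differential (stab_atlas A) (lift_fun f 0) (i, u, a) (p, r, s) (v, vr, vs) =
        ?\<beta> i p v + 0 * vr + time_derivative f p t * vs" for v vr vs
      unfolding differential_lift_fun[OF p s t] lift_form_def by simp
    show "\<omega> i p (sgrad \<omega> ?\<beta> i p) v = ?\<beta> i p v" for v
      by (rule sgrad_eq[of p i ?\<beta>, OF p one_form_linear[OF \<beta> p]])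
  qed
  then show ?thesis by simp
qed

end

text \<open>The number \<open>c\<close> is the speed of the circle coordinate: \<open>1\<close> for
  the suspended Hamiltonian, \<open>0\<close> for lifted closed forms.\<close>

lemma stab_curveI:
  assumes \<gamma>: "integral_curve A X UNIV \<gamma>" and \<rho>: "\<And>t. (\<rho> has_real_derivative \<rho>' t) (at t)"
    and Y: "\<And>t i u a. \<gamma> t \<in> Cd i \<Longrightarrow> circle_of (\<sigma> + c * t) \<in> cdom (circle_atlas a) \<Longrightarrow>
      Y (i, u, a) (\<gamma> t, \<rho> t, circle_of (\<sigma> + c * t)) = (X t i (\<gamma> t), \<rho>' t, c)"
  shows "N.curve Y UNIV (\<lambda>t. (\<gamma> t, \<rho> t, circle_of (\<sigma> + c * t)))"
  unfolding integral_curve_def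
proof (intro conjI ballI allI impI)
  have "continuous_on UNIV \<rho>" using \<rho> by (intro continuous_at_imp_continuous_on ballI DERIV_isCont)
  moreover have "continuous_on UNIV \<gamma>" using \<gamma> by (simp add: integral_curve_def)
  moreover have "continuous_on UNIV (\<lambda>t. circle_of (\<sigma> + c * t))"
    by (rule continuous_on_compose2[OF continuous_on_circle_of]) (auto intro!: continuous_intros)
  ultimately show "continuous_on UNIV (\<lambda>t. (\<gamma> t, \<rho> t, circle_of (\<sigma> + c * t)))" by (intro continuous_on_Pair)
  fix t and k :: "'i \<times> unit \<times> real" assume P: "(\<gamma> t, \<rho> t, circle_of (\<sigma> + c * t)) \<in> N.Cd k"
  obtain i u a where k: "k = (i, u, a)" by (cases k)
  have g: "\<gamma> t \<in> Cd i" and a: "circle_of (\<sigma> + c * t) \<in> cdom (circle_atlas a)"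
    using P unfolding k in_cdom_stab_iff by blast+
  have 1: "((\<lambda>t. cm i (\<gamma> t)) has_vector_derivative X t i (\<gamma> t)) (at t)"
    using \<gamma> g unfolding integral_curve_def o_def by simp
  have 2: "(\<rho> has_vector_derivative \<rho>' t) (at t)"
    using \<rho> by (simp add: has_real_derivative_iff_has_vector_derivative)
  have "((\<lambda>t. (cm i (\<gamma> t), \<rho> t, cmap (circle_atlas a) (circle_of (\<sigma> + c * t)))) has_vector_derivative (X t i (\<gamma> t), \<rho>' t, c)) (at t)"
    by (rule has_vector_derivative_Pair[OF 1 has_vector_derivative_Pair[OF 2 cmap_circle_curve_derivative[OF a]]])
  then show "((N.cm k \<circ> (\<lambda>t. (\<gamma> t, \<rho> t, circle_of (\<sigma> + c * t)))) has_vector_derivative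
      Y k (\<gamma> t, \<rho> t, circle_of (\<sigma> + c * t))) (at t within UNIV)"
    unfolding k o_def cmap_stab_atlas Y[OF g a] .
qed

end

text \<open>The \<open>r\<close>-component is determined by conservation of \<open>F + r\<close>.\<close>

definition stab_flow :: "('a \<times> circle \<Rightarrow> real) \<Rightarrow> (real \<Rightarrow> 'a \<Rightarrow> 'a) \<Rightarrow> real \<Rightarrow> 'a \<times> real \<times> circle \<Rightarrow> 'a \<times> real \<times> circle" where
  "stab_flow F \<phi> t P = (let \<sigma> = circle_rep (snd (snd P)); \<gamma> = (\<lambda>t. \<phi> (t + \<sigma>) (inv (\<phi> \<sigma>) (fst P))) in
    (\<gamma> t, fst (snd P) + at_time F \<sigma> (\<gamma> 0) - at_time F (t + \<sigma>) (\<gamma> t), circle_of (\<sigma> + 1 * t)))"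

section \<open>The suspended flow and periodicity in time\<close>

context symplectic_mfd
begin

interpretation N: symplectic_mfd "stab_atlas A" "stab_form \<omega>"
  by (intro symplectic_mfd.intro smooth_manifold.intro symplectic_mfd_axioms.intro
      smooth_atlas_stab[OF atlas] symplectic_manifold_stab[OF symplectic])

lemma differential_eq_0:
  assumes U: "open U" "p \<in> U" and f: "\<And>q. q \<in> U \<Longrightarrow> f q = 0" and p: "p \<in> Cd i"
  shows "differential A f i p v = 0"
proof -
  have "((\<lambda>x. 0) has_derivative (\<lambda>v. 0)) (at (cm i p))" by simp
  then have "(f \<circ> ci i has_derivative (\<lambda>v. 0)) (at (cm i p))"
  proof (rule has_derivative_transform_within_open[OF _ open_ci_vimage[of U i, OF U(1)]])
    show "cm i p \<in> {x \<in> Cr i. ci i x \<in> U}" using p U(2) by simp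
    show "0 = (f \<circ> ci i) x" if "x \<in> {x \<in> Cr i. ci i x \<in> U}" for x using that f by simp
  qed
  from frechet_derivative_eq[OF this] show ?thesis by (simp add: differential_def)
qed

context
  fixes F :: "'a \<times> circle \<Rightarrow> real"
  assumes F: "smooth_fun (prod_atlas A circle_atlas) F"
begin

text \<open>A Hamiltonian is stationary along its own gradient because \<omega> is alternating, so
  only the explicit dependence on time contributes.\<close>

lemma at_time_along_curve:
  assumes \<gamma>: "integral_curve A (\<lambda>t. sgrad_fun A \<omega> (at_time F (t + \<sigma>))) UNIV \<gamma>"
  shows "((\<lambda>t. at_time F (t + \<sigma>) (\<gamma> t)) has_real_derivative time_derivative F (\<gamma> t) (t + \<sigma>)) (at t)"
proof -
  obtain i where i: "\<gamma> t \<in> Cd i" using ex_chart by blast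
  let ?X = "sgrad_fun A \<omega> (at_time F (t + \<sigma>)) i (\<gamma> t)"
  obtain e where e: "0 < e" "\<And>s. \<bar>s - t\<bar> < e \<Longrightarrow> s \<in> UNIV \<and> \<gamma> s \<in> Cd i \<and>
      ((\<lambda>s. cm i (\<gamma> s)) has_vector_derivative sgrad_fun A \<omega> (at_time F (s + \<sigma>)) i (\<gamma> s)) (at s)"
    by (rule integral_curve_chart[OF \<gamma> open_UNIV, of t i]) (use i in auto)
  have d1: "((\<lambda>s. cm i (\<gamma> s)) has_vector_derivative ?X) (at t)" using e by simp
  have d2: "((\<lambda>s. s + \<sigma>) has_vector_derivative 1) (at t)"
    by (auto intro!: derivative_eq_intros simp: has_vector_derivative_def)
  have "- differential A (at_time F (t + \<sigma>)) i (\<gamma> t) ?X = \<omega> i (\<gamma> t) ?X ?X"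
    by (rule sgrad_fun_eq[OF at_time_smooth[OF F] i, symmetric])
  also have "\<dots> = 0" by (rule om_alternating[OF i])
  finally have 0: "differential A (at_time F (t + \<sigma>)) i (\<gamma> t) ?X = 0" by simp
  from vector_derivative_diff_chain_within[of "\<lambda>s. (cm i (\<gamma> s), s + \<sigma>)" "(?X, 1)" t UNIV,
      OF has_vector_derivative_Pair[OF d1 d2] has_derivative_at_withinI[OF chart_time_has_derivative[OF F i]]]
  have "((\<lambda>s. at_time F (s + \<sigma>) (ci i (cm i (\<gamma> s)))) has_vector_derivative time_derivative F (\<gamma> t) (t + \<sigma>)) (at t)"
    by (simp add: o_def 0)
  then have "((\<lambda>s. at_time F (s + \<sigma>) (\<gamma> s)) has_vector_derivative time_derivative F (\<gamma> t) (t + \<sigma>)) (at t)"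
  proof (rule has_vector_derivative_transform_within_open[OF _ open_ball[of t e]])
    show "t \<in> ball t e" using e(1) by simp
    fix s assume "s \<in> ball t e"
    then have "\<bar>s - t\<bar> < e" by (simp add: dist_real_def abs_minus_commute)
    then show "at_time F (s + \<sigma>) (ci i (cm i (\<gamma> s))) = at_time F (s + \<sigma>) (\<gamma> s)" using e(2) by simp
  qed
  then show ?thesis by (simp add: has_real_derivative_iff_has_vector_derivative)
qed

lemma stab_curve:
  assumes \<gamma>: "integral_curve A (\<lambda>t. sgrad_fun A \<omega> (at_time F (t + \<sigma>))) UNIV \<gamma>"
  shows "N.curve (sgrad_fun (stab_atlas A) (stab_form \<omega>) (lift_fun F 1)) UNIV
    (\<lambda>t. (\<gamma> t, r + at_time F \<sigma> (\<gamma> 0) - at_time F (t + \<sigma>) (\<gamma> t), circle_of (\<sigma> + 1 * t)))"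
proof (rule stab_curveI[OF \<gamma>])
  show "((\<lambda>t. r + at_time F \<sigma> (\<gamma> 0) - at_time F (t + \<sigma>) (\<gamma> t)) has_real_derivative
      0 - time_derivative F (\<gamma> t) (t + \<sigma>)) (at t)" for t
    by (rule DERIV_diff[OF DERIV_const at_time_along_curve[OF \<gamma>]])
  fix t i u a assume p: "\<gamma> t \<in> Cd i" and s: "circle_of (\<sigma> + 1 * t) \<in> cdom (circle_atlas a)"
  have "circle_of (t + \<sigma>) = circle_of (\<sigma> + 1 * t)" by (simp add: add.commute)
  from sgrad_fun_lift_fun[OF F p s this]
  show "sgrad_fun (stab_atlas A) (stab_form \<omega>) (lift_fun F 1) (i, u, a)
      (\<gamma> t, r + at_time F \<sigma> (\<gamma> 0) - at_time F (t + \<sigma>) (\<gamma> t), circle_of (\<sigma> + 1 * t)) =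
      (sgrad_fun A \<omega> (at_time F (t + \<sigma>)) i (\<gamma> t), 0 - time_derivative F (\<gamma> t) (t + \<sigma>), 1)"
    by simp
qed

context
  fixes \<phi> :: "real \<Rightarrow> 'a \<Rightarrow> 'a"
  assumes \<phi>: "is_flow A (\<lambda>t. sgrad_fun A \<omega> (at_time F t)) UNIV \<phi>"
begin

lemma flow_curve_shift: "integral_curve A (\<lambda>t. sgrad_fun A \<omega> (at_time F (t + \<sigma>))) UNIV (\<lambda>t. \<phi> (t + \<sigma>) q)"
proof -
  have "integral_curve A (\<lambda>t. sgrad_fun A \<omega> (at_time F t)) UNIV (\<lambda>t. \<phi> t q)" using \<phi> by (simp add: is_flow_def)
  from integral_curve_shift[OF this, of \<sigma>] show ?thesis by (simp only: surj_diff_right)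
qed

lemma stab_flow_curve:
  "N.curve (sgrad_fun (stab_atlas A) (stab_form \<omega>) (lift_fun F 1)) UNIV (\<lambda>t. stab_flow F \<phi> t P)"
  unfolding stab_flow_def Let_def by (rule stab_curve[OF flow_curve_shift])

lemma stab_flow_0: "stab_flow F \<phi> 0 P = P"
proof -
  have "bij (\<phi> t)" for t using \<phi> by (simp add: is_flow_def)
  then have "\<phi> t (inv (\<phi> t) p) = p" for t p by (meson bij_inv_eq_iff)
  then show ?thesis by (simp add: stab_flow_def Let_def)
qed

lemma stab_flow: "N.flow (sgrad_fun (stab_atlas A) (stab_form \<omega>) (lift_fun F 1)) (stab_flow F \<phi>)"
  by (rule N.flowI[OF N.sgrad_fun_vector_field[OF lift_fun_smooth[OF F]] stab_flow_curve stab_flow_0])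

text \<open>\<open>stab_flow\<close> is written with the representative of the phase in
  \<open>[0, 1)\<close>; by uniqueness of integral curves any other lift \<sigma>, with any curve
  \<gamma> of the shifted field, describes the same orbit.\<close>

lemma stab_flow_eq:
  assumes \<gamma>: "integral_curve A (\<lambda>t. sgrad_fun A \<omega> (at_time F (t + \<sigma>))) UNIV \<gamma>"
  shows "stab_flow F \<phi> t (\<gamma> 0, r, circle_of \<sigma>)
    = (\<gamma> t, r + at_time F \<sigma> (\<gamma> 0) - at_time F (t + \<sigma>) (\<gamma> t), circle_of (\<sigma> + t))"
proof -
  have "stab_flow F \<phi> t (\<gamma> 0, r, circle_of \<sigma>)
      = (\<gamma> t, r + at_time F \<sigma> (\<gamma> 0) - at_time F (t + \<sigma>) (\<gamma> t), circle_of (\<sigma> + 1 * t))"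
    by (rule N.integral_curve_unique[OF N.sgrad_fun_vector_field[OF lift_fun_smooth[OF F]] open_UNIV connected_UNIV
          stab_flow_curve stab_curve[OF \<gamma>], of 0]) (simp_all add: stab_flow_0)
  then show ?thesis by simp
qed

lemma stab_flow_apply: "fst (stab_flow F \<phi> t (\<phi> \<sigma> x, r, circle_of \<sigma>)) = \<phi> (t + \<sigma>) x"
  using stab_flow_eq[OF flow_curve_shift, of t \<sigma> x r] by simp

text \<open>Phases \<open>1\<close> and \<open>0\<close> are the same point of the circle, so both
  sides are the projection of one orbit on \<open>N\<close>.\<close>

lemma periodic_flow: "\<phi> (t + 1) x = \<phi> t (\<phi> 1 x)"
proof -
  have "circle_of 1 = circle_of 0" by (simp add: circle_of_eq_iff)
  moreover have "\<phi> 0 (\<phi> 1 x) = \<phi> 1 x" using \<phi> by (simp add: is_flow_def)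
  ultimately show ?thesis
    using stab_flow_apply[of t 1 x 0] stab_flow_apply[of t 0 "\<phi> 1 x" 0] by simp
qed

lemma periodic_flow_funpow: "\<phi> (t + real n) x = \<phi> t ((\<phi> 1 ^^ n) x)"
proof (induction n arbitrary: x)
  case (Suc n)
  have "\<phi> (t + real (Suc n)) x = \<phi> ((t + real n) + 1) x" by (simp add: algebra_simps)
  also have "\<dots> = \<phi> (t + real n) (\<phi> 1 x)" by (rule periodic_flow)
  also have "\<dots> = \<phi> t ((\<phi> 1 ^^ Suc n) x)" unfolding Suc funpow_Suc_right by simp
  finally show ?case .
qed simp

text \<open>The time-dependent flow inherits continuity from the autonomous one on \<open>N\<close>,
  started at phase \<open>0\<close>.\<close>

lemma flow_jointly_continuous: "continuous_on UNIV (\<lambda>z. \<phi> (snd z) (fst z))"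
proof -
  have c: "continuous_on UNIV (\<lambda>q. stab_flow F \<phi> (snd q) (fst q))"
    by (rule N.flow_continuous[OF N.sgrad_fun_vector_field[OF lift_fun_smooth[OF F]] stab_flow])
  have "\<phi> 0 p = p" for p using \<phi> by (simp add: is_flow_def)
  then have "\<phi> (snd z) (fst z) = fst (stab_flow F \<phi> (snd z) (fst z, 0, circle_of 0))" for z
    using stab_flow_apply[of "snd z" 0 "fst z" 0] by simp
  moreover have "continuous_on UNIV (\<lambda>z. fst (stab_flow F \<phi> (snd z) (fst z, 0, circle_of 0)))"
    by (rule continuous_on_fst[OF continuous_on_compose2[OF c, of UNIV "\<lambda>z. ((fst z, 0, circle_of 0), snd z)", simplified]])
      (intro continuous_intros)
  ultimately show ?thesis by simp
qed

context
  fixes K :: "'a set"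
  assumes K: "closed K" and F0: "\<forall>p. p \<notin> K \<longrightarrow> (\<forall>s. F (p, s) = 0)"
begin

lemma sgrad_fun_outside:
  assumes p: "p \<notin> K" "p \<in> Cd i"
  shows "sgrad_fun A \<omega> (at_time F t) i p = 0"
proof -
  have 0: "differential A (at_time F t) i p v = 0" for v
    by (rule differential_eq_0[OF open_Compl[OF K] _ _ p(2)]) (use p F0 in \<open>simp_all add: at_time_def\<close>)
  show ?thesis unfolding sgrad_fun_def
  proof (rule sgrad_unique[of p i "\<lambda>i p v. - differential A (at_time F t) i p v", OF p(2)])
    show "linear (\<lambda>v. - differential A (at_time F t) i p v)" by (simp add: 0 linear_zero)
    show "\<omega> i p 0 v = - differential A (at_time F t) i p v" for v
      unfolding 0 using bilinear_lzero[OF om_bilinear[OF p(2)]] by simp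
  qed
qed

text \<open>Off \<open>K\<close> the field on \<open>M\<close> vanishes at all times, so a constant
  curve is the projected orbit.\<close>

lemma flow_outside:
  assumes p: "p \<notin> K"
  shows "fst (stab_flow F \<phi> t (p, r, s)) = p"
proof -
  obtain \<sigma> where \<sigma>: "s = circle_of \<sigma>" by (rule circle_of_cases)
  have c: "integral_curve A (\<lambda>t. sgrad_fun A \<omega> (at_time F (t + \<sigma>))) UNIV (\<lambda>t. p)"
    by (simp add: integral_curve_def sgrad_fun_outside[OF p] o_def)
  show ?thesis using stab_flow_eq[OF c, of t r] unfolding \<sigma> by simp
qed

lemma flow_outside_id: "p \<notin> K \<Longrightarrow> \<phi> t p = p"
  using flow_outside[of p t 0 "circle_of 0"] stab_flow_apply[of t 0 p 0] \<phi> by (simp add: is_flow_def)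

text \<open>The map \<open>\<phi> t\<close> is injective and fixes every point of the complement of
  \<open>K\<close>.\<close>

lemma flow_inside:
  assumes p: "p \<in> K"
  shows "\<phi> t p \<in> K"
proof (rule ccontr)
  assume n: "\<phi> t p \<notin> K"
  have "inj (\<phi> t)" using \<phi> by (simp add: is_flow_def bij_is_inj)
  with flow_outside_id[OF n, of t] have "\<phi> t p = p" by (rule injD[rotated])
  with n p show False by simp
qed

end

lemma restrict_smooth:
  assumes h: "smooth_fun (stab_atlas A) h"
  shows "smooth_fun (prod_atlas A circle_atlas) (\<lambda>z. h (fst z, 0, snd z))"
  unfolding smooth_fun_prod_iff[OF atlas smooth_atlas_circle]
proof (intro allI)
  fix i and a :: real
  let ?k = "(i, (), a)" and ?S = "Cr i \<times> {a<..<a + 1}"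
  have o: "open ?S" by (intro open_Times open_Cr open_greaterThanLessThan)
  have bl: "bounded_linear (\<lambda>w::'e \<times> real. (fst w, 0::real, snd w))"
    by (intro bounded_linear_Pair bounded_linear_fst bounded_linear_snd bounded_linear_zero)
  have "smooth_on (\<lambda>w. h (N.ci ?k (fst w, 0, snd w))) ?S"
    by (rule smooth_on_compose[OF o N.open_Cr _ smooth_on_bounded_linear[OF o bl] N.smooth_fun_chart[OF h]])
      (auto simp: crange_stab_atlas)
  then have "smooth_on (\<lambda>w. h (fst (ci i (fst w), cinv (circle_atlas a) (snd w)), 0,
      snd (ci i (fst w), cinv (circle_atlas a) (snd w)))) ?S"
  proof (rule smooth_on_cong[OF o, rotated])
    fix w assume "w \<in> ?S"
    then have w: "fst w \<in> Cr i" "snd w \<in> {a<..<a + 1}" by (simp_all add: mem_Times_iff)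
    show "h (N.ci ?k (fst w, 0, snd w)) = h (fst (ci i (fst w), cinv (circle_atlas a) (snd w)), 0,
        snd (ci i (fst w), cinv (circle_atlas a) (snd w)))"
      by (simp only: cinv_stab_atlas[OF atlas w] cinv_circle_atlas[OF w(2)] fst_conv snd_conv)
  qed
  then show "smooth_on (\<lambda>w. h (fst (ci i (fst w), cinv (circle_atlas a) (snd w)), 0,
      snd (ci i (fst w), cinv (circle_atlas a) (snd w)))) (Cr i \<times> crange (circle_atlas a))"
    by (simp only: crange_circle_atlas)
qed

section \<open>Averaging on the stabilization\<close>

context
  fixes \<alpha> :: "('i, 'a, 'e) form1"
  assumes \<alpha>: "closed_one_form A \<alpha>"
begin

lemma contract_stab:
  "contract (stab_atlas A) (lift_form \<alpha>) (sgrad_fun (stab_atlas A) (stab_form \<omega>) (lift_fun F 1)) (p, r, circle_of t)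
    = contract A \<alpha> (sgrad_fun A \<omega> (at_time F t)) p"
proof -
  have 1: "one_form A \<alpha>" "one_form (stab_atlas A) (lift_form \<alpha>)"
    using \<alpha> lift_form_closed[OF \<alpha>] by (simp_all add: closed_one_form_def)
  obtain i where i: "p \<in> Cd i" using ex_chart by blast
  have "t \<in> {t - 1/2<..<t - 1/2 + 1}" by simp
  then have s: "circle_of t \<in> cdom (circle_atlas (t - 1/2))" unfolding cdom_circle_atlas by (rule imageI)
  have P: "(p, r, circle_of t) \<in> N.Cd (i, (), t - 1/2)" using i s by (simp add: in_cdom_stab_iff)
  show ?thesis
    unfolding N.contract_chart[OF 1(2) N.sgrad_fun_vector_field[OF lift_fun_smooth[OF F]] P]
      contract_chart[OF 1(1) sgrad_fun_vector_field[OF at_time_smooth[OF F]] i]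
    unfolding lift_form_def sgrad_fun_lift_fun[OF F i s refl] fst_conv ..
qed

lemma contract_stab_flow:
  "contract (stab_atlas A) (lift_form \<alpha>) (sgrad_fun (stab_atlas A) (stab_form \<omega>) (lift_fun F 1))
      (stab_flow F \<phi> \<tau> (p, r, circle_of \<sigma>))
    = contract A \<alpha> (sgrad_fun A \<omega> (at_time F (\<tau> + \<sigma>))) (\<phi> (\<tau> + \<sigma>) (inv (\<phi> \<sigma>) p))"
proof -
  have "bij (\<phi> \<sigma>)" using \<phi> by (simp add: is_flow_def)
  then have "\<phi> (0 + \<sigma>) (inv (\<phi> \<sigma>) p) = p" by (metis add_0 bij_inv_eq_iff)
  then show ?thesis
    using stab_flow_eq[OF flow_curve_shift[of \<sigma> "inv (\<phi> \<sigma>) p"], of \<tau> r] contract_stab by (simp add: add.commute)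
qed

text \<open>Joint continuity in time and point is inherited from a smooth function on
  \<open>N\<close>.\<close>

lemma contract_stab_continuous:
  "continuous_on UNIV (\<lambda>(t, p). contract A \<alpha> (sgrad_fun A \<omega> (at_time F t)) p)"
proof -
  let ?a = "contract (stab_atlas A) (lift_form \<alpha>) (sgrad_fun (stab_atlas A) (stab_form \<omega>) (lift_fun F 1))"
  have 1: "one_form (stab_atlas A) (lift_form \<alpha>)"
    using lift_form_closed[OF \<alpha>] by (simp add: closed_one_form_def)
  have c: "continuous_on UNIV ?a"
    by (rule N.smooth_fun_continuous[OF N.contract_smooth[OF 1 N.sgrad_fun_vector_field[OF lift_fun_smooth[OF F]]]])
  have "continuous_on UNIV (\<lambda>z. ?a (snd z, 0, circle_of (fst z)))"
    by (rule continuous_on_compose2[OF c])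
      (auto intro!: continuous_intros continuous_on_compose2[OF continuous_on_circle_of])
  then show ?thesis by (simp add: contract_stab case_prod_unfold)
qed

context
  fixes K :: "'a set"
  assumes K: "compact K" and F0: "\<forall>p. p \<notin> K \<longrightarrow> (\<forall>s. F (p, s) = 0)"
begin

lemma contract_outside:
  assumes p: "p \<notin> K"
  shows "contract A \<alpha> (sgrad_fun A \<omega> (at_time F t)) p = 0"
proof -
  obtain i where i: "p \<in> Cd i" using ex_chart by blast
  have 1: "one_form A \<alpha>" using \<alpha> by (simp add: closed_one_form_def)
  show ?thesis
    unfolding contract_chart[OF 1 sgrad_fun_vector_field[OF at_time_smooth[OF F]] i]
      sgrad_fun_outside[OF compact_imp_closed[OF K] F0 p i]
    by (rule linear_0[OF one_form_linear[OF 1 i]])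
qed

text \<open>The averaged function does not depend on \<open>r\<close> and vanishes over the complement of \<open>K\<close>. The perturbed
  flow on \<open>N\<close> is therefore assembled from compactly perturbed flows on \<open>M\<close>, one for each point of
  the circle, with \<open>r\<close> obtained by integration.\<close>

theorem stab_averaging:
  assumes \<psi>: "flow (sgrad \<omega> \<alpha>) \<psi>" and T: "0 < T"
    and avg: "\<And>p \<sigma>. 0 \<le> \<sigma> \<Longrightarrow> \<sigma> < 1 \<Longrightarrow> integral {0..T} (\<lambda>\<tau>. contract A \<alpha> (sgrad_fun A \<omega> (at_time F (\<tau> + \<sigma>))) (\<phi> (\<tau> + \<sigma>) p)) < T"
  shows "\<exists>\<theta>. hamiltonian_diffeo (stab_atlas A) (stab_form \<omega>) \<theta> \<and>
    (\<forall>P. lift_fun F 1 (\<psi> 1 (fst P), snd P) - lift_fun F 1 (\<theta> P) < 1)"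
proof -
  let ?V = "sgrad_fun (stab_atlas A) (stab_form \<omega>) (lift_fun F 1)"
  let ?a = "contract (stab_atlas A) (lift_form \<alpha>) ?V" and ?\<Phi> = "stab_flow F \<phi>"
  have 1: "one_form A \<alpha>" "one_form (stab_atlas A) (lift_form \<alpha>)"
    using \<alpha> lift_form_closed[OF \<alpha>] by (simp_all add: closed_one_form_def)
  have H: "smooth_fun (stab_atlas A) (lift_fun F 1)" by (rule lift_fun_smooth[OF F])
  have V: "N.vector_field ?V" by (rule N.sgrad_fun_vector_field[OF H])
  have Z: "vector_field (sgrad \<omega> \<alpha>)" by (rule sgrad_vector_field[OF 1(1)])
  \<comment> \<open>The value of \<open>r\<close> affects neither the projected orbit nor its phase,
    and the lifted form does not see it; so \<open>g\<close> comes from a function on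
    \<open>M\<close> times the circle.\<close>
  have orbit: "?a (?\<Phi> \<tau> (p, r, s)) = ?a (?\<Phi> \<tau> (p, 0, s))" for \<tau> p r s
  proof -
    obtain \<sigma> where "s = circle_of \<sigma>" by (rule circle_of_cases)
    then show ?thesis by (simp only: contract_stab_flow)
  qed
  have orbit0: "?a (?\<Phi> \<tau> (p, r, s)) = 0" if p: "p \<notin> K" for \<tau> p r s
  proof -
    obtain r' s' where e: "?\<Phi> \<tau> (p, r, s) = (p, r', s')"
      using flow_outside[OF compact_imp_closed[OF K] F0 p, of \<tau> r s] by (metis prod.collapse)
    obtain \<sigma> where \<sigma>: "s' = circle_of \<sigma>" by (rule circle_of_cases)
    show ?thesis
      unfolding e \<sigma> contract_stab by (rule contract_outside[OF p])
  qed
  define g where "g = N.weighted_average ?\<Phi> ?a T"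
  have g: "smooth_fun (stab_atlas A) g"
    unfolding g_def by (rule N.weighted_average_smooth[OF V stab_flow N.contract_smooth[OF 1(2) V]])
  define G where "G = (\<lambda>z. g (fst z, 0, snd z))"
  have G: "smooth_fun (prod_atlas A circle_atlas) G" unfolding G_def by (rule restrict_smooth[OF g])
  have gG: "g = lift_fun G 0"
  proof
    fix P :: "'a \<times> real \<times> circle"
    obtain p r s where P: "P = (p, r, s)" by (cases P)
    show "g P = lift_fun G 0 P"
      unfolding P G_def g_def N.weighted_average_def[OF V stab_flow] fst_conv snd_conv orbit[of _ p r s] by (simp add: lift_fun_def)
  qed
  have G0: "G (p, s) = 0" if "p \<notin> K" for p s
    using orbit0[OF that] by (simp add: G_def g_def N.weighted_average_def[OF V stab_flow])
  let ?\<beta> = "\<lambda>s i p v. \<alpha> i p v + differential A (at_time G (circle_rep s)) i p v"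
  have \<beta>: "one_form A (?\<beta> s)" for s by (rule one_form_add[OF 1(1) differential_one_form[OF at_time_smooth[OF G]]])
  have "\<exists>\<Psi>. flow (sgrad \<omega> (?\<beta> s)) \<Psi>" for s
  proof (rule compact_perturbation_imp_flow[OF Z \<psi> sgrad_vector_field[OF \<beta>] K])
    fix p i assume p: "p \<notin> K" "p \<in> Cd i"
    have "differential A (at_time G (circle_rep s)) i p v = 0" for v
      by (rule differential_eq_0[OF open_Compl[OF compact_imp_closed[OF K]] _ _ p(2)]) (use p G0 in \<open>simp_all add: at_time_def\<close>)
    then show "sgrad \<omega> (?\<beta> s) i p = sgrad \<omega> \<alpha> i p" by (simp add: sgrad_def)
  qed
  then have "\<forall>s. \<exists>\<Psi>. flow (sgrad \<omega> (?\<beta> s)) \<Psi>" by (rule allI)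
  from choice[OF this] obtain \<Psi> where \<Psi>: "\<forall>s. flow (sgrad \<omega> (?\<beta> s)) (\<Psi> s)" by (elim exE)
  have "\<exists>R. \<forall>t. (R has_real_derivative time_derivative G (\<Psi> s t p) (circle_rep s)) (at t)" for s p
  proof (rule antiderivative_real)
    have "continuous_on UNIV (\<lambda>t. \<Psi> s t p)"
      using flow_curve[OF \<Psi>[rule_format, of s], of p] by (simp add: integral_curve_def)
    then show "continuous_on UNIV (\<lambda>t. time_derivative G (\<Psi> s t p) (circle_rep s))"
      by (rule continuous_on_compose2[OF time_derivative_continuous[OF G]]) simp
  qed
  then have "\<forall>z. \<exists>R. \<forall>t. (R has_real_derivative time_derivative G (\<Psi> (snd z) t (fst z)) (circle_rep (snd z))) (at t)"
    by (intro allI)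
  from choice[OF this] obtain R where
    R: "\<forall>z t. (R z has_real_derivative time_derivative G (\<Psi> (snd z) t (fst z)) (circle_rep (snd z))) (at t)"
    by (elim exE)
  define \<psi>' where "\<psi>' t P = (\<Psi> (snd (snd P)) t (fst P),
    fst (snd P) + R (fst P, snd (snd P)) t - R (fst P, snd (snd P)) 0, circle_of (circle_rep (snd (snd P)) + 0 * t))"
    for t P
  let ?\<beta>' = "\<lambda>k P V. lift_form \<alpha> k P V + differential (stab_atlas A) g k P V"
  have \<psi>': "N.flow (sgrad (stab_form \<omega>) ?\<beta>') \<psi>'"
  proof (rule N.flowI[OF N.sgrad_vector_field[OF N.one_form_add[OF 1(2) N.differential_one_form[OF g]]]])
    fix P :: "'a \<times> real \<times> circle"
    obtain p r s where P: "P = (p, r, s)" by (cases P)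
    show "\<psi>' 0 P = P" using flow_0[OF \<Psi>[rule_format, of s]] by (simp add: \<psi>'_def P)
    show "N.curve (sgrad (stab_form \<omega>) ?\<beta>') UNIV (\<lambda>t. \<psi>' t P)"
      unfolding \<psi>'_def P fst_conv snd_conv
    proof (rule stab_curveI[OF flow_curve[OF \<Psi>[rule_format, of s]]])
      show "((\<lambda>t. r + R (p, s) t - R (p, s) 0) has_real_derivative
          time_derivative G (\<Psi> s t p) (circle_rep s)) (at t)" for t
        using R[rule_format, of "(p, s)" t] by (auto intro!: derivative_eq_intros)
      fix t i u a assume q: "\<Psi> s t p \<in> Cd i" and s: "circle_of (circle_rep s + 0 * t) \<in> cdom (circle_atlas a)"
      have "circle_of (circle_rep s) = circle_of (circle_rep s + 0 * t)" by simp
      from sgrad_perturbed_lift_form[OF G \<alpha> q s this]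
      show "sgrad (stab_form \<omega>) ?\<beta>' (i, u, a) (\<Psi> s t p, r + R (p, s) t - R (p, s) 0, circle_of (circle_rep s + 0 * t)) =
        (sgrad \<omega> (?\<beta> s) i (\<Psi> s t p), time_derivative G (\<Psi> s t p) (circle_rep s), 0)"
        unfolding gG .
    qed
  qed
  \<comment> \<open>The flow of the lifted form: \<psi> on \<open>M\<close>, the identity on the
    cotangent bundle of the circle.\<close>
  define \<psi>2 where "\<psi>2 t P = (\<psi> t (fst P), fst (snd P), circle_of (circle_rep (snd (snd P)) + 0 * t))" for t and P :: "'a \<times> real \<times> circle"
  have \<psi>2: "N.flow (sgrad (stab_form \<omega>) (lift_form \<alpha>)) \<psi>2"
  proof (rule N.flowI[OF N.sgrad_vector_field[OF 1(2)]])
    show "\<psi>2 0 P = P" for P by (simp add: \<psi>2_def flow_0[OF \<psi>])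
    show "N.curve (sgrad (stab_form \<omega>) (lift_form \<alpha>)) UNIV (\<lambda>t. \<psi>2 t P)" for P
      unfolding \<psi>2_def
    proof (rule stab_curveI[OF flow_curve[OF \<psi>]])
      show "((\<lambda>t. fst (snd P)) has_real_derivative 0) (at t)" for t by simp
      fix t i u a assume "\<psi> t (fst P) \<in> Cd i" "circle_of (circle_rep (snd (snd P)) + 0 * t) \<in> cdom (circle_atlas a)"
      from sgrad_lift_form[OF \<alpha> this]
      show "sgrad (stab_form \<omega>) (lift_form \<alpha>) (i, u, a) (\<psi> t (fst P), fst (snd P), circle_of (circle_rep (snd (snd P)) + 0 * t)) =
        (sgrad \<omega> \<alpha> i (\<psi> t (fst P)), 0, 0)" .
    qed
  qed
  have "\<exists>\<theta>. hamiltonian_diffeo (stab_atlas A) (stab_form \<omega>) \<theta> \<and> (\<forall>P. lift_fun F 1 (\<psi>2 1 P) - lift_fun F 1 (\<theta> P) < 1)"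
  proof (rule N.hamiltonian_diffeo_averaging[OF lift_form_closed[OF \<alpha>] \<psi>2 H stab_flow T])
    show "integral {0..T} (\<lambda>\<tau>. ?a (?\<Phi> \<tau> P)) < T" for P
    proof -
      obtain p r s where P: "P = (p, r, s)" by (cases P)
      have \<sigma>: "s = circle_of (circle_rep s)" by simp
      show ?thesis
        unfolding P by (subst \<sigma>, unfold contract_stab_flow, rule avg[OF circle_rep_ge_0 circle_rep_lt_1])
    qed
    show "N.flow (sgrad (stab_form \<omega>) (\<lambda>k P V. lift_form \<alpha> k P V +
        differential (stab_atlas A) (N.weighted_average ?\<Phi> ?a T) k P V)) \<psi>'"
      using \<psi>' unfolding g_def .
  qed
  then show ?thesis by (simp only: \<psi>2_def mult_zero_left add_0_right circle_of_circle_rep prod.collapse)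
qed

end

end

end

end

end

section \<open>Invariant measures\<close>

lemma compact_decseq_Int_empty:
  fixes E :: "nat \<Rightarrow> 'a::topological_space set"
  assumes K: "compact K" and E: "\<And>n. closed (E n)" "decseq E" and empty: "K \<inter> (\<Inter>n. E n) = {}"
  shows "\<exists>n. K \<inter> E n = {}"
proof -
  have cov: "K \<subseteq> (\<Union>n\<in>UNIV. - E n)" using empty by auto
  obtain C where C: "finite C" "K \<subseteq> (\<Union>n\<in>C. - E n)"
    by (rule compactE_image[OF K _ cov]) (auto intro: E(1) open_Compl)
  have "E (Max (insert 0 C)) \<subseteq> E n" if "n \<in> C" for n
    by (rule decseqD[OF E(2)]) (use C(1) that in simp)
  then have "K \<inter> E (Max (insert 0 C)) = {}" using C(2) by blast
  then show ?thesis ..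
qed

text \<open>With digits \<open>0\<close> and \<open>1\<close> in base \<open>3\<close>, as for the
  Cantor set, strings that differ in an early digit have values a definite distance apart; in base
  \<open>2\<close> this fails.\<close>

definition ternary :: "(nat \<Rightarrow> real) \<Rightarrow> real" where
  "ternary s = (\<Sum>n. s n / 3 ^ n)"

lemma ternary_summable:
  assumes "\<forall>n. s n \<in> {0, 1}"
  shows "summable (\<lambda>n. s n / 3 ^ n :: real)"
proof (rule summable_comparison_test')
  show "summable (\<lambda>n. (1/3::real) ^ n)" by (rule summable_geometric) simp
  show "norm (s n / 3 ^ n) \<le> (1/3) ^ n" for n
    using assms[rule_format, of n] by (auto simp: power_divide)
qed

lemma ternary_ge_0:
  assumes "\<forall>n. s n \<in> {0, 1}"
  shows "0 \<le> ternary s"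
  unfolding ternary_def
  by (rule suminf_nonneg[OF ternary_summable[OF assms]]) (use assms in \<open>metis divide_nonneg_nonneg empty_iff insert_iff order.refl zero_le_numeral zero_le_one zero_le_power\<close>)

lemma ternary_le:
  assumes "\<forall>n. s n \<in> {0, 1}"
  shows "ternary s \<le> 3 / 2"
proof -
  have "ternary s \<le> (\<Sum>n. (1/3::real) ^ n)"
    unfolding ternary_def
  proof (rule suminf_le[OF _ ternary_summable[OF assms] summable_geometric])
    show "s n / 3 ^ n \<le> (1/3) ^ n" for n using assms[rule_format, of n] by (auto simp: power_divide)
  qed simp
  also have "\<dots> = 3 / 2" by (simp add: suminf_geometric)
  finally show ?thesis .
qed

lemma ternary_Suc:
  assumes "\<forall>n. s n \<in> {0, 1}"
  shows "ternary s = s 0 + ternary (\<lambda>n. s (Suc n)) / 3"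
proof -
  have s: "summable (\<lambda>n. s (Suc n) / 3 ^ n)" by (rule ternary_summable) (use assms in blast)
  have "(\<Sum>n. s (Suc n) / 3 ^ Suc n) = (\<Sum>n. s (Suc n) / 3 ^ n) / 3"
    using suminf_divide[OF s, of 3] by (simp add: mult.commute)
  then show ?thesis
    using suminf_split_head[OF ternary_summable[OF assms]] by (simp add: ternary_def)
qed

text \<open>A differing digit at position \<open>0\<close> contributes \<open>1\<close>, and the
  tails, of value between \<open>0\<close> and \<open>3 / 2\<close>, can cancel at most
  \<open>(3 / 2) / 3 = 1 / 2\<close> of it. Position \<open>N\<close> follows by shifting, which
  scales distances by \<open>3\<close>.\<close>

lemma ternary_digit:
  assumes "\<forall>n. s n \<in> {0, 1}" "\<forall>n. t n \<in> {0, 1}" "\<bar>ternary s - ternary t\<bar> < 1 / (2 * 3 ^ N)"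
  shows "s N = t N"
  using assms
proof (induction N arbitrary: s t)
  have head: "s 0 = t 0" if s: "\<forall>n. s n \<in> {0, 1}" and t: "\<forall>n. t n \<in> {0, 1}"
    and d: "\<bar>ternary s - ternary t\<bar> < 1 / 2" for s t
  proof -
    have 1: "\<forall>n. s (Suc n) \<in> {0, 1}" "\<forall>n. t (Suc n) \<in> {0, 1}" using s t by blast+
    show ?thesis
      using s[rule_format, of 0] t[rule_format, of 0] d ternary_Suc[OF s] ternary_Suc[OF t]
        ternary_ge_0[OF 1(1)] ternary_le[OF 1(1)] ternary_ge_0[OF 1(2)] ternary_le[OF 1(2)] by auto
  qed
  {
    case 0
    then show ?case using head[of s t] by simp
  next
    case (Suc N)
    have "(2::real) \<le> 2 * 3 ^ Suc N" using one_le_power[of "3::real" "Suc N"] by linarith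
    then have "1 / (2 * 3 ^ Suc N) \<le> (1 / 2 :: real)" by (rule divide_left_mono) simp_all
    from less_le_trans[OF Suc.prems(3) this] have 0: "s 0 = t 0" by (rule head[OF Suc.prems(1,2)])
    have "\<bar>ternary s - ternary t\<bar> = \<bar>ternary (\<lambda>n. s (Suc n)) - ternary (\<lambda>n. t (Suc n))\<bar> / 3"
      unfolding ternary_Suc[OF Suc.prems(1)] ternary_Suc[OF Suc.prems(2)] 0
      by (simp only: add_diff_cancel_left diff_divide_distrib[symmetric] abs_divide abs_numeral)
    moreover have "1 / (2 * 3 ^ Suc N) = 1 / (2 * 3 ^ N) / (3::real)" by simp
    ultimately have "\<bar>ternary (\<lambda>n. s (Suc n)) - ternary (\<lambda>n. t (Suc n))\<bar> / 3 < 1 / (2 * 3 ^ N) / 3"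
      using Suc.prems(3) by simp
    moreover have "a / 3 < b / 3 \<Longrightarrow> a < b" for a b :: real by simp
    ultimately have d: "\<bar>ternary (\<lambda>n. s (Suc n)) - ternary (\<lambda>n. t (Suc n))\<bar> < 1 / (2 * 3 ^ N)" by blast
    show ?case by (rule Suc.IH[OF _ _ d]) (use Suc.prems in blast)+
  }
qed

text \<open>The digits of \<open>e x\<close> tell which members of a countable separating family contain \<open>x\<close>. The code
  is not continuous, but nearby codes share their first digits, so that it has a continuous
  left inverse on the closure of the image of a compact set.\<close>

lemma separating_code:
  obtains e :: "'a::{second_countable_topology,t2_space} \<Rightarrow> real"
  where "\<And>x. 0 \<le> e x \<and> e x \<le> 3 / 2"
    and "\<And>x y. x \<noteq> y \<Longrightarrow> \<exists>U V \<delta>. open U \<and> open V \<and> x \<in> U \<and> y \<in> V \<and> 0 < \<delta> \<and> (\<forall>z\<in>U. \<forall>w\<in>V. \<delta> \<le> \<bar>e z - e w\<bar>)"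
proof -
  obtain B :: "'a set set" where B: "countable B" "topological_basis B"
    using ex_countable_basis by blast
  \<comment> \<open>The pair of empty sets makes \<open>Q\<close> nonempty, as its enumeration
    requires.\<close>
  define Q where "Q = insert ({}, {}) {(U, V). U \<in> B \<and> V \<in> B \<and> U \<inter> V = {}}"
  have Q: "countable Q"
    unfolding Q_def by (rule countable_insert[OF countable_subset[OF _ countable_SIGMA[OF B(1) B(1)]]]) blast
  define f where "f = from_nat_into Q"
  have f: "range f = Q" unfolding f_def by (rule range_from_nat_into[OF _ Q]) (simp add: Q_def)
  define s where "s x n = (if x \<in> fst (f n) then 1 else 0 :: real)" for x n
  have s: "\<forall>n. s x n \<in> {0, 1}" for x by (simp add: s_def)
  show ?thesis
  proof (rule that[of "\<lambda>x. ternary (s x)"])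
    show "0 \<le> ternary (s x) \<and> ternary (s x) \<le> 3 / 2" for x using ternary_ge_0[OF s] ternary_le[OF s] by blast
    fix x y :: 'a assume "x \<noteq> y"
    then obtain U' V' where UV': "open U'" "open V'" "x \<in> U'" "y \<in> V'" "U' \<inter> V' = {}" by (rule hausdorff[THEN exE]) blast
    obtain U where U: "U \<in> B" "x \<in> U" "U \<subseteq> U'" by (rule topological_basisE[OF B(2) UV'(1,3)])
    obtain V where V: "V \<in> B" "y \<in> V" "V \<subseteq> V'" by (rule topological_basisE[OF B(2) UV'(2,4)])
    have dis: "U \<inter> V = {}" using UV'(5) U(3) V(3) by blast
    then have "(U, V) \<in> range f" using U(1) V(1) unfolding f Q_def by blast
    then obtain n where n: "(U, V) = f n" by (rule rangeE)
    \<comment> \<open>The digit at position \<open>n\<close> is \<open>1\<close> throughout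
      \<open>U\<close> and \<open>0\<close> throughout \<open>V\<close>.\<close>
    have "1 / (2 * 3 ^ n) \<le> \<bar>ternary (s z) - ternary (s w)\<bar>" if zw: "z \<in> U" "w \<in> V" for z w
    proof (rule ccontr)
      assume "\<not> ?thesis"
      then have "s z n = s w n" by (intro ternary_digit[OF s s]) simp
      moreover have "w \<notin> U" using zw dis by blast
      ultimately show False using zw by (simp add: s_def n[symmetric])
    qed
    moreover have "open U" "open V" using topological_basis_open[OF B(2)] U V by blast+
    moreover have "0 < 1 / (2 * 3 ^ n :: real)" by simp
    ultimately show "\<exists>U V \<delta>. open U \<and> open V \<and> x \<in> U \<and> y \<in> V \<and> 0 < \<delta> \<and>
        (\<forall>z\<in>U. \<forall>w\<in>V. \<delta> \<le> \<bar>ternary (s z) - ternary (s w)\<bar>)" using U(2) V(2) by blast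
  qed
qed

text \<open>For \<open>d\<close> in the closure of the codes the sets \<open>E d n\<close> have
  exactly one common point in \<open>K\<close>: compactness provides one, and two would have
  neighbourhoods whose codes stay apart. This point is \<open>\<pi> d\<close>. A second use of
  compactness shows that \<open>E d n\<close>, within \<open>K\<close>, shrinks into any
  neighbourhood of it, hence the continuity of \<pi>.\<close>

lemma compact_code:
  fixes K :: "'a::{second_countable_topology,t2_space} set"
  assumes K: "compact K"
  obtains e :: "'a \<Rightarrow> real" and \<pi> D where "compact D" "e ` K \<subseteq> D" "continuous_on D \<pi>" "\<pi> ` D \<subseteq> K" "\<And>x. x \<in> K \<Longrightarrow> \<pi> (e x) = x"
proof -
  obtain e :: "'a \<Rightarrow> real" where e: "\<And>x. 0 \<le> e x \<and> e x \<le> 3 / 2"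
    and sep: "\<And>x y. x \<noteq> y \<Longrightarrow> \<exists>U V \<delta>. open U \<and> open V \<and> x \<in> U \<and> y \<in> V \<and> 0 < \<delta> \<and> (\<forall>z\<in>U. \<forall>w\<in>V. \<delta> \<le> \<bar>e z - e w\<bar>)"
    by (rule separating_code) blast
  define S where "S d n = {z \<in> K. \<bar>e z - d\<bar> < 1 / real (Suc n)}" for d n
  define E where "E d n = closure (S d n)" for d n
  define D where "D = closure (e ` K)"
  have D: "compact D" unfolding D_def compact_closure by (rule bounded_subset[of "{0..3/2}"]) (use e in auto)
  have Sdec: "S d m \<subseteq> S d n" if "n \<le> m" for d m n
  proof -
    have "1 / real (Suc m) \<le> 1 / real (Suc n)" using that by (simp add: field_simps)
    then show ?thesis by (auto simp: S_def)
  qed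
  have E: "closed (E d n)" "decseq (E d)" for d n
    using closure_mono[OF Sdec] by (simp_all add: E_def decseq_def)
  have ex: "\<exists>x\<in>K. \<forall>n. x \<in> E d n" if d: "d \<in> D" for d
  proof (rule ccontr)
    assume "\<not> ?thesis"
    then have "K \<inter> (\<Inter>n. E d n) = {}" by blast
    from compact_decseq_Int_empty[OF K E this] obtain n where n: "K \<inter> E d n = {}" by blast
    have "0 < 1 / real (Suc n)" by simp
    with d obtain y where y: "y \<in> e ` K" "dist y d < 1 / real (Suc n)"
      unfolding D_def closure_approachable by blast
    then obtain z where "z \<in> K" "y = e z" by blast
    then have z: "z \<in> S d n" using y by (simp add: S_def dist_real_def)
    then have "z \<in> E d n" unfolding E_def by (rule closure_subset[THEN subsetD])
    then show False using n z by (auto simp: S_def)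
  qed
  have unique: "x = y" if x: "\<forall>n. x \<in> E d n" and y: "\<forall>n. y \<in> E d n" for d x y
  proof (rule ccontr)
    assume "x \<noteq> y"
    from sep[OF this] obtain U V \<delta> where *: "open U" "open V" "x \<in> U" "y \<in> V" "0 < \<delta>"
        "\<forall>z\<in>U. \<forall>w\<in>V. \<delta> \<le> \<bar>e z - e w\<bar>" by blast
    obtain n where n: "1 / real (Suc n) < \<delta> / 2" using nat_approx_posE[of "\<delta> / 2"] *(5) by auto
    have "U \<inter> S d n \<noteq> {}" "V \<inter> S d n \<noteq> {}"
      using x y *(1-4) open_Int_closure_eq_empty unfolding E_def by blast+
    then obtain z w where zw: "z \<in> U" "z \<in> S d n" "w \<in> V" "w \<in> S d n" by blast
    have "\<delta> \<le> \<bar>e z - e w\<bar>" using * zw by blast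
    moreover have "\<bar>e z - d\<bar> < 1 / real (Suc n)" "\<bar>e w - d\<bar> < 1 / real (Suc n)" using zw by (simp_all add: S_def)
    ultimately show False using n by linarith
  qed
  define \<pi> where "\<pi> d = (SOME x. x \<in> K \<and> (\<forall>n. x \<in> E d n))" for d
  have \<pi>: "\<pi> d \<in> K \<and> (\<forall>n. \<pi> d \<in> E d n)" if "d \<in> D" for d
    unfolding \<pi>_def by (rule someI_ex) (use ex[OF that] in blast)
  show ?thesis
  proof (rule that[of D e \<pi>])
    show "compact D" by (rule D)
    show "e ` K \<subseteq> D" unfolding D_def by (rule closure_subset)
    show "\<pi> ` D \<subseteq> K" using \<pi> by blast
    show "\<pi> (e x) = x" if x: "x \<in> K" for x
    proof (rule unique)
      have "e x \<in> D" unfolding D_def by (rule closure_subset[THEN subsetD, OF imageI[OF x]])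
      then show "\<forall>n. \<pi> (e x) \<in> E (e x) n" using \<pi> by blast
      have "x \<in> S (e x) n" for n using x by (simp add: S_def)
      then show "\<forall>n. x \<in> E (e x) n" unfolding E_def by (intro allI closure_subset[THEN subsetD])
    qed
    show "continuous_on D \<pi>"
      unfolding continuous_on_topological
    proof (intro ballI allI impI)
      fix d W assume d: "d \<in> D" and W: "open W" "\<pi> d \<in> W"
      have "(K - W) \<inter> (\<Inter>n. E d n) = {}" using unique[of "\<pi> d" d] \<pi>[OF d] W(2) by blast
      from compact_decseq_Int_empty[OF compact_diff[OF K W(1)] E this]
      obtain n where n: "(K - W) \<inter> E d n = {}" by blast
      \<comment> \<open>\<open>1 / real (Suc ?m)\<close> is half of \<open>1 / real (Suc n)\<close>:
        one half for moving \<open>d\<close> to \<open>d'\<close>, the other for the code of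
        \<open>z\<close>.\<close>
      let ?m = "Suc (2 * n)"
      have m: "1 / real (Suc ?m) + 1 / real (Suc ?m) = 1 / real (Suc n)" by (simp add: field_simps)
      have "\<pi> d' \<in> W" if d': "d' \<in> D" "d' \<in> ball d (1 / real (Suc ?m))" for d'
      proof -
        have "S d' ?m \<subseteq> S d n"
        proof
          fix z assume "z \<in> S d' ?m"
          then have z: "z \<in> K" "\<bar>e z - d'\<bar> < 1 / real (Suc ?m)" unfolding S_def by blast+
          have "\<bar>d - d'\<bar> < 1 / real (Suc ?m)" using d'(2) by (simp only: mem_ball dist_real_def)
          then have "\<bar>e z - d\<bar> < 1 / real (Suc n)" using z(2) m by linarith
          then show "z \<in> S d n" using z(1) by (simp add: S_def)
        qed
        then have "E d' ?m \<subseteq> E d n" unfolding E_def by (rule closure_mono)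
        then show ?thesis using \<pi>[OF d'(1)] n by blast
      qed
      then show "\<exists>A. open A \<and> d \<in> A \<and> (\<forall>y\<in>D. y \<in> A \<longrightarrow> \<pi> y \<in> W)"
        by (intro exI[of _ "ball d (1 / real (Suc ?m))"]) auto
    qed
  qed
qed

text \<open>The coding moves the empirical measures to the real line, where weak limits are provided by
  Helly's selection theorem.\<close>

theorem krylov_bogoliubov:
  fixes T :: "'a::{second_countable_topology,t2_space} \<Rightarrow> 'a" and b :: "'a \<Rightarrow> real"
  assumes K: "compact K" and T: "continuous_on UNIV T" "\<And>x. x \<in> K \<Longrightarrow> T x \<in> K"
    and cozero: "\<And>U :: 'a set. open U \<Longrightarrow> \<exists>h::'a \<Rightarrow> real. continuous_on UNIV h \<and> (\<forall>x. 0 \<le> h x) \<and> U = {x. h x \<noteq> 0}"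
    and b: "continuous_on UNIV b" and x: "\<And>n. x n \<in> K"
    and large: "\<And>n. real n - c \<le> (\<Sum>k<n. b ((T ^^ k) (x n)))"
  obtains \<mu> where "prob_space \<mu>" "sets \<mu> = sets borel" "AE x in \<mu>. x \<in> K"
    "T \<in> measurable \<mu> \<mu>" "distr \<mu> \<mu> T = \<mu>" "1 \<le> (\<integral>x. b x \<partial>\<mu>)"
proof -
  obtain D and e :: "'a \<Rightarrow> real" and \<pi> where D: "compact D" "e ` K \<subseteq> D" "continuous_on D \<pi>" "\<pi> ` D \<subseteq> K"
    and \<pi>: "\<And>x. x \<in> K \<Longrightarrow> \<pi> (e x) = x"
    by (rule compact_code[OF K]) blast
  have Tn: "(T ^^ k) z \<in> K" if "z \<in> K" for k z using that T(2) by (induction k) auto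
  have eD: "e ((T ^^ k) (x n)) \<in> D" for k n using D(2) Tn[OF x] by blast
  have D0: "D \<noteq> {}" using eD by blast
  \<comment> \<open>Index \<open>n\<close> stands for the orbit segment of length
    \<open>Suc n\<close>, so the denominator never vanishes.\<close>
  define avg where "avg h n = (\<Sum>k<Suc n. h ((T ^^ k) (x (Suc n)))) / real (Suc n)" for h :: "'a \<Rightarrow> real" and n
  define \<nu> where "\<nu> n = distr (measure_pmf (pmf_of_set {..<Suc n})) borel (\<lambda>k. e ((T ^^ k) (x (Suc n))))" for n
  have \<nu>: "real_distribution (\<nu> n)" for n
    unfolding \<nu>_def real_distribution_def real_distribution_axioms_def
    by (intro conjI prob_space.prob_space_distr measure_pmf.prob_space_axioms) simp_all
  have int\<nu>: "(\<integral>d. g d \<partial>\<nu> n) = (\<Sum>k<Suc n. g (e ((T ^^ k) (x (Suc n))))) / real (Suc n)"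
    if "g \<in> borel_measurable borel" for g :: "real \<Rightarrow> real" and n
  proof -
    have "(\<integral>d. g d \<partial>\<nu> n) = (\<integral>k. g (e ((T ^^ k) (x (Suc n)))) \<partial>measure_pmf (pmf_of_set {..<Suc n}))"
      unfolding \<nu>_def by (rule integral_distr[OF _ that]) simp
    also have "\<dots> = (\<Sum>k<Suc n. g (e ((T ^^ k) (x (Suc n))))) / real (card {..<Suc n})"
      by (rule integral_pmf_of_set) auto
    finally show ?thesis by simp
  qed
  have "tight \<nu>"
    unfolding tight_def
  proof (intro conjI allI impI \<nu>)
    fix \<epsilon> :: real assume \<epsilon>: "0 < \<epsilon>"
    obtain a where a: "0 < a" "\<forall>d\<in>D. \<bar>d\<bar> \<le> a"
      using compact_imp_bounded[OF D(1)] unfolding bounded_pos real_norm_def by blast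
    have "measure (\<nu> n) {- a - 1<..a} = 1" for n
    proof -
      have "\<bar>e ((T ^^ k) (x (Suc n)))\<bar> \<le> a" for k using a(2) eD by blast
      then have "(\<lambda>k. e ((T ^^ k) (x (Suc n)))) -` {- a - 1<..a} = UNIV"
        by (force simp: abs_le_iff)
      then show ?thesis unfolding \<nu>_def by (subst measure_distr) simp_all
    qed
    then show "\<exists>a b. a < b \<and> (\<forall>n. 1 - \<epsilon> < measure (\<nu> n) {a<..b})"
      using \<epsilon> a(1) by (intro exI[of _ "- a - 1"] exI[of _ a]) simp
  qed
  from tight_imp_convergent_subsubsequence[OF this strict_mono_id]
  obtain r M where r: "strict_mono (r :: nat \<Rightarrow> nat)" and M: "real_distribution M" and conv: "weak_conv_m (\<nu> \<circ> r) M"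
    by auto
  interpret M: real_distribution M by (rule M)
  have lim: "(\<lambda>j. \<integral>d. g d \<partial>\<nu> (r j)) \<longlonglongrightarrow> (\<integral>d. g d \<partial>M)"
    if g: "continuous_on UNIV g" "\<And>d. \<bar>g d\<bar> \<le> B" for g :: "real \<Rightarrow> real" and B
    using weak_conv_imp_integral_bdd_continuous_conv[of "\<nu> \<circ> r" M g B] \<nu> M conv g
    by (simp add: continuous_on_eq_continuous_at)
  have M_D: "AE d in M. d \<in> D"
  proof -
    \<comment> \<open>A bounded continuous function that vanishes at all codes of orbit points, so
      its integral against the weak limit is zero.\<close>
    define g where "g d = min 1 (infdist d D)" for d
    have g: "continuous_on UNIV g" unfolding g_def by (intro continuous_intros)
    have gb: "0 \<le> g d" "\<bar>g d\<bar> \<le> 1" for d using infdist_nonneg[of d D] by (auto simp: g_def)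
    have gm: "g \<in> borel_measurable borel" by (rule borel_measurable_continuous_onI[OF g])
    have "(\<integral>d. g d \<partial>\<nu> (r j)) = 0" for j
      unfolding int\<nu>[OF gm] by (simp add: g_def eD)
    then have 0: "(\<integral>d. g d \<partial>M) = 0" using lim[OF g gb(2)] by (simp add: LIMSEQ_const_iff)
    have "integrable M g"
      by (rule M.integrable_const_bound[of _ 1]) (use gb gm in auto)
    with 0 gb(1) have "AE d in M. g d = 0" by (subst (asm) integral_nonneg_eq_0_iff_AE) auto
    then show ?thesis
    proof eventually_elim
      case (elim d)
      then have "infdist d D = 0" using infdist_nonneg[of d D] by (auto simp: g_def min_def split: if_splits)
      then show "d \<in> D" using in_closed_iff_infdist_zero[OF compact_imp_closed[OF D(1)] D0] by blast
    qed
  qed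
  \<comment> \<open>Off the closed set \<open>D\<close>, which carries \<open>M\<close>, the
    decoding is completed by a point of \<open>K\<close>; it becomes Borel and keeps its values in
    \<open>K\<close>.\<close>
  define p where "p d = (if d \<in> D then \<pi> d else x 0)" for d
  have Db: "D \<in> sets borel" using compact_imp_closed[OF D(1)] by simp
  have p: "p \<in> borel_measurable borel"
    unfolding p_def by (rule borel_measurable_continuous_on_if[OF Db D(3) continuous_on_const])
  then have pM: "p \<in> measurable M borel" by (simp add: measurable_def M.events_eq_borel sets_eq_imp_space_eq[OF M.events_eq_borel])
  define \<mu> where "\<mu> = distr M borel p"
  have pK: "p d \<in> K" for d using D(4) x by (auto simp: p_def)
  have sets\<mu>: "sets \<mu> = sets borel" by (simp add: \<mu>_def)
  interpret \<mu>: prob_space \<mu> unfolding \<mu>_def by (rule M.prob_space_distr[OF pM])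
  have Kb: "K \<in> sets borel" using compact_imp_closed[OF K] by simp
  have AEK: "AE x in \<mu>. x \<in> K" unfolding \<mu>_def by (subst AE_distr_iff[OF pM]) (use Kb pK in auto)
  have Tm: "T \<in> measurable borel borel" by (rule borel_measurable_continuous_onI[OF T(1)])
  have T\<mu>: "T \<in> measurable \<mu> \<mu>" using Tm by (simp cong: measurable_cong_sets add: sets\<mu>)
  have key: "(\<lambda>j. avg h (r j)) \<longlonglongrightarrow> (\<integral>x. h x \<partial>\<mu>)" if h: "continuous_on UNIV h" for h
  proof -
    have hm: "h \<in> borel_measurable borel" by (rule borel_measurable_continuous_onI[OF h])
    have c: "continuous_on D (\<lambda>d. h (\<pi> d))" by (rule continuous_on_compose2[OF h D(3)]) simp
    obtain B where B: "0 < B" "\<forall>y\<in>(\<lambda>d. h (\<pi> d)) ` D. norm y \<le> B"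
      using compact_imp_bounded[OF compact_continuous_image[OF c D(1)]] unfolding bounded_pos by blast
    \<comment> \<open>Weak convergence tests bounded continuous functions on the line;
      \<open>h \<circ> \<pi>\<close> lives on \<open>D\<close> and is extended by Tietze's theorem
      with the same bound.\<close>
    obtain g where g: "continuous_on UNIV g" "\<And>d. d \<in> D \<Longrightarrow> g d = h (\<pi> d)" "\<And>d. d \<in> UNIV \<Longrightarrow> norm (g d) \<le> B"
      by (rule Tietze[OF c, of UNIV B]) (use B compact_imp_closed[OF D(1)] in auto)
    have gm: "g \<in> borel_measurable borel" by (rule borel_measurable_continuous_onI[OF g(1)])
    have "(\<integral>d. g d \<partial>\<nu> n) = avg h n" for n
      unfolding int\<nu>[OF gm] avg_def g(2)[OF eD] \<pi>[OF Tn[OF x]] ..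
    moreover have "(\<lambda>j. \<integral>d. g d \<partial>\<nu> (r j)) \<longlonglongrightarrow> (\<integral>d. g d \<partial>M)"
      by (rule lim[OF g(1)]) (use g(3) in auto)
    moreover have "(\<integral>d. g d \<partial>M) = (\<integral>d. h (p d) \<partial>M)"
    proof (rule integral_cong_AE)
      show "g \<in> borel_measurable M" using gm by simp
      show "(\<lambda>d. h (p d)) \<in> borel_measurable M" by (rule measurable_compose[OF pM hm])
      show "AE d in M. g d = h (p d)" using M_D by eventually_elim (simp add: g(2) p_def)
    qed
    moreover have "(\<integral>d. h (p d) \<partial>M) = (\<integral>x. h x \<partial>\<mu>)" unfolding \<mu>_def by (rule integral_distr[OF pM hm, symmetric])
    ultimately show ?thesis by simp
  qed
  have inv: "(\<integral>x. h (T x) \<partial>\<mu>) = (\<integral>x. h x \<partial>\<mu>)" if h: "continuous_on UNIV h" for h :: "'a \<Rightarrow> real"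
  proof -
    have hT: "continuous_on UNIV (\<lambda>x. h (T x))" by (rule continuous_on_compose2[OF h T(1)]) simp
    obtain B where B: "0 < B" "\<forall>y\<in>h ` K. norm y \<le> B"
      using compact_imp_bounded[OF compact_continuous_image[OF continuous_on_subset[OF h] K]] unfolding bounded_pos by auto
    \<comment> \<open>The sums of \<open>h \<circ> T\<close> and \<open>h\<close> along an orbit
      telescope to two end terms, of total size at most \<open>2 * B\<close>.\<close>
    have "norm (avg (\<lambda>x. h (T x)) (r j) - avg h (r j)) \<le> 2 * B / real (Suc j)" for j
    proof -
      let ?n = "Suc (r j)"
      have "(\<Sum>k<?n. h (T ((T ^^ k) (x ?n)))) - (\<Sum>k<?n. h ((T ^^ k) (x ?n)))
          = (\<Sum>k<?n. h ((T ^^ Suc k) (x ?n)) - h ((T ^^ k) (x ?n)))" by (simp only: sum_subtractf funpow.simps o_apply)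
      also have "\<dots> = h ((T ^^ ?n) (x ?n)) - h ((T ^^ 0) (x ?n))" by (rule sum_lessThan_telescope)
      finally have "avg (\<lambda>x. h (T x)) (r j) - avg h (r j) = (h ((T ^^ ?n) (x ?n)) - h (x ?n)) / real ?n"
        unfolding avg_def diff_divide_distrib[symmetric] by simp
      moreover have "norm (h ((T ^^ ?n) (x ?n)) - h (x ?n)) \<le> 2 * B"
        using norm_triangle_ineq4[of "h ((T ^^ ?n) (x ?n))" "h (x ?n)"]
          B(2)[rule_format, OF imageI[OF Tn[OF x[of ?n], of ?n], of h]] B(2)[rule_format, OF imageI[OF x[of ?n], of h]]
        by linarith
      ultimately have "norm (avg (\<lambda>x. h (T x)) (r j) - avg h (r j)) \<le> 2 * B / real ?n"
        by (simp only: norm_divide) (simp add: divide_right_mono)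
      also have "\<dots> \<le> 2 * B / real (Suc j)"
        using seq_suble[OF r, of j] B(1) by (intro divide_left_mono) auto
      finally show ?thesis .
    qed
    moreover have "(\<lambda>j. 2 * B / real (Suc j)) \<longlonglongrightarrow> 0"
      using LIMSEQ_Suc[OF lim_const_over_n[of "2 * B"]] by simp
    ultimately have "(\<lambda>j. avg (\<lambda>x. h (T x)) (r j) - avg h (r j)) \<longlonglongrightarrow> 0"
      by (rule Lim_null_comparison[OF always_eventually[OF allI]])
    from LIMSEQ_unique[OF tendsto_diff[OF key[OF hT] key[OF h]] this] show ?thesis by simp
  qed
  have open_inv: "measure \<mu> (T -` U) = measure \<mu> U" if U: "open U" for U
  proof -
    obtain h :: "'a \<Rightarrow> real" where h: "continuous_on UNIV h" "\<forall>x. 0 \<le> h x" "U = {x. h x \<noteq> 0}"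
      using cozero[OF U] by (elim exE conjE)
    \<comment> \<open>These continuous functions tend to the indicator of \<open>U\<close>, so that
      dominated convergence passes invariance on to open sets.\<close>
    define f where "f m x = min 1 (real m * h x)" for m x
    have f: "continuous_on UNIV (f m)" for m unfolding f_def by (intro continuous_intros h(1))
    have fb: "norm (f m x) \<le> 1" for m x using h(2) by (simp add: f_def)
    have fl: "(\<lambda>m. f m x) \<longlonglongrightarrow> indicator U x" for x
    proof (cases "h x = 0")
      case True
      then show ?thesis by (simp add: f_def h(3))
    next
      case False
      then have hx: "0 < h x" using h(2) by (simp add: less_le)
      have "f m x = 1" if "m \<ge> nat \<lceil>1 / h x\<rceil>" for m
      proof -
        have "1 / h x \<le> real m" using that by linarith
        then have "1 \<le> real m * h x" using hx by (simp add: field_simps)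
        then show ?thesis by (simp add: f_def)
      qed
      then have "eventually (\<lambda>m. f m x = 1) sequentially" unfolding eventually_sequentially by blast
      then show ?thesis using False by (simp add: h(3) tendsto_eventually)
    qed
    have Us: "U \<in> sets \<mu>" using U by (simp add: sets\<mu>)
    have TUs: "T -` U \<in> sets \<mu>" using open_vimage[OF U T(1)] by (simp add: sets\<mu>)
    have fm: "f m \<in> borel_measurable \<mu>" for m
      using borel_measurable_continuous_onI[OF f[of m]] by (simp cong: measurable_cong_sets add: sets\<mu>)
    have l1: "(\<lambda>m. \<integral>x. f m x \<partial>\<mu>) \<longlonglongrightarrow> (\<integral>x. indicator U x \<partial>\<mu>)"
      by (rule integral_dominated_convergence[where w="\<lambda>_. 1"]) (use Us fm fl fb in auto)
    have l2: "(\<lambda>m. \<integral>x. f m (T x) \<partial>\<mu>) \<longlonglongrightarrow> (\<integral>x. indicator U (T x) \<partial>\<mu>)"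
    proof (rule integral_dominated_convergence[where w="\<lambda>_. 1"])
      show "(\<lambda>x. indicator U (T x) :: real) \<in> borel_measurable \<mu>"
        by (rule measurable_compose[OF T\<mu>]) (use Us in simp)
      show "(\<lambda>x. f m (T x)) \<in> borel_measurable \<mu>" for m by (rule measurable_compose[OF T\<mu> fm])
    qed (use fl fb in auto)
    have "(\<integral>x. indicator U (T x) \<partial>\<mu>) = (\<integral>x. indicator U x \<partial>\<mu> :: real)"
      by (rule LIMSEQ_unique[OF l2]) (use l1 in \<open>simp only: inv[OF f]\<close>)
    moreover have "(\<lambda>x. indicator U (T x) :: real) = indicator (T -` U)" by (auto simp: indicator_def fun_eq_iff)
    ultimately show ?thesis using Us TUs by (simp add: \<mu>.emeasure_eq_measure)
  qed
  have distr_T: "distr \<mu> \<mu> T = \<mu>"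
  proof (rule measure_eqI_generator_eq[where \<Omega>=UNIV and E="{U. open U}" and A="\<lambda>_. UNIV"])
    show "Int_stable {U :: 'a set. open U}" by (auto simp: Int_stable_def)
    show "emeasure (distr \<mu> \<mu> T) U = emeasure \<mu> U" if "U \<in> {U. open U}" for U
    proof -
      have U: "open U" "U \<in> sets \<mu>" using that by (simp_all add: sets\<mu>)
      have "space \<mu> = UNIV" using sets_eq_imp_space_eq[OF sets\<mu>] by simp
      then show ?thesis
        using open_inv[OF U(1)] by (simp add: emeasure_distr[OF T\<mu> U(2)] \<mu>.emeasure_eq_measure)
    qed
    show "sets (distr \<mu> \<mu> T) = sigma_sets UNIV {U. open U}" "sets \<mu> = sigma_sets UNIV {U. open U}"
      by (simp_all add: sets\<mu> borel_def)
    show "emeasure (distr \<mu> \<mu> T) UNIV \<noteq> \<infinity>"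
      using \<mu>.prob_space_distr[OF T\<mu>] by (simp add: prob_space.emeasure_eq_1_AE emeasure_distr[OF T\<mu>] sets\<mu>)
  qed auto
  have "1 \<le> (\<integral>x. b x \<partial>\<mu>)"
  proof (rule LIMSEQ_le[OF _ key[OF b]])
    have "(\<lambda>j. 1 - c / real (Suc j)) \<longlonglongrightarrow> 1 - 0"
      using LIMSEQ_Suc[OF lim_const_over_n[of c]] by (intro tendsto_diff) auto
    then have "((\<lambda>j. 1 - c / real (Suc j)) \<circ> r) \<longlonglongrightarrow> 1 - 0" by (rule LIMSEQ_subseq_LIMSEQ[OF _ r])
    then show "(\<lambda>j. 1 - c / real (Suc (r j))) \<longlonglongrightarrow> 1" by (simp add: o_def)
    show "\<exists>N. \<forall>j\<ge>N. 1 - c / real (Suc (r j)) \<le> avg b (r j)"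
    proof (intro exI allI impI)
      fix j
      have "1 - c / real (Suc (r j)) = (real (Suc (r j)) - c) / real (Suc (r j))" by (simp add: diff_divide_distrib)
      also have "\<dots> \<le> avg b (r j)" unfolding avg_def by (rule divide_right_mono[OF large]) simp
      finally show "1 - c / real (Suc (r j)) \<le> avg b (r j)" .
    qed
  qed
  then show ?thesis by (rule that[OF \<mu>.prob_space_axioms sets\<mu> AEK T\<mu> distr_T])
qed

section \<open>Orbits with large rotation\<close>

lemma antiderivative_bound:
  fixes G :: "real \<Rightarrow> real"
  assumes G: "\<And>t. (G has_real_derivative g t) (at t)" and ab: "a \<le> b"
    and C: "\<And>t. a \<le> t \<Longrightarrow> t \<le> b \<Longrightarrow> \<bar>g t\<bar> \<le> C"
  shows "\<bar>G b - G a\<bar> \<le> C * (b - a)"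
proof (cases "a = b")
  case False
  then have "a < b" using ab by simp
  from MVT2[OF this G] obtain z where z: "a < z" "z < b" "G b - G a = (b - a) * g z" by blast
  then have "\<bar>G b - G a\<bar> = (b - a) * \<bar>g z\<bar>" by (simp add: abs_mult)
  also have "\<dots> \<le> (b - a) * C" using C[of z] z ab by (intro mult_left_mono) auto
  finally show ?thesis by (simp add: mult.commute)
qed simp

text \<open>Shifting the starting time from \<open>0\<close> to \<sigma> alters the integral only by
  two end pieces of length less than \<open>1\<close>, each at most \<open>C\<close> in absolute
  value; hence \<open>2 * C\<close>.\<close>

lemma orbit_integral_le:
  fixes f :: "real \<Rightarrow> 'a \<Rightarrow> real"
  assumes f: "\<And>x. continuous_on UNIV (\<lambda>t. f t x)" and per: "\<And>t n x. f (t + real n) x = f t ((T ^^ n) x)"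
    and C: "\<And>t x. 0 \<le> t \<Longrightarrow> t \<le> 1 \<Longrightarrow> \<bar>f t x\<bar> \<le> C" and \<sigma>: "0 \<le> \<sigma>" "\<sigma> < 1"
  shows "integral {0..real n} (\<lambda>\<tau>. f (\<tau> + \<sigma>) x) \<le> (\<Sum>k<n. integral {0..1} (\<lambda>t. f t ((T ^^ k) x))) + 2 * C"
proof -
  obtain G where G: "\<And>t. (G has_real_derivative f t x) (at t)" using antiderivative_real[OF f[of x]] by blast
  have int: "integral {0..l} (\<lambda>\<tau>. f (\<tau> + s) x) = G (l + s) - G s" if "0 \<le> l" for l s
  proof -
    have "((\<lambda>\<tau>. f (\<tau> + s) x) has_integral G (l + s) - G (0 + s)) {0..l}"
    proof (rule fundamental_theorem_of_calculus[OF that])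
      show "((\<lambda>\<tau>. G (\<tau> + s)) has_vector_derivative f (\<tau> + s) x) (at \<tau> within {0..l})" for \<tau>
        using has_field_derivative_at_within[OF DERIV_shift[THEN iffD1, OF G]]
        by (simp add: has_real_derivative_iff_has_vector_derivative)
    qed
    then show ?thesis by (simp add: integral_unique)
  qed
  have "integral {0..1} (\<lambda>t. f t ((T ^^ k) x)) = G (real (Suc k)) - G (real k)" for k
    using int[of 1 "real k"] by (simp add: per add.commute)
  then have "(\<Sum>k<n. integral {0..1} (\<lambda>t. f t ((T ^^ k) x))) = (\<Sum>k<n. G (real (Suc k)) - G (real k))" by simp
  also have "\<dots> = G (real n) - G (real 0)" by (rule sum_lessThan_telescope)
  finally have sum: "(\<Sum>k<n. integral {0..1} (\<lambda>t. f t ((T ^^ k) x))) = G (real n) - G 0" by simp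
  have C0: "0 \<le> C" using C[of 0 x] by linarith
  have "\<bar>G \<sigma> - G 0\<bar> \<le> C * (\<sigma> - 0)" by (rule antiderivative_bound[OF G \<sigma>(1)]) (use C \<sigma> in auto)
  also have "\<dots> \<le> C" using \<sigma> C0 by (simp add: mult_left_le)
  finally have 1: "\<bar>G \<sigma> - G 0\<bar> \<le> C" .
  have "\<bar>G (real n + \<sigma>) - G (real n)\<bar> \<le> C * (real n + \<sigma> - real n)"
  proof (rule antiderivative_bound[OF G])
    fix t assume "real n \<le> t" "t \<le> real n + \<sigma>"
    then show "\<bar>f t x\<bar> \<le> C" using C[of "t - real n" "(T ^^ n) x"] per[of "t - real n" n x] \<sigma> by simp
  qed (use \<sigma> in simp)
  also have "\<dots> \<le> C" using \<sigma> C0 by (simp add: mult_left_le)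
  finally show ?thesis using 1 int[of "real n" \<sigma>] sum by simp
qed

context smooth_manifold
begin

text \<open>A cone over a ball in a chart, extended by zero. It vanishes off the image
  \<open>C\<close> of the closed ball, which is compact and therefore closed in a Hausdorff space;
  continuity is checked on the two open sets \<open>Cd i\<close> and \<open>- C\<close>.\<close>

lemma bump_function:
  assumes U: "open U" "p \<in> U"
  shows "\<exists>h::'a \<Rightarrow> real. continuous_on UNIV h \<and> (\<forall>x. 0 \<le> h x \<and> h x \<le> 1) \<and> h p \<noteq> 0 \<and> {x. h x \<noteq> 0} \<subseteq> U"
proof -
  obtain i where i: "p \<in> Cd i" using ex_chart by blast
  have "cm i p \<in> {x \<in> Cr i. ci i x \<in> U}" using i U(2) by simp
  then obtain e where e: "0 < e" "cball (cm i p) e \<subseteq> {x \<in> Cr i. ci i x \<in> U}"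
    using open_ci_vimage[of U i, OF U(1)] open_contains_cball by blast
  define h where "h q = (if q \<in> Cd i then max 0 (1 - dist (cm i q) (cm i p) / e) else 0)" for q
  define C where "C = ci i ` cball (cm i p) e"
  have "compact C"
    unfolding C_def
    by (rule compact_continuous_image[OF continuous_on_subset[OF continuous_on_ci] compact_cball]) (use e(2) in auto)
  then have C: "open (- C)" by (intro open_Compl compact_imp_closed)
  have near: "dist (cm i q) (cm i p) < e" if "h q \<noteq> 0" for q
    using that e(1) by (auto simp: h_def max_def field_simps split: if_splits)
  have out: "h q = 0" if "q \<in> - C" for q
  proof (rule ccontr)
    assume n: "h q \<noteq> 0"
    then have "q \<in> Cd i" by (rule contrapos_np) (simp add: h_def)
    moreover have "cm i q \<in> cball (cm i p) e" using near[OF n] by (simp add: dist_commute)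
    ultimately have "q \<in> C" unfolding C_def by (metis ci_cm imageI)
    with that show False by simp
  qed
  have "continuous_on (Cd i \<union> - C) h"
  proof (rule continuous_on_open_Un[OF open_Cd C])
    have "continuous_on (Cd i) (\<lambda>q. max 0 (1 - dist (cm i q) (cm i p) / e))"
      by (intro continuous_intros continuous_on_cm) (use e(1) in simp)
    then show "continuous_on (Cd i) h" by (rule continuous_on_eq) (simp add: h_def)
    show "continuous_on (- C) h" by (rule continuous_on_eq[OF continuous_on_const]) (simp add: out)
  qed
  moreover have "Cd i \<union> - C = UNIV" using e(2) by (auto simp: C_def)
  moreover have "0 \<le> h x \<and> h x \<le> 1" for x using e(1) by (simp add: h_def)
  moreover have "h p \<noteq> 0" using i by (simp add: h_def)
  moreover have "q \<in> U" if n: "h q \<noteq> 0" for q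
  proof -
    have i: "q \<in> Cd i" using n by (rule contrapos_np) (simp add: h_def)
    have "cm i q \<in> cball (cm i p) e" using near[OF n] by (simp add: dist_commute)
    then have "ci i (cm i q) \<in> U" using e(2) by blast
    then show ?thesis using i by simp
  qed
  ultimately show ?thesis by (intro exI[of _ h]) auto
qed

text \<open>By Lindelof's theorem countably many sets \<open>{x. h x \<noteq> 0}\<close> of bump
  functions exhaust \<open>U\<close>; bounds by \<open>1\<close> and the weights
  \<open>(1/2) ^ n\<close> make the sum converge uniformly. The result supplies the hypothesis
  \<open>cozero\<close> of \<open>krylov_bogoliubov\<close>, through which integrals of continuous
  functions determine a Borel measure without a metric.\<close>

lemma open_cozero:
  assumes U: "open U"
  shows "\<exists>h::'a \<Rightarrow> real. continuous_on UNIV h \<and> (\<forall>x. 0 \<le> h x) \<and> U = {x. h x \<noteq> 0}"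
proof -
  define \<F> where "\<F> = {S. S \<subseteq> U \<and> (\<exists>h::'a \<Rightarrow> real. continuous_on UNIV h \<and> (\<forall>x. 0 \<le> h x \<and> h x \<le> 1) \<and> S = {x. h x \<noteq> 0})}"
  have op: "open S" if S: "S \<in> \<F>" for S
  proof -
    from S[unfolded \<F>_def, THEN CollectD, THEN conjunct2] obtain h :: "'a \<Rightarrow> real"
      where h: "continuous_on UNIV h" "\<forall>x. 0 \<le> h x \<and> h x \<le> 1" "S = {x. h x \<noteq> 0}" by (elim exE conjE)
    have "S = h -` (- {0})" using h(3) by auto
    then show ?thesis using open_vimage[OF open_Compl[OF closed_singleton] h(1), of 0] by simp
  qed
  obtain \<F>' where F': "\<F>' \<subseteq> \<F>" "countable \<F>'" "\<Union>\<F>' = \<Union>\<F>" by (rule Lindelof[OF op])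
  have "U \<subseteq> \<Union>\<F>"
  proof
    fix p assume "p \<in> U"
    from bump_function[OF U this] obtain h :: "'a \<Rightarrow> real" where
      h: "continuous_on UNIV h" "\<forall>x. 0 \<le> h x \<and> h x \<le> 1" "h p \<noteq> 0" "{x. h x \<noteq> 0} \<subseteq> U" by (elim exE conjE)
    then have "{x. h x \<noteq> 0} \<in> \<F>" unfolding \<F>_def by (intro CollectI conjI exI[of _ h] refl)
    then show "p \<in> \<Union>\<F>" using h(3) by blast
  qed
  moreover have "\<Union>\<F> \<subseteq> U" unfolding \<F>_def by (rule Union_least) (drule CollectD, erule conjunct1)
  ultimately have un: "\<Union>\<F>' = U" using F'(3) by simp
  \<comment> \<open>The empty set is adjoined so that the countable family is nonempty and can be
    enumerated, even for empty \<open>U\<close>.\<close>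
  have "continuous_on UNIV (\<lambda>x::'a. 0::real)" by simp
  then have "{} \<in> \<F>" unfolding \<F>_def by (intro CollectI conjI exI[of _ "\<lambda>_. 0"]) simp_all
  then have F0: "insert {} \<F>' \<subseteq> \<F>" using F'(1) by blast
  define f where "f = from_nat_into (insert {} \<F>')"
  have f: "range f = insert {} \<F>'" unfolding f_def using F'(2) by (intro range_from_nat_into) auto
  have Uf: "U = \<Union>(range f)" unfolding f using un by simp
  have "\<forall>n. \<exists>h::'a \<Rightarrow> real. continuous_on UNIV h \<and> (\<forall>x. 0 \<le> h x \<and> h x \<le> 1) \<and> f n = {x. h x \<noteq> 0}"
  proof
    fix n
    have fn: "f n \<in> \<F>" using rangeI[of f n] unfolding f by (rule subsetD[OF F0])
    show "\<exists>h::'a \<Rightarrow> real. continuous_on UNIV h \<and> (\<forall>x. 0 \<le> h x \<and> h x \<le> 1) \<and> f n = {x. h x \<noteq> 0}"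
      by (rule fn[unfolded \<F>_def, THEN CollectD, THEN conjunct2])
  qed
  from choice[OF this] obtain h :: "nat \<Rightarrow> 'a \<Rightarrow> real"
    where h: "\<forall>n. continuous_on UNIV (h n) \<and> (\<forall>x. 0 \<le> h n x \<and> h n x \<le> 1) \<and> f n = {x. h n x \<noteq> 0}" by (elim exE)
  have hb: "0 \<le> h n x" "h n x \<le> 1" for n x using h by blast+
  let ?t = "\<lambda>n x. (1/2) ^ n * h n x"
  have sg: "summable (\<lambda>n. (1/2::real) ^ n)" by (rule summable_geometric) simp
  have tb: "norm (?t n x) \<le> (1/2) ^ n" for n x
    using hb[of n x] by (simp add: abs_mult mult_left_le)
  have sm: "summable (\<lambda>n. ?t n x)" for x by (rule summable_comparison_test'[OF sg tb])
  have ul: "uniform_limit UNIV (\<lambda>n x. \<Sum>i<n. ?t i x) (\<lambda>x. \<Sum>n. ?t n x) sequentially"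
    by (rule Weierstrass_m_test[OF tb sg])
  have hc: "continuous_on UNIV (h n)" for n using h by blast
  have "continuous_on UNIV (\<lambda>x. \<Sum>i<n. ?t i x)" for n
    by (intro continuous_on_sum continuous_on_mult continuous_on_const hc)
  then have "\<forall>\<^sub>F n in sequentially. continuous_on UNIV (\<lambda>x. \<Sum>i<n. ?t i x)"
    by (rule always_eventually[OF allI])
  from uniform_limit_theorem[OF this ul sequentially_bot]
  have "continuous_on UNIV (\<lambda>x. \<Sum>n. ?t n x)" .
  moreover have "0 \<le> (\<Sum>n. ?t n x)" for x by (rule suminf_nonneg[OF sm]) (simp add: hb)
  moreover have "x \<in> U \<longleftrightarrow> (\<Sum>n. ?t n x) \<noteq> 0" for x
  proof -
    have "x \<in> U \<longleftrightarrow> (\<exists>n. x \<in> f n)" unfolding Uf by blast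
    also have "\<dots> \<longleftrightarrow> (\<exists>n. h n x \<noteq> 0)" using h by blast
    also have "\<dots> \<longleftrightarrow> (\<Sum>n. ?t n x) \<noteq> 0"
      by (subst suminf_eq_zero_iff[OF sm]) (simp_all add: hb)
    finally show ?thesis .
  qed
  ultimately show ?thesis by (intro exI[of _ "\<lambda>x. \<Sum>n. ?t n x"]) blast
qed

end

section \<open>Rotation along orbits\<close>

context symplectic_mfd
begin

context
  fixes F :: "'a \<times> circle \<Rightarrow> real" and \<phi> :: "real \<Rightarrow> 'a \<Rightarrow> 'a" and K :: "'a set"
  assumes F: "smooth_fun (prod_atlas A circle_atlas) F"
    and \<phi>: "is_flow A (\<lambda>t. sgrad_fun A \<omega> (at_time F t)) UNIV \<phi>"
    and K: "compact K" and F0: "\<forall>p. p \<notin> K \<longrightarrow> (\<forall>s. F (p, s) = 0)"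
begin

text \<open>The integrand of the rotation vector along the orbit of \<open>x\<close>; over unit time
  it integrates to the integral of the form over the trajectory.\<close>

definition rate :: "('i, 'a, 'e) form1 \<Rightarrow> real \<Rightarrow> 'a \<Rightarrow> real" where
  "rate \<alpha> t x = contract A \<alpha> (sgrad_fun A \<omega> (at_time F t)) (\<phi> t x)"

lemma rate_continuous:
  assumes \<alpha>: "closed_one_form A \<alpha>"
  shows "continuous_on UNIV (\<lambda>z. rate \<alpha> (fst z) (snd z))"
proof -
  have "continuous_on UNIV (\<lambda>z. (\<lambda>(t, p). contract A \<alpha> (sgrad_fun A \<omega> (at_time F t)) p) (fst z, \<phi> (fst z) (snd z)))"
  proof (rule continuous_on_compose2[OF contract_stab_continuous[OF F \<phi> \<alpha>]])
    have "continuous_on UNIV (\<lambda>z. (\<lambda>z. \<phi> (snd z) (fst z)) (snd z, fst z))"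
      by (rule continuous_on_compose2[OF flow_jointly_continuous[OF F \<phi>]]) (intro continuous_intros subset_UNIV)+
    then show "continuous_on UNIV (\<lambda>z. (fst z, \<phi> (fst z) (snd z)))" by (intro continuous_intros) simp
  qed simp
  then show ?thesis by (simp add: rate_def)
qed

lemma rate_continuous_time: "closed_one_form A \<alpha> \<Longrightarrow> continuous_on S (\<lambda>t. rate \<alpha> t x)"
  by (rule continuous_on_compose2[OF rate_continuous, of \<alpha> S "\<lambda>t. (t, x)", simplified])
    (auto intro!: continuous_intros)

lemma rate_periodic: "rate \<alpha> (t + real n) x = rate \<alpha> t ((\<phi> 1 ^^ n) x)"
proof -
  have "circle_of (t + real n) = circle_of t" by (simp add: circle_of_eq_iff)
  then have "at_time F (t + real n) = at_time F t" by (simp add: at_time_def fun_eq_iff)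
  then show ?thesis by (simp add: rate_def periodic_flow_funpow[OF F \<phi>])
qed

lemma rate_outside: "closed_one_form A \<alpha> \<Longrightarrow> p \<notin> K \<Longrightarrow> rate \<alpha> t p = 0"
  unfolding rate_def flow_outside_id[OF F \<phi> compact_imp_closed[OF K] F0]
  by (rule contract_outside[OF F \<phi> _ K F0])

lemma rate_bounded:
  assumes \<alpha>: "closed_one_form A \<alpha>"
  obtains C where "0 \<le> C" "\<And>t p. 0 \<le> t \<Longrightarrow> t \<le> 1 \<Longrightarrow> \<bar>rate \<alpha> t p\<bar> \<le> C"
proof -
  have "compact ((\<lambda>z. rate \<alpha> (fst z) (snd z)) ` ({0..1} \<times> K))"
    by (intro compact_continuous_image continuous_on_subset[OF rate_continuous[OF \<alpha>]] compact_Times compact_Icc K) simp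
  from compact_imp_bounded[OF this] obtain C where C: "0 < C"
    "\<forall>y\<in>(\<lambda>z. rate \<alpha> (fst z) (snd z)) ` ({0..1} \<times> K). norm y \<le> C" unfolding bounded_pos by blast
  show ?thesis
  proof (rule that[of C])
    show "0 \<le> C" using C(1) by simp
    fix t p assume t: "0 \<le> t" "t \<le> (1::real)"
    show "\<bar>rate \<alpha> t p\<bar> \<le> C"
    proof (cases "p \<in> K")
      case True
      then have "(t, p) \<in> {0..1} \<times> K" using t by simp
      from C(2)[rule_format, OF imageI[OF this]] show ?thesis by simp
    next
      case False
      then show ?thesis using C(1) rate_outside[OF \<alpha>] by simp
    qed
  qed
qed

lemma average_rate_continuous:
  assumes \<alpha>: "closed_one_form A \<alpha>"
  shows "continuous_on UNIV (\<lambda>x. integral {0..1} (\<lambda>t. rate \<alpha> t x))"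
proof -
  have "continuous_on UNIV (\<lambda>z. (\<lambda>z. rate \<alpha> (fst z) (snd z)) (snd z, fst z))"
    by (rule continuous_on_compose2[OF rate_continuous[OF \<alpha>]]) (intro continuous_intros subset_UNIV)+
  then have "continuous_on UNIV (\<lambda>(x, t). rate \<alpha> t x)" by (simp add: case_prod_unfold)
  then have "continuous_on (UNIV \<times> cbox 0 1) (\<lambda>(x, t). rate \<alpha> t x)" by (rule continuous_on_subset) simp
  from integral_continuous_on_param[OF this] show ?thesis by simp
qed

text \<open>Along a trajectory the two forms differ by the derivative of \<open>g\<close>, so the
  rotations differ by a coboundary of the time-one map. Orbit sums then change by two end terms
  only, which allows a passage from \<alpha> to the representative chosen in
  \<open>rotation_vector\<close>.\<close>

lemma cohomologous_average_rate:
  assumes \<alpha>: "closed_one_form A \<alpha>" and \<beta>: "closed_one_form A \<beta>" and g: "smooth_fun A g"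
    and eq: "\<forall>i. \<forall>p\<in>cdom (A i). \<forall>v. \<beta> i p v = \<alpha> i p v + differential A g i p v"
  shows "integral {0..1} (\<lambda>t. rate \<beta> t x) = integral {0..1} (\<lambda>t. rate \<alpha> t x) + (g (\<phi> 1 x) - g x)"
proof -
  have c: "integral_curve A (\<lambda>t. sgrad_fun A \<omega> (at_time F t)) UNIV (\<lambda>t. \<phi> t x)" using \<phi> by (simp add: is_flow_def)
  have 1: "one_form A \<alpha>" "one_form A \<beta>" using \<alpha> \<beta> by (simp_all add: closed_one_form_def)
  have d: "((\<lambda>t. g (\<phi> t x)) has_real_derivative rate \<beta> t x - rate \<alpha> t x) (at t)" for t
  proof -
    obtain i where i: "\<phi> t x \<in> Cd i" using ex_chart by blast
    have "rate \<beta> t x - rate \<alpha> t x = differential A g i (\<phi> t x) (sgrad_fun A \<omega> (at_time F t) i (\<phi> t x))"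
      unfolding rate_def contract_chart[OF 1(1) sgrad_fun_vector_field[OF at_time_smooth[OF F]] i]
        contract_chart[OF 1(2) sgrad_fun_vector_field[OF at_time_smooth[OF F]] i]
      using eq i by simp
    then show ?thesis using smooth_fun_along_curve[OF g c i] by simp
  qed
  have "((\<lambda>t. rate \<beta> t x - rate \<alpha> t x) has_integral g (\<phi> 1 x) - g (\<phi> 0 x)) {0..1}"
    by (rule fundamental_theorem_of_calculus)
      (use d in \<open>auto simp: has_real_derivative_iff_has_vector_derivative[symmetric] intro: has_field_derivative_at_within\<close>)
  moreover have "\<phi> 0 x = x" using \<phi> by (simp add: is_flow_def)
  ultimately have "integral {0..1} (\<lambda>t. rate \<beta> t x - rate \<alpha> t x) = g (\<phi> 1 x) - g x" by (simp add: integral_unique)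
  moreover have "integral {0..1} (\<lambda>t. rate \<beta> t x - rate \<alpha> t x)
      = integral {0..1} (\<lambda>t. rate \<beta> t x) - integral {0..1} (\<lambda>t. rate \<alpha> t x)"
    by (rule integral_diff; rule integrable_continuous_real; rule rate_continuous_time; fact)
  ultimately show ?thesis by simp
qed

text \<open>Fubini's theorem for a bounded integrand and two finite measures. The rotation vector
  integrates over space first, the orbit sums over time first.\<close>

lemma time_average_space_average:
  assumes \<alpha>: "closed_one_form A \<alpha>" and \<mu>: "prob_space \<mu>" "sets \<mu> = sets borel"
  shows "(LINT t:{0..1}|lborel. LINT x|\<mu>. rate \<alpha> t x) = (LINT x|\<mu>. integral {0..1} (\<lambda>t. rate \<alpha> t x))"
proof -
  interpret \<mu>: prob_space \<mu> by (rule \<mu>(1))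
  define L where "L = restrict_space lborel {0..1::real}"
  have L: "finite_measure L"
    unfolding L_def by (rule finite_measureI) (simp add: emeasure_restrict_space space_restrict_space)
  interpret L: finite_measure L by (rule L)
  interpret L\<mu>: pair_sigma_finite L \<mu> by unfold_locales
  have fin: "finite_measure (L \<Otimes>\<^sub>M \<mu>)"
    by (rule finite_measure_pair_measure) unfold_locales
  obtain C where C: "\<And>t p. 0 \<le> t \<Longrightarrow> t \<le> 1 \<Longrightarrow> \<bar>rate \<alpha> t p\<bar> \<le> C" using rate_bounded[OF \<alpha>] by blast
  have "(\<lambda>z. rate \<alpha> (fst z) (snd z)) \<in> borel_measurable (borel \<Otimes>\<^sub>M borel)"
    unfolding borel_prod by (rule borel_measurable_continuous_onI[OF rate_continuous[OF \<alpha>]])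
  moreover have "(\<lambda>z. (fst z, snd z)) \<in> measurable (L \<Otimes>\<^sub>M \<mu>) (borel \<Otimes>\<^sub>M borel)"
  proof (rule measurable_Pair)
    have "(\<lambda>t. t) \<in> measurable L borel" unfolding L_def by (rule measurable_restrict_space1) simp
    then show "fst \<in> measurable (L \<Otimes>\<^sub>M \<mu>) borel" by (rule measurable_compose[OF measurable_fst])
    have "(\<lambda>t. t) \<in> measurable \<mu> borel" by (rule measurable_ident_sets[OF \<mu>(2)])
    then show "snd \<in> measurable (L \<Otimes>\<^sub>M \<mu>) borel" by (rule measurable_compose[OF measurable_snd])
  qed
  ultimately have m: "(\<lambda>(t, x). rate \<alpha> t x) \<in> borel_measurable (L \<Otimes>\<^sub>M \<mu>)"
    using measurable_compose by (fastforce simp: case_prod_unfold)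
  have int: "integrable (L \<Otimes>\<^sub>M \<mu>) (\<lambda>(t, x). rate \<alpha> t x)"
  proof (rule finite_measure.integrable_const_bound[OF fin _ m])
    show "AE z in L \<Otimes>\<^sub>M \<mu>. norm ((\<lambda>(t, x). rate \<alpha> t x) z) \<le> C"
    proof (rule AE_I2)
      fix z assume "z \<in> space (L \<Otimes>\<^sub>M \<mu>)"
      then have "fst z \<in> {0..1}" by (simp add: space_pair_measure L_def space_restrict_space mem_Times_iff)
      then show "norm ((\<lambda>(t, x). rate \<alpha> t x) z) \<le> C" using C[of "fst z" "snd z"] by (simp add: case_prod_unfold)
    qed
  qed
  have "(LINT t:{0..1}|lborel. LINT x|\<mu>. rate \<alpha> t x) = (LINT t|L. LINT x|\<mu>. rate \<alpha> t x)"
    unfolding L_def set_lebesgue_integral_def by (rule integral_restrict_space[symmetric]) simp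
  also have "\<dots> = (LINT x|\<mu>. LINT t|L. rate \<alpha> t x)" by (rule L\<mu>.Fubini_integral[OF int, symmetric])
  also have "\<dots> = (LINT x|\<mu>. integral {0..1} (\<lambda>t. rate \<alpha> t x))"
  proof -
    have "(LINT t|L. rate \<alpha> t x) = integral {0..1} (\<lambda>t. rate \<alpha> t x)" for x
    proof -
      have "(LINT t|L. rate \<alpha> t x) = (LINT t:{0..1}|lborel. rate \<alpha> t x)"
        unfolding L_def set_lebesgue_integral_def by (rule integral_restrict_space) simp
      also have "\<dots> = integral {0..1} (\<lambda>t. rate \<alpha> t x)"
        by (rule set_borel_integral_eq_integral(2)[OF borel_integrable_atLeastAtMost'[OF rate_continuous_time[OF \<alpha>]]])
      finally show ?thesis .
    qed
    then show ?thesis by simp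
  qed
  finally show ?thesis .
qed

text \<open>Otherwise the orbit integrals of length \<open>n\<close> are below \<open>n\<close> from
  every phase, the shift of phase costing at most \<open>2 * C\<close>, and
  \<open>stab_averaging\<close> yields a diffeomorphism \<theta> that contradicts the intersection
  granted by \<open>Q1\<close>.\<close>

lemma large_orbit_sum:
  assumes \<alpha>: "closed_one_form A \<alpha>" and \<psi>: "flow (sgrad \<omega> \<alpha>) \<psi>"
    and Q1: "\<forall>\<theta>. hamiltonian_diffeo (stab_atlas A) (stab_form \<omega>) \<theta> \<longrightarrow> \<theta> ` stab Y \<inter> stab X \<noteq> {}"
    and X: "\<forall>t. \<forall>x\<in>X. at_time F t x \<le> 0" and Y: "\<forall>t. \<forall>x\<in>\<psi> 1 ` Y. at_time F t x \<ge> 1"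
    and C: "\<And>t p. 0 \<le> t \<Longrightarrow> t \<le> 1 \<Longrightarrow> \<bar>rate \<alpha> t p\<bar> \<le> C" and n: "0 < n"
  shows "\<exists>x. real n - 2 * C \<le> (\<Sum>k<n. integral {0..1} (\<lambda>t. rate \<alpha> t ((\<phi> 1 ^^ k) x)))"
proof (rule ccontr)
  assume neg: "\<not> ?thesis"
  have "integral {0..real n} (\<lambda>\<tau>. rate \<alpha> (\<tau> + \<sigma>) p) < real n" if \<sigma>: "0 \<le> \<sigma>" "\<sigma> < 1" for p \<sigma>
  proof -
    have "integral {0..real n} (\<lambda>\<tau>. rate \<alpha> (\<tau> + \<sigma>) p)
        \<le> (\<Sum>k<n. integral {0..1} (\<lambda>t. rate \<alpha> t ((\<phi> 1 ^^ k) p))) + 2 * C"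
      by (rule orbit_integral_le[of "rate \<alpha>", OF rate_continuous_time[OF \<alpha>] rate_periodic C \<sigma>])
    also have "\<dots> < real n" using neg by (metis diff_le_eq not_le)
    finally show ?thesis .
  qed
  then have avg: "\<And>p \<sigma>. 0 \<le> \<sigma> \<Longrightarrow> \<sigma> < 1 \<Longrightarrow>
      integral {0..real n} (\<lambda>\<tau>. contract A \<alpha> (sgrad_fun A \<omega> (at_time F (\<tau> + \<sigma>))) (\<phi> (\<tau> + \<sigma>) p)) < real n"
    by (simp only: rate_def)
  have n': "0 < real n" using n by simp
  have "\<exists>\<theta>. hamiltonian_diffeo (stab_atlas A) (stab_form \<omega>) \<theta> \<and>
      (\<forall>P. lift_fun F 1 (\<psi> 1 (fst P), snd P) - lift_fun F 1 (\<theta> P) < 1)"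
    by (rule stab_averaging[OF F \<phi> \<alpha> K F0 \<psi> n']) (rule avg)
  then obtain \<theta> where \<theta>: "hamiltonian_diffeo (stab_atlas A) (stab_form \<omega>) \<theta>"
    "\<forall>P. lift_fun F 1 (\<psi> 1 (fst P), snd P) - lift_fun F 1 (\<theta> P) < 1" by (elim exE conjE)
  from Q1[rule_format, OF \<theta>(1)] obtain P where P: "P \<in> stab Y" "\<theta> P \<in> stab X" by blast
  obtain y s where y: "P = (y, 0, s)" "y \<in> Y" using P(1) unfolding stab_def by blast
  obtain x s' where x: "\<theta> P = (x, 0, s')" "x \<in> X" using P(2) unfolding stab_def by blast
  obtain t t' where t: "s = circle_of t" "s' = circle_of t'" by (metis circle_of_cases)
  \<comment> \<open>On both stabilizations \<open>r = 0\<close>, so the suspended Hamiltonian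
    reduces to \<open>F\<close> at the two points.\<close>
  have "1 \<le> F (\<psi> 1 y, s)" using Y[rule_format, OF imageI[OF y(2)], of t] by (simp add: at_time_def t)
  moreover have "F (x, s') \<le> 0" using X[rule_format, OF x(2), of t'] by (simp add: at_time_def t)
  moreover have "F (\<psi> 1 y, s) - F (x, s') < 1"
    using \<theta>(2)[rule_format, of P] x(1) y(1) by (simp add: lift_fun_def)
  ultimately show False by simp
qed

end

end

section \<open>Orbits of increasing length and their limit measure\<close>

theorem theorem4p1:
  fixes A :: "('i, 'a::{second_countable_topology,t2_space}, 'e::euclidean_space) atlas"
    and \<omega> :: "('i, 'a, 'e) form2"
    and X Y :: "'a set"
    and \<alpha> :: "('i, 'a, 'e) form1"
    and \<psi> :: "real \<Rightarrow> 'a \<Rightarrow> 'a"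
  assumes M: "symplectic_manifold A \<omega>" "connected (UNIV :: 'a set)"
    and XY: "compact X" "compact Y"
    and Q1: "\<forall>\<theta>. hamiltonian_diffeo (stab_atlas A) (stab_form \<omega>) \<theta> \<longrightarrow> \<theta> ` stab Y \<inter> stab X \<noteq> {}"
    and Q2: "closed_one_form A \<alpha>" "is_flow A (\<lambda>t. sgrad \<omega> \<alpha>) UNIV \<psi>" "\<psi> 1 ` Y \<inter> X = {}"
  shows "\<forall>(F :: 'a \<times> circle \<Rightarrow> real) \<phi>.
     smooth_fun (prod_atlas A circle_atlas) F \<and> compactly_supported F \<and>
     (\<forall>t. \<forall>x\<in>X. at_time F t x \<le> 0) \<and>
     (\<forall>t. \<forall>x\<in>\<psi> 1 ` Y. at_time F t x \<ge> 1) \<and>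
     is_flow A (\<lambda>t. sgrad_fun A \<omega> (at_time F t)) UNIV \<phi> \<longrightarrow>
     (\<exists>\<mu>. compactly_supported_borel_prob \<mu> \<and> invariant_measure (\<phi> 1) \<mu> \<and>
        \<bar>rotation_vector A \<omega> F \<phi> \<mu> (deRham_class A \<alpha>)\<bar> \<ge> 1)"
proof (intro allI impI, elim conjE)
  fix F :: "'a \<times> circle \<Rightarrow> real" and \<phi>
  assume F: "smooth_fun (prod_atlas A circle_atlas) F" and supp: "compactly_supported F"
    and X: "\<forall>t. \<forall>x\<in>X. at_time F t x \<le> 0" and Y: "\<forall>t. \<forall>x\<in>\<psi> 1 ` Y. at_time F t x \<ge> 1"
    and \<phi>: "is_flow A (\<lambda>t. sgrad_fun A \<omega> (at_time F t)) UNIV \<phi>"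
  have "smooth_atlas A" using M(1) by (simp add: symplectic_manifold_def)
  then interpret symplectic_mfd A \<omega>
    by (intro symplectic_mfd.intro smooth_manifold.intro symplectic_mfd_axioms.intro M(1))
  let ?T = "\<phi> 1"
  \<comment> \<open>The shadow of the support on \<open>M\<close>, outside which the Hamiltonian
    vanishes at all times.\<close>
  define K where "K = fst ` closure {x. F x \<noteq> 0}"
  have K: "compact K"
    unfolding K_def using supp unfolding compactly_supported_def by (intro compact_continuous_image continuous_intros)
  have F0: "\<forall>p. p \<notin> K \<longrightarrow> (\<forall>s. F (p, s) = 0)"
  proof (intro allI impI, rule ccontr)
    fix p s assume p: "p \<notin> K" "F (p, s) \<noteq> 0"
    then have "(p, s) \<in> closure {x. F x \<noteq> 0}" by (intro closure_subset[THEN subsetD] CollectI)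
    then have "p \<in> K" unfolding K_def by (metis fst_conv imageI)
    with p(1) show False by simp
  qed
  let ?R = "rate F \<phi>"
  \<comment> \<open>The representative that \<open>rotation_vector\<close> picks. The orbit estimate
    is available for \<alpha>, whose gradient generates \<psi>, and has to be carried over to
    \<beta>.\<close>
  define \<beta> where "\<beta> = (SOME \<beta>. \<beta> \<in> deRham_class A \<alpha>)"
  have "smooth_fun A (\<lambda>_. 0)" unfolding smooth_fun_def o_def by (intro allI smooth_on_const open_Cr)
  moreover have "differential A (\<lambda>_. 0) i p v = 0" if "p \<in> Cd i" for i p v
    by (rule differential_eq_0[OF open_UNIV UNIV_I _ that]) simp
  ultimately have "\<alpha> \<in> deRham_class A \<alpha>"
    unfolding deRham_class_def using Q2(1) by (intro CollectI conjI exI[of _ "\<lambda>_. 0"]) simp_all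
  then have "\<beta> \<in> deRham_class A \<alpha>" unfolding \<beta>_def by (rule someI[of "\<lambda>\<beta>. \<beta> \<in> deRham_class A \<alpha>"])
  then obtain g where \<beta>: "closed_one_form A \<beta>" and g: "smooth_fun A g"
    and eq: "\<forall>i. \<forall>p\<in>cdom (A i). \<forall>v. \<beta> i p v = \<alpha> i p v + differential A g i p v"
    unfolding deRham_class_def by blast
  let ?B = "\<lambda>x. integral {0..1} (\<lambda>t. ?R \<alpha> t x)" and ?b = "\<lambda>x. integral {0..1} (\<lambda>t. ?R \<beta> t x)"
  have b: "?b x = ?B x + (g (?T x) - g x)" for x
    by (rule cohomologous_average_rate[OF F \<phi> K F0 Q2(1) \<beta> g eq])
  obtain C where C0: "0 \<le> C" and C: "\<And>t p. 0 \<le> t \<Longrightarrow> t \<le> 1 \<Longrightarrow> \<bar>?R \<alpha> t p\<bar> \<le> C"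
    by (rule rate_bounded[OF F \<phi> K F0 Q2(1)]) blast
  have BC: "\<bar>?B x\<bar> \<le> C" for x
  proof -
    have "norm (integral {0..1} (\<lambda>t. ?R \<alpha> t x)) \<le> C * (1 - 0)"
      by (rule integral_bound[OF _ rate_continuous_time[OF F \<phi> K F0 Q2(1)]]) (use C in auto)
    then show ?thesis by simp
  qed
  have TK: "?T x \<in> K" if "x \<in> K" for x by (rule flow_inside[OF F \<phi> compact_imp_closed[OF K] F0 that])
  have TnK: "(?T ^^ k) x \<in> K" if "x \<in> K" for k x using that TK by (induction k) auto
  have "continuous_on K g" by (rule continuous_on_subset[OF smooth_fun_continuous[OF g]]) simp
  from compact_imp_bounded[OF compact_continuous_image[OF this K]]
  obtain G where G: "\<forall>y\<in>g ` K. norm y \<le> G" unfolding bounded_pos by blast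
  have gG: "\<bar>g x\<bar> \<le> G" if "x \<in> K" for x using G[rule_format, OF imageI[OF that]] by simp
  have telescope: "(\<Sum>k<n. ?b ((?T ^^ k) x)) = (\<Sum>k<n. ?B ((?T ^^ k) x)) + (g ((?T ^^ n) x) - g x)" for n x
  proof -
    have "(\<Sum>k<n. g ((?T ^^ Suc k) x) - g ((?T ^^ k) x)) = g ((?T ^^ n) x) - g ((?T ^^ 0) x)"
      by (rule sum_lessThan_telescope)
    then show ?thesis unfolding b sum.distrib by simp
  qed
  \<comment> \<open>Points off \<open>K\<close> are fixed and have rate zero, so a positive lower
    bound for the sum forces the point into \<open>K\<close>.\<close>
  have big: "\<exists>x\<in>K. real n - 2 * C \<le> (\<Sum>k<n. ?B ((?T ^^ k) x))" if n: "0 < n" "2 * C < real n" for n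
  proof -
    have "\<exists>x. real n - 2 * C \<le> (\<Sum>k<n. ?B ((?T ^^ k) x))"
      by (rule large_orbit_sum[OF F \<phi> K F0 Q2(1,2) Q1 X Y _ n(1)]) (rule C)
    then obtain x where x: "real n - 2 * C \<le> (\<Sum>k<n. ?B ((?T ^^ k) x))" by (elim exE)
    have "x \<in> K"
    proof (rule ccontr)
      assume "x \<notin> K"
      then have "?T x = x" by (rule flow_outside_id[OF F \<phi> compact_imp_closed[OF K] F0])
      then have "(?T ^^ k) x = x" for k by (induction k) auto
      then have "(\<Sum>k<n. ?B ((?T ^^ k) x)) = 0" using rate_outside[OF F \<phi> K F0 Q2(1) \<open>x \<notin> K\<close>] by simp
      then show False using x n(2) by simp
    qed
    then show ?thesis using x by blast
  qed
  \<comment> \<open>One sufficiently long orbit shows that \<open>K\<close> is nonempty; the point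
    \<open>x0\<close> will serve for small \<open>n\<close>.\<close>
  obtain N :: nat where N: "2 * C < real N" using reals_Archimedean2 by blast
  then have "0 < N" using C0 by (cases N) auto
  from big[OF this N] obtain x0 where x0: "x0 \<in> K" by blast
  \<comment> \<open>The constant collects \<open>2 * C\<close> for the phase shift,
    \<open>2 * G\<close> for the end terms of the coboundary, and \<open>2 * C * C\<close> for the
    case \<open>real n \<le> 2 * C\<close>, where the sum over the orbit of \<open>x0\<close> is at
    least \<open>- (real n * C)\<close>.\<close>
  have "\<exists>x\<in>K. real n - (2 * C + 2 * C * C + 2 * G) \<le> (\<Sum>k<n. ?b ((?T ^^ k) x))" for n
  proof (cases "n = 0 \<or> real n \<le> 2 * C")
    case True
    have "\<bar>\<Sum>k<n. ?B ((?T ^^ k) x0)\<bar> \<le> (\<Sum>k<n. C)" by (rule order_trans[OF sum_abs sum_mono[OF BC]])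
    also have "\<dots> = real n * C" by simp
    also have "\<dots> \<le> 2 * C * C" using True C0 by (intro mult_right_mono) auto
    finally have "- (2 * C * C) \<le> (\<Sum>k<n. ?B ((?T ^^ k) x0))" by linarith
    moreover have "real n \<le> 2 * C" using True C0 by auto
    moreover have "- (2 * G) \<le> g ((?T ^^ n) x0) - g x0" using gG[OF x0] gG[OF TnK[OF x0, of n]] by linarith
    ultimately show ?thesis using x0 unfolding telescope by (intro bexI[OF _ x0]) linarith
  next
    case False
    then have n: "0 < n" "2 * C < real n" by auto
    from big[OF this] obtain x where x: "x \<in> K" "real n - 2 * C \<le> (\<Sum>k<n. ?B ((?T ^^ k) x))" by blast
    have "- (2 * G) \<le> g ((?T ^^ n) x) - g x" using gG[OF x(1)] gG[OF TnK[OF x(1), of n]] by linarith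
    moreover have "0 \<le> 2 * C * C" using C0 by simp
    ultimately show ?thesis using x(2) unfolding telescope by (intro bexI[OF _ x(1)]) linarith
  qed
  then have "\<forall>n. \<exists>x. x \<in> K \<and> real n - (2 * C + 2 * C * C + 2 * G) \<le> (\<Sum>k<n. ?b ((?T ^^ k) x))" by blast
  from choice[OF this] obtain x where
    x: "\<forall>n. x n \<in> K \<and> real n - (2 * C + 2 * C * C + 2 * G) \<le> (\<Sum>k<n. ?b ((?T ^^ k) (x n)))" by (elim exE)
  have xK: "x n \<in> K" and large: "real n - (2 * C + 2 * C * C + 2 * G) \<le> (\<Sum>k<n. ?b ((?T ^^ k) (x n)))" for n
    using x by simp_all
  have "continuous_on UNIV (\<lambda>z. (\<lambda>z. \<phi> (snd z) (fst z)) (z, 1))"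
    by (rule continuous_on_compose2[OF flow_jointly_continuous[OF F \<phi>]]) (intro continuous_intros subset_UNIV)+
  then have T: "continuous_on UNIV ?T" by simp
  obtain \<mu> where \<mu>: "prob_space \<mu>" "sets \<mu> = sets borel" "AE x in \<mu>. x \<in> K"
    "?T \<in> measurable \<mu> \<mu>" "distr \<mu> \<mu> ?T = \<mu>" "1 \<le> (\<integral>x. ?b x \<partial>\<mu>)"
    by (rule krylov_bogoliubov[OF K T TK open_cozero average_rate_continuous[OF F \<phi> K F0 \<beta>] xK large])
  have "rotation_vector A \<omega> F \<phi> \<mu> (deRham_class A \<alpha>) = (LINT t:{0..1}|lborel. LINT x|\<mu>. ?R \<beta> t x)"
    unfolding rotation_vector_def Let_def \<beta>_def[symmetric] rate_def[OF F \<phi> K F0] ..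
  also have "\<dots> = (LINT x|\<mu>. ?b x)" by (rule time_average_space_average[OF F \<phi> K F0 \<beta> \<mu>(1,2)])
  finally have "1 \<le> \<bar>rotation_vector A \<omega> F \<phi> \<mu> (deRham_class A \<alpha>)\<bar>" using \<mu>(6) by simp
  moreover have "compactly_supported_borel_prob \<mu>"
    unfolding compactly_supported_borel_prob_def using \<mu>(1-3) K by blast
  moreover have "invariant_measure ?T \<mu>" unfolding invariant_measure_def using \<mu>(4,5) by blast
  ultimately show "\<exists>\<mu>. compactly_supported_borel_prob \<mu> \<and> invariant_measure (\<phi> 1) \<mu> \<and>
      1 \<le> \<bar>rotation_vector A \<omega> F \<phi> \<mu> (deRham_class A \<alpha>)\<bar>" by blast
qed

end
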